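(* Let $M=G/H$ be a commutative homogeneous space of a compact Lie group $G$ and $A$ be an invariant function algebra on $M$. Let $F\subseteq M$ be the maximal set of antisymmetry for $A$ containing the base point $o=eH$, let $\widetilde H=\{g\in G: gF=F\}$ (so that $F=\widetilde H o=\widetilde H/H$), $\widetilde M=G/\widetilde H$, and $\pi: M\to\widetilde M$ the natural projection. For $f\in C(M)$ and $y\in\widetilde M$ put $\alpha f(y)=\int f\,d\nu_y$, where $\nu_y$ is the unique probability measure on the fibre $\pi^{-1}(y)$ invariant under the stabilizer of $y$ in $G$. Then: (a) $\alpha$ restricted to $A$ is a surjective algebra homomorphism $A\to C(\widetilde M)$; (b) $\ker\alpha$ (the kernel in $A$) is the maximal proper $G$-invariant ideal of $A$, i.e. it is a $G$-invariant ideal different from $A$ which contains every $G$-invariant ideal of $A$ different from $A$; (c) the map $\varphi\mapsto\varphi\circ\iota\circ\alpha$, where $\iota:C(\widetilde M)\to A$, $\iota f=f\circ\pi$, restricted to the maximal ideal space $\mathcal{M}_A$, defines a $G$-equivariant fibration $\mathcal{M}_A\to\widetilde M$ (where $y\in\widetilde M$ is identified with the functional $f\mapsto\alpha f(y)$ on $A$), whose fibre over the base point $\pi(o)$ is the $A$-hull $\widehat F$ of $F$. In particular, the fibration of $\mathcal{M}_A$ over $\widetilde M$ extends the fibration $\pi$ of $M$ over $\widetilde M$ (i.e. its composition with the evaluation map $M\to\mathcal{M}_A$ is $\pi$).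
   Context: $G$ need not be connected. A homogeneous space $M=G/H$ of a compact Lie group $G$ ($H$ closed) is called commutative if it is multiplicity free, i.e. the quasiregular representation $\tau_g f(x)=f(g^{-1}x)$ of $G$ in $C(M)$ contains every irreducible representation of $G$ with multiplicity $0$ or $1$ (equivalently, $(G,H)$ is a Gelfand pair). $C(M)$ is the Banach algebra of continuous complex-valued functions with the sup-norm. An invariant function algebra on $M$ is a closed $G$-invariant subalgebra of $C(M)$ containing the constants. A set $Y\subseteq M$ is a set of antisymmetry for $A$ if every $f\in A$ which takes only real values on $Y$ is constant on $Y$; every such set is contained in a maximal one, and the maximal ones are closed and pairwise disjoint. For an invariant algebra, $\widetilde H$ is a closed subgroup of $G$ containing $H$, the maximal sets of antisymmetry are exactly the fibres of $\pi$, and $f\circ\pi\in A$ for every $f\in C(\widetilde M)$. $\mathcal{M}_A$ is the set of all nonzero multiplicative linear functionals on $A$ with the weak-$*$ topology and the dual action of $G$. The $A$-hull of a closed set $K\subseteq M$ is $\widehat K=\{\varphi\in\mathcal{M}_A: |\varphi(f)|\le\sup_{q\in K}|f(q)| \text{ for all } f\in A\}$. *)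

theory Defs
  imports
    "HOL-Probability.Probability_Measure"
    "HOL-Analysis.Analysis"
    "HOL-Algebra.Left_Coset"
    "HOL-Algebra.Subrings"
    "HOL-Algebra.Group_Action"
    "Jordan_Normal_Form.Matrix"
begin

text \<open>
  Coordinates take values in \<^const>\<open>Euclidean_space\<close> \<open>n\<close>, so that the dimension \<open>n\<close>
  is an ordinary natural number and \<open>n = 0\<close> (finite groups) is covered.  On an open set \<open>U\<close>,
  \<open>cont_diff n k U f\<close> says that all partial derivatives of \<open>f\<close> of order at most \<open>k\<close> exist
  and are continuous on \<open>U\<close>.
\<close>

primrec cont_diff :: "nat \<Rightarrow> nat \<Rightarrow> (nat \<Rightarrow> real) set \<Rightarrow> ((nat \<Rightarrow> real) \<Rightarrow> real) \<Rightarrow> bool" where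
  "cont_diff n 0 U f \<longleftrightarrow>
     continuous_map (subtopology (Euclidean_space n) U) euclideanreal f"
| "cont_diff n (Suc k) U f \<longleftrightarrow>
     continuous_map (subtopology (Euclidean_space n) U) euclideanreal f \<and>
     (\<forall>i<n. (\<forall>x\<in>U. (\<lambda>t. f (x(i := t))) differentiable (at (x i))) \<and>
            cont_diff n k U (\<lambda>x. deriv (\<lambda>t. f (x(i := t))) (x i)))"

definition smooth_map ::
    "nat \<Rightarrow> nat \<Rightarrow> (nat \<Rightarrow> real) set \<Rightarrow> ((nat \<Rightarrow> real) \<Rightarrow> (nat \<Rightarrow> real)) \<Rightarrow> bool" where
  "smooth_map n m U f \<longleftrightarrow>
     openin (Euclidean_space n) U \<and> (\<forall>j<m. \<forall>k. cont_diff n k U (\<lambda>x. f x j))"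

definition chart :: "'g topology \<Rightarrow> nat \<Rightarrow> 'g set \<times> ('g \<Rightarrow> nat \<Rightarrow> real) \<Rightarrow> bool" where
  "chart T n = (\<lambda>(U, \<phi>).
     openin T U \<and> openin (Euclidean_space n) (\<phi> ` U) \<and>
     homeomorphic_map (subtopology T U) (subtopology (Euclidean_space n) (\<phi> ` U)) \<phi>)"

definition smooth_atlas :: "'g topology \<Rightarrow> nat \<Rightarrow> ('g set \<times> ('g \<Rightarrow> nat \<Rightarrow> real)) set \<Rightarrow> bool" where
  "smooth_atlas T n \<A> \<longleftrightarrow>
     (\<forall>c\<in>\<A>. chart T n c) \<and> (\<Union>(U, \<phi>)\<in>\<A>. U) = topspace T \<and>
     (\<forall>(U, \<phi>)\<in>\<A>. \<forall>(V, \<psi>)\<in>\<A>. smooth_map n n (\<phi> ` (U \<inter> V)) (\<psi> \<circ> inv_into U \<phi>))"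

locale topological_group = group G for G (structure) +
  fixes T
  assumes topspace_eq: "topspace T = carrier G"
    and continuous_mult: "continuous_map (prod_topology T T) T (\<lambda>(x, y). x \<otimes> y)"
    and continuous_inv: "continuous_map T T (\<lambda>x. inv x)"

text \<open>
  The chart of the product manifold determined by \<open>(U, \<phi>)\<close> and \<open>(V, \<psi>)\<close> has as coordinates
  the \<open>n\<close> coordinates of \<open>\<phi>\<close> followed by those of \<open>\<psi>\<close>; \<open>fst_coords\<close> and \<open>snd_coords\<close>
  recover the two blocks.
\<close>

definition fst_coords :: "nat \<Rightarrow> (nat \<Rightarrow> real) \<Rightarrow> nat \<Rightarrow> real" where
  "fst_coords n z = (\<lambda>i. if i < n then z i else 0)"

definition snd_coords :: "nat \<Rightarrow> (nat \<Rightarrow> real) \<Rightarrow> nat \<Rightarrow> real" where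
  "snd_coords n z = (\<lambda>i. if i < n then z (n + i) else 0)"

definition smooth_group_operations ::
    "('g, 'b) monoid_scheme \<Rightarrow> nat \<Rightarrow> ('g set \<times> ('g \<Rightarrow> nat \<Rightarrow> real)) set \<Rightarrow> bool" where
  "smooth_group_operations G n \<A> \<longleftrightarrow>
     (\<forall>(U, \<phi>)\<in>\<A>. \<forall>(V, \<psi>)\<in>\<A>. \<forall>(W, \<xi>)\<in>\<A>.
        let m = (\<lambda>z. inv_into U \<phi> (fst_coords n z) \<otimes>\<^bsub>G\<^esub> inv_into V \<psi> (snd_coords n z)) in
        smooth_map (n + n) n
          {z \<in> topspace (Euclidean_space (n + n)).
             fst_coords n z \<in> \<phi> ` U \<and> snd_coords n z \<in> \<psi> ` V \<and> m z \<in> W}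
          (\<xi> \<circ> m)) \<and>
     (\<forall>(U, \<phi>)\<in>\<A>. \<forall>(W, \<xi>)\<in>\<A>.
        let j = (\<lambda>z. inv\<^bsub>G\<^esub> (inv_into U \<phi> z)) in
        smooth_map n n {z \<in> \<phi> ` U. j z \<in> W} (\<xi> \<circ> j))"

locale compact_lie_group = topological_group +
  assumes Hausdorff: "Hausdorff_space T"
    and second_countable: "second_countable T"
    and compact: "compact_space T"
    and smooth_structure: "\<exists>n \<A>. smooth_atlas T n \<A> \<and> smooth_group_operations G n \<A>"

text \<open>
  Points of \<open>G/H\<close> are the left cosets \<open>g <# H\<close>, the base point is \<open>H\<close> itself, and \<open>g\<close> acts on
  the cosets by \<open>l_coset G g\<close>.
\<close>

definition coset_space :: "('g, 'b) monoid_scheme \<Rightarrow> 'g topology \<Rightarrow> 'g set \<Rightarrow> 'g set topology" where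
  "coset_space G T H =
     topology (\<lambda>\<U>. \<U> \<subseteq> lcosets\<^bsub>G\<^esub> H \<and> openin T {g \<in> carrier G. g <#\<^bsub>G\<^esub> H \<in> \<U>})"

lemma istopology_coset_space:
  assumes "topspace T = carrier G"
  shows "istopology (\<lambda>\<U>. \<U> \<subseteq> lcosets\<^bsub>G\<^esub> H \<and> openin T {g \<in> carrier G. g <#\<^bsub>G\<^esub> H \<in> \<U>})"
proof -
  have "{g \<in> carrier G. g <#\<^bsub>G\<^esub> H \<in> \<U> \<inter> \<V>} =
        {g \<in> carrier G. g <#\<^bsub>G\<^esub> H \<in> \<U>} \<inter> {g \<in> carrier G. g <#\<^bsub>G\<^esub> H \<in> \<V>}" for \<U> \<V>
    by auto
  moreover have "{g \<in> carrier G. g <#\<^bsub>G\<^esub> H \<in> \<Union>\<K>} =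
        (\<Union>\<U>\<in>\<K>. {g \<in> carrier G. g <#\<^bsub>G\<^esub> H \<in> \<U>})" for \<K>
    by auto
  ultimately show ?thesis
    unfolding istopology_def by (auto intro!: openin_Union)
qed

lemma openin_coset_space:
  assumes "topspace T = carrier G"
  shows "openin (coset_space G T H) \<U> \<longleftrightarrow>
         \<U> \<subseteq> lcosets\<^bsub>G\<^esub> H \<and> openin T {g \<in> carrier G. g <#\<^bsub>G\<^esub> H \<in> \<U>}"
  using topology_inverse'[OF istopology_coset_space[OF assms, of H]]
  by (simp add: coset_space_def)

lemma topspace_coset_space:
  assumes "topspace T = carrier G"
  shows "topspace (coset_space G T H) = lcosets\<^bsub>G\<^esub> H"
proof -
  have "{g \<in> carrier G. g <#\<^bsub>G\<^esub> H \<in> lcosets\<^bsub>G\<^esub> H} = topspace T"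
    using assms by (auto simp: LCOSETS_def)
  then have "openin (coset_space G T H) (lcosets\<^bsub>G\<^esub> H)"
    using openin_coset_space[OF assms] by (metis openin_topspace subset_refl)
  then show ?thesis
    by (metis assms openin_coset_space openin_subset openin_topspace subset_antisym)
qed

definition coset_projection :: "('g, 'b) monoid_scheme \<Rightarrow> 'g set \<Rightarrow> 'g set \<Rightarrow> 'g set" where
  "coset_projection G K x = x <#>\<^bsub>G\<^esub> K"

text \<open>
  Functions on \<open>X\<close> are taken \<^const>\<open>extensional\<close>, so that equal functions are equal as terms.
  The sup-norm metric is that of \<^const>\<open>cfunspace\<close>, whose points are the elements of the
  carrier below whenever \<open>X\<close> is compact.
\<close>

definition cfun_ring :: "'x topology \<Rightarrow> ('x \<Rightarrow> complex) ring" where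
  "cfun_ring X =
     \<lparr>carrier = {f \<in> extensional (topspace X). continuous_map X euclidean f},
      mult = (\<lambda>f g. \<lambda>x\<in>topspace X. f x * g x),
      one = (\<lambda>x\<in>topspace X. 1),
      zero = (\<lambda>x\<in>topspace X. 0),
      add = (\<lambda>f g. \<lambda>x\<in>topspace X. f x + g x)\<rparr>"

abbreviation cfun_subring :: "'x topology \<Rightarrow> ('x \<Rightarrow> complex) set \<Rightarrow> ('x \<Rightarrow> complex) ring" where
  "cfun_subring X A \<equiv> (cfun_ring X)\<lparr>carrier := A\<rparr>"

definition cfun_scale :: "'x topology \<Rightarrow> complex \<Rightarrow> ('x \<Rightarrow> complex) \<Rightarrow> 'x \<Rightarrow> complex" where
  "cfun_scale X c f = (\<lambda>x\<in>topspace X. c * f x)"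

definition function_algebra :: "'x topology \<Rightarrow> ('x \<Rightarrow> complex) set \<Rightarrow> bool" where
  "function_algebra X A \<longleftrightarrow>
     subring A (cfun_ring X) \<and> (\<forall>c. (\<lambda>x\<in>topspace X. c) \<in> A) \<and>
     closedin (mtopology_of (cfunspace X euclidean_metric)) A"

definition algebra_hom ::
    "'x topology \<Rightarrow> ('x \<Rightarrow> complex) set \<Rightarrow> 'y topology \<Rightarrow> ('y \<Rightarrow> complex) set \<Rightarrow>
     (('x \<Rightarrow> complex) \<Rightarrow> ('y \<Rightarrow> complex)) \<Rightarrow> bool" where
  "algebra_hom X A Y B h \<longleftrightarrow>
     h \<in> Ring.ring_hom (cfun_subring X A) (cfun_subring Y B) \<and>
     (\<forall>c. \<forall>f\<in>A. h (cfun_scale X c f) = cfun_scale Y c (h f))"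

definition translate ::
    "('g, 'b) monoid_scheme \<Rightarrow> 'g set topology \<Rightarrow> 'g \<Rightarrow> ('g set \<Rightarrow> complex) \<Rightarrow> 'g set \<Rightarrow> complex" where
  "translate G X g f = (\<lambda>x\<in>topspace X. f (inv\<^bsub>G\<^esub> g <#\<^bsub>G\<^esub> x))"

definition translation_invariant ::
    "('g, 'b) monoid_scheme \<Rightarrow> 'g set topology \<Rightarrow> ('g set \<Rightarrow> complex) set \<Rightarrow> bool" where
  "translation_invariant G X I \<longleftrightarrow> (\<forall>g\<in>carrier G. \<forall>f\<in>I. translate G X g f \<in> I)"

definition antisymmetric_set :: "('x \<Rightarrow> complex) set \<Rightarrow> 'x set \<Rightarrow> bool" where
  "antisymmetric_set A Y \<longleftrightarrow> (\<forall>f\<in>A. f ` Y \<subseteq> \<real> \<longrightarrow> f constant_on Y)"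

definition maximal_antisymmetric_set ::
    "'x topology \<Rightarrow> ('x \<Rightarrow> complex) set \<Rightarrow> 'x set \<Rightarrow> bool" where
  "maximal_antisymmetric_set X A Y \<longleftrightarrow>
     Y \<subseteq> topspace X \<and> antisymmetric_set A Y \<and>
     (\<forall>Z. Z \<subseteq> topspace X \<and> antisymmetric_set A Z \<and> Y \<subseteq> Z \<longrightarrow> Z = Y)"

definition characters :: "'x topology \<Rightarrow> ('x \<Rightarrow> complex) set \<Rightarrow> (('x \<Rightarrow> complex) \<Rightarrow> complex) set" where
  "characters X A =
     {\<phi> \<in> extensional A.
        (\<forall>f\<in>A. \<forall>g\<in>A. \<phi> (f \<oplus>\<^bsub>cfun_ring X\<^esub> g) = \<phi> f + \<phi> g) \<and>
        (\<forall>c. \<forall>f\<in>A. \<phi> (cfun_scale X c f) = c * \<phi> f) \<and>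
        (\<forall>f\<in>A. \<forall>g\<in>A. \<phi> (f \<otimes>\<^bsub>cfun_ring X\<^esub> g) = \<phi> f * \<phi> g) \<and>
        (\<exists>f\<in>A. \<phi> f \<noteq> 0)}"

text \<open>The weak-* topology on functionals is the topology of pointwise convergence on \<open>A\<close>.\<close>

definition maximal_ideal_space ::
    "'x topology \<Rightarrow> ('x \<Rightarrow> complex) set \<Rightarrow> (('x \<Rightarrow> complex) \<Rightarrow> complex) topology" where
  "maximal_ideal_space X A =
     subtopology (product_topology (\<lambda>_. euclidean) A) (characters X A)"

definition dual_action ::
    "('g, 'b) monoid_scheme \<Rightarrow> 'g set topology \<Rightarrow> ('g set \<Rightarrow> complex) set \<Rightarrow>
     'g \<Rightarrow> (('g set \<Rightarrow> complex) \<Rightarrow> complex) \<Rightarrow> ('g set \<Rightarrow> complex) \<Rightarrow> complex" where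
  "dual_action G X A g \<phi> = (\<lambda>f\<in>A. \<phi> (translate G X (inv\<^bsub>G\<^esub> g) f))"

definition algebra_hull ::
    "'x topology \<Rightarrow> ('x \<Rightarrow> complex) set \<Rightarrow> 'x set \<Rightarrow> (('x \<Rightarrow> complex) \<Rightarrow> complex) set" where
  "algebra_hull X A K = {\<phi> \<in> characters X A. \<forall>f\<in>A. cmod (\<phi> f) \<le> (SUP q\<in>K. cmod (f q))}"

text \<open>
  Irreducible representations of a compact group are finite-dimensional, hence are matrix
  representations up to isomorphism.
\<close>

definition matrix_representation ::
    "('g, 'b) monoid_scheme \<Rightarrow> 'g topology \<Rightarrow> nat \<Rightarrow> ('g \<Rightarrow> complex mat) \<Rightarrow> bool" where
  "matrix_representation G T n \<rho> \<longleftrightarrow>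
     (\<forall>g\<in>carrier G. \<rho> g \<in> carrier_mat n n) \<and> \<rho> \<one>\<^bsub>G\<^esub> = 1\<^sub>m n \<and>
     (\<forall>g\<in>carrier G. \<forall>h\<in>carrier G. \<rho> (g \<otimes>\<^bsub>G\<^esub> h) = \<rho> g * \<rho> h) \<and>
     (\<forall>i<n. \<forall>j<n. continuous_map T euclidean (\<lambda>g. \<rho> g $$ (i, j)))"

definition irreducible_representation ::
    "('g, 'b) monoid_scheme \<Rightarrow> 'g topology \<Rightarrow> nat \<Rightarrow> ('g \<Rightarrow> complex mat) \<Rightarrow> bool" where
  "irreducible_representation G T n \<rho> \<longleftrightarrow>
     matrix_representation G T n \<rho> \<and> n > 0 \<and>
     (\<forall>W. W \<subseteq> carrier_vec n \<and> 0\<^sub>v n \<in> W \<and> (\<forall>u\<in>W. \<forall>v\<in>W. u + v \<in> W) \<and>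
          (\<forall>c. \<forall>v\<in>W. c \<cdot>\<^sub>v v \<in> W) \<and> (\<forall>g\<in>carrier G. \<forall>v\<in>W. \<rho> g *\<^sub>v v \<in> W)
        \<longrightarrow> W = {0\<^sub>v n} \<or> W = carrier_vec n)"

definition intertwiners ::
    "('g, 'b) monoid_scheme \<Rightarrow> 'g set topology \<Rightarrow> nat \<Rightarrow> ('g \<Rightarrow> complex mat) \<Rightarrow>
     (complex vec \<Rightarrow> 'g set \<Rightarrow> complex) set" where
  "intertwiners G X n \<rho> =
     {S. (\<forall>v\<in>carrier_vec n. S v \<in> carrier (cfun_ring X)) \<and>
         (\<forall>u\<in>carrier_vec n. \<forall>v\<in>carrier_vec n. S (u + v) = S u \<oplus>\<^bsub>cfun_ring X\<^esub> S v) \<and>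
         (\<forall>c. \<forall>v\<in>carrier_vec n. S (c \<cdot>\<^sub>v v) = cfun_scale X c (S v)) \<and>
         (\<forall>g\<in>carrier G. \<forall>v\<in>carrier_vec n. S (\<rho> g *\<^sub>v v) = translate G X g (S v))}"

text \<open>
  The multiplicity of \<open>\<rho>\<close> in \<open>C(G/H)\<close> is the dimension of the space of intertwining operators;
  it is at most 1 iff all of them are multiples of a single one.
\<close>

definition commutative_homogeneous_space ::
    "('g, 'b) monoid_scheme \<Rightarrow> 'g topology \<Rightarrow> 'g set \<Rightarrow> bool" where
  "commutative_homogeneous_space G T H \<longleftrightarrow>
     (\<forall>n \<rho>. irreducible_representation G T n \<rho> \<longrightarrow>
        (\<exists>S\<in>intertwiners G (coset_space G T H) n \<rho>.
           \<forall>R\<in>intertwiners G (coset_space G T H) n \<rho>.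
             \<exists>c. \<forall>v\<in>carrier_vec n. R v = cfun_scale (coset_space G T H) c (S v)))"

definition borel_of :: "'x topology \<Rightarrow> 'x measure" where
  "borel_of X = sigma (topspace X) {U. openin X U}"

definition invariant_probability ::
    "('g, 'b) monoid_scheme \<Rightarrow> 'g set \<Rightarrow> 'g set topology \<Rightarrow> 'g set measure \<Rightarrow> bool" where
  "invariant_probability G S Y \<mu> \<longleftrightarrow>
     sets \<mu> = sets (borel_of Y) \<and> prob_space \<mu> \<and>
     (\<forall>g\<in>S. \<forall>B\<in>sets \<mu>. emeasure \<mu> (l_coset G g ` B) = emeasure \<mu> B)"

definition fibre_measure ::
    "('g, 'b) monoid_scheme \<Rightarrow> 'g set topology \<Rightarrow> 'g set \<Rightarrow> 'g set \<Rightarrow> 'g set measure" where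
  "fibre_measure G X K y =
     (THE \<mu>. invariant_probability G (stabilizer G (l_coset G) y)
               (subtopology X {x \<in> topspace X. coset_projection G K x = y}) \<mu>)"

definition fibre_average ::
    "('g, 'b) monoid_scheme \<Rightarrow> 'g topology \<Rightarrow> 'g set \<Rightarrow> 'g set \<Rightarrow>
     ('g set \<Rightarrow> complex) \<Rightarrow> 'g set \<Rightarrow> complex" where
  "fibre_average G T H K f =
     (\<lambda>y\<in>topspace (coset_space G T K). \<integral>x. f x \<partial>fibre_measure G (coset_space G T H) K y)"

definition locally_trivial_fibration :: "'x topology \<Rightarrow> 'y topology \<Rightarrow> ('x \<Rightarrow> 'y) \<Rightarrow> bool" where
  "locally_trivial_fibration X Y p \<longleftrightarrow>
     continuous_map X Y p \<and> p ` topspace X = topspace Y \<and>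
     (\<forall>y\<in>topspace Y. \<exists>U h. openin Y U \<and> y \<in> U \<and>
        homeomorphic_map (subtopology X {x \<in> topspace X. p x \<in> U})
          (prod_topology (subtopology Y U) (subtopology X {x \<in> topspace X. p x = y})) h \<and>
        (\<forall>x\<in>topspace X. p x \<in> U \<longrightarrow> fst (h x) = p x))"

end

theory Submission imports Defs begin

text \<open>
 By the theorem of Bishop and Machado, functions that are constant on the fibres of \<open>\<pi>\<close> lie in \<open>A\<close>, so
 that \<open>A\<close> splits as the sum of \<open>\<iota> C(G/K)\<close> and the space \<open>A0\<close> of the functions whose averages over the
 fibres vanish. If \<open>f, g \<in> A0\<close> had \<open>\<integral> f g \<noteq> 0\<close>, then \<open>f\<close> and the conjugate of \<open>g\<close> would both have a
 component in some isotypic space of \<open>C(G/H)\<close>; that space being irreducible, suitable convolutions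
 of the two coincide. The common value \<open>s \<noteq> 0\<close> and its conjugate then lie in \<open>A\<close>, hence \<open>s\<close> is constant on
 fibres by antisymmetry, and so \<open>s = 0\<close> because \<open>s \<in> A0\<close>. Thus \<open>\<integral> f g = 0\<close> on \<open>A0\<close>, which makes the average
 multiplicative. A proper invariant ideal must be killed by averaging, since otherwise averaging
 over \<open>G\<close> produces a nonzero constant. Finally, a continuous local section \<open>\<sigma>\<close> of \<open>G \<rightarrow> G/K\<close> trivialises
 the fibration near \<open>y\<close> through \<open>\<phi> \<mapsto> (p \<phi>, \<sigma>(y) \<sigma>(p \<phi>)\<^sup>-\<^sup>1 \<cdot> \<phi>)\<close>.
\<close>

section \<open>Compact Hausdorff spaces\<close>

text \<open>Commutativity speaks of matrix representations, so an isotypic component must be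
  exhibited concretely: it is cut out of a finite-dimensional eigenspace of a convolution operator
  built from \<open>f\<close> and \<open>g\<close>. Everything stays within continuous functions,
  although they are not complete for the integral norm, because \<open>A\<close> is closed only
  uniformly; convolution maps sequences bounded in that norm to sequences with uniformly convergent
  subsequences, which supplies the limits. Integrals are exchanged through uniform approximation by
  finite sums, so Fubini needs no product sigma-algebra. The pairing \<open>\<integral> f g\<close>
  carries no conjugate since \<open>A\<close> need not be closed under conjugation and the product
  \<open>f g\<close> is what has to be averaged. The Lie structure serves only the local section of
  \<open>G \<rightarrow> G/K\<close>. The closed subgroup \<open>K\<close> gets no Lie algebra or
  exponential map: a coset near \<open>K\<close> is represented by its shortest element in a chart.
  Uniqueness of that element is the obstacle, and it is overcome by extracting square roots in
  \<open>K\<close> of small elements of \<open>K\<close>.\<close>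

abbreviation cmap :: "'x topology => ('x => 'c::topological_space) => bool" where
 "cmap X \<equiv> continuous_map X euclidean"

abbreviation rcmap :: "'x topology => ('x => real) => bool" where
 "rcmap \<equiv> cmap"

lemma continuous_map_compact_bounded:
 fixes f :: "'x => 'c::real_normed_vector"
 assumes "compact_space X" "cmap X f"
 obtains B where "B > 0" "\<And>x. x \<in> topspace X ==> norm (f x) \<le> B"
proof -
 have "compact (f ` topspace X)" using image_compactin[OF _ assms(2), of "topspace X"] assms(1)
  by (simp add: compact_space_def)
 hence "bounded (f ` topspace X)" by (rule compact_imp_bounded)
 thus ?thesis using that by (auto simp: bounded_pos)
qed

text \<open>Uniformity in \<open>y\<close> without a metric on \<open>X\<close>: the points where
  \<open>F x y\<close> is \<open>e\<close>-close to \<open>F x0 y\<close> form an open set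
  containing the slice over \<open>x0\<close>, and the tube lemma gives the neighbourhood.\<close>

lemma continuous_map_compact_tube:
 fixes F :: "'x => 'y => 'c::real_normed_vector"
 assumes Y: "compact_space Y" and F: "cmap (prod_topology X Y) (\<lambda>(x, y). F x y)"
  and x0: "x0 \<in> topspace X" and e: "e > 0"
 obtains U where "openin X U" "x0 \<in> U"
  "\<And>x y. x \<in> U ==> y \<in> topspace Y ==> norm (F x y - F x0 y) < e"
proof -
 have "continuous_map (prod_topology X Y) (prod_topology X Y) (\<lambda>z. (x0, snd z))"
  using x0 by (intro continuous_map_pairedI continuous_map_snd) auto
 from continuous_map_compose[OF this F]
 have "cmap (prod_topology X Y) (\<lambda>z. F x0 (snd z))" by (simp add: o_def)
 hence "rcmap (prod_topology X Y) (\<lambda>z. norm ((case z of (x, y) => F x y) - F x0 (snd z)))"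
  using F by (intro continuous_map_norm continuous_map_diff)
 hence "openin (prod_topology X Y)
   {z \<in> topspace (prod_topology X Y). norm ((case z of (x, y) => F x y) - F x0 (snd z)) \<in> {..<e}}"
  by (rule openin_continuous_map_preimage) auto
 moreover have "{x0} \<times> topspace Y \<subseteq>
   {z \<in> topspace (prod_topology X Y). norm ((case z of (x, y) => F x y) - F x0 (snd z)) \<in> {..<e}}"
  using x0 e by auto
 ultimately obtain U V where "openin X U" "x0 \<in> U" "topspace Y \<subseteq> V" and
   UV: "U \<times> V \<subseteq> {z \<in> topspace (prod_topology X Y). norm ((case z of (x, y) => F x y) - F x0 (snd z)) \<in> {..<e}}"
  using tube_lemma_right[of X Y _ "topspace Y" x0] Y x0 unfolding compact_space_def by meson
 thus ?thesis by (intro that[of U]) (use subsetD[OF UV, of "(_, _)"] in auto)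
qed

lemma Hausdorff_compact_Urysohn:
 assumes "compact_space X" "Hausdorff_space X" "closedin X C" "closedin X D" "C \<inter> D = {}"
 obtains f :: "'x => real" where "rcmap X f"
  "\<And>x. x \<in> topspace X ==> 0 \<le> f x" "\<And>x. x \<in> topspace X ==> f x \<le> 1"
  "\<And>x. x \<in> C ==> f x = 0" "\<And>x. x \<in> D ==> f x = 1"
proof -
 have "normal_space X" using assms compact_Hausdorff_or_regular_imp_normal_space by blast
 then obtain f where "continuous_map X (top_of_set {0..1::real}) f" "f ` C \<subseteq> {0}" "f ` D \<subseteq> {1}"
  using Urysohn_lemma[of X C D 0 1] assms by (auto simp: disjnt_def)
 thus ?thesis by (intro that[of f]) (auto simp: continuous_map_in_subtopology image_subset_iff Pi_iff)
qed

text \<open>Finite-rank approximation of \<open>F\<close>, uniform in both variables. It takes the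
  place of Riemann sums when integrals are exchanged and of Arzela-Ascoli when convolution is shown
  to be compact. The weights are Urysohn bumps divided by their sum.\<close>

lemma continuous_partition_of_unity:
 fixes F :: "'x => 'y => 'c::real_normed_vector"
 assumes X: "compact_space X" "Hausdorff_space X" and Y: "compact_space Y"
  and F: "cmap (prod_topology X Y) (\<lambda>(x, y). F x y)" and e: "e > 0"
 obtains P and \<phi> :: "'x => 'x => real" where "finite P" "P \<subseteq> topspace X"
  "\<And>p. p \<in> P ==> rcmap X (\<phi> p)"
  "\<And>p x. p \<in> P ==> x \<in> topspace X ==> 0 \<le> \<phi> p x"
  "\<And>x. x \<in> topspace X ==> (\<Sum>p\<in>P. \<phi> p x) = 1"
  "\<And>x y. x \<in> topspace X ==> y \<in> topspace Y ==> norm (F x y - (\<Sum>p\<in>P. \<phi> p x *\<^sub>R F p y)) \<le> e"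
proof -
 have "\<exists>U f. openin X U \<and> p \<in> U \<and> rcmap X f \<and>
   (\<forall>x\<in>topspace X. 0 \<le> f x) \<and> f p = 1 \<and>
   (\<forall>x\<in>topspace X. \<forall>y\<in>topspace Y. f x \<noteq> 0 \<longrightarrow> norm (F x y - F p y) < e)"
  if p: "p \<in> topspace X" for p
 proof -
  obtain U where U: "openin X U" "p \<in> U"
   and UF: "\<And>x y. x \<in> U ==> y \<in> topspace Y ==> norm (F x y - F p y) < e"
   using continuous_map_compact_tube[OF Y F p e] by metis
  have "closedin X {p}" using X(2) p by (simp add: closedin_Hausdorff_sing_eq)
  moreover have "closedin X (topspace X - U)" using U by blast
  moreover have "(topspace X - U) \<inter> {p} = {}" using U by simp
  ultimately obtain f :: "'x => real" where f: "rcmap X f"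
   "\<And>x. x \<in> topspace X ==> 0 \<le> f x" "\<And>x. x \<in> topspace X ==> f x \<le> 1"
   "\<And>x. x \<in> topspace X - U ==> f x = 0" "\<And>x. x \<in> {p} ==> f x = 1"
   using Hausdorff_compact_Urysohn[OF X, of "topspace X - U" "{p}"] by metis
  have "\<forall>x\<in>topspace X. \<forall>y\<in>topspace Y. f x \<noteq> 0 \<longrightarrow> norm (F x y - F p y) < e"
   using UF f(4) by (metis DiffI)
  thus ?thesis using U f by (intro exI[of _ U] exI[of _ f]) simp
 qed
 then obtain U f where Uf: "\<And>p. p \<in> topspace X ==> openin X (U p) \<and> p \<in> U p \<and>
   rcmap X (f p) \<and> (\<forall>x\<in>topspace X. 0 \<le> f p x) \<and> f p p = (1::real) \<and>
   (\<forall>x\<in>topspace X. \<forall>y\<in>topspace Y. f p x \<noteq> 0 \<longrightarrow> norm (F x y - F p y) < e)"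
  by metis
 define V where "V p = {x \<in> topspace X. f p x \<in> {0<..}}" for p
 have "openin X (V p)" if "p \<in> topspace X" for p
  unfolding V_def using Uf[OF that] by (intro openin_continuous_map_preimage) auto
 moreover have "topspace X \<subseteq> \<Union>(V ` topspace X)" using Uf by (force simp: V_def)
 ultimately obtain \<F> where \<F>: "finite \<F>" "\<F> \<subseteq> V ` topspace X" "topspace X \<subseteq> \<Union>\<F>"
  using X(1) unfolding compact_space_def compactin_def by (metis (no_types, lifting) imageE)
 then obtain P where P: "finite P" "P \<subseteq> topspace X" "\<F> = V ` P" by (meson finite_subset_image)
 define s where "s x = (\<Sum>p\<in>P. f p x)" for x
 have s: "s x > 0" if x: "x \<in> topspace X" for x
 proof -
  obtain p where "p \<in> P" "f p x > 0" using x \<F> P by (auto simp: V_def)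
  thus ?thesis unfolding s_def using P Uf x by (intro sum_pos2[of P p]) auto
 qed
 have contP: "rcmap X (f p)" if "p \<in> P" for p using P Uf that by blast
 have scont: "rcmap X s"
  unfolding s_def by (rule continuous_map_sum[OF P(1)]) (use contP in auto)
 show ?thesis
 proof (rule that[of P "\<lambda>p x. f p x / s x"])
  show "finite P" "P \<subseteq> topspace X" using P by auto
  show "rcmap X (\<lambda>x. f p x / s x)" if "p \<in> P" for p
   using contP[OF that] scont s by (intro continuous_map_real_divide) (auto simp: less_imp_neq[symmetric])
  show "0 \<le> f p x / s x" if "p \<in> P" "x \<in> topspace X" for p x
   using Uf P s[OF that(2)] that by (simp add: subset_iff less_imp_le)
  show sum1: "(\<Sum>p\<in>P. f p x / s x) = 1" if "x \<in> topspace X" for x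
   using s[OF that] by (simp add: sum_divide_distrib[symmetric] s_def)
  fix x y assume x: "x \<in> topspace X" and y: "y \<in> topspace Y"
  have "F x y - (\<Sum>p\<in>P. (f p x / s x) *\<^sub>R F p y) = (\<Sum>p\<in>P. (f p x / s x) *\<^sub>R (F x y - F p y))"
   using sum1[OF x] by (simp add: scaleR_diff_right sum_subtractf scaleR_left.sum[symmetric])
  also have "norm ... \<le> (\<Sum>p\<in>P. (f p x / s x) * e)"
  proof (rule sum_norm_le)
   fix p assume p: "p \<in> P"
   have "norm ((f p x / s x) *\<^sub>R (F x y - F p y)) = (f p x / s x) * norm (F x y - F p y)"
    using Uf p P s[OF x] x by (simp add: subset_iff)
   also have "... \<le> (f p x / s x) * e"
   proof (cases "f p x = 0")
    case False
    thus ?thesis using Uf p P s[OF x] x y by (intro mult_left_mono) (auto simp: subset_iff less_imp_le)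
   qed auto
   finally show "norm ((f p x / s x) *\<^sub>R (F x y - F p y)) \<le> (f p x / s x) * e" .
  qed
  also have "... = e" unfolding sum_distrib_right[symmetric] sum1[OF x] by simp
  finally show "norm (F x y - (\<Sum>p\<in>P. (f p x / s x) *\<^sub>R F p y)) \<le> e" .
 qed
qed

text \<open>Regularity and a countable base write \<open>U\<close> as a countable union of basic
  sets whose closures lie in \<open>U\<close>; the running maxima of their Urysohn functions
  increase to the indicator of \<open>U\<close>. Thus integrals of continuous functions control the
  measure of open sets.\<close>

lemma increasing_functions_to_open:
 assumes X: "compact_space X" "Hausdorff_space X" "second_countable X" and U: "openin X U"
 obtains f :: "nat => 'x => real" where "\<And>n. rcmap X (f n)"
  "\<And>n x. x \<in> topspace X ==> 0 \<le> f n x" "\<And>n x. x \<in> topspace X ==> f n x \<le> 1"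
  "\<And>x. mono (\<lambda>n. f n x)"
  "\<And>n x. x \<in> topspace X - U ==> f n x = 0" "\<And>x. x \<in> U ==> \<exists>n. f n x = 1"
proof (cases "U = {}")
 case True
 thus ?thesis by (intro that[of "\<lambda>_ _. 0"]) (auto simp: mono_def)
next
 case False
 obtain \<B> where \<B>: "countable \<B>" "\<And>V. V \<in> \<B> ==> openin X V"
  "\<And>U x. openin X U ==> x \<in> U ==> \<exists>V\<in>\<B>. x \<in> V \<and> V \<subseteq> U"
  using X(3) unfolding second_countable_def by metis
 define \<C> where "\<C> = {V \<in> \<B>. X closure_of V \<subseteq> U}"
 have reg: "regular_space X" using X by (simp add: compact_Hausdorff_imp_regular_space)
 have cover: "\<exists>V\<in>\<C>. x \<in> V" if x: "x \<in> U" for x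
 proof -
  obtain W D where "openin X W" "closedin X D" "x \<in> W" "W \<subseteq> D" "D \<subseteq> U"
   using neighbourhood_base_of_closedin[of X] reg U x unfolding neighbourhood_base_of by meson
  then obtain V where "V \<in> \<B>" "x \<in> V" "V \<subseteq> W" using \<B>(3) by blast
  hence "X closure_of V \<subseteq> U"
   by (meson \<open>D \<subseteq> U\<close> \<open>W \<subseteq> D\<close> \<open>closedin X D\<close> closure_of_minimal order_trans)
  thus ?thesis using \<open>V \<in> \<B>\<close> \<open>x \<in> V\<close> by (auto simp: \<C>_def)
 qed
 have ne: "\<C> \<noteq> {}" using False cover by blast
 have "countable \<C>" using \<B>(1) by (simp add: \<C>_def)
 hence v: "range (from_nat_into \<C>) = \<C>" using ne by (simp add: range_from_nat_into)
 define v where "v = from_nat_into \<C>"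
 note v = v[folded v_def]
 have "\<exists>h :: 'x => real. rcmap X h \<and> (\<forall>x\<in>topspace X. 0 \<le> h x \<and> h x \<le> 1) \<and>
   (\<forall>x\<in>topspace X - U. h x = 0) \<and> (\<forall>x\<in>v n. h x = 1)" for n
 proof -
  have "v n \<in> \<C>" using v by blast
  hence "openin X (v n)" "X closure_of (v n) \<subseteq> U" using \<B>(2) by (auto simp: \<C>_def)
  hence "v n \<subseteq> X closure_of (v n)" by (simp add: closure_of_subset openin_subset)
  moreover have "closedin X (topspace X - U)" using U by blast
  ultimately show ?thesis
   using Hausdorff_compact_Urysohn[OF X(1,2) \<open>closedin X (topspace X - U)\<close> closedin_closure_of[of X "v n"]]
    \<open>X closure_of (v n) \<subseteq> U\<close>
   by (smt (verit) DiffE disjoint_iff subset_eq)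
 qed
 then obtain h :: "nat => 'x => real" where
  h: "\<And>n. rcmap X (h n)" "\<And>n x. x \<in> topspace X ==> 0 \<le> h n x \<and> h n x \<le> 1"
    "\<And>n x. x \<in> topspace X - U ==> h n x = 0" "\<And>n x. x \<in> v n ==> h n x = 1"
  by metis
 define f where "f n x = rec_nat (h 0 x) (\<lambda>k r. max r (h (Suc k) x)) n" for n x
 have f0: "f 0 = h 0" and fS: "f (Suc n) = (\<lambda>x. max (f n x) (h (Suc n) x))" for n
  by (auto simp: f_def)
 have cont: "rcmap X (f n)" for n
  by (induction n) (auto simp: f0 fS h intro!: continuous_map_real_max)
 have bd: "0 \<le> f n x \<and> f n x \<le> 1" if "x \<in> topspace X" for n x
  by (induction n) (use h(2)[OF that] in \<open>auto simp: f0 fS le_max_iff_disj\<close>)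
 have ge: "h n x \<le> f n x" for n x by (cases n) (auto simp: f0 fS)
 show ?thesis
 proof (rule that[of f])
  show "mono (\<lambda>n. f n x)" for x by (auto simp: mono_iff_le_Suc fS)
  show "f n x = 0" if "x \<in> topspace X - U" for n x
   by (induction n) (use h(3)[OF that] in \<open>auto simp: f0 fS\<close>)
  show "\<exists>n. f n x = 1" if "x \<in> U" for x
  proof -
   obtain n where "x \<in> v n" using cover[OF \<open>x \<in> U\<close>] v by blast
   hence "f n x \<ge> 1" using h(4) ge by metis
   thus ?thesis using bd[of x n] U that openin_subset by (metis in_mono order_antisym)
  qed
 qed (use cont bd in auto)
qed

lemma space_borel_of [simp]: "space (borel_of X) = topspace X"
 by (simp add: borel_of_def space_measure_of_conv)

lemma sets_borel_of: "sets (borel_of X) = sigma_sets (topspace X) {U. openin X U}"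
 unfolding borel_of_def by (rule sets_measure_of) (auto dest: openin_subset)

lemma borel_of_openin: "openin X U ==> U \<in> sets (borel_of X)" by (simp add: sets_borel_of)

lemma borel_measurable_continuous_map:
 assumes "sets \<mu> = sets (borel_of X)" "cmap X f"
 shows "f \<in> borel_measurable \<mu>"
proof -
 have "f \<in> borel_measurable (borel_of X)"
 proof (rule borel_measurableI)
  fix S :: "'b set" assume "open S"
  hence "openin X {x \<in> topspace X. f x \<in> S}"
   using openin_continuous_map_preimage[OF assms(2)] by auto
  moreover have "f -` S \<inter> space (borel_of X) = {x \<in> topspace X. f x \<in> S}" by auto
  ultimately show "f -` S \<inter> space (borel_of X) \<in> sets (borel_of X)" by (metis borel_of_openin)
 qed
 thus ?thesis using assms(1) measurable_cong_sets by blast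
qed

lemma measurable_borel_of_continuous_map:
 assumes f: "continuous_map X Y f"
 shows "f \<in> measurable (borel_of X) (borel_of Y)" unfolding borel_of_def[of Y]
proof (rule measurable_measure_of)
 show "f \<in> space (borel_of X) \<rightarrow> topspace Y"
  using f continuous_map_image_subset_topspace by fastforce
 fix U assume "U \<in> {U. openin Y U}"
 hence "openin X {x \<in> topspace X. f x \<in> U}" using openin_continuous_map_preimage[OF f] by auto
 moreover have "f -` U \<inter> space (borel_of X) = {x \<in> topspace X. f x \<in> U}" by auto
 ultimately show "f -` U \<inter> space (borel_of X) \<in> sets (borel_of X)" by (metis borel_of_openin)
qed (auto dest: openin_subset)

lemma integrable_continuous_map:
 fixes f :: "'x => 'c::{banach, second_countable_topology}"
 assumes "compact_space X" "sets \<mu> = sets (borel_of X)" "finite_measure \<mu>"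
  and f: "cmap X f"
 shows "integrable \<mu> f"
proof -
 interpret finite_measure \<mu> by fact
 obtain B where "\<And>x. x \<in> topspace X ==> norm (f x) \<le> B"
  using continuous_map_compact_bounded[OF assms(1) f] by metis
 moreover have "space \<mu> = topspace X" using sets_eq_imp_space_eq[OF assms(2)] by simp
 ultimately show ?thesis
  by (intro integrable_const_bound[of _ B] borel_measurable_continuous_map[OF assms(2) f]) auto
qed

text \<open>Dominated convergence along functions increasing to an open set gives agreement on the
  open sets, an intersection-stable generator.\<close>

lemma integral_eq_imp_measure_eq:
 assumes X: "compact_space X" "Hausdorff_space X" "second_countable X"
  and \<mu>: "sets \<mu> = sets (borel_of X)" "finite_measure \<mu>"
  and \<nu>: "sets \<nu> = sets (borel_of X)" "finite_measure \<nu>"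
  and eq: "\<And>f :: 'x => real. rcmap X f ==> (\<integral>x. f x \<partial>\<mu>) = (\<integral>x. f x \<partial>\<nu>)"
 shows "\<mu> = \<nu>"
proof -
 interpret \<mu>: finite_measure \<mu> by fact
 interpret \<nu>: finite_measure \<nu> by fact
 have sp: "space \<mu> = topspace X" "space \<nu> = topspace X"
  using sets_eq_imp_space_eq[OF \<mu>(1)] sets_eq_imp_space_eq[OF \<nu>(1)] by simp_all
 have lim: "(\<lambda>n. \<integral>x. f n x \<partial>M) \<longlonglongrightarrow> measure M U"
  if M: "sets M = sets (borel_of X)" "finite_measure M" and U: "openin X U"
   and f: "\<And>n. rcmap X (f n)"
   "\<And>n x. x \<in> topspace X ==> 0 \<le> f n x" "\<And>n x. x \<in> topspace X ==> f n x \<le> 1"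
   "\<And>x. mono (\<lambda>n. f n x)"
   "\<And>n x. x \<in> topspace X - U ==> f n x = 0" "\<And>x. x \<in> U ==> \<exists>n. f n x = 1"
  for M U and f :: "nat => 'x => real"
 proof -
  interpret M: finite_measure M by fact
  have sp: "space M = topspace X" using sets_eq_imp_space_eq[OF M(1)] by simp
  have UM: "U \<in> sets M" using U M(1) borel_of_openin by blast
  have "(\<lambda>n. \<integral>x. f n x \<partial>M) \<longlonglongrightarrow> (\<integral>x. indicator U x \<partial>M)"
  proof (rule integral_dominated_convergence[where w = "\<lambda>_. 1"])
   show "AE x in M. (\<lambda>n. f n x) \<longlonglongrightarrow> indicator U x"
   proof (rule AE_I2)
    fix x assume "x \<in> space M"
    hence x: "x \<in> topspace X" by (simp add: sp)
    show "(\<lambda>n. f n x) \<longlonglongrightarrow> indicator U x"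
    proof (cases "x \<in> U")
     case True
     obtain n where n: "f n x = 1" using f(6)[OF True] by blast
     have "f m x = 1" if "m \<ge> n" for m using monoD[OF f(4)[of x] that] n f(3)[OF x, of m] by linarith
     hence "eventually (\<lambda>m. f m x = indicator U x) sequentially"
      using True eventually_sequentially by auto
     thus ?thesis by (rule tendsto_eventually)
    next
     case False
     thus ?thesis using f(5) x by simp
    qed
   qed
   show "AE x in M. norm (f n x) \<le> 1" for n using f(2,3) sp by (intro AE_I2) auto
   show "f n \<in> borel_measurable M" for n by (rule borel_measurable_continuous_map[OF M(1) f(1)])
  qed (use UM in auto)
  thus ?thesis using UM by simp
 qed
 have eqU: "emeasure \<mu> U = emeasure \<nu> U" if U: "openin X U" for U
 proof -
  obtain f :: "nat => 'x => real" where f: "\<And>n. rcmap X (f n)"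
   "\<And>n x. x \<in> topspace X ==> 0 \<le> f n x" "\<And>n x. x \<in> topspace X ==> f n x \<le> 1"
   "\<And>x. mono (\<lambda>n. f n x)"
   "\<And>n x. x \<in> topspace X - U ==> f n x = 0" "\<And>x. x \<in> U ==> \<exists>n. f n x = 1"
   using increasing_functions_to_open[OF X U] by metis
  have "measure \<mu> U = measure \<nu> U"
   using lim[OF \<mu> U f] lim[OF \<nu> U f] eq[OF f(1)] LIMSEQ_unique by fastforce
  thus ?thesis by (simp add: \<mu>.emeasure_eq_measure \<nu>.emeasure_eq_measure)
 qed
 show ?thesis
 proof (rule measure_eqI_generator_eq[where E = "{U. openin X U}" and \<Omega> = "topspace X" and A = "\<lambda>_. topspace X"])
  show "sets \<mu> = sigma_sets (topspace X) {U. openin X U}" "sets \<nu> = sigma_sets (topspace X) {U. openin X U}"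
   using \<mu>(1) \<nu>(1) by (auto simp: sets_borel_of)
 qed (use eqU in \<open>auto simp: Int_stable_def dest: openin_subset\<close>)
qed

section \<open>Riesz representation\<close>

text \<open>Riesz by way of Caratheodory: on strips between continuous graphs,
  \<open>L (g - f)\<close> is a premeasure, and Lebesgue measure on the vertical slices proves its
  additivity. The strips are half-open so that a difference of two is again a disjoint union of
  strips.\<close>

definition region :: "'x topology => ('x => real) \<times> ('x => real) => ('x \<times> real) set" where
 "region X = (\<lambda>(f, g). {(x, t). x \<in> topspace X \<and> f x \<le> t \<and> t < g x})"

definition ordered_pairs :: "'x topology => (('x => real) \<times> ('x => real)) set" where
 "ordered_pairs X = {(f, g). rcmap X f \<and> rcmap X g \<and>
   (\<forall>x\<in>topspace X. f x \<le> g x)}"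

lemma mem_region [simp]: "(x, t) \<in> region X (f, g) \<longleftrightarrow> x \<in> topspace X \<and> f x \<le> t \<and> t < g x"
 by (simp add: region_def)

lemma region_subset: "region X i \<subseteq> topspace X \<times> UNIV"
 by (auto simp: region_def split: prod.splits)

lemma semiring_of_sets_region: "semiring_of_sets (topspace X \<times> UNIV) (region X ` ordered_pairs X)"
proof (unfold_locales)
 show "region X ` ordered_pairs X \<subseteq> Pow (topspace X \<times> UNIV)" using region_subset by blast
 have "region X (\<lambda>_. 0, \<lambda>_. 0) = {}" by (auto simp: region_def)
 moreover have "(\<lambda>_. 0, \<lambda>_. 0) \<in> ordered_pairs X" by (simp add: ordered_pairs_def)
 ultimately show "{} \<in> region X ` ordered_pairs X" by (metis imageI)
next
 fix a b assume "a \<in> region X ` ordered_pairs X" "b \<in> region X ` ordered_pairs X"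
 then obtain f g f' g' where a: "a = region X (f, g)" "(f, g) \<in> ordered_pairs X"
  and b: "b = region X (f', g')" "(f', g') \<in> ordered_pairs X" by auto
 hence c: "rcmap X f" "rcmap X g"
  "rcmap X f'" "rcmap X g'"
  and le: "\<And>x. x \<in> topspace X ==> f x \<le> g x" "\<And>x. x \<in> topspace X ==> f' x \<le> g' x"
  by (auto simp: ordered_pairs_def)
 \<comment> \<open>The intersection is the strip from \<open>l\<close> to \<open>u\<close>; the
   difference is the part of the first strip below \<open>f'\<close>, ending at \<open>v\<close>,
   and the part above \<open>g'\<close>, starting at \<open>w\<close>. Clamping keeps the pairs
   ordered where a slice is empty.\<close>
 define l where "l x = max (f x) (f' x)" for x
 define u where "u x = max (l x) (min (g x) (g' x))" for x
 define v where "v x = max (f x) (min (g x) (f' x))" for x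
 define w where "w x = min (g x) (max (f x) (g' x))" for x
 have cont: "rcmap X l" "rcmap X u"
   "rcmap X v" "rcmap X w"
  unfolding l_def u_def v_def w_def using c
  by (simp_all add: continuous_map_real_max continuous_map_real_min)
 have "a \<inter> b = region X (l, u)" unfolding a b by (auto simp: region_def l_def u_def)
 moreover have "(l, u) \<in> ordered_pairs X" using cont by (auto simp: ordered_pairs_def u_def)
 ultimately show "a \<inter> b \<in> region X ` ordered_pairs X" by blast
 have "a - b = \<Union>{region X (f, v), region X (w, g)}"
  unfolding a b using le by (auto simp: region_def v_def w_def)
 moreover have "(f, v) \<in> ordered_pairs X" "(w, g) \<in> ordered_pairs X"
  using cont c by (auto simp: ordered_pairs_def v_def w_def)
 moreover have "disjoint {region X (f, v), region X (w, g)}"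
 proof -
  have "(x, t) \<notin> region X (w, g)" if "(x, t) \<in> region X (f, v)" for x t
   using that le(2)[of x] by (auto simp: v_def w_def)
  thus ?thesis unfolding disjoint_def by (metis IntI empty_iff equals0I insertE prod.collapse IntE)
 qed
 ultimately show "\<exists>C\<subseteq>region X ` ordered_pairs X. finite C \<and> disjoint C \<and> a - b = \<Union>C"
  by (intro exI[of _ "{region X (f, v), region X (w, g)}"]) blast
qed

locale positive_functional =
 fixes X :: "'x topology" and L :: "('x => real) => real"
 assumes cpt: "compact_space X" and hd: "Hausdorff_space X" and sc: "second_countable X"
  and L_add: "rcmap X f ==> rcmap X g ==>
   L (\<lambda>x. f x + g x) = L f + L g"
  and L_scale: "rcmap X f ==> L (\<lambda>x. c * f x) = c * L f"
  and L_mono: "rcmap X f ==> rcmap X g ==>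
   (\<And>x. x \<in> topspace X ==> f x \<le> g x) ==> L f \<le> L g"
  and L_one: "L (\<lambda>_. 1) = 1"
begin

lemma L_const: "L (\<lambda>_. c) = c" using L_scale[of "\<lambda>_. 1" c] L_one by simp

lemma L_sum:
 assumes "finite S" "\<And>i. i \<in> S ==> rcmap X (f i)"
 shows "L (\<lambda>x. \<Sum>i\<in>S. f i x) = (\<Sum>i\<in>S. L (f i))" using assms
proof (induction S rule: finite_induct)
 case empty
 show ?case by (simp add: L_const)
next
 case (insert i S)
 thus ?case using L_add[of "f i" "\<lambda>x. \<Sum>i\<in>S. f i x"] by (simp add: continuous_map_sum)
qed

text \<open>Dini's argument: the increasing open sets on which the remainder is below
  \<open>e/2\<close> cover \<open>X\<close>, so by compactness one index serves all points, and
  monotonicity of \<open>L\<close> does the rest.\<close>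

lemma L_suminf:
 assumes f: "\<And>n. rcmap X (f n)" "\<And>n x. x \<in> topspace X ==> 0 \<le> f n x"
  and g: "rcmap X g" and sums: "\<And>x. x \<in> topspace X ==> (\<lambda>n. f n x) sums g x"
 shows "(\<lambda>n. L (f n)) sums L g"
proof -
 define S where "S n x = (\<Sum>i<n. f i x)" for n x
 have Sc: "rcmap X (S n)" for n
  unfolding S_def by (intro continuous_map_sum) (use f in auto)
 have Sle: "S n x \<le> S m x" if "n \<le> m" "x \<in> topspace X" for n m x
  unfolding S_def by (intro sum_mono2) (use f that in auto)
 have Sg: "S n x \<le> g x" if "x \<in> topspace X" for n x
  unfolding S_def using sum_le_suminf[OF sums_summable[OF sums[OF that]], of "{..<n}"] f that sums_unique[OF sums[OF that]]
  by auto
 have "(\<lambda>n. L (S n)) \<longlonglongrightarrow> L g"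
 proof (rule LIMSEQ_I)
  fix e :: real assume e: "e > 0"
  define V where "V n = {x \<in> topspace X. g x - S n x \<in> {..<e/2}}" for n
  have V: "openin X (V n)" for n
   unfolding V_def by (intro openin_continuous_map_preimage[of X euclideanreal] continuous_map_diff g Sc) auto
  have "topspace X \<subseteq> \<Union>(range V)"
  proof
   fix x assume x: "x \<in> topspace X"
   have "(\<lambda>n. S n x) \<longlonglongrightarrow> g x" using sums[OF x] by (simp add: sums_def S_def)
   hence "eventually (\<lambda>n. dist (S n x) (g x) < e/2) sequentially" using e by (intro tendstoD) auto
   then obtain n where "dist (S n x) (g x) < e/2" by (meson eventually_sequentially order_refl)
   hence "g x - S n x < e/2" unfolding dist_real_def by linarith
   thus "x \<in> \<Union>(range V)" using x by (auto simp: V_def)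
  qed
  then obtain \<F> where \<F>: "finite \<F>" "\<F> \<subseteq> range V" "topspace X \<subseteq> \<Union>\<F>"
   using cpt V unfolding compact_space_def compactin_def by (metis (no_types, lifting) imageE)
  then obtain N where N: "finite N" "\<F> = V ` N" by (meson finite_subset_image)
  define m where "m = Max (insert 0 N)"
  have le: "g x \<le> S n x + e/2" if n: "n \<ge> m" and x: "x \<in> topspace X" for n x
  proof -
   obtain k where k: "k \<in> N" "x \<in> V k" using x \<F>(3) N(2) by blast
   hence "k \<le> m" using N by (simp add: m_def)
   thus ?thesis using k Sle[of k n x] n x by (auto simp: V_def)
  qed
  show "\<exists>no. \<forall>n\<ge>no. norm (L (S n) - L g) < e"
  proof (intro exI allI impI)
   fix n assume n: "n \<ge> m"
   have "L (S n) \<le> L g" using Sg by (intro L_mono Sc g) auto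
   moreover have "L g \<le> L (\<lambda>x. S n x + e/2)"
    using le[OF n] by (intro L_mono g continuous_map_add Sc) auto
   moreover have "L (\<lambda>x. S n x + e/2) = L (S n) + e/2"
    using L_add[OF Sc, of "\<lambda>_. e/2" n] by (simp add: L_const)
   ultimately show "norm (L (S n) - L g) < e" using e by auto
  qed
 qed
 moreover have "L (S n) = (\<Sum>i<n. L (f i))" for n unfolding S_def by (intro L_sum) (use f in auto)
 ultimately show ?thesis by (simp add: sums_def)
qed

definition region_measure :: "('x \<times> real) measure" where
 "region_measure = extend_measure (topspace X \<times> UNIV) (ordered_pairs X) (region X)
   (\<lambda>(f, g). ennreal (L (\<lambda>x. g x - f x)))"

lemma sets_region_measure: "sets region_measure = sigma_sets (topspace X \<times> UNIV) (region X ` ordered_pairs X)"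
 and space_region_measure: "space region_measure = topspace X \<times> UNIV"
proof -
 have "region X ` ordered_pairs X \<subseteq> Pow (topspace X \<times> UNIV)" using region_subset by blast
 thus "sets region_measure = sigma_sets (topspace X \<times> UNIV) (region X ` ordered_pairs X)"
  "space region_measure = topspace X \<times> UNIV"
  unfolding region_measure_def by (simp_all add: sets_extend_measure space_extend_measure)
qed

lemma region_in_sets:
 assumes "rcmap X f" "rcmap X g"
  "\<And>x. x \<in> topspace X ==> f x \<le> g x"
 shows "region X (f, g) \<in> sets region_measure"
 unfolding sets_region_measure using assms by (auto simp: ordered_pairs_def)

text \<open>Countable additivity: a slice of a strip is an interval whose length is the width, so
  the widths of a disjoint decomposition add up pointwise, and \<open>L_suminf\<close> transports
  this sum through \<open>L\<close>.\<close>

lemma emeasure_region: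
 assumes f: "rcmap X f" and g: "rcmap X g"
  and le: "\<And>x. x \<in> topspace X ==> f x \<le> g x"
 shows "emeasure region_measure (region X (f, g)) = ennreal (L (\<lambda>x. g x - f x))"
proof -
 have pos: "0 \<le> L (\<lambda>x. snd i x - fst i x)" if "i \<in> ordered_pairs X" for i
  using L_mono[of "\<lambda>_. 0" "\<lambda>x. snd i x - fst i x"] that
  by (auto simp: ordered_pairs_def L_const continuous_map_diff)
 have width: "emeasure lborel (Pair x -` region X i) = ennreal (snd i x - fst i x)"
  if "i \<in> ordered_pairs X" "x \<in> topspace X" for x i
 proof -
  have "Pair x -` region X i = {fst i x..<snd i x}" using that by (auto simp: region_def split: prod.splits)
  thus ?thesis using that by (auto simp: ordered_pairs_def)
 qed
 \<comment> \<open>Well-definedness: a strip does not determine its pair, since an empty slice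
   leaves the common value arbitrary, but it determines every width and hence the value of
   \<open>L\<close>.\<close>
 have Leq: "L (\<lambda>x. snd i x - fst i x) = L (\<lambda>x. snd j x - fst j x)"
  if "i \<in> ordered_pairs X" "j \<in> ordered_pairs X" and eq: "region X i = region X j" for i j
 proof -
  have "snd i x - fst i x = snd j x - fst j x" if "x \<in> topspace X" for x
   using width[OF \<open>i \<in> _\<close> that] width[OF \<open>j \<in> _\<close> that] eq \<open>i \<in> _\<close> \<open>j \<in> _\<close> that
   by (auto simp: ordered_pairs_def)
  thus ?thesis using that by (intro antisym L_mono) (auto simp: ordered_pairs_def continuous_map_diff)
 qed
 have "emeasure region_measure (region X (f, g)) = (\<lambda>(f, g). ennreal (L (\<lambda>x. g x - f x))) (f, g)"
 proof (rule extend_measure_caratheodory[OF region_measure_def])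
  show "(f, g) \<in> ordered_pairs X" using assms by (auto simp: ordered_pairs_def)
  show "semiring_of_sets (topspace X \<times> UNIV) (region X ` ordered_pairs X)"
   by (rule semiring_of_sets_region)
  have z: "(\<lambda>_. 0, \<lambda>_. 0) \<in> ordered_pairs X" "region X (\<lambda>_. 0, \<lambda>_. 0) = {}"
   by (auto simp: ordered_pairs_def region_def)
  show "(case i of (f, g) => ennreal (L (\<lambda>x. g x - f x))) = 0"
   if "i \<in> ordered_pairs X" "region X i = {}" for i
   using Leq[OF that(1) z(1)] that(2) z(2) L_const[of 0] by (simp add: case_prod_beta)
  show "(case i of (f, g) => ennreal (L (\<lambda>x. g x - f x))) = (case j of (f, g) => ennreal (L (\<lambda>x. g x - f x)))"
   if "i \<in> ordered_pairs X" "j \<in> ordered_pairs X" "region X i = region X j" for i j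
   using Leq[OF that] by (simp add: case_prod_beta)
  show "0 \<le> (case i of (f, g) => ennreal (L (\<lambda>x. g x - f x)))" for i by simp
  fix A :: "nat => ('x => real) \<times> ('x => real)" and j
  assume A: "A \<in> UNIV \<rightarrow> ordered_pairs X" and j: "j \<in> ordered_pairs X"
   and disj: "disjoint_family (region X \<circ> A)" and U: "(\<Union>i. region X (A i)) = region X j"
  have An: "A n \<in> ordered_pairs X" for n using A by auto
  have "(\<lambda>n. L (\<lambda>x. snd (A n) x - fst (A n) x)) sums L (\<lambda>x. snd j x - fst j x)"
  proof (rule L_suminf)
   fix x assume x: "x \<in> topspace X"
   have "(\<Sum>n. emeasure lborel (Pair x -` region X (A n))) = emeasure lborel (\<Union>n. Pair x -` region X (A n))"
   proof (rule suminf_emeasure)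
    show "range (\<lambda>n. Pair x -` region X (A n)) \<subseteq> sets lborel"
    proof safe
     fix n
     have "Pair x -` region X (A n) = {fst (A n) x..<snd (A n) x}"
      using x by (auto simp: region_def split: prod.splits)
     thus "Pair x -` region X (A n) \<in> sets lborel" by simp
    qed
    show "disjoint_family (\<lambda>n. Pair x -` region X (A n))"
     using disj unfolding disjoint_family_on_def by fastforce
   qed
   also have "(\<Union>n. Pair x -` region X (A n)) = Pair x -` region X j" using U by blast
   finally have s: "(\<Sum>n. ennreal (snd (A n) x - fst (A n) x)) = ennreal (snd j x - fst j x)"
    using width[OF An x] width[OF j x] by simp
   have nn: "0 \<le> snd (A n) x - fst (A n) x" for n using An[of n] x by (auto simp: ordered_pairs_def)
   have nj: "0 \<le> snd j x - fst j x" using j x by (auto simp: ordered_pairs_def)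
   have sm: "summable (\<lambda>n. snd (A n) x - fst (A n) x)"
    using nn s by (intro summable_suminf_not_top) (auto simp del: ennreal_minus)
   hence "ennreal (\<Sum>n. snd (A n) x - fst (A n) x) = ennreal (snd j x - fst j x)"
    using s suminf_ennreal2[OF nn sm] by simp
   hence "(\<Sum>n. snd (A n) x - fst (A n) x) = snd j x - fst j x"
    using suminf_nonneg[OF sm nn] nj by simp
   thus "(\<lambda>n. snd (A n) x - fst (A n) x) sums (snd j x - fst j x)" using sm by (simp add: sums_iff)
   show "0 \<le> snd (A n) x - fst (A n) x" for n by (rule nn)
  qed (use An j in \<open>auto simp: ordered_pairs_def case_prod_beta intro!: continuous_map_diff\<close>)
  thus "(\<Sum>n. case A n of (f, g) => ennreal (L (\<lambda>x. g x - f x))) = (case j of (f, g) => ennreal (L (\<lambda>x. g x - f x)))"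
   using pos[OF An] by (simp add: case_prod_beta suminf_ennreal2 sums_iff)
 qed
 thus ?thesis by simp
qed

text \<open>The strip of height one over the whole space, projected down: the mass of
  \<open>B\<close> is that of the cylinder \<open>B \<times> {0..<1}\<close>.\<close>

definition representing_measure :: "'x measure" where
 "representing_measure = distr (restrict_space region_measure (region X (\<lambda>_. 0, \<lambda>_. 1))) (borel_of X) fst"

lemma cylinder_in_sets:
 assumes U: "openin X U"
 shows "U \<times> {0..<1} \<in> sets region_measure"
proof -
 obtain f :: "nat => 'x => real" where f: "\<And>n. rcmap X (f n)"
  "\<And>n x. x \<in> topspace X ==> 0 \<le> f n x" "\<And>n x. x \<in> topspace X ==> f n x \<le> 1"
  "\<And>n x. x \<in> topspace X - U ==> f n x = 0" "\<And>x. x \<in> U ==> \<exists>n. f n x = 1"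
  using increasing_functions_to_open[OF cpt hd sc U] by metis
 have "U \<times> {0..<1} = (\<Union>n. region X (\<lambda>_. 0, f n))"
 proof safe
  fix x t assume x: "x \<in> U" and t: "t \<in> {0..<1::real}"
  obtain n where "f n x = 1" using f(5)[OF x] by blast
  thus "(x, t) \<in> (\<Union>n. region X (\<lambda>_. 0, f n))"
   using x t openin_subset[OF U] by (intro UN_I[of n]) auto
 next
  fix x t n assume *: "(x, t) \<in> region X (\<lambda>_. 0, f n)"
  hence "f n x \<noteq> 0" "x \<in> topspace X" by auto
  thus "x \<in> U" using f(4)[of x n] by blast
  show "t \<in> {0..<1}" using * f(3)[of x n] by auto
 qed
 thus ?thesis using f by (auto intro!: region_in_sets)
qed

lemma fst_measurable:
 "fst \<in> measurable (restrict_space region_measure (region X (\<lambda>_. 0, \<lambda>_. 1))) (borel_of X)"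
 unfolding borel_of_def
proof (rule measurable_measure_of)
 have R: "region X (\<lambda>_. 0, \<lambda>_. 1) \<in> sets region_measure" by (rule region_in_sets) auto
 have sp: "space (restrict_space region_measure (region X (\<lambda>_. 0, \<lambda>_. 1))) = region X (\<lambda>_. 0, \<lambda>_. 1)"
  using region_subset by (auto simp: space_restrict_space space_region_measure)
 thus "fst \<in> space (restrict_space region_measure (region X (\<lambda>_. 0, \<lambda>_. 1))) \<rightarrow> topspace X"
  by auto
 fix U assume "U \<in> {U. openin X U}"
 hence U: "openin X U" by simp
 have "fst -` U \<inter> region X (\<lambda>_. 0, \<lambda>_. 1) = U \<times> {0..<1}"
  using openin_subset[OF U] by auto
 thus "fst -` U \<inter> space (restrict_space region_measure (region X (\<lambda>_. 0, \<lambda>_. 1)))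
   \<in> sets (restrict_space region_measure (region X (\<lambda>_. 0, \<lambda>_. 1)))"
  using cylinder_in_sets[OF U] R openin_subset[OF U] region_subset[of X "(\<lambda>_. 0, \<lambda>_. 1)"]
  by (auto simp: sp sets_restrict_space_iff space_region_measure Int_absorb2)
qed (auto dest: openin_subset)

lemma sets_representing_measure [simp]: "sets representing_measure = sets (borel_of X)"
 by (simp add: representing_measure_def)

lemma emeasure_representing_measure:
 assumes "B \<in> sets (borel_of X)"
 shows "emeasure representing_measure B = emeasure region_measure (B \<times> {0..<1})"
  and "B \<times> {0..<1} \<in> sets region_measure"
proof -
 have R: "region X (\<lambda>_. 0, \<lambda>_. 1) \<in> sets region_measure" by (rule region_in_sets) auto
 have sp: "space (restrict_space region_measure (region X (\<lambda>_. 0, \<lambda>_. 1))) = region X (\<lambda>_. 0, \<lambda>_. 1)"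
  using region_subset by (auto simp: space_restrict_space space_region_measure)
 have B: "fst -` B \<inter> region X (\<lambda>_. 0, \<lambda>_. 1) = B \<times> {0..<1}"
  using sets.sets_into_space[OF assms] by auto
 have "B \<times> {0..<1} \<in> sets (restrict_space region_measure (region X (\<lambda>_. 0, \<lambda>_. 1)))"
  using measurable_sets[OF fst_measurable assms] by (simp add: sp B)
 thus "B \<times> {0..<1} \<in> sets region_measure"
  using R region_subset[of X "(\<lambda>_. 0, \<lambda>_. 1)"]
  by (simp add: sets_restrict_space_iff space_region_measure Int_absorb2)
 show "emeasure representing_measure B = emeasure region_measure (B \<times> {0..<1})"
  unfolding representing_measure_def
  using R region_subset[of X "(\<lambda>_. 0, \<lambda>_. 1)"] B sets.sets_into_space[OF assms]
  by (subst emeasure_distr[OF fst_measurable assms], simp only: sp B)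
   (subst emeasure_restrict_space, auto simp: space_region_measure Int_absorb2)
qed

lemma prob_space_representing_measure: "prob_space representing_measure"
proof (rule prob_spaceI)
 have "space representing_measure = topspace X" by (simp add: representing_measure_def)
 moreover have "topspace X \<in> sets (borel_of X)" by (simp add: borel_of_openin)
 moreover have "topspace X \<times> {0..<1} = region X (\<lambda>_. 0, \<lambda>_. 1)" by auto
 ultimately show "emeasure representing_measure (space representing_measure) = 1"
  using emeasure_representing_measure[of "topspace X"] emeasure_region[of "\<lambda>_. 0" "\<lambda>_. 1"]
  by (simp add: L_const)
qed

text \<open>If \<open>a = 1\<close> wherever \<open>b > 0\<close>, the cylinder over the support of
  \<open>b\<close> lies below the graph of \<open>a\<close>, so the integral of \<open>b\<close> is
  at most \<open>L a\<close>. Cutting \<open>n * f\<close> into layers of height one makes each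
  layer equal to 1 on the support of the next.\<close>

lemma integral_representing_measure_le:
 assumes f: "rcmap X f" and f01: "\<And>x. x \<in> topspace X ==> 0 \<le> f x \<and> f x \<le> 1"
 shows "(\<integral>x. f x \<partial>representing_measure) \<le> L f"
proof -
 interpret prob_space representing_measure by (rule prob_space_representing_measure)
 have sp: "space representing_measure = topspace X" by (simp add: representing_measure_def)
 have key: "(\<integral>x. b x \<partial>representing_measure) \<le> L a"
  if a: "rcmap X a" "\<And>x. x \<in> topspace X ==> 0 \<le> a x \<and> a x \<le> 1"
   and b: "rcmap X b" "\<And>x. x \<in> topspace X ==> 0 \<le> b x \<and> b x \<le> 1"
   and ab: "\<And>x. x \<in> topspace X ==> 0 < b x ==> a x = 1" for a b
 proof -
  define B where "B = {x \<in> topspace X. b x \<in> {0<..}}"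
  have "openin X B" unfolding B_def by (intro openin_continuous_map_preimage[OF b(1)]) auto
  hence B: "B \<in> sets representing_measure" by (simp add: borel_of_openin)
  have "(\<integral>x. b x \<partial>representing_measure) \<le> (\<integral>x. indicator B x \<partial>representing_measure)"
  proof (rule integral_mono)
   show "integrable representing_measure b"
    by (intro integrable_continuous_map[OF cpt _ _ b(1)]) (auto simp: finite_measure_axioms)
   show "integrable representing_measure (indicator B :: 'x => real)"
    using B by (intro integrable_real_indicator) (auto simp: emeasure_eq_measure)
   show "b x \<le> indicator B x" if "x \<in> space representing_measure" for x
    using b(2)[of x] that by (auto simp: sp B_def indicator_def)
  qed
  also have "... = prob B" using B by simp
  also have "... \<le> L a"
  proof -
   have "emeasure representing_measure B = emeasure region_measure (B \<times> {0..<1})"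
    using B by (intro emeasure_representing_measure) simp
   also have "... \<le> emeasure region_measure (region X (\<lambda>_. 0, a))"
    using ab a by (intro emeasure_mono region_in_sets) (auto simp: B_def)
   also have "... = ennreal (L a)" using a by (subst emeasure_region) auto
   finally have "ennreal (prob B) \<le> ennreal (L a)" by (simp add: emeasure_eq_measure)
   moreover have "0 \<le> L a" using L_mono[of "\<lambda>_. 0" a] a by (simp add: L_const)
   ultimately show ?thesis by simp
  qed
  finally show ?thesis .
 qed
 have "(\<integral>x. f x \<partial>representing_measure) \<le> L f + e" if e: "e > 0" for e
 proof -
  obtain n :: nat where n: "n > 0" "1 / n < e" using e by (metis nat_approx_posE of_nat_Suc zero_less_Suc)
  \<comment> \<open>The part of \<open>n * f\<close> between the heights \<open>k\<close> and
    \<open>k + 1\<close>: the layers below \<open>n\<close> add up to \<open>n * f\<close>, and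
    \<open>h k = 1\<close> where \<open>h (Suc k) > 0\<close>.\<close>
  define h where "h k x = min 1 (max 0 (n * f x - real k))" for k x
  have hc: "rcmap X (h k)" for k
   unfolding h_def by (intro continuous_map_real_min continuous_map_real_max continuous_map_diff
     continuous_map_real_mult_left f) auto
  have hs: "(\<Sum>k<m. h k x) = min (real m) (n * f x)" if "x \<in> topspace X" for m x
  proof (induction m)
   case (Suc m)
   thus ?case using f01[OF that] n by (auto simp: h_def min_def max_def not_le)
  qed (use f01[OF that] in auto)
  have hs': "(\<Sum>k<n. h k x) = n * f x" if "x \<in> topspace X" for x
   using hs[OF that, of n] f01[OF that] n by (simp add: min_def mult_left_le)
  have int: "integrable representing_measure (h k)" for k
   by (intro integrable_continuous_map[OF cpt _ _ hc]) (auto simp: finite_measure_axioms)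
  have "n * (\<integral>x. f x \<partial>representing_measure) = (\<integral>x. (\<Sum>k<n. h k x) \<partial>representing_measure)"
   unfolding integral_mult_right_zero[symmetric]
   by (rule Bochner_Integration.integral_cong) (auto simp: hs' sp)
  also have "... = (\<Sum>k<n. \<integral>x. h k x \<partial>representing_measure)"
   by (intro Bochner_Integration.integral_sum int)
  \<comment> \<open>The extra term lets the index be shifted: layer 0 is bounded by 1, layer
    \<open>k + 1\<close> by \<open>L (h k)\<close>. The price of 1 becomes \<open>1 / n\<close>
    after division.\<close>
  also have "... \<le> (\<Sum>k<Suc n. \<integral>x. h k x \<partial>representing_measure)"
   by (intro sum_mono2) (auto simp: h_def intro!: integral_nonneg_AE)
  also have "... = (\<integral>x. h 0 x \<partial>representing_measure) + (\<Sum>k<n. \<integral>x. h (Suc k) x \<partial>representing_measure)"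
   by (rule sum.lessThan_Suc_shift)
  also have "... \<le> 1 + (\<Sum>k<n. L (h k))"
  proof (intro add_mono sum_mono)
   have "(\<integral>x. h 0 x \<partial>representing_measure) \<le> (\<integral>x. 1 \<partial>representing_measure)"
    by (intro integral_mono int) (auto simp: h_def)
   thus "(\<integral>x. h 0 x \<partial>representing_measure) \<le> 1" by (simp add: prob_space)
   show "(\<integral>x. h (Suc k) x \<partial>representing_measure) \<le> L (h k)" for k
    by (rule key[OF hc _ hc]) (auto simp: h_def)
  qed
  also have "(\<Sum>k<n. L (h k)) = L (\<lambda>x. \<Sum>k<n. h k x)"
   by (rule L_sum[symmetric]) (auto simp: hc)
  also have "... \<le> L (\<lambda>x. n * f x)"
   by (rule L_mono) (auto simp: hs' intro!: continuous_map_sum hc continuous_map_real_mult_left f)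
  also have "... = n * L f" by (rule L_scale[OF f])
  finally have "n * (\<integral>x. f x \<partial>representing_measure) \<le> n * (L f + 1 / n)"
   using n by (simp add: algebra_simps)
  hence "(\<integral>x. f x \<partial>representing_measure) \<le> L f + 1 / n"
   using n by (subst (asm) mult_le_cancel_left_pos) auto
  thus ?thesis using n by linarith
 qed
 thus ?thesis by (rule field_le_epsilon)
qed

theorem integral_representing_measure:
 assumes f: "rcmap X f"
 shows "(\<integral>x. f x \<partial>representing_measure) = L f"
proof -
 interpret prob_space representing_measure by (rule prob_space_representing_measure)
 have int: "integrable representing_measure g" if "rcmap X g" for g
  by (intro integrable_continuous_map[OF cpt _ _ that]) (auto simp: finite_measure_axioms)
 have le: "(\<integral>x. g x \<partial>representing_measure) \<le> L g" if g: "rcmap X g" for g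
 proof -
  obtain B where B: "B > 0" "\<And>x. x \<in> topspace X ==> norm (g x) \<le> B"
   using continuous_map_compact_bounded[OF cpt g] by metis
  \<comment> \<open>Rescaling into [0, 1], where the inequality is available; applying the result to
    both \<open>f\<close> and its negative yields equality.\<close>
  define h where "h x = (1 / (2 * B)) * (g x + B)" for x
  have hc: "rcmap X h"
   unfolding h_def by (intro continuous_map_real_mult_left continuous_map_add g) auto
  have "(\<integral>x. h x \<partial>representing_measure) \<le> L h"
   using B by (intro integral_representing_measure_le[OF hc]) (force simp: h_def field_simps abs_le_iff)
  moreover have "(\<integral>x. h x \<partial>representing_measure) = (1 / (2 * B)) * ((\<integral>x. g x \<partial>representing_measure) + B)"
   unfolding h_def using int[OF g] by (simp add: prob_space)
  moreover have "L h = (1 / (2 * B)) * (L g + B)"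
  proof -
   have "rcmap X (\<lambda>x. g x + B)" by (intro continuous_map_add g) auto
   hence "L h = (1 / (2 * B)) * L (\<lambda>x. g x + B)" unfolding h_def by (rule L_scale)
   thus ?thesis using L_add[OF g, of "\<lambda>_. B"] by (simp add: L_const)
  qed
  ultimately show ?thesis using B by (simp add: divide_le_cancel)
 qed
 show ?thesis using le[OF f] le[OF continuous_map_minus[OF f]] L_scale[OF f, of "-1"] by simp
qed

end

section \<open>Coset spaces\<close>

lemma (in group) l_coset_eq_iff:
 assumes "subgroup H G" "a \<in> carrier G" "b \<in> carrier G"
 shows "a <# H = b <# H \<longleftrightarrow> inv a \<otimes> b \<in> H"
proof
 assume "a <# H = b <# H"
 hence "b \<in> a <# H" using lcos_self assms by blast
 thus "inv a \<otimes> b \<in> H" using subgroup.lcos_module_imp[OF assms(1) group_axioms assms(2)] by blast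
next
 assume "inv a \<otimes> b \<in> H"
 hence "b \<in> a <# H" using subgroup.lcos_module_rev[OF assms(1) group_axioms assms(2,3)] by blast
 thus "a <# H = b <# H" using l_repr_independence assms by blast
qed

context topological_group
begin

lemma continuous_map_mult:
 assumes "continuous_map X T f" "continuous_map X T g"
 shows "continuous_map X T (\<lambda>x. f x \<otimes> g x)"
 using continuous_map_compose[OF continuous_map_pairedI[OF assms] continuous_mult] by (simp add: o_def)

lemma continuous_map_inverse:
 assumes "continuous_map X T f"
 shows "continuous_map X T (\<lambda>x. inv (f x))"
 using continuous_map_compose[OF assms continuous_inv] by (simp add: o_def)

lemma continuous_map_const_carrier: "a \<in> carrier G ==> continuous_map X T (\<lambda>x. a)"
 by (simp add: topspace_eq)

lemma continuous_map_left_mult: "a \<in> carrier G ==> continuous_map T T (\<lambda>x. a \<otimes> x)"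
 by (intro continuous_map_mult continuous_map_const_carrier) auto

lemma continuous_map_right_mult: "a \<in> carrier G ==> continuous_map T T (\<lambda>x. x \<otimes> a)"
 by (intro continuous_map_mult continuous_map_const_carrier) auto

lemma topspace_cosets: "topspace (coset_space G T H) = (\<lambda>g. g <# H) ` carrier G"
 by (auto simp: topspace_coset_space[OF topspace_eq] LCOSETS_def)

lemma continuous_map_coset: "continuous_map T (coset_space G T H) (\<lambda>g. g <# H)"
 unfolding continuous_map
proof (intro conjI allI impI)
 fix \<U> assume "openin (coset_space G T H) \<U>"
 thus "openin T {x \<in> topspace T. x <# H \<in> \<U>}"
  by (simp add: openin_coset_space[OF topspace_eq] topspace_eq)
qed (auto simp: topspace_cosets topspace_eq)

text \<open>The preimage of the image of \<open>U\<close> is the union of the right translates of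
  \<open>U\<close> by elements of \<open>H\<close>.\<close>

lemma open_map_coset:
 assumes H: "subgroup H G"
 shows "open_map T (coset_space G T H) (\<lambda>g. g <# H)" unfolding open_map_def
proof (intro allI impI)
 fix U assume U: "openin T U"
 hence UG: "U \<subseteq> carrier G" using openin_subset topspace_eq by blast
 have "{g \<in> carrier G. g <# H \<in> (\<lambda>g. g <# H) ` U} = (\<Union>h\<in>H. {g \<in> topspace T. g \<otimes> h \<in> U})"
 proof (intro equalityI subsetI)
  fix g assume "g \<in> {g \<in> carrier G. g <# H \<in> (\<lambda>g. g <# H) ` U}"
  then obtain u where u: "g \<in> carrier G" "u \<in> U" "g <# H = u <# H" by auto
  hence "inv g \<otimes> u \<in> H" using l_coset_eq_iff[OF H] UG by blast
  moreover have "g \<otimes> (inv g \<otimes> u) = u"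
   using u UG by (simp add: subset_iff m_assoc[symmetric])
  ultimately show "g \<in> (\<Union>h\<in>H. {g \<in> topspace T. g \<otimes> h \<in> U})"
   using u topspace_eq by (metis (mono_tags, lifting) UN_I mem_Collect_eq)
 next
  fix g assume "g \<in> (\<Union>h\<in>H. {g \<in> topspace T. g \<otimes> h \<in> U})"
  then obtain h where h: "h \<in> H" "g \<in> carrier G" "g \<otimes> h \<in> U" by (auto simp: topspace_eq)
  hence hG: "h \<in> carrier G" using H subgroup.mem_carrier by fastforce
  have "inv g \<otimes> (g \<otimes> h) = h" using h hG by (simp add: m_assoc[symmetric])
  hence "g <# H = (g \<otimes> h) <# H" using l_coset_eq_iff[OF H h(2), of "g \<otimes> h"] h hG by simp
  thus "g \<in> {g \<in> carrier G. g <# H \<in> (\<lambda>g. g <# H) ` U}" using h by auto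
 qed
 moreover have "openin T {g \<in> topspace T. g \<otimes> h \<in> U}" if "h \<in> H" for h
  using that H subgroup.mem_carrier[OF H] by (intro openin_continuous_map_preimage[OF continuous_map_right_mult U]) auto
 ultimately have "openin T {g \<in> carrier G. g <# H \<in> (\<lambda>g. g <# H) ` U}" by auto
 moreover have "(\<lambda>g. g <# H) ` U \<subseteq> lcosets H" using UG by (auto simp: LCOSETS_def)
 ultimately show "openin (coset_space G T H) ((\<lambda>g. g <# H) ` U)"
  by (simp add: openin_coset_space[OF topspace_eq])
qed

lemma quotient_map_coset: "subgroup H G ==> quotient_map T (coset_space G T H) (\<lambda>g. g <# H)"
 by (intro continuous_open_imp_quotient_map continuous_map_coset open_map_coset)
   (auto simp: topspace_cosets topspace_eq)

text \<open>As \<open>H\<close> is closed, the pairs with \<open>inv x \<otimes> y\<close> outside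
  \<open>H\<close> form an open set; a product neighbourhood inside it projects to disjoint open
  sets.\<close>

lemma Hausdorff_coset_space:
 assumes H: "subgroup H G" and cl: "closedin T H"
 shows "Hausdorff_space (coset_space G T H)" unfolding Hausdorff_space_def
proof (intro allI impI)
 fix p q assume pq: "p \<in> topspace (coset_space G T H) \<and> q \<in> topspace (coset_space G T H) \<and> p \<noteq> q"
 then obtain x y where x: "x \<in> carrier G" "p = x <# H" and y: "y \<in> carrier G" "q = y <# H"
  by (auto simp: topspace_cosets)
 define W where "W = {z \<in> topspace (prod_topology T T). inv (fst z) \<otimes> snd z \<in> topspace T - H}"
 have cm: "continuous_map (prod_topology T T) T (\<lambda>z. inv (fst z) \<otimes> snd z)"
  by (intro continuous_map_mult continuous_map_inverse continuous_map_fst continuous_map_snd)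
 have "openin T (topspace T - H)" using cl by (simp add: closedin_def)
 hence oW: "openin (prod_topology T T) W" unfolding W_def by (rule openin_continuous_map_preimage[OF cm])
 have xyW: "(x, y) \<in> W" using pq x y l_coset_eq_iff[OF H] by (auto simp: W_def topspace_eq)
 obtain U V where UV: "openin T U" "openin T V" "x \<in> U" "y \<in> V" "U \<times> V \<subseteq> W"
  using openin_prod_topology_alt[THEN iffD1, rule_format, OF oW xyW] by metis
 have "disjnt ((\<lambda>g. g <# H) ` U) ((\<lambda>g. g <# H) ` V)"
 proof -
  have "u <# H \<noteq> v <# H" if "u \<in> U" "v \<in> V" for u v
   using that UV(5) l_coset_eq_iff[OF H, of u v] by (auto simp: W_def topspace_eq)
  thus ?thesis by (auto simp: disjnt_iff)
 qed
 thus "\<exists>U V. openin (coset_space G T H) U \<and> openin (coset_space G T H) V \<and> p \<in> U \<and> q \<in> V \<and> disjnt U V"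
  using UV x y open_map_coset[OF H, unfolded open_map_def, rule_format, OF UV(1)]
   open_map_coset[OF H, unfolded open_map_def, rule_format, OF UV(2)]
  by (intro exI[of _ "(\<lambda>g. g <# H) ` U"] exI[of _ "(\<lambda>g. g <# H) ` V"]) auto
qed

lemma coset_action:
 assumes "subgroup H G" "a \<in> carrier G" "b \<in> carrier G"
 shows "a <# (b <# H) = (a \<otimes> b) <# H" using assms lcos_m_assoc subgroup.subset by blast

lemma coset_action_closed:
 assumes "subgroup H G" "a \<in> carrier G" "x \<in> topspace (coset_space G T H)"
 shows "a <# x \<in> topspace (coset_space G T H)" using assms coset_action by (auto simp: topspace_cosets)

lemma coset_action_assoc:
 assumes "subgroup H G" "a \<in> carrier G" "b \<in> carrier G" "x \<in> topspace (coset_space G T H)"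
 shows "a <# (b <# x) = (a \<otimes> b) <# x"
 using assms by (auto simp: topspace_cosets coset_action m_assoc)

lemma coset_action_one:
 assumes "subgroup H G" "x \<in> topspace (coset_space G T H)"
 shows "\<one> <# x = x" using assms by (auto simp: topspace_cosets coset_action)

lemma subgroup_topological_group:
 assumes K: "subgroup K G"
 shows "topological_group (G\<lparr>carrier := K\<rparr>) (subtopology T K)"
proof (intro topological_group.intro topological_group_axioms.intro)
 show "group (G\<lparr>carrier := K\<rparr>)" by (rule subgroup.subgroup_is_group[OF K group_axioms])
 have KG: "K \<subseteq> carrier G" using K by (rule subgroup.subset)
 show "topspace (subtopology T K) = carrier (G\<lparr>carrier := K\<rparr>)"
  using KG by (auto simp: topspace_eq)
 have id: "continuous_map (subtopology T K) T (\<lambda>x. x)" by (simp add: continuous_map_from_subtopology)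
 have p: "continuous_map (prod_topology (subtopology T K) (subtopology T K)) T fst"
   "continuous_map (prod_topology (subtopology T K) (subtopology T K)) T snd"
  using continuous_map_compose[OF continuous_map_fst id] continuous_map_compose[OF continuous_map_snd id]
  by (simp_all add: o_def)
 have "continuous_map (prod_topology (subtopology T K) (subtopology T K)) T (\<lambda>z. fst z \<otimes> snd z)"
  by (intro continuous_map_mult p)
 hence "continuous_map (prod_topology (subtopology T K) (subtopology T K)) (subtopology T K) (\<lambda>z. fst z \<otimes> snd z)"
  using subgroup.m_closed[OF K] by (auto simp: continuous_map_in_subtopology)
 thus "continuous_map (prod_topology (subtopology T K) (subtopology T K)) (subtopology T K)
   (\<lambda>(x, y). x \<otimes>\<^bsub>G\<lparr>carrier := K\<rparr>\<^esub> y)"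
  by (simp add: case_prod_unfold)
 have "continuous_map (subtopology T K) (subtopology T K) (\<lambda>x. inv x)"
  using continuous_map_inverse[OF id] subgroup.m_inv_closed[OF K] by (auto simp: continuous_map_in_subtopology)
 thus "continuous_map (subtopology T K) (subtopology T K) (\<lambda>x. inv\<^bsub>G\<lparr>carrier := K\<rparr>\<^esub> x)"
  by (rule continuous_map_eq) (use m_inv_consistent[OF K] in auto)
qed

end

locale compact_group = topological_group +
 assumes compact_T: "compact_space T" and Hausdorff_T: "Hausdorff_space T"
  and second_countable_T: "second_countable T"
begin

lemma compact_coset_space: "compact_space (coset_space G T H)"
proof -
 have "compactin (coset_space G T H) ((\<lambda>g. g <# H) ` topspace T)"
  using compact_T by (intro image_compactin[OF _ continuous_map_coset]) (simp add: compact_space_def)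
 thus ?thesis by (simp add: compact_space_def topspace_cosets topspace_eq)
qed

lemma second_countable_coset_space:
 assumes "subgroup H G"
 shows "second_countable (coset_space G T H)"
 using second_countable_open_map_image[OF continuous_map_coset open_map_coset[OF assms] _ second_countable_T]
 by (simp add: topspace_cosets topspace_eq)

text \<open>Continuity may be tested on representatives, because the product of a quotient map with
  the identity of the locally compact group is again a quotient map.\<close>

lemma continuous_map_coset_action:
 assumes H: "subgroup H G"
 shows "continuous_map (prod_topology T (coset_space G T H)) (coset_space G T H) (\<lambda>(g, x). g <# x)"
proof (rule continuous_compose_quotient_map)
 show "quotient_map (prod_topology T T) (prod_topology T (coset_space G T H)) (\<lambda>(g, a). (g, a <# H))"
  by (intro quotient_map_prod_right quotient_map_coset H compact_imp_locally_compact_space compact_T)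
    (simp add: Hausdorff_T)
 have "continuous_map (prod_topology T T) (coset_space G T H) ((\<lambda>g. g <# H) \<circ> (\<lambda>z. fst z \<otimes> snd z))"
  by (intro continuous_map_compose[OF _ continuous_map_coset] continuous_map_mult continuous_map_fst continuous_map_snd)
 thus "continuous_map (prod_topology T T) (coset_space G T H) ((\<lambda>(g, x). g <# x) \<circ> (\<lambda>(g, a). (g, a <# H)))"
  by (rule continuous_map_eq) (auto simp: topspace_eq coset_action[OF H])
qed

lemma continuous_map_act:
 assumes "subgroup H G" "continuous_map X T a" "continuous_map X (coset_space G T H) f"
 shows "continuous_map X (coset_space G T H) (\<lambda>x. a x <# f x)"
 using continuous_map_compose[OF continuous_map_pairedI[OF assms(2,3)] continuous_map_coset_action[OF assms(1)]]
 by (simp add: o_def)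

lemma compact_subgroup:
 assumes "subgroup K G" "closedin T K"
 shows "compact_group (G\<lparr>carrier := K\<rparr>) (subtopology T K)"
proof (intro compact_group.intro compact_group_axioms.intro subgroup_topological_group assms)
 show "compact_space (subtopology T K)"
  using assms compact_T closedin_compact_space compact_space_subtopology by blast
qed (auto intro: Hausdorff_space_subtopology Hausdorff_T second_countable_subtopology second_countable_T)

end

section \<open>Parameter integrals and Fubini for continuous functions on compact spaces\<close>

lemma continuous_map_integral_parameter:
 fixes F :: "'x => 'y => 'c::{banach, second_countable_topology}"
 assumes Y: "compact_space Y" "sets \<nu> = sets (borel_of Y)" "prob_space \<nu>"
  and F: "cmap (prod_topology X Y) (\<lambda>(x, y). F x y)"
 shows "cmap X (\<lambda>x. \<integral>y. F x y \<partial>\<nu>)"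
 unfolding continuous_map_def
proof (intro conjI allI impI)
 interpret prob_space \<nu> by fact
 have sp: "space \<nu> = topspace Y" using sets_eq_imp_space_eq[OF Y(2)] by simp
 have cy: "cmap Y (F x)" if "x \<in> topspace X" for x
 proof -
  have "continuous_map Y (prod_topology X Y) (\<lambda>y. (x, y))"
   using that by (intro continuous_map_pairedI) auto
  from continuous_map_compose[OF this F] show ?thesis by (simp add: o_def)
 qed
 have int: "integrable \<nu> (F x)" if "x \<in> topspace X" for x
  by (rule integrable_continuous_map[OF Y(1,2) _ cy[OF that]]) (rule finite_measure_axioms)
 fix U :: "'c set" assume "openin euclidean U"
 hence U: "open U" by (rule open_openin[THEN iffD2])
 show "openin X {x \<in> topspace X. (\<integral>y. F x y \<partial>\<nu>) \<in> U}"
 proof (subst openin_subopen, safe)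
  fix x assume x: "x \<in> topspace X" "(\<integral>y. F x y \<partial>\<nu>) \<in> U"
  obtain e where e: "e > 0" "ball (\<integral>y. F x y \<partial>\<nu>) e \<subseteq> U"
   using U x openE by blast
  obtain W where W: "openin X W" "x \<in> W"
   "\<And>z y. z \<in> W ==> y \<in> topspace Y ==> norm (F z y - F x y) < e / 2"
   using continuous_map_compact_tube[OF Y(1) F x(1) half_gt_zero[OF e(1)]] by metis
  have "(\<integral>y. F z y \<partial>\<nu>) \<in> U" if z: "z \<in> W" for z
  proof -
   have zX: "z \<in> topspace X" using z W(1) openin_subset by blast
   have "norm ((\<integral>y. F z y \<partial>\<nu>) - (\<integral>y. F x y \<partial>\<nu>)) = norm (\<integral>y. F z y - F x y \<partial>\<nu>)"
    using int[OF zX] int[OF x(1)] by simp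
   also have "... \<le> (\<integral>y. norm (F z y - F x y) \<partial>\<nu>)"
    by (rule integral_norm_bound)
   also have "... \<le> (\<integral>y. e / 2 \<partial>\<nu>)"
    using int[OF zX] int[OF x(1)] W(3)[OF z] by (intro integral_mono) (auto simp: sp less_imp_le)
   also have "... < e" using e by (simp add: prob_space)
   finally show ?thesis using e(2) by (auto simp: dist_norm norm_minus_commute)
  qed
  thus "\<exists>W. openin X W \<and> x \<in> W \<and> W \<subseteq> {x \<in> topspace X. (\<integral>y. F x y \<partial>\<nu>) \<in> U}"
   using W openin_subset[OF W(1)] by (intro exI[of _ W]) auto
 qed
qed auto

text \<open>Integrating a partition of unity yields nodes and weights that serve all
  \<open>y\<close> at once and also the integral over \<open>y\<close>. This gives Fubini, and later
  places convolutions in the uniform closure of the span of translates.\<close>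

lemma integral_uniform_sums:
 fixes F :: "'x => 'y => 'c::{banach, second_countable_topology}"
 assumes X: "compact_space X" "Hausdorff_space X" "sets \<mu> = sets (borel_of X)" "prob_space \<mu>"
  and Y: "compact_space Y" "sets \<nu> = sets (borel_of Y)" "prob_space \<nu>"
  and F: "cmap (prod_topology X Y) (\<lambda>(x, y). F x y)" and e: "e > 0"
 shows "\<exists>P (w :: 'x => real). finite P \<and> P \<subseteq> topspace X \<and> (\<forall>p\<in>P. 0 \<le> w p) \<and> sum w P = 1 \<and>
  (\<forall>y\<in>topspace Y. norm ((\<integral>x. F x y \<partial>\<mu>) - (\<Sum>p\<in>P. w p *\<^sub>R F p y)) \<le> e) \<and>
  norm ((\<integral>x. (\<integral>y. F x y \<partial>\<nu>) \<partial>\<mu>) - (\<Sum>p\<in>P. w p *\<^sub>R (\<integral>y. F p y \<partial>\<nu>))) \<le> e"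
proof -
 interpret X: prob_space \<mu> by fact
 interpret Y: prob_space \<nu> by fact
 have spX: "space \<mu> = topspace X" and spY: "space \<nu> = topspace Y"
  using sets_eq_imp_space_eq[OF X(3)] sets_eq_imp_space_eq[OF Y(2)] by simp_all
 obtain P and \<phi> :: "'x => 'x => real" where P: "finite P" "P \<subseteq> topspace X"
  and \<phi>: "\<And>p. p \<in> P ==> rcmap X (\<phi> p)"
  "\<And>p x. p \<in> P ==> x \<in> topspace X ==> 0 \<le> \<phi> p x"
  "\<And>x. x \<in> topspace X ==> (\<Sum>p\<in>P. \<phi> p x) = 1"
  "\<And>x y. x \<in> topspace X ==> y \<in> topspace Y ==> norm (F x y - (\<Sum>p\<in>P. \<phi> p x *\<^sub>R F p y)) \<le> e"
  using continuous_partition_of_unity[OF X(1,2) Y(1) F e] by blast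
 define w where "w p = (\<integral>x. \<phi> p x \<partial>\<mu>)" for p
 have int\<phi>: "integrable \<mu> (\<phi> p)" if "p \<in> P" for p
  by (rule integrable_continuous_map[OF X(1,3) _ \<phi>(1)[OF that]]) (rule X.finite_measure_axioms)
 have cy: "cmap Y (F x)" if "x \<in> topspace X" for x
 proof -
  have "continuous_map Y (prod_topology X Y) (\<lambda>y. (x, y))"
   using that by (intro continuous_map_pairedI) auto
  from continuous_map_compose[OF this F] show ?thesis by (simp add: o_def)
 qed
 have cx: "cmap X (\<lambda>x. F x y)" if "y \<in> topspace Y" for y
 proof -
  have "continuous_map X (prod_topology X Y) (\<lambda>x. (x, y))"
   using that by (intro continuous_map_pairedI) auto
  from continuous_map_compose[OF this F] show ?thesis by (simp add: o_def)
 qed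
 have intY: "integrable \<nu> (F x)" if "x \<in> topspace X" for x
  by (rule integrable_continuous_map[OF Y(1,2) _ cy[OF that]]) (rule Y.finite_measure_axioms)
 have intX: "integrable \<mu> (\<lambda>x. F x y)" if "y \<in> topspace Y" for y
  by (rule integrable_continuous_map[OF X(1,3) _ cx[OF that]]) (rule X.finite_measure_axioms)
 have intXY: "integrable \<mu> (\<lambda>x. \<integral>y. F x y \<partial>\<nu>)"
  by (rule integrable_continuous_map[OF X(1,3) _ continuous_map_integral_parameter[OF Y F]])
   (rule X.finite_measure_axioms)
 have bound: "norm ((\<integral>x. g x \<partial>\<mu>) - (\<Sum>p\<in>P. w p *\<^sub>R c p)) \<le> e"
  if g: "integrable \<mu> g" and le: "\<And>x. x \<in> topspace X ==> norm (g x - (\<Sum>p\<in>P. \<phi> p x *\<^sub>R c p)) \<le> e"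
  for g :: "'x => 'c" and c
 proof -
  have isum: "integrable \<mu> (\<lambda>x. \<Sum>p\<in>P. \<phi> p x *\<^sub>R c p)"
   using int\<phi> by (intro Bochner_Integration.integrable_sum integrable_scaleR_left) auto
  have "(\<Sum>p\<in>P. w p *\<^sub>R c p) = (\<integral>x. (\<Sum>p\<in>P. \<phi> p x *\<^sub>R c p) \<partial>\<mu>)"
   unfolding w_def using int\<phi> by (simp add: Bochner_Integration.integral_sum)
  hence "norm ((\<integral>x. g x \<partial>\<mu>) - (\<Sum>p\<in>P. w p *\<^sub>R c p)) = norm (\<integral>x. g x - (\<Sum>p\<in>P. \<phi> p x *\<^sub>R c p) \<partial>\<mu>)"
   using g isum by simp
  also have "... \<le> (\<integral>x. norm (g x - (\<Sum>p\<in>P. \<phi> p x *\<^sub>R c p)) \<partial>\<mu>)"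
   by (rule integral_norm_bound)
  also have "... \<le> (\<integral>x. e \<partial>\<mu>)"
   using g isum le by (intro integral_mono) (auto simp: spX)
  finally show ?thesis by (simp add: X.prob_space)
 qed
 show ?thesis
 proof (intro exI[of _ P] exI[of _ w] conjI ballI)
  show "0 \<le> w p" if "p \<in> P" for p
   unfolding w_def using \<phi>(2)[OF that] by (intro integral_nonneg_AE AE_I2) (auto simp: spX)
  have "sum w P = (\<integral>x. (\<Sum>p\<in>P. \<phi> p x) \<partial>\<mu>)"
   unfolding w_def using int\<phi> by (simp add: Bochner_Integration.integral_sum)
  also have "... = (\<integral>x. 1 \<partial>\<mu>)"
   by (rule Bochner_Integration.integral_cong) (auto simp: \<phi>(3) spX)
  finally show "sum w P = 1" by (simp add: X.prob_space)
  show "norm ((\<integral>x. F x y \<partial>\<mu>) - (\<Sum>p\<in>P. w p *\<^sub>R F p y)) \<le> e" if "y \<in> topspace Y" for y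
   by (rule bound[OF intX[OF that]]) (rule \<phi>(4)[OF _ that])
  show "norm ((\<integral>x. (\<integral>y. F x y \<partial>\<nu>) \<partial>\<mu>) - (\<Sum>p\<in>P. w p *\<^sub>R (\<integral>y. F p y \<partial>\<nu>))) \<le> e"
  proof (rule bound[OF intXY])
   fix x assume x: "x \<in> topspace X"
   have isum: "integrable \<nu> (\<lambda>y. \<Sum>p\<in>P. \<phi> p x *\<^sub>R F p y)"
    using P intY by (intro Bochner_Integration.integrable_sum integrable_scaleR_right) auto
   have "(\<Sum>p\<in>P. \<phi> p x *\<^sub>R (\<integral>y. F p y \<partial>\<nu>)) = (\<integral>y. (\<Sum>p\<in>P. \<phi> p x *\<^sub>R F p y) \<partial>\<nu>)"
    using P intY by (subst Bochner_Integration.integral_sum) auto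
   hence "norm ((\<integral>y. F x y \<partial>\<nu>) - (\<Sum>p\<in>P. \<phi> p x *\<^sub>R (\<integral>y. F p y \<partial>\<nu>)))
     = norm (\<integral>y. F x y - (\<Sum>p\<in>P. \<phi> p x *\<^sub>R F p y) \<partial>\<nu>)"
    using intY[OF x] isum by simp
   also have "... \<le> (\<integral>y. norm (F x y - (\<Sum>p\<in>P. \<phi> p x *\<^sub>R F p y)) \<partial>\<nu>)"
    by (rule integral_norm_bound)
   also have "... \<le> (\<integral>y. e \<partial>\<nu>)"
    using intY[OF x] isum \<phi>(4)[OF x] by (intro integral_mono) (auto simp: spY)
   finally show "norm ((\<integral>y. F x y \<partial>\<nu>) - (\<Sum>p\<in>P. \<phi> p x *\<^sub>R (\<integral>y. F p y \<partial>\<nu>))) \<le> e"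
    by (simp add: Y.prob_space)
  qed
 qed (use P in auto)
qed

text \<open>For finite sums the exchange is linearity, and one choice of nodes and weights brings
  both iterated integrals within \<open>e / 2\<close> of the same sum.\<close>

lemma Fubini_continuous:
 fixes F :: "'x => 'y => 'c::{banach, second_countable_topology}"
 assumes X: "compact_space X" "Hausdorff_space X" "sets \<mu> = sets (borel_of X)" "prob_space \<mu>"
  and Y: "compact_space Y" "sets \<nu> = sets (borel_of Y)" "prob_space \<nu>"
  and F: "cmap (prod_topology X Y) (\<lambda>(x, y). F x y)"
 shows "(\<integral>x. (\<integral>y. F x y \<partial>\<nu>) \<partial>\<mu>) = (\<integral>y. (\<integral>x. F x y \<partial>\<mu>) \<partial>\<nu>)" (is "?l = ?r")
proof -
 interpret Y: prob_space \<nu> by fact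
 have spY: "space \<nu> = topspace Y" using sets_eq_imp_space_eq[OF Y(2)] by simp
 have cy: "cmap Y (F x)" if "x \<in> topspace X" for x
 proof -
  have "continuous_map Y (prod_topology X Y) (\<lambda>y. (x, y))"
   using that by (intro continuous_map_pairedI) auto
  from continuous_map_compose[OF this F] show ?thesis by (simp add: o_def)
 qed
 have intY: "integrable \<nu> (F x)" if "x \<in> topspace X" for x
  by (rule integrable_continuous_map[OF Y(1,2) _ cy[OF that]]) (rule Y.finite_measure_axioms)
 have "cmap (prod_topology Y X) ((\<lambda>(x, y). F x y) \<circ> (\<lambda>z. (snd z, fst z)))"
  by (intro continuous_map_compose[OF _ F] continuous_map_pairedI continuous_map_fst continuous_map_snd)
 hence "cmap (prod_topology Y X) (\<lambda>(y, x). F x y)"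
  by (simp add: o_def case_prod_unfold)
 from continuous_map_integral_parameter[OF X(1,3,4) this]
 have intI: "integrable \<nu> (\<lambda>y. \<integral>x. F x y \<partial>\<mu>)"
  by (rule integrable_continuous_map[OF Y(1,2) Y.finite_measure_axioms])
 have le: "norm (?l - ?r) \<le> e" if e: "e > 0" for e
 proof -
  obtain P and w :: "'x => real" where P: "finite P" "P \<subseteq> topspace X"
   and w: "\<And>y. y \<in> topspace Y ==> norm ((\<integral>x. F x y \<partial>\<mu>) - (\<Sum>p\<in>P. w p *\<^sub>R F p y)) \<le> e / 2"
   "norm (?l - (\<Sum>p\<in>P. w p *\<^sub>R (\<integral>y. F p y \<partial>\<nu>))) \<le> e / 2"
   using integral_uniform_sums[OF X Y F half_gt_zero[OF e]] by blast
  have isum: "integrable \<nu> (\<lambda>y. \<Sum>p\<in>P. w p *\<^sub>R F p y)"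
   using P intY by (intro Bochner_Integration.integrable_sum integrable_scaleR_right) auto
  have "(\<Sum>p\<in>P. w p *\<^sub>R (\<integral>y. F p y \<partial>\<nu>)) = (\<integral>y. (\<Sum>p\<in>P. w p *\<^sub>R F p y) \<partial>\<nu>)"
   using P intY by (subst Bochner_Integration.integral_sum) auto
  hence "norm (?r - (\<Sum>p\<in>P. w p *\<^sub>R (\<integral>y. F p y \<partial>\<nu>)))
    = norm (\<integral>y. (\<integral>x. F x y \<partial>\<mu>) - (\<Sum>p\<in>P. w p *\<^sub>R F p y) \<partial>\<nu>)"
   using intI isum by simp
  also have "... \<le> (\<integral>y. norm ((\<integral>x. F x y \<partial>\<mu>) - (\<Sum>p\<in>P. w p *\<^sub>R F p y)) \<partial>\<nu>)"
   by (rule integral_norm_bound)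
  also have "... \<le> (\<integral>y. e / 2 \<partial>\<nu>)"
   using intI isum w(1) by (intro integral_mono) (auto simp: spY)
  also have "... = e / 2" by (simp add: Y.prob_space)
  finally have "norm (?r - (\<Sum>p\<in>P. w p *\<^sub>R (\<integral>y. F p y \<partial>\<nu>))) \<le> e / 2" .
  thus ?thesis
   using w(2) norm_triangle_ineq4[of "?l - (\<Sum>p\<in>P. w p *\<^sub>R (\<integral>y. F p y \<partial>\<nu>))" "?r - (\<Sum>p\<in>P. w p *\<^sub>R (\<integral>y. F p y \<partial>\<nu>))"]
   by simp
 qed
 have "norm (?l - ?r) \<le> 0" by (rule field_le_epsilon) (simp add: le)
 thus ?thesis by simp
qed

section \<open>Haar measure\<close>

context compact_group
begin

definition dense_seq :: "nat => 'a" where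
 "dense_seq = (SOME d. range d \<subseteq> carrier G \<and> (\<forall>U. openin T U \<and> U \<noteq> {} \<longrightarrow> (\<exists>j. d j \<in> U)))"

lemma dense_seq: "dense_seq j \<in> carrier G" "openin T U ==> x \<in> U ==> \<exists>j. dense_seq j \<in> U"
proof -
 obtain C where C: "countable C" "C \<subseteq> topspace T" "T closure_of C = topspace T"
  using second_countable_imp_separable_space[OF second_countable_T] unfolding separable_space_def by blast
 hence ne: "C \<noteq> {}" using topspace_eq one_closed by force
 have "range (from_nat_into C) = C" using C(1) ne by (simp add: range_from_nat_into)
 moreover have "\<exists>c\<in>C. c \<in> U" if "openin T U" "U \<noteq> {}" for U
  using that C(3) dense_intersects_open[of T C] by blast
 ultimately have "range (from_nat_into C) \<subseteq> carrier G \<and> (\<forall>U. openin T U \<and> U \<noteq> {} \<longrightarrow> (\<exists>j. from_nat_into C j \<in> U))"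
  using C(2) topspace_eq by (metis rangeE)
 hence "\<exists>d :: nat => 'a. range d \<subseteq> carrier G \<and> (\<forall>U. openin T U \<and> U \<noteq> {} \<longrightarrow> (\<exists>j. d j \<in> U))"
  by blast
 from someI_ex[OF this, folded dense_seq_def]
 have "range dense_seq \<subseteq> carrier G \<and> (\<forall>U. openin T U \<and> U \<noteq> {} \<longrightarrow> (\<exists>j. dense_seq j \<in> U))" .
 thus "dense_seq j \<in> carrier G" "openin T U ==> x \<in> U ==> \<exists>j. dense_seq j \<in> U"
  by blast+
qed

text \<open>One step of a random walk on the right, with weight \<open>(1/2) ^ Suc j\<close> at the
  \<open>j\<close>-th point of a dense sequence. Iterating it flattens a continuous function to a
  constant, its Haar mean.\<close>

definition smear :: "('a => real) => 'a => real" where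
 "smear f x = (\<Sum>j. (1/2) ^ Suc j * f (x \<otimes> dense_seq j))"

definition bdd :: "('a => real) => bool" where
 "bdd f \<longleftrightarrow> (\<exists>B. \<forall>x\<in>carrier G. \<bar>f x\<bar> \<le> B)"

lemma bdd_I: "(\<And>x. x \<in> carrier G ==> a \<le> f x \<and> f x \<le> b) ==> bdd f"
 unfolding bdd_def by (intro exI[of _ "\<bar>a\<bar> + \<bar>b\<bar>"] ballI) (smt (verit))

lemma bdd_continuous: "rcmap T f ==> bdd f"
 unfolding bdd_def by (rule continuous_map_compact_bounded[OF compact_T, of f]) (auto simp: topspace_eq)

lemma bdd_add:
 assumes "bdd f" "bdd g"
 shows "bdd (\<lambda>x. f x + g x)"
proof -
 obtain B C where "\<And>x. x \<in> carrier G ==> \<bar>f x\<bar> \<le> B" "\<And>x. x \<in> carrier G ==> \<bar>g x\<bar> \<le> C"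
  using assms unfolding bdd_def by blast
 hence "\<bar>f x + g x\<bar> \<le> B + C" if "x \<in> carrier G" for x
  using that by (meson abs_triangle_ineq add_mono order_trans)
 thus ?thesis unfolding bdd_def by blast
qed

lemma bdd_const: "bdd (\<lambda>_. c)" unfolding bdd_def by blast

lemma bdd_scale: "bdd f ==> bdd (\<lambda>x. c * f x)"
 unfolding bdd_def by (metis abs_mult abs_ge_zero mult_left_mono)

lemma smear_summable:
 assumes "bdd f" "x \<in> carrier G"
 shows "summable (\<lambda>j. (1/2) ^ Suc j * f (x \<otimes> dense_seq j))"
proof -
 obtain B where B: "\<And>x. x \<in> carrier G ==> \<bar>f x\<bar> \<le> B"
  using assms bdd_def by blast
 show ?thesis
 proof (rule summable_comparison_test')
  show "summable (\<lambda>j. (1/2) ^ Suc j * B)"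
   using power_half_series by (intro summable_mult2) (simp add: sums_iff)
  show "norm ((1/2) ^ Suc j * f (x \<otimes> dense_seq j)) \<le> (1/2) ^ Suc j * B" if "j \<ge> 0" for j
   using B[of "x \<otimes> dense_seq j"] assms(2) dense_seq(1) by (simp add: abs_mult)
 qed
qed

lemma smear_const: "smear (\<lambda>_. c) x = c"
 unfolding smear_def using sums_mult2[OF power_half_series, of c] by (simp add: sums_iff)

lemma smear_add: "bdd f ==> bdd g ==> x \<in> carrier G ==> smear (\<lambda>x. f x + g x) x = smear f x + smear g x"
 unfolding smear_def using suminf_add[OF smear_summable smear_summable, of f x g x] by (simp add: distrib_left)

lemma smear_scale: "bdd f ==> x \<in> carrier G ==> smear (\<lambda>x. c * f x) x = c * smear f x"
 unfolding smear_def using suminf_mult[OF smear_summable, of f x c] by (simp add: mult_ac)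

lemma smear_mono:
 assumes "bdd f" "bdd g" "x \<in> carrier G" "\<And>x. x \<in> carrier G ==> f x \<le> g x"
 shows "smear f x \<le> smear g x" unfolding smear_def using assms dense_seq(1)
 by (intro suminf_le smear_summable mult_left_mono) auto

lemma smear_cong: "x \<in> carrier G ==> (\<And>x. x \<in> carrier G ==> f x = g x) ==> smear f x = smear g x"
 unfolding smear_def using dense_seq(1) by simp

lemma smear_bounds:
 assumes "\<And>x. x \<in> carrier G ==> a \<le> f x \<and> f x \<le> b" "x \<in> carrier G"
 shows "a \<le> smear f x" "smear f x \<le> b"
 using smear_mono[of "\<lambda>_. a" f x] smear_mono[of f "\<lambda>_. b" x] assms bdd_I[of a f b]
 by (auto simp: smear_const bdd_def)

lemma smear_pow_bdd: "bdd f ==> bdd ((smear ^^ n) f)"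
proof (induction n)
 case (Suc n)
 then obtain B where "\<forall>x\<in>carrier G. \<bar>(smear ^^ n) f x\<bar> \<le> B"
  unfolding bdd_def by auto
 hence "- B \<le> (smear ^^ n) f x \<and> (smear ^^ n) f x \<le> B" if "x \<in> carrier G" for x
  using that by (simp add: abs_le_iff minus_le_iff)
 thus ?case using smear_bounds[of "-B" "(smear ^^ n) f" B] by (intro bdd_I[of "-B" _ B]) simp
qed simp

lemma smear_pow_add: "bdd f ==> bdd g ==> x \<in> carrier G ==>
  (smear ^^ n) (\<lambda>x. f x + g x) x = (smear ^^ n) f x + (smear ^^ n) g x"
proof (induction n arbitrary: x)
 case (Suc n)
 thus ?case
  using smear_cong[of x "(smear ^^ n) (\<lambda>x. f x + g x)" "\<lambda>x. (smear ^^ n) f x + (smear ^^ n) g x"]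
  by (simp add: smear_add smear_pow_bdd)
qed simp

lemma smear_pow_scale:
 "bdd f ==> x \<in> carrier G ==> (smear ^^ n) (\<lambda>x. c * f x) x = c * (smear ^^ n) f x"
proof (induction n arbitrary: x)
 case (Suc n)
 thus ?case using smear_cong[of x "(smear ^^ n) (\<lambda>x. c * f x)" "\<lambda>x. c * (smear ^^ n) f x"]
  by (simp add: smear_scale smear_pow_bdd)
qed simp

lemma smear_pow_mono:
 "bdd f ==> bdd g ==> (\<And>x. x \<in> carrier G ==> f x \<le> g x) ==> x \<in> carrier G ==>
  (smear ^^ n) f x \<le> (smear ^^ n) g x"
 by (induction n arbitrary: x) (auto intro!: smear_mono smear_pow_bdd)

lemma smear_pow_translate:
 assumes "a \<in> carrier G"
 shows "x \<in> carrier G ==> (smear ^^ n) (\<lambda>x. f (a \<otimes> x)) x = (smear ^^ n) f (a \<otimes> x)"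
proof (induction n arbitrary: x)
 case (Suc n)
 hence "(smear ^^ Suc n) (\<lambda>x. f (a \<otimes> x)) x = smear (\<lambda>x. (smear ^^ n) f (a \<otimes> x)) x"
  by (auto intro!: smear_cong)
 also have "... = smear ((smear ^^ n) f) (a \<otimes> x)"
  unfolding smear_def using Suc.prems assms dense_seq(1) by (simp add: m_assoc)
 finally show ?case by simp
qed simp

text \<open>Oscillation contracts: for every \<open>x\<close> one of the first \<open>J\<close>
  translates comes within \<open>2 * e\<close> of the infimum of \<open>u\<close>, and its weight of
  at least \<open>(1/2) ^ J\<close> pulls the mean down from the upper bound.\<close>

lemma smear_step:
 assumes cover: "\<And>x y. x \<in> carrier G ==> y \<in> carrier G ==> \<exists>j<J. \<bar>u (x \<otimes> dense_seq j) - u y\<bar> \<le> e"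
  and u: "\<And>x. x \<in> carrier G ==> a \<le> u x \<and> u x \<le> b" and e: "e > 0"
 obtains a' b' where "a \<le> a'" "b' \<le> b" "\<And>x. x \<in> carrier G ==> a' \<le> smear u x \<and> smear u x \<le> b'"
  "b' - a' \<le> (1 - (1/2) ^ J) * (b - a) + 2 * (1/2) ^ J * e"
proof -
 define d :: real where "d = (1/2) ^ J"
 have d: "0 < d" "d \<le> 1" by (auto simp: d_def power_le_one)
 define s where "s = Inf (u ` carrier G)"
 have bb: "bdd_below (u ` carrier G)" using u by (intro bdd_belowI[of _ a]) auto
 have ne: "u ` carrier G \<noteq> {}" using one_closed by blast
 have s_le: "s \<le> u x" if "x \<in> carrier G" for x
  unfolding s_def using bb that by (intro cInf_lower) auto
 have as: "a \<le> s" unfolding s_def using u ne by (intro cInf_greatest) auto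
 obtain y where y: "y \<in> carrier G" "u y \<le> s + e"
  using cInf_lessD[OF ne, of "s + e"] e by (auto simp: s_def less_imp_le)
 have sb: "s \<le> b" using s_le[OF one_closed] u[OF one_closed] by linarith
 have bu: "bdd u" using u by (rule bdd_I)
 \<comment> \<open>All terms of the mean of \<open>b - u\<close> are nonnegative, so the single term
   at the good index bounds it from below.\<close>
 have up: "smear u x \<le> b - d * (b - s - 2 * e)" if x: "x \<in> carrier G" and ge: "b - s - 2 * e \<ge> 0" for x
 proof -
  obtain j where j: "j < J" "\<bar>u (x \<otimes> dense_seq j) - u y\<bar> \<le> e"
   using cover[OF x y(1)] by blast
  hence le: "u (x \<otimes> dense_seq j) \<le> s + 2 * e" using y(2) by linarith
  have "b - smear u x = smear (\<lambda>x. b + (-1) * u x) x"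
   using smear_add[of "\<lambda>_. b" "\<lambda>x. -1 * u x" x] smear_scale[OF bu x, of "-1"] x bdd_scale[OF bu, of "-1"]
   by (simp add: smear_const bdd_const)
  also have "... \<ge> (1/2) ^ Suc j * (b - u (x \<otimes> dense_seq j))"
  proof -
   have "bdd (\<lambda>x. b + (-1) * u x)"
    using bdd_add[of "\<lambda>_. b" "\<lambda>x. -1 * u x"] bdd_scale[OF bu, of "-1"] bdd_const by simp
   hence "summable (\<lambda>j. (1/2) ^ Suc j * (b + (-1) * u (x \<otimes> dense_seq j)))"
    using smear_summable x by blast
   hence "(\<Sum>i\<in>{j}. (1/2) ^ Suc i * (b + (-1) * u (x \<otimes> dense_seq i))) \<le> smear (\<lambda>x. b + (-1) * u x) x"
    unfolding smear_def using u x dense_seq(1) by (intro sum_le_suminf) auto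
   thus ?thesis by simp
  qed
  also have "(1/2) ^ Suc j * (b - u (x \<otimes> dense_seq j)) \<ge> d * (b - s - 2 * e)"
  proof (rule mult_mono)
   show "d \<le> (1/2) ^ Suc j" unfolding d_def using j(1) by (intro power_decreasing) auto
  qed (use le ge d in auto)
  finally show ?thesis by simp
 qed
 show ?thesis
 proof (cases "b - s - 2 * e \<ge> 0")
  case True
  have "0 \<le> (1 - d) * (s - a)" "0 \<le> d * (b - s - 2 * e)" using d as True by simp_all
  thus ?thesis using up True as d smear_bounds[of s u b] u s_le
   by (intro that[of s "b - d * (b - s - 2 * e)"]) (auto simp: d_def[symmetric] algebra_simps)
 next
  \<comment> \<open>Here \<open>b - s\<close> is already below \<open>2 * e\<close>, and the
    interval from \<open>s\<close> to \<open>b\<close> is short enough as it stands.\<close>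
  case False
  have "0 \<le> (1 - d) * (s - a)" "d * (b - s - 2 * e) \<le> 0"
   using d as False by (auto simp: mult_le_0_iff)
  thus ?thesis using as smear_bounds[of s u b] u s_le
   by (intro that[of s b]) (auto simp: d_def[symmetric] algebra_simps)
 qed
qed

text \<open>Density moves \<open>x\<close> close to \<open>y\<close> by some point of the sequence,
  and compactness of the set of pairs bounds the index. Closeness for all right multiples
  \<open>g\<close> is demanded because that is what survives iterated smearing.\<close>

lemma smear_cover:
 assumes f: "rcmap T f" and e: "e > 0"
 obtains J where "\<And>x y. x \<in> carrier G ==> y \<in> carrier G ==>
   \<exists>j<J. \<forall>g\<in>carrier G. \<bar>f (x \<otimes> dense_seq j \<otimes> g) - f (y \<otimes> g)\<bar> \<le> e"
proof -
 have cF: "rcmap (prod_topology T T) (\<lambda>(x, g). f (x \<otimes> g))"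
  using continuous_map_compose[OF continuous_mult f] by (simp add: o_def case_prod_unfold)
 define near where "near j x y \<longleftrightarrow> (\<forall>g\<in>carrier G. \<bar>f (x \<otimes> dense_seq j \<otimes> g) - f (y \<otimes> g)\<bar> \<le> e)" for j x y
 define \<O> where "\<O> = {Ob. openin (prod_topology T T) Ob \<and> (\<exists>j. \<forall>z\<in>Ob. near j (fst z) (snd z))}"
 have cov: "\<exists>Ob\<in>\<O>. z \<in> Ob" if z: "z \<in> topspace (prod_topology T T)" for z
 proof -
  obtain x y where xy: "z = (x, y)" "x \<in> carrier G" "y \<in> carrier G" using z topspace_eq by auto
  obtain U where U: "openin T U" "y \<in> U"
   "\<And>y' g. y' \<in> U ==> g \<in> topspace T ==> norm (f (y' \<otimes> g) - f (y \<otimes> g)) < e / 2"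
   using continuous_map_compact_tube[OF compact_T cF _ half_gt_zero[OF e], of y] xy topspace_eq by metis
  have "openin T {g \<in> topspace T. x \<otimes> g \<in> U}"
   by (intro openin_continuous_map_preimage[OF continuous_map_left_mult U(1)] xy)
  moreover have "inv x \<otimes> y \<in> {g \<in> topspace T. x \<otimes> g \<in> U}"
   using xy U(2) by (simp add: topspace_eq m_assoc[symmetric])
  ultimately obtain j where j: "x \<otimes> dense_seq j \<in> U" using dense_seq(2) by fastforce
  define Ob where "Ob = {x \<in> topspace T. x \<otimes> dense_seq j \<in> U} \<times> U"
  have "openin (prod_topology T T) Ob"
   unfolding Ob_def using U(1) openin_continuous_map_preimage[OF continuous_map_right_mult[OF dense_seq(1)] U(1)]
   by (simp add: openin_prod_Times_iff)
  moreover have "z \<in> Ob" using xy j U(2) by (simp add: Ob_def topspace_eq)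
  moreover have "\<bar>f (x' \<otimes> dense_seq j \<otimes> g) - f (y' \<otimes> g)\<bar> \<le> e"
   if "(x', y') \<in> Ob" "g \<in> carrier G" for x' y' g
  proof -
   have "\<bar>f (x' \<otimes> dense_seq j \<otimes> g) - f (y \<otimes> g)\<bar> < e / 2" "\<bar>f (y' \<otimes> g) - f (y \<otimes> g)\<bar> < e / 2"
    using U(3)[of "x' \<otimes> dense_seq j" g] U(3)[of y' g] that by (auto simp: Ob_def topspace_eq)
   thus ?thesis by linarith
  qed
  ultimately have "openin (prod_topology T T) Ob" "z \<in> Ob" "\<forall>z\<in>Ob. near j (fst z) (snd z)"
   by (auto simp: near_def)
  hence "Ob \<in> \<O>" "z \<in> Ob" unfolding \<O>_def by blast+
  thus ?thesis ..
 qed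
 have "compactin (prod_topology T T) (topspace (prod_topology T T))"
  using compact_T compact_space_prod_topology[of T T] by (auto simp: compact_space_def)
 moreover have "openin (prod_topology T T) Ob" if "Ob \<in> \<O>" for Ob using that by (simp add: \<O>_def)
 moreover have "topspace (prod_topology T T) \<subseteq> \<Union>\<O>" using cov by blast
 ultimately obtain \<F> where \<F>: "finite \<F>" "\<F> \<subseteq> \<O>" "topspace (prod_topology T T) \<subseteq> \<Union>\<F>"
  using compactinD[of "prod_topology T T" "topspace (prod_topology T T)" \<O>] by metis
 have "\<forall>Ob\<in>\<F>. \<exists>j. \<forall>z\<in>Ob. near j (fst z) (snd z)"
  using \<F>(2) by (auto simp: \<O>_def)
 from bchoice[OF this] obtain j where j: "\<forall>Ob\<in>\<F>. \<forall>z\<in>Ob. near (j Ob) (fst z) (snd z)" ..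
 show ?thesis
 proof (rule that[of "Suc (Max (j ` \<F>))"])
  fix x y assume "x \<in> carrier G" "y \<in> carrier G"
  hence "(x, y) \<in> topspace (prod_topology T T)" by (simp add: topspace_eq)
  then obtain Ob where Ob: "Ob \<in> \<F>" "(x, y) \<in> Ob" using \<F>(3) by blast
  hence "j Ob < Suc (Max (j ` \<F>))" using \<F>(1) by (simp add: le_imp_less_Suc)
  moreover have "near (j Ob) x y" using j Ob by force
  ultimately show "\<exists>k<Suc (Max (j ` \<F>)). \<forall>g\<in>carrier G. \<bar>f (x \<otimes> dense_seq k \<otimes> g) - f (y \<otimes> g)\<bar> \<le> e"
   unfolding near_def by blast
 qed
qed

text \<open>Smearing multiplies on the right and so commutes with left translation by
  \<open>x\<close> and by \<open>y\<close>; averaging preserves a bound valid for all right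
  multiples.\<close>

lemma smear_modulus:
 assumes f: "bdd f"
  and xy: "x \<in> carrier G" "y \<in> carrier G" "\<And>g. g \<in> carrier G ==> \<bar>f (x \<otimes> g) - f (y \<otimes> g)\<bar> \<le> e"
  and "g \<in> carrier G"
 shows "\<bar>(smear ^^ n) f (x \<otimes> g) - (smear ^^ n) f (y \<otimes> g)\<bar> \<le> e"
 using \<open>g \<in> carrier G\<close>
proof (induction n arbitrary: g)
 case (Suc n)
 define v where "v = (\<lambda>g. (smear ^^ n) f (x \<otimes> g))"
 define w where "w = (\<lambda>g. (smear ^^ n) f (y \<otimes> g))"
 have b: "bdd v" "bdd w" using smear_pow_bdd[OF f, of n] xy unfolding v_def w_def bdd_def by auto
 have s: "smear v g = (smear ^^ Suc n) f (x \<otimes> g)" "smear w g = (smear ^^ Suc n) f (y \<otimes> g)"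
  using Suc.prems xy dense_seq(1) by (simp_all add: smear_def v_def w_def m_assoc)
 have "smear v g \<le> smear (\<lambda>x. w x + e) g" "smear w g \<le> smear (\<lambda>x. v x + e) g"
  using Suc.IH b by (intro smear_mono Suc.prems bdd_add; force simp: v_def w_def abs_le_iff bdd_def)+
 moreover have "smear (\<lambda>x. w x + e) g = smear w g + e" "smear (\<lambda>x. v x + e) g = smear v g + e"
  using smear_add[OF b(1), of "\<lambda>_. e"] smear_add[OF b(2), of "\<lambda>_. e"] Suc.prems
  by (auto simp: smear_const bdd_def)
 ultimately show ?case using s by (simp add: abs_le_iff)
qed (use xy in auto)

lemma smear_pow_eventually_near_constant:
 assumes f: "rcmap T f" and e: "e > 0"
 obtains N a where "\<And>n x. n \<ge> N ==> x \<in> carrier G ==> a \<le> (smear ^^ n) f x \<and> (smear ^^ n) f x \<le> a + e"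
proof -
 obtain J where J: "\<And>x y. x \<in> carrier G ==> y \<in> carrier G ==>
   \<exists>j<J. \<forall>g\<in>carrier G. \<bar>f (x \<otimes> dense_seq j \<otimes> g) - f (y \<otimes> g)\<bar> \<le> e / 4"
  using smear_cover[OF f, of "e / 4"] e by auto
 have cover: "\<exists>j<J. \<bar>(smear ^^ n) f (x \<otimes> dense_seq j) - (smear ^^ n) f y\<bar> \<le> e / 4"
  if xy: "x \<in> carrier G" "y \<in> carrier G" for x y n
 proof -
  obtain j where j: "j < J" "\<forall>g\<in>carrier G. \<bar>f (x \<otimes> dense_seq j \<otimes> g) - f (y \<otimes> g)\<bar> \<le> e / 4"
   using J[OF xy] by blast
  have "\<bar>(smear ^^ n) f (x \<otimes> dense_seq j \<otimes> \<one>) - (smear ^^ n) f (y \<otimes> \<one>)\<bar> \<le> e / 4"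
   using j that dense_seq(1) by (intro smear_modulus bdd_continuous f) auto
  thus ?thesis using j that dense_seq(1) by auto
 qed
 define d :: real where "d = (1/2) ^ J"
 have d: "0 < d" "d \<le> 1" by (auto simp: d_def power_le_one)
 obtain B where B: "B > 0" "\<And>x. x \<in> carrier G ==> \<bar>f x\<bar> \<le> B"
  using continuous_map_compact_bounded[OF compact_T f] topspace_eq by (metis real_norm_def)
 \<comment> \<open>The widths satisfy \<open>w' \<le> (1 - d) * w + d * (e / 2)\<close>, whose fixed
   point is \<open>e / 2\<close>; this explains the shape of the bound.\<close>
 have "\<exists>a b. (\<forall>x\<in>carrier G. a \<le> (smear ^^ n) f x \<and> (smear ^^ n) f x \<le> b) \<and> b - a \<le> (1 - d) ^ n * (2 * B) + e / 2" for n
 proof (induction n)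
  case 0
  show ?case using B e by (intro exI[of _ "-B"] exI[of _ B]) (auto simp: abs_le_iff minus_le_iff)
 next
  case (Suc n)
  then obtain a b where ab: "\<And>x. x \<in> carrier G ==> a \<le> (smear ^^ n) f x \<and> (smear ^^ n) f x \<le> b"
   "b - a \<le> (1 - d) ^ n * (2 * B) + e / 2" by blast
  obtain a' b' where ab': "\<And>x. x \<in> carrier G ==> a' \<le> smear ((smear ^^ n) f) x \<and> smear ((smear ^^ n) f) x \<le> b'"
   "b' - a' \<le> (1 - (1/2) ^ J) * (b - a) + 2 * (1/2) ^ J * (e / 4)"
   using smear_step[where J = J and u = "(smear ^^ n) f" and e = "e / 4" and a = a and b = b] cover ab(1) e
   by (smt (verit, ccfv_SIG) divide_pos_pos)
  have "b' - a' \<le> (1 - d) * (b - a) + d * (e / 2)" using ab'(2) by (simp add: d_def mult_ac)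
  also have "... \<le> (1 - d) * ((1 - d) ^ n * (2 * B) + e / 2) + d * (e / 2)"
   using ab(2) d by (intro add_mono mult_left_mono) auto
  also have "... = (1 - d) ^ Suc n * (2 * B) + e / 2" by (simp add: field_simps)
  finally show ?case using ab'(1) by (intro exI[of _ a'] exI[of _ b']) auto
 qed
 moreover obtain N where N: "(1 - d) ^ N * (2 * B) < e / 2"
 proof -
  have "(\<lambda>n. (1 - d) ^ n * (2 * B)) \<longlonglongrightarrow> 0"
   using d by (intro tendsto_mult_left_zero LIMSEQ_realpow_zero) auto
  hence "eventually (\<lambda>n. (1 - d) ^ n * (2 * B) < e / 2) sequentially"
   using e by (intro order_tendstoD) auto
  thus ?thesis using that by (meson eventually_sequentially order_refl)
 qed
 ultimately obtain a b where ab: "\<And>x. x \<in> carrier G ==> a \<le> (smear ^^ N) f x \<and> (smear ^^ N) f x \<le> b" "b - a \<le> e"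
  by (smt (verit) field_sum_of_halves)
 \<comment> \<open>Averages stay within the range of the averaged function, so the bounds reached at
   \<open>N\<close> persist.\<close>
 have "a \<le> (smear ^^ (N + k)) f x \<and> (smear ^^ (N + k)) f x \<le> b" if "x \<in> carrier G" for k x
  using that
 proof (induction k arbitrary: x)
  case (Suc k)
  thus ?case using smear_bounds[of a "(smear ^^ (N + k)) f" b, OF Suc.IH] by simp
 qed (use ab(1) in simp)
 thus ?thesis using ab(2) by (intro that[of N a]) (metis add.commute diff_le_eq le_Suc_ex order_trans)
qed

definition hmean :: "('a => real) => real" where
 "hmean f = lim (\<lambda>n. (smear ^^ n) f \<one>)"

lemma smear_pow_tendsto:
 assumes f: "rcmap T f" and x: "x \<in> carrier G"
 shows "(\<lambda>n. (smear ^^ n) f x) \<longlonglongrightarrow> hmean f"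
proof -
 have near: "\<exists>N. \<forall>m\<ge>N. \<forall>n\<ge>N. \<forall>x\<in>carrier G. \<forall>y\<in>carrier G. \<bar>(smear ^^ m) f x - (smear ^^ n) f y\<bar> < e"
  if e: "e > 0" for e
 proof -
  obtain N a where N: "\<And>n x. n \<ge> N ==> x \<in> carrier G ==> a \<le> (smear ^^ n) f x \<and> (smear ^^ n) f x \<le> a + e / 2"
   using smear_pow_eventually_near_constant[OF f, of "e / 2"] e by auto
  have "\<bar>(smear ^^ m) f x - (smear ^^ n) f y\<bar> < e"
   if "m \<ge> N" "n \<ge> N" "x \<in> carrier G" "y \<in> carrier G" for m n x y
   using N[OF that(1,3)] N[OF that(2,4)] e by (auto simp: abs_less_iff)
  thus ?thesis by blast
 qed
 have "Cauchy (\<lambda>n. (smear ^^ n) f \<one>)"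
 proof (rule metric_CauchyI)
  fix e :: real assume "e > 0"
  thus "\<exists>M. \<forall>m\<ge>M. \<forall>n\<ge>M. dist ((smear ^^ m) f \<one>) ((smear ^^ n) f \<one>) < e"
   using near[of e] one_closed unfolding dist_real_def by meson
 qed
 hence lim: "(\<lambda>n. (smear ^^ n) f \<one>) \<longlonglongrightarrow> hmean f"
  unfolding hmean_def by (simp add: Cauchy_convergent_iff convergent_LIMSEQ_iff)
 have "(\<lambda>n. (smear ^^ n) f x - (smear ^^ n) f \<one>) \<longlonglongrightarrow> 0"
 proof (rule LIMSEQ_I)
  fix e :: real assume "e > 0"
  thus "\<exists>N. \<forall>n\<ge>N. norm ((smear ^^ n) f x - (smear ^^ n) f \<one> - 0) < e"
   using near[of e] one_closed x by (metis diff_zero real_norm_def)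
 qed
 from tendsto_add[OF this lim] show ?thesis by simp
qed

text \<open>Left translation commutes with smearing on the right, and the limit is the same at
  \<open>a\<close> as at the unit.\<close>

lemma hmean_translate:
 assumes f: "rcmap T f" and a: "a \<in> carrier G"
 shows "hmean (\<lambda>x. f (a \<otimes> x)) = hmean f"
proof -
 have "rcmap T (\<lambda>x. f (a \<otimes> x))"
  using continuous_map_compose[OF continuous_map_left_mult[OF a] f] by (simp add: o_def)
 from smear_pow_tendsto[OF this one_closed]
 have "(\<lambda>n. (smear ^^ n) f a) \<longlonglongrightarrow> hmean (\<lambda>x. f (a \<otimes> x))"
  using a by (simp add: smear_pow_translate)
 thus ?thesis using smear_pow_tendsto[OF f a] LIMSEQ_unique by blast
qed

sublocale hmean: positive_functional T hmean
proof
 show "compact_space T" "Hausdorff_space T" "second_countable T"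
  by (rule compact_T Hausdorff_T second_countable_T)+
 fix f g :: "'a => real" and c :: real
 assume f: "rcmap T f"
 have "(\<lambda>n. c * (smear ^^ n) f \<one>) \<longlonglongrightarrow> hmean (\<lambda>x. c * f x)"
  using smear_pow_tendsto[OF continuous_map_real_mult_left[OF f, of c] one_closed]
  by (simp add: smear_pow_scale bdd_continuous[OF f])
 thus "hmean (\<lambda>x. c * f x) = c * hmean f"
  using tendsto_mult_left[OF smear_pow_tendsto[OF f one_closed], of c] LIMSEQ_unique by blast
 assume g: "rcmap T g"
 have "(\<lambda>n. (smear ^^ n) f \<one> + (smear ^^ n) g \<one>) \<longlonglongrightarrow> hmean (\<lambda>x. f x + g x)"
  using smear_pow_tendsto[OF continuous_map_add[OF f g] one_closed]
  by (simp add: smear_pow_add bdd_continuous[OF f] bdd_continuous[OF g])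
 thus "hmean (\<lambda>x. f x + g x) = hmean f + hmean g"
  using tendsto_add[OF smear_pow_tendsto[OF f one_closed] smear_pow_tendsto[OF g one_closed]] LIMSEQ_unique by blast
 assume "\<And>x. x \<in> topspace T ==> f x \<le> g x"
 thus "hmean f \<le> hmean g" using smear_pow_tendsto[OF f one_closed] smear_pow_tendsto[OF g one_closed]
  by (intro LIMSEQ_le[of "\<lambda>n. (smear ^^ n) f \<one>" _ "\<lambda>n. (smear ^^ n) g \<one>"])
   (auto intro!: smear_pow_mono bdd_continuous f g simp: topspace_eq)
next
 have "(smear ^^ n) (\<lambda>_. 1) = (\<lambda>_. 1)" for n by (induction n) (auto simp: smear_const)
 thus "hmean (\<lambda>_. 1) = 1" by (simp add: hmean_def)
qed

definition haar :: "'a measure" where "haar = hmean.representing_measure"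

lemma sets_haar [simp]: "sets haar = sets (borel_of T)" and prob_space_haar: "prob_space haar"
 by (simp_all add: haar_def hmean.prob_space_representing_measure)

lemma space_haar [simp]: "space haar = carrier G" using sets_eq_imp_space_eq[OF sets_haar] topspace_eq by simp

sublocale haar: prob_space haar by (rule prob_space_haar)

lemma haar_prob [simp]: "haar.prob (carrier G) = 1" using haar.prob_space by simp

lemma haar_integrable:
 fixes f :: "'a => 'c::{banach, second_countable_topology}"
 assumes "cmap T f"
 shows "integrable haar f"
 by (rule integrable_continuous_map[OF compact_T _ _ assms]) (auto simp: haar.finite_measure_axioms)

lemma haar_distr_eqI:
 assumes h: "continuous_map T T h"
  and "\<And>f :: 'a => real. rcmap T f ==> (\<integral>x. f (h x) \<partial>haar) = (\<integral>x. f x \<partial>haar)"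
 shows "distr haar (borel_of T) h = haar"
proof (rule integral_eq_imp_measure_eq[OF compact_T Hausdorff_T second_countable_T])
 have hm: "h \<in> measurable haar (borel_of T)"
  using measurable_borel_of_continuous_map[OF h] measurable_cong_sets[OF sets_haar refl] by blast
 show "finite_measure (distr haar (borel_of T) h)" by (rule haar.finite_measure_distr[OF hm])
 show "(\<integral>x. f x \<partial>distr haar (borel_of T) h) = (\<integral>x. f x \<partial>haar)"
  if "rcmap T f" for f :: "'a => real"
  using assms(2)[OF that] borel_measurable_continuous_map[OF refl that] by (subst integral_distr[OF hm]) auto
qed (auto simp: haar.finite_measure_axioms)

lemma haar_integral_eqI:
 fixes f :: "'a => 'c::{banach, second_countable_topology}"
 assumes h: "continuous_map T T h" and eq: "distr haar (borel_of T) h = haar"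
  and f: "cmap T f"
 shows "(\<integral>x. f (h x) \<partial>haar) = (\<integral>x. f x \<partial>haar)"
proof -
 have hm: "h \<in> measurable haar (borel_of T)"
  using measurable_borel_of_continuous_map[OF h] measurable_cong_sets[OF sets_haar refl] by blast
 show ?thesis using borel_measurable_continuous_map[OF refl f] integral_distr[OF hm, of f] by (simp add: eq)
qed

lemma haar_left: "a \<in> carrier G ==> distr haar (borel_of T) (\<lambda>x. a \<otimes> x) = haar"
proof (rule haar_distr_eqI)
 fix f :: "'a => real"
 assume a: "a \<in> carrier G" and f: "rcmap T f"
 have "rcmap T (\<lambda>x. f (a \<otimes> x))"
  using continuous_map_compose[OF continuous_map_left_mult[OF a] f] by (simp add: o_def)
 thus "(\<integral>x. f (a \<otimes> x) \<partial>haar) = (\<integral>x. f x \<partial>haar)"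
  unfolding haar_def using hmean_translate[OF f a] f by (simp add: hmean.integral_representing_measure)
qed (rule continuous_map_left_mult)

lemma haar_integral_left:
 fixes f :: "'a => 'c::{banach, second_countable_topology}"
 assumes "a \<in> carrier G" "cmap T f"
 shows "(\<integral>x. f (a \<otimes> x) \<partial>haar) = (\<integral>x. f x \<partial>haar)"
 using haar_integral_eqI[OF continuous_map_left_mult haar_left] assms by blast

lemma haar_Fubini:
 fixes F :: "'a => 'a => 'c::{banach, second_countable_topology}"
 assumes "cmap (prod_topology T T) (\<lambda>(x, y). F x y)"
 shows "(\<integral>x. (\<integral>y. F x y \<partial>haar) \<partial>haar) = (\<integral>y. (\<integral>x. F x y \<partial>haar) \<partial>haar)"
 by (rule Fubini_continuous[OF compact_T Hausdorff_T _ prob_space_haar compact_T _ prob_space_haar assms]) auto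

text \<open>The double integral of \<open>f (inv y \<otimes> x)\<close> is computed in two orders:
  left invariance in \<open>x\<close> gives the integral of \<open>f\<close>, left invariance in
  \<open>y\<close> that of \<open>f\<close> composed with the inverse. Right invariance
  follows.\<close>

lemma haar_inverse: "distr haar (borel_of T) (\<lambda>x. inv x) = haar"
proof (rule haar_distr_eqI[OF continuous_inv])
 fix f :: "'a => real"
 assume f: "rcmap T f"
 have "rcmap (prod_topology T T) (f \<circ> (\<lambda>z. inv (snd z) \<otimes> fst z))"
  by (intro continuous_map_compose[OF _ f] continuous_map_mult continuous_map_inverse continuous_map_fst continuous_map_snd)
 hence F: "rcmap (prod_topology T T) (\<lambda>(x, y). f (inv y \<otimes> x))"
  by (simp add: o_def case_prod_unfold)
 have fi: "rcmap T (\<lambda>y. f (inv y))"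
  using continuous_map_compose[OF continuous_inv f] by (simp add: o_def)
 have "(\<integral>x. f (inv x) \<partial>haar) = (\<integral>x. (\<integral>y. f (inv y) \<partial>haar) \<partial>haar)"
  by (simp add: haar.prob_space)
 also have "... = (\<integral>x. (\<integral>y. f (inv y \<otimes> x) \<partial>haar) \<partial>haar)"
 proof (rule Bochner_Integration.integral_cong[OF refl])
  fix x assume "x \<in> space haar"
  hence x: "x \<in> carrier G" by simp
  have "(\<integral>y. f (inv (inv x \<otimes> y)) \<partial>haar) = (\<integral>y. f (inv y) \<partial>haar)"
   by (rule haar_integral_left[OF _ fi]) (use x in auto)
  moreover have "(\<integral>y. f (inv (inv x \<otimes> y)) \<partial>haar) = (\<integral>y. f (inv y \<otimes> x) \<partial>haar)"
   using x by (intro Bochner_Integration.integral_cong) (auto simp: inv_mult_group)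
  ultimately show "(\<integral>y. f (inv y) \<partial>haar) = (\<integral>y. f (inv y \<otimes> x) \<partial>haar)"
   by simp
 qed
 also have "... = (\<integral>y. (\<integral>x. f (inv y \<otimes> x) \<partial>haar) \<partial>haar)"
  by (rule haar_Fubini[OF F])
 also have "... = (\<integral>y. (\<integral>x. f x \<partial>haar) \<partial>haar)"
  by (intro Bochner_Integration.integral_cong refl haar_integral_left[OF _ f]) auto
 also have "... = (\<integral>x. f x \<partial>haar)" by (simp add: haar.prob_space)
 finally show "(\<integral>x. f (inv x) \<partial>haar) = (\<integral>x. f x \<partial>haar)" .
qed

lemma haar_integral_inverse:
 fixes f :: "'a => 'c::{banach, second_countable_topology}"
 assumes "cmap T f"
 shows "(\<integral>x. f (inv x) \<partial>haar) = (\<integral>x. f x \<partial>haar)"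
 using haar_integral_eqI[OF continuous_inv haar_inverse assms] .

lemma haar_integral_right:
 fixes f :: "'a => 'c::{banach, second_countable_topology}"
 assumes a: "a \<in> carrier G" and f: "cmap T f"
 shows "(\<integral>x. f (x \<otimes> a) \<partial>haar) = (\<integral>x. f x \<partial>haar)"
proof -
 have c: "cmap T (\<lambda>x. f (x \<otimes> a))"
  using continuous_map_compose[OF continuous_map_right_mult[OF a] f] by (simp add: o_def)
 have ci: "cmap T (\<lambda>x. f (inv x))"
  using continuous_map_compose[OF continuous_inv f] by (simp add: o_def)
 have "(\<integral>x. f (x \<otimes> a) \<partial>haar) = (\<integral>x. f (inv x \<otimes> a) \<partial>haar)"
  using haar_integral_inverse[OF c] by simp
 also have "... = (\<integral>x. f (inv (inv a \<otimes> x)) \<partial>haar)"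
  using a by (intro Bochner_Integration.integral_cong) (auto simp: inv_mult_group)
 also have "... = (\<integral>x. f (inv x) \<partial>haar)"
  using a by (intro haar_integral_left[OF _ ci]) auto
 also have "... = (\<integral>x. f x \<partial>haar)" by (rule haar_integral_inverse[OF f])
 finally show ?thesis .
qed

end

section \<open>Convolution operators\<close>

lemma continuous_map_mult_algebra:
 fixes f g :: "'x => 'c::real_normed_algebra"
 assumes "cmap X f" "cmap X g"
 shows "cmap X (\<lambda>x. f x * g x)"
proof -
 have "cmap X (\<lambda>x. (f x, g x))" using continuous_map_pairedI[OF assms] by simp
 moreover have "cmap euclidean (\<lambda>z::'c \<times> 'c. fst z * snd z)"
  by (simp add: continuous_map_iff_continuous2 continuous_on_fst continuous_on_snd continuous_on_mult continuous_on_id)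
 ultimately have "cmap X ((\<lambda>z::'c \<times> 'c. fst z * snd z) \<circ> (\<lambda>x. (f x, g x)))"
  by (rule continuous_map_compose)
 thus ?thesis by (simp add: o_def)
qed

lemma continuous_map_compose_continuous_on:
 assumes "cmap X f" "continuous_on UNIV h"
 shows "cmap X (\<lambda>x. h (f x))"
 using continuous_map_compose[OF assms(1), of euclidean h] assms(2)
 by (simp add: o_def continuous_map_iff_continuous2)

lemma continuous_map_cnj: "cmap X f ==> cmap X (\<lambda>x. cnj (f x))"
 by (erule continuous_map_compose_continuous_on) (intro continuous_intros)

lemma continuous_map_of_real:
 "cmap X f ==> cmap X (\<lambda>x. of_real (f x) :: complex)"
 by (erule continuous_map_compose_continuous_on) (intro continuous_intros)

lemma continuous_map_apply:
 "cmap Y f ==> continuous_map X Y a ==> cmap X (\<lambda>x. f (a x))"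
 using continuous_map_compose[of X Y a euclidean f] by (simp add: o_def)

context compact_group
begin

abbreviation cfun :: "('a => complex) => bool" where
 "cfun f \<equiv> cmap T f"

definition convolution :: "('a => complex) => ('a => complex) => 'a => complex" where
 "convolution u k x = (\<integral>y. u y * k (inv y \<otimes> x) \<partial>haar)"

definition ip :: "('a => complex) => ('a => complex) => complex" where
 "ip u v = (\<integral>x. u x * cnj (v x) \<partial>haar)"

text \<open>The kernel of the adjoint of convolution by \<open>k\<close> from the right, see
  \<open>ip_convolution\<close>.\<close>

definition adj :: "('a => complex) => 'a => complex" where
 "adj k x = cnj (k (inv x))"

definition nsq :: "('a => complex) => real" where
 "nsq u = (\<integral>x. (cmod (u x))\<^sup>2 \<partial>haar)"

lemma cfun_translate: "cfun u ==> g \<in> carrier G ==> cfun (\<lambda>x. u (g \<otimes> x))"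
 using continuous_map_apply continuous_map_left_mult by blast

lemma cfun_inv: "cfun u ==> cfun (\<lambda>x. u (inv x))"
 using continuous_map_apply continuous_inv by blast

lemma cfun_adj: "cfun k ==> cfun (adj k)"
 unfolding adj_def by (intro continuous_map_cnj cfun_inv)

lemma cfun_scale: "cfun u ==> cfun (\<lambda>x. c * u x)"
 by (intro continuous_map_mult_algebra) auto

lemma continuous_conv_kernel:
 assumes "cfun u" "cfun k"
 shows "cmap (prod_topology T T) (\<lambda>(x, y). u y * k (inv y \<otimes> x))"
 unfolding case_prod_unfold
 by (intro continuous_map_mult_algebra continuous_map_apply[OF assms(1)] continuous_map_apply[OF assms(2)]
   continuous_map_mult continuous_map_inverse continuous_map_fst continuous_map_snd)

lemma cfun_kernel_section:
 assumes "cfun u" "cfun k" "x \<in> carrier G"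
 shows "cfun (\<lambda>y. u y * k (inv y \<otimes> x))"
 by (intro continuous_map_mult_algebra assms(1) continuous_map_apply[OF assms(2)]
   continuous_map_mult continuous_inv) (simp add: topspace_eq assms)

lemma cfun_convolution: "cfun u ==> cfun k ==> cfun (convolution u k)"
 unfolding convolution_def
 by (rule continuous_map_integral_parameter[OF compact_T sets_haar prob_space_haar continuous_conv_kernel])

lemma haar_integral_cong: "(\<And>x. x \<in> carrier G ==> f x = g x) ==> (\<integral>x. f x \<partial>haar) = (\<integral>x. g x \<partial>haar)"
 by (rule Bochner_Integration.integral_cong) auto

lemma haar_cnj: "cnj (\<integral>x. f x \<partial>haar) = (\<integral>x. cnj (f x) \<partial>haar)" by simp

text \<open>Convolution from the right commutes with left translation; hence eigenspaces of such
  operators are representations of the group.\<close>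

lemma convolution_left:
 assumes u: "cfun u" and k: "cfun k" and g: "g \<in> carrier G" and x: "x \<in> carrier G"
 shows "convolution (\<lambda>x. u (inv g \<otimes> x)) k x = convolution u k (inv g \<otimes> x)"
proof -
 have "cfun (\<lambda>y. u (inv g \<otimes> y) * k (inv y \<otimes> x))"
  using cfun_kernel_section[OF cfun_translate[OF u] k x] g by blast
 from haar_integral_left[OF g this]
 have "convolution (\<lambda>x. u (inv g \<otimes> x)) k x = (\<integral>y. u (inv g \<otimes> (g \<otimes> y)) * k (inv (g \<otimes> y) \<otimes> x) \<partial>haar)"
  by (simp add: convolution_def)
 also have "... = convolution u k (inv g \<otimes> x)"
  unfolding convolution_def using g x by (intro haar_integral_cong) (simp add: m_assoc[symmetric] inv_mult_group)
 finally show ?thesis .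
qed

lemma convolution_cong: "(\<And>x. x \<in> carrier G ==> u x = v x) ==> convolution u k x = convolution v k x"
 unfolding convolution_def by (intro haar_integral_cong) simp

lemma convolution_assoc:
 assumes u: "cfun u" and f: "cfun f" and h: "cfun h" and x: "x \<in> carrier G"
 shows "convolution (convolution u f) h x = convolution u (convolution f h) x"
proof -
 have c: "cmap (prod_topology T T) (\<lambda>(y, z). u z * f (inv z \<otimes> y) * h (inv y \<otimes> x))"
  unfolding case_prod_unfold
  by (intro continuous_map_mult_algebra continuous_map_apply[OF u] continuous_map_apply[OF f] continuous_map_apply[OF h]
   continuous_map_mult continuous_map_inverse continuous_map_fst continuous_map_snd continuous_map_const_carrier x)
 have "convolution (convolution u f) h x = (\<integral>y. (\<integral>z. u z * f (inv z \<otimes> y) * h (inv y \<otimes> x) \<partial>haar) \<partial>haar)"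
  unfolding convolution_def by simp
 also have "... = (\<integral>z. (\<integral>y. u z * f (inv z \<otimes> y) * h (inv y \<otimes> x) \<partial>haar) \<partial>haar)"
  by (rule haar_Fubini[OF c])
 also have "... = (\<integral>z. u z * convolution f h (inv z \<otimes> x) \<partial>haar)"
 proof (rule haar_integral_cong)
  fix z assume z: "z \<in> carrier G"
  have "(\<integral>y. u z * f (inv z \<otimes> y) * h (inv y \<otimes> x) \<partial>haar) = u z * (\<integral>y. f (inv z \<otimes> y) * h (inv y \<otimes> x) \<partial>haar)"
   by (simp add: mult.assoc)
  also have "(\<integral>y. f (inv z \<otimes> y) * h (inv y \<otimes> x) \<partial>haar) = convolution f h (inv z \<otimes> x)"
   using convolution_left[OF f h z x] by (simp add: convolution_def)
  finally show "(\<integral>y. u z * f (inv z \<otimes> y) * h (inv y \<otimes> x) \<partial>haar) = u z * convolution f h (inv z \<otimes> x)" .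
 qed
 finally show ?thesis by (simp add: convolution_def)
qed

lemma adj_convolution:
 assumes a: "cfun a" and b: "cfun b" and x: "x \<in> carrier G"
 shows "adj (convolution a b) x = convolution (adj b) (adj a) x"
proof -
 have c: "cfun (\<lambda>y. cnj (b (inv y)) * cnj (a (inv (inv y \<otimes> x))))"
  using cfun_kernel_section[OF cfun_adj[OF b] cfun_adj[OF a] x] by (simp add: adj_def)
 have "adj (convolution a b) x = (\<integral>y. cnj (a y * b (inv y \<otimes> inv x)) \<partial>haar)"
  by (simp only: adj_def convolution_def haar_cnj)
 also have "... = (\<integral>y. cnj (b (inv (x \<otimes> y))) * cnj (a (inv (inv (x \<otimes> y) \<otimes> x))) \<partial>haar)"
  using x by (intro haar_integral_cong) (simp add: inv_mult_group m_assoc)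
 also have "... = convolution (adj b) (adj a) x"
  unfolding convolution_def adj_def by (rule haar_integral_left[OF x c])
 finally show ?thesis .
qed

lemma adj_adj: "x \<in> carrier G ==> adj (adj k) x = k x" by (simp add: adj_def)

lemma ip_convolution:
 assumes u: "cfun u" and k: "cfun k" and v: "cfun v"
 shows "ip (convolution u k) v = ip u (convolution v (adj k))"
proof -
 have c: "cmap (prod_topology T T) (\<lambda>(x, y). u y * k (inv y \<otimes> x) * cnj (v x))"
  unfolding case_prod_unfold
  by (intro continuous_map_mult_algebra continuous_map_cnj continuous_map_apply[OF u] continuous_map_apply[OF k] continuous_map_apply[OF v]
   continuous_map_mult continuous_map_inverse continuous_map_fst continuous_map_snd)
 have "ip (convolution u k) v = (\<integral>x. (\<integral>y. u y * k (inv y \<otimes> x) * cnj (v x) \<partial>haar) \<partial>haar)"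
  unfolding ip_def convolution_def by simp
 also have "... = (\<integral>y. (\<integral>x. u y * k (inv y \<otimes> x) * cnj (v x) \<partial>haar) \<partial>haar)"
  by (rule haar_Fubini[OF c])
 also have "... = (\<integral>y. u y * cnj (\<integral>x. v x * adj k (inv x \<otimes> y) \<partial>haar) \<partial>haar)"
 proof (rule haar_integral_cong)
  fix y assume y: "y \<in> carrier G"
  have "cnj (\<integral>x. v x * adj k (inv x \<otimes> y) \<partial>haar) = (\<integral>x. cnj (v x * adj k (inv x \<otimes> y)) \<partial>haar)"
   by (rule haar_cnj)
  also have "... = (\<integral>x. k (inv y \<otimes> x) * cnj (v x) \<partial>haar)"
   using y by (intro haar_integral_cong) (simp add: adj_def inv_mult_group)
  finally show "(\<integral>x. u y * k (inv y \<otimes> x) * cnj (v x) \<partial>haar) = u y * cnj (\<integral>x. v x * adj k (inv x \<otimes> y) \<partial>haar)"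
   by (simp add: mult.assoc)
 qed
 finally show ?thesis by (simp add: ip_def convolution_def)
qed

lemma ip_cnj: "cnj (ip u v) = ip v u" unfolding ip_def haar_cnj by (simp add: mult.commute)

lemma ip_integrable: "cfun u ==> cfun v ==> integrable haar (\<lambda>x. u x * cnj (v x))"
 by (intro haar_integrable continuous_map_mult_algebra continuous_map_cnj)

lemma ip_scale_left: "ip (\<lambda>x. c * u x) w = c * ip u w" unfolding ip_def by (simp add: mult.assoc)

lemma ip_diff_left: "cfun u ==> cfun v ==> cfun w ==> ip (\<lambda>x. u x - v x) w = ip u w - ip v w"
 unfolding ip_def by (simp add: left_diff_distrib ip_integrable)

lemma ip_scale_right: "ip u (\<lambda>x. c * w x) = cnj c * ip u w"
 unfolding ip_def by (simp add: mult.left_commute)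

lemma ip_diff_right: "cfun u ==> cfun v ==> cfun w ==> ip w (\<lambda>x. u x - v x) = ip w u - ip w v"
 unfolding ip_def by (simp add: right_diff_distrib ip_integrable)

lemma ip_sum_left:
 assumes "finite S" "\<And>i. i \<in> S ==> cfun (u i)" "cfun w"
 shows "ip (\<lambda>x. \<Sum>i\<in>S. u i x) w = (\<Sum>i\<in>S. ip (u i) w)"
 unfolding ip_def sum_distrib_right using assms
 by (intro Bochner_Integration.integral_sum ip_integrable) auto

lemma ip_cong: "(\<And>x. x \<in> carrier G ==> u x = u' x) ==> (\<And>x. x \<in> carrier G ==> v x = v' x) ==> ip u v = ip u' v'"
 unfolding ip_def by (intro haar_integral_cong) simp

lemma ip_self: "ip u u = of_real (nsq u)" unfolding ip_def nsq_def integral_complex_of_real[symmetric]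
 by (rule haar_integral_cong) (simp add: complex_norm_square del: of_real_power)

lemma nsq_integrable: "cfun u ==> integrable haar (\<lambda>x. (cmod (u x))\<^sup>2)"
 unfolding power2_eq_square by (intro haar_integrable continuous_map_mult_algebra continuous_map_norm)

lemma nsq_nonneg: "0 \<le> nsq u" unfolding nsq_def by (intro integral_nonneg_AE) simp

lemma nsq_scale: "nsq (\<lambda>x. c * u x) = (cmod c)\<^sup>2 * nsq u"
 unfolding nsq_def by (simp add: norm_mult power_mult_distrib)

lemma nsq_cong: "(\<And>x. x \<in> carrier G ==> u x = v x) ==> nsq u = nsq v"
 unfolding nsq_def by (intro haar_integral_cong) simp

lemma nsq_bound:
 assumes u: "cfun u" and "\<And>x. x \<in> carrier G ==> cmod (u x) \<le> C"
 shows "nsq u \<le> C\<^sup>2"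
proof -
 have "nsq u \<le> (\<integral>x. C\<^sup>2 \<partial>haar)"
  unfolding nsq_def using assms by (intro integral_mono nsq_integrable) (auto intro!: power_mono)
 thus ?thesis by simp
qed

lemma nsq_diff:
 assumes "cfun u" "cfun v"
 shows "nsq (\<lambda>x. u x - v x) = nsq u - 2 * Re (ip u v) + nsq v"
proof -
 have "cfun (\<lambda>x. u x - v x)" by (intro continuous_map_diff assms)
 hence "of_real (nsq (\<lambda>x. u x - v x)) = ip u u - ip u v - ip v u + ip v v"
  using assms by (simp add: ip_self[symmetric] ip_diff_left ip_diff_right)
 hence "nsq (\<lambda>x. u x - v x) = Re (ip u u - ip u v - ip v u + ip v v)" by (metis Re_complex_of_real)
 moreover have "Re (ip v u) = Re (ip u v)" using ip_cnj[of u v] by (metis complex_cnj(1) cnj.simps(1))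
 ultimately show ?thesis by (simp add: ip_self)
qed

text \<open>The pointwise inequality between the arithmetic and geometric mean with a free scale
  \<open>s\<close>, integrated and then optimised over \<open>s\<close>.\<close>

lemma Cauchy_Schwarz:
 assumes u: "cfun u" and v: "cfun v"
 shows "cmod (ip u v) \<le> sqrt (nsq u) * sqrt (nsq v)"
proof -
 have mid: "cmod (ip u v) \<le> (s * nsq u + nsq v / s) / 2" if s: "s > 0" for s
 proof -
  have "cmod (ip u v) \<le> (\<integral>x. cmod (u x * cnj (v x)) \<partial>haar)"
   unfolding ip_def by (rule integral_norm_bound)
  also have "... \<le> (\<integral>x. (s * (cmod (u x))\<^sup>2 + (cmod (v x))\<^sup>2 / s) / 2 \<partial>haar)"
  proof (rule integral_mono)
   show "integrable haar (\<lambda>x. cmod (u x * cnj (v x)))" by (intro integrable_norm ip_integrable u v)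
   show "integrable haar (\<lambda>x. (s * (cmod (u x))\<^sup>2 + (cmod (v x))\<^sup>2 / s) / 2)"
    using nsq_integrable[OF u] nsq_integrable[OF v] by simp
   fix x
   have "0 \<le> (s * cmod (u x) - cmod (v x))\<^sup>2 / s" using s by simp
   thus "cmod (u x * cnj (v x)) \<le> (s * (cmod (u x))\<^sup>2 + (cmod (v x))\<^sup>2 / s) / 2"
    using s by (simp add: norm_mult power2_eq_square field_simps)
  qed
  also have "... = (s * nsq u + nsq v / s) / 2"
   unfolding nsq_def using nsq_integrable[OF u] nsq_integrable[OF v] by simp
  finally show ?thesis .
 qed
 have eps: "cmod (ip u v) \<le> sqrt (nsq u + e) * sqrt (nsq v + e)" if e: "e > 0" for e
 proof -
  \<comment> \<open>The optimal scale is \<open>b / a\<close>; adding \<open>e\<close> keeps it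
    meaningful when a norm vanishes, and \<open>e\<close> tends to 0 at the end.\<close>
  define a b where "a = sqrt (nsq u + e)" and "b = sqrt (nsq v + e)"
  have ab: "a > 0" "b > 0" "a\<^sup>2 = nsq u + e" "b\<^sup>2 = nsq v + e"
   using e nsq_nonneg[of u] nsq_nonneg[of v] by (auto simp: a_def b_def add_nonneg_pos)
  have "cmod (ip u v) \<le> (b / a * nsq u + nsq v / (b / a)) / 2" using ab by (intro mid) auto
  also have "... \<le> (b / a * a\<^sup>2 + b\<^sup>2 / (b / a)) / 2"
   using ab e by (intro divide_right_mono add_mono mult_left_mono) auto
  also have "... = a * b" using ab(1,2) by (simp add: power2_eq_square field_simps)
  finally show ?thesis by (simp add: a_def b_def)
 qed
 have "((\<lambda>e. sqrt (nsq u + e) * sqrt (nsq v + e)) \<longlongrightarrow> sqrt (nsq u + 0) * sqrt (nsq v + 0)) (at_right 0)"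
  by (intro tendsto_intros)
 moreover have "eventually (\<lambda>e. cmod (ip u v) \<le> sqrt (nsq u + e) * sqrt (nsq v + e)) (at_right 0)"
  using eventually_at_right_less[of "0::real"] by eventually_elim (rule eps)
 ultimately show ?thesis using tendsto_lowerbound[of _ _ "at_right (0::real)"] by fastforce
qed

lemma convolution_eq_ip:
 assumes "x \<in> carrier G"
 shows "convolution u k x = ip u (\<lambda>y. cnj (k (inv y \<otimes> x)))"
 by (simp add: convolution_def ip_def)

lemma cfun_kernel: "cfun k ==> x \<in> carrier G ==> cfun (\<lambda>y. cnj (k (inv y \<otimes> x)))"
 using continuous_map_cnj[OF cfun_kernel_section[of "\<lambda>_. 1" k x]] by simp

lemma convolution_bound:
 assumes k: "cfun k"
 obtains C where "C > 0" "\<And>u x. cfun u ==> x \<in> carrier G ==> cmod (convolution u k x) \<le> C * sqrt (nsq u)"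
  "\<And>x. x \<in> carrier G ==> nsq (\<lambda>y. cnj (k (inv y \<otimes> x))) \<le> C\<^sup>2"
proof -
 obtain C where C: "C > 0" "\<And>x. x \<in> topspace T ==> cmod (k x) \<le> C"
  using continuous_map_compact_bounded[OF compact_T k] by metis
 have n: "nsq (\<lambda>y. cnj (k (inv y \<otimes> x))) \<le> C\<^sup>2" if "x \<in> carrier G" for x
  using C that by (intro nsq_bound cfun_kernel k) (auto simp: topspace_eq)
 have "cmod (convolution u k x) \<le> C * sqrt (nsq u)" if u: "cfun u" and x: "x \<in> carrier G" for u x
 proof -
  have "cmod (convolution u k x) \<le> sqrt (nsq u) * sqrt (nsq (\<lambda>y. cnj (k (inv y \<otimes> x))))"
   unfolding convolution_eq_ip[OF x] by (intro Cauchy_Schwarz u cfun_kernel k x)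
  also have "... \<le> sqrt (nsq u) * C"
   using n[OF x] C(1) nsq_nonneg by (intro mult_left_mono) (auto simp: real_le_lsqrt)
  finally show ?thesis by (simp add: mult.commute)
 qed
 thus ?thesis using that C(1) n by blast
qed

lemma convolution_diff: "cfun u ==> cfun v ==> cfun k ==> x \<in> carrier G ==>
  convolution (\<lambda>x. u x - v x) k x = convolution u k x - convolution v k x"
 unfolding convolution_def by (simp add: left_diff_distrib haar_integrable cfun_kernel_section)

lemma convolution_scale: "convolution (\<lambda>x. c * u x) k x = c * convolution u k x"
 unfolding convolution_def by (simp add: mult.assoc)

text \<open>Haar measure has full support: finitely many translates of the open set
  \<open>{f > c}\<close> cover the group, so the sum of the corresponding translates of
  \<open>f\<close> is at least \<open>c\<close> everywhere.\<close>

lemma haar_integral_pos: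
 fixes f :: "'a => real"
 assumes f: "rcmap T f" and nn: "\<And>x. x \<in> carrier G ==> 0 \<le> f x"
  and x0: "x0 \<in> carrier G" "f x0 > 0"
 shows "(\<integral>x. f x \<partial>haar) > 0"
proof -
 define c where "c = f x0 / 2"
 define V where "V g = {x \<in> topspace T. f (g \<otimes> x) \<in> {c<..}}" for g
 have cg: "rcmap T (\<lambda>x. f (g \<otimes> x))" if "g \<in> carrier G" for g
  using continuous_map_apply[OF f continuous_map_left_mult[OF that]] .
 have "openin T (V g)" if "g \<in> carrier G" for g
  unfolding V_def by (rule openin_continuous_map_preimage[OF cg[OF that]]) auto
 hence "openin T U" if "U \<in> V ` carrier G" for U using that by auto
 moreover have "topspace T \<subseteq> \<Union>(V ` carrier G)"
 proof
  fix x assume "x \<in> topspace T"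
  hence x: "x \<in> carrier G" by (simp add: topspace_eq)
  hence "x \<in> V (x0 \<otimes> inv x)" using x0 by (simp add: V_def topspace_eq m_assoc c_def)
  thus "x \<in> \<Union>(V ` carrier G)" using x x0(1) by (intro UN_I[of "x0 \<otimes> inv x"]) auto
 qed
 ultimately obtain \<F> where \<F>: "finite \<F>" "\<F> \<subseteq> V ` carrier G" "topspace T \<subseteq> \<Union>\<F>"
  using compactinD[OF compact_T[unfolded compact_space_def], of "V ` carrier G"] by metis
 obtain P where P: "P \<subseteq> carrier G" "finite P" "\<F> = V ` P"
  using finite_subset_image[OF \<F>(1,2)] by blast
 have "c \<le> (\<Sum>g\<in>P. f (g \<otimes> x))" if x: "x \<in> carrier G" for x
 proof -
  obtain g where g: "g \<in> P" "c < f (g \<otimes> x)"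
   using \<F>(3) P(3) x by (auto simp: V_def topspace_eq)
  have "f (g \<otimes> x) \<le> (\<Sum>g\<in>P. f (g \<otimes> x))"
   using P nn x g(1) by (intro member_le_sum) (auto simp: subset_iff)
  thus ?thesis using g(2) by linarith
 qed
 hence "(\<integral>x. c \<partial>haar) \<le> (\<integral>x. (\<Sum>g\<in>P. f (g \<otimes> x)) \<partial>haar)"
  using P cg by (intro integral_mono Bochner_Integration.integrable_sum haar_integrable) auto
 also have "... = (\<Sum>g\<in>P. \<integral>x. f (g \<otimes> x) \<partial>haar)"
  using P cg by (intro Bochner_Integration.integral_sum haar_integrable) auto
 also have "... = (\<Sum>g\<in>P. \<integral>x. f x \<partial>haar)"
  using P by (intro sum.cong refl haar_integral_left[OF _ f]) auto
 finally have "c \<le> real (card P) * (\<integral>x. f x \<partial>haar)" by simp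
 moreover have "c > 0" using x0 by (simp add: c_def)
 ultimately show ?thesis by (smt (verit) mult_nonneg_nonpos of_nat_0_le_iff)
qed

lemma nsq_eq_0: "cfun u ==> nsq u = 0 ==> x \<in> carrier G ==> u x = 0"
proof (rule ccontr)
 assume "cfun u" "nsq u = 0" "x \<in> carrier G" "u x \<noteq> 0"
 moreover have "rcmap T (\<lambda>x. (cmod (u x))\<^sup>2)"
  unfolding power2_eq_square using \<open>cfun u\<close> by (intro continuous_map_mult_algebra continuous_map_norm)
 ultimately show False
  using haar_integral_pos[of "\<lambda>x. (cmod (u x))\<^sup>2" x] by (simp add: nsq_def)
qed

end

section \<open>Compactness of convolution operators and existence of eigenfunctions\<close>

lemma bounded_sequences_compact: "compact {f :: nat => complex. \<forall>i. cmod (f i) \<le> C}"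
proof -
 have "compactin (product_topology (\<lambda>_. euclidean) UNIV) (PiE UNIV (\<lambda>_::nat. cball (0::complex) C))"
  by (subst compactin_PiE) auto
 moreover have "PiE UNIV (\<lambda>_::nat. cball (0::complex) C) = {f. \<forall>i. cmod (f i) \<le> C}"
  by (auto simp: PiE_def Pi_def)
 ultimately show ?thesis by (simp add: euclidean_product_topology)
qed

text \<open>Tychonoff stands in for the diagonal argument: a countable product of discs is compact
  and metric, hence sequentially compact.\<close>

lemma bounded_sequences_convergent_subseq:
 fixes a :: "nat => nat => complex"
 assumes "\<And>n i. cmod (a n i) \<le> C"
 obtains r :: "nat => nat" and l where "strict_mono r" "\<And>i. (\<lambda>n. a (r n) i) \<longlonglongrightarrow> l i"
proof -
 have "\<forall>n. a n \<in> {f :: nat => complex. \<forall>i. cmod (f i) \<le> C}"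
  using assms by simp
 then obtain l r where "strict_mono r" and lim: "(a \<circ> r) \<longlonglongrightarrow> l"
  using bounded_sequences_compact[of C] unfolding compact_def by blast
 have "(\<lambda>n. a (r n) i) \<longlonglongrightarrow> l i" for i
 proof -
  have "continuous_on UNIV (\<lambda>f :: nat => complex. f i)"
   by (rule continuous_on_product_coordinates)
  hence "isCont (\<lambda>f :: nat => complex. f i) l"
   by (metis UNIV_I continuous_on_eq_continuous_at open_UNIV)
  from isCont_tendsto_compose[OF this lim] show ?thesis by (simp add: o_def)
 qed
 thus ?thesis using that \<open>strict_mono r\<close> by blast
qed

context compact_group
begin

text \<open>Partitions of unity express the images up to \<open>e\<close> by their values at
  finitely many nodes that do not depend on \<open>n\<close>. A subsequence converging at the
  countably many nodes of all accuracies is therefore uniformly Cauchy.\<close>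

lemma convolution_compact:
 assumes k: "cfun k" and u: "\<And>n. cfun (u n)" "\<And>n. nsq (u n) \<le> 1"
 obtains r :: "nat => nat" and w where "strict_mono r" "cfun w"
  "\<And>e. e > 0 ==> \<exists>N. \<forall>n\<ge>N. \<forall>x\<in>carrier G. cmod (convolution (u (r n)) k x - w x) < e"
proof -
 define v where "v n = convolution (u n) k" for n
 have cv: "cfun (v n)" for n unfolding v_def by (intro cfun_convolution u k)
 obtain C where C: "C > 0" "\<And>u x. cfun u ==> x \<in> carrier G ==> cmod (convolution u k x) \<le> C * sqrt (nsq u)"
  using convolution_bound[OF k] by metis
 have vb: "cmod (v n x) \<le> C" if "x \<in> carrier G" for n x
 proof -
  have "C * sqrt (nsq (u n)) \<le> C * 1" using u(2) C(1) by (intro mult_left_mono) auto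
  thus ?thesis using C(2)[OF u(1) that, of n] by (simp add: v_def)
 qed
 have cK: "cmap (prod_topology T T) (\<lambda>(x, y). k (inv y \<otimes> x))"
  unfolding case_prod_unfold
  by (intro continuous_map_apply[OF k] continuous_map_mult continuous_map_inverse continuous_map_fst continuous_map_snd)
 have pou: "\<exists>P \<phi>. finite P \<and> P \<subseteq> carrier G \<and> (\<forall>x\<in>carrier G. (\<forall>p\<in>P. 0 \<le> \<phi> p x) \<and> (\<Sum>p\<in>P. \<phi> p x) = 1 \<and>
   (\<forall>n. cmod (v n x - (\<Sum>p\<in>P. of_real (\<phi> p x) * v n p)) \<le> e))"
  if e: "e > 0" for e :: real
 proof -
  obtain P and \<phi> :: "'a => 'a => real" where P: "finite P" "P \<subseteq> topspace T"
   and \<phi>: "\<And>p. p \<in> P ==> rcmap T (\<phi> p)"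
   "\<And>p x. p \<in> P ==> x \<in> topspace T ==> 0 \<le> \<phi> p x"
   "\<And>x. x \<in> topspace T ==> (\<Sum>p\<in>P. \<phi> p x) = 1"
   "\<And>x y. x \<in> topspace T ==> y \<in> topspace T ==> norm (k (inv y \<otimes> x) - (\<Sum>p\<in>P. \<phi> p x *\<^sub>R k (inv y \<otimes> p))) \<le> e"
   using continuous_partition_of_unity[OF compact_T Hausdorff_T compact_T cK e] by blast
  have "cmod (v n x - (\<Sum>p\<in>P. of_real (\<phi> p x) * v n p)) \<le> e" if x: "x \<in> carrier G" for n x
  proof -
   define D where "D y = k (inv y \<otimes> x) - (\<Sum>p\<in>P. of_real (\<phi> p x) * k (inv y \<otimes> p))" for y
   have pG: "p \<in> carrier G" if "p \<in> P" for p using P(2) that topspace_eq by blast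
   have int: "integrable haar (\<lambda>y. u n y * k (inv y \<otimes> p))" if "p \<in> carrier G" for p
    by (intro haar_integrable cfun_kernel_section u k that)
   have "v n x - (\<Sum>p\<in>P. of_real (\<phi> p x) * v n p) = (\<integral>y. u n y * D y \<partial>haar)"
   proof -
    have "(\<Sum>p\<in>P. of_real (\<phi> p x) * v n p) = (\<Sum>p\<in>P. \<integral>y. of_real (\<phi> p x) * (u n y * k (inv y \<otimes> p)) \<partial>haar)"
     by (simp add: v_def convolution_def)
    also have "... = (\<integral>y. (\<Sum>p\<in>P. of_real (\<phi> p x) * (u n y * k (inv y \<otimes> p))) \<partial>haar)"
     using int pG by (subst Bochner_Integration.integral_sum) auto
    finally have "v n x - (\<Sum>p\<in>P. of_real (\<phi> p x) * v n p) =
      (\<integral>y. u n y * k (inv y \<otimes> x) - (\<Sum>p\<in>P. of_real (\<phi> p x) * (u n y * k (inv y \<otimes> p))) \<partial>haar)"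
     using int[OF x] int pG by (simp add: v_def convolution_def)
    also have "... = (\<integral>y. u n y * D y \<partial>haar)"
     by (intro haar_integral_cong) (simp add: D_def right_diff_distrib sum_distrib_left mult_ac)
    finally show ?thesis .
   qed
   also have "cmod ... \<le> (\<integral>y. cmod (u n y * D y) \<partial>haar)"
    by (rule integral_norm_bound)
   \<comment> \<open>The elementary bound of a modulus by half of one plus its square lets the
     control of \<open>nsq\<close> suffice for an integral of the modulus.\<close>
   also have "... \<le> (\<integral>y. e * ((1 + (cmod (u n y))\<^sup>2) / 2) \<partial>haar)"
   proof (rule integral_mono)
    have "cfun (\<lambda>y. k (inv y \<otimes> p))" if "p \<in> carrier G" for p
     using continuous_map_cnj[OF cfun_kernel[OF k that]] by simp
    hence "cfun D"
     unfolding D_def using x pG P(1) by (intro continuous_map_diff continuous_map_sum continuous_map_mult_algebra) auto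
    thus "integrable haar (\<lambda>y. cmod (u n y * D y))"
     by (intro integrable_norm haar_integrable continuous_map_mult_algebra u)
    show "integrable haar (\<lambda>y. e * ((1 + (cmod (u n y))\<^sup>2) / 2))"
     using nsq_integrable[OF u(1)[of n]] by simp
    fix y assume "y \<in> space haar"
    hence D: "cmod (D y) \<le> e"
     using \<phi>(4)[of x y] x by (simp add: D_def topspace_eq scaleR_conv_of_real)
    have "cmod (u n y) \<le> (1 + (cmod (u n y))\<^sup>2) / 2"
     using zero_le_power2[of "cmod (u n y) - 1"] by (simp add: power2_eq_square algebra_simps)
    hence "cmod (u n y) * cmod (D y) \<le> (1 + (cmod (u n y))\<^sup>2) / 2 * e"
     using D e by (intro mult_mono) auto
    thus "cmod (u n y * D y) \<le> e * ((1 + (cmod (u n y))\<^sup>2) / 2)"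
     by (simp add: norm_mult mult.commute)
   qed
   also have "... = e * ((1 + nsq (u n)) / 2)"
    using nsq_integrable[OF u(1)[of n]] by (simp add: nsq_def)
   also have "... \<le> e" using u(2)[of n] e by (simp add: mult_left_le)
   finally show ?thesis .
  qed
  thus ?thesis using P \<phi>(2,3) topspace_eq by (intro exI[of _ P] exI[of _ \<phi>]) auto
 qed
 define e where "e m = 1 / real (Suc m)" for m
 have "\<forall>m. \<exists>P\<phi>. finite (fst P\<phi>) \<and> fst P\<phi> \<subseteq> carrier G \<and> (\<forall>x\<in>carrier G. (\<forall>p\<in>fst P\<phi>. 0 \<le> snd P\<phi> p x) \<and>
   (\<Sum>p\<in>fst P\<phi>. snd P\<phi> p x) = 1 \<and> (\<forall>n. cmod (v n x - (\<Sum>p\<in>fst P\<phi>. of_real (snd P\<phi> p x) * v n p)) \<le> e m))"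
 proof
  fix m
  have "e m > 0" by (simp add: e_def)
  from pou[OF this] obtain P \<phi> where "finite P \<and> P \<subseteq> carrier G \<and> (\<forall>x\<in>carrier G. (\<forall>p\<in>P. 0 \<le> \<phi> p x) \<and> (\<Sum>p\<in>P. \<phi> p x) = 1 \<and>
   (\<forall>n. cmod (v n x - (\<Sum>p\<in>P. of_real (\<phi> p x) * v n p)) \<le> e m))" by (elim exE)
  thus "\<exists>P\<phi>. finite (fst P\<phi>) \<and> fst P\<phi> \<subseteq> carrier G \<and> (\<forall>x\<in>carrier G. (\<forall>p\<in>fst P\<phi>. 0 \<le> snd P\<phi> p x) \<and>
   (\<Sum>p\<in>fst P\<phi>. snd P\<phi> p x) = 1 \<and> (\<forall>n. cmod (v n x - (\<Sum>p\<in>fst P\<phi>. of_real (snd P\<phi> p x) * v n p)) \<le> e m))"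
   by (intro exI[of _ "(P, \<phi>)"]) simp
 qed
 from choice[OF this] obtain Q where
  Q: "\<And>m. finite (fst (Q m))" "\<And>m. fst (Q m) \<subseteq> carrier G"
   "\<And>m x p. x \<in> carrier G ==> p \<in> fst (Q m) ==> 0 \<le> snd (Q m) p x"
   "\<And>m x. x \<in> carrier G ==> (\<Sum>p\<in>fst (Q m). snd (Q m) p x) = 1"
   "\<And>m x n. x \<in> carrier G ==> cmod (v n x - (\<Sum>p\<in>fst (Q m). of_real (snd (Q m) p x) * v n p)) \<le> e m"
  by blast
 \<comment> \<open>All nodes for all accuracies; the unit is inserted so that the set can be
   enumerated even if no node occurs.\<close>
 define D where "D = insert \<one> (\<Union>m. fst (Q m))"
 have D: "countable D" "D \<noteq> {}" "D \<subseteq> carrier G"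
  unfolding D_def using Q(1,2) by (auto intro: countable_finite)
 define d where "d = from_nat_into D"
 have d: "range d = D" unfolding d_def using D(2,1) by (rule range_from_nat_into)
 obtain r l where r: "strict_mono r" and l: "\<And>i. (\<lambda>n. v (r n) (d i)) \<longlonglongrightarrow> l i"
  using bounded_sequences_convergent_subseq[of "\<lambda>n i. v n (d i)" C] vb d D(3) by (metis rangeI subsetD)
 have cauchy: "\<exists>N. \<forall>m n x. N \<le> m \<longrightarrow> N \<le> n \<longrightarrow> x \<in> topspace T \<longrightarrow> dist (v (r m) x) (v (r n) x) < \<epsilon>"
  if \<epsilon>: "\<epsilon> > 0" for \<epsilon>
 proof -
  obtain m where m: "e m < \<epsilon> / 4"
   using \<epsilon> nat_approx_posE[of "\<epsilon> / 4"] unfolding e_def by auto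
  have "\<exists>N. \<forall>n\<ge>N. \<forall>n'\<ge>N. dist (v (r n) p) (v (r n') p) < \<epsilon> / 4" if "p \<in> fst (Q m)" for p
  proof -
   have "p \<in> D" using that by (auto simp: D_def)
   then obtain i where "p = d i" using d by (metis imageE)
   hence "Cauchy (\<lambda>n. v (r n) p)" using l by (auto intro: LIMSEQ_imp_Cauchy)
   thus ?thesis by (rule metric_CauchyD) (use \<epsilon> in auto)
  qed
  then obtain N where N: "\<And>p n n'. p \<in> fst (Q m) ==> n \<ge> N p ==> n' \<ge> N p ==> dist (v (r n) p) (v (r n') p) < \<epsilon> / 4"
   by metis
  \<comment> \<open>The sum serves as a common upper bound of the finitely many thresholds.\<close>
  define N0 where "N0 = (\<Sum>p\<in>fst (Q m). N p)"
  have N0: "N p \<le> N0" if "p \<in> fst (Q m)" for p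
   unfolding N0_def using Q(1) that by (intro member_le_sum) auto
  have "dist (v (r n) x) (v (r n') x) < \<epsilon>" if n: "N0 \<le> n" "N0 \<le> n'" and x: "x \<in> carrier G" for n n' x
  proof -
   define S where "S n = (\<Sum>p\<in>fst (Q m). of_real (snd (Q m) p x) * v n p)" for n
   have "cmod (S (r n) - S (r n')) = cmod (\<Sum>p\<in>fst (Q m). of_real (snd (Q m) p x) * (v (r n) p - v (r n') p))"
    by (simp add: S_def sum_subtractf right_diff_distrib)
   also have "... \<le> (\<Sum>p\<in>fst (Q m). snd (Q m) p x * (\<epsilon> / 4))"
   proof (rule sum_norm_le)
    fix p assume p: "p \<in> fst (Q m)"
    have "cmod (v (r n) p - v (r n') p) \<le> \<epsilon> / 4"
     using N[OF p] N0[OF p] n by (metis dist_norm less_imp_le order_trans)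
    thus "cmod (of_real (snd (Q m) p x) * (v (r n) p - v (r n') p)) \<le> snd (Q m) p x * (\<epsilon> / 4)"
     unfolding norm_mult norm_of_real abs_of_nonneg[OF Q(3)[OF x p]]
     by (rule mult_left_mono[OF _ Q(3)[OF x p]])
   qed
   also have "... = \<epsilon> / 4" unfolding sum_distrib_right[symmetric] Q(4)[OF x] by simp
   finally have 1: "cmod (S (r n) - S (r n')) \<le> \<epsilon> / 4" .
   have 2: "cmod (v (r n) x - S (r n)) < \<epsilon> / 4" "cmod (v (r n') x - S (r n')) < \<epsilon> / 4"
    using Q(5)[OF x, of _ m] m unfolding S_def by (meson le_less_trans)+
   have "v (r n) x - v (r n') x = (v (r n) x - S (r n)) + (S (r n) - S (r n')) - (v (r n') x - S (r n'))"
    by simp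
   also have "cmod ... \<le> cmod (v (r n) x - S (r n)) + cmod (S (r n) - S (r n')) + cmod (v (r n') x - S (r n'))"
    using norm_triangle_ineq4 norm_triangle_ineq by (smt (verit))
   also have "... < \<epsilon>" using 1 2 \<epsilon> by linarith
   finally show ?thesis by (simp add: dist_norm)
  qed
  thus ?thesis by (auto simp: topspace_eq)
 qed
 obtain w where w: "cfun w" "\<And>\<epsilon>. 0 < \<epsilon> ==> \<forall>\<^sub>F n in sequentially. \<forall>x\<in>topspace T. dist (v (r n) x) (w x) < \<epsilon>"
  using Met_TC.continuous_map_uniformly_Cauchy_limit[of T "\<lambda>n. v (r n)"] cv cauchy
  by (auto simp: complete_UNIV mcomplete_iff_complete)
 show ?thesis
 proof (rule that[OF r w(1)])
  fix \<epsilon> :: real assume "\<epsilon> > 0"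
  from w(2)[OF this] show "\<exists>N. \<forall>n\<ge>N. \<forall>x\<in>carrier G. cmod (convolution (u (r n)) k x - w x) < \<epsilon>"
   by (simp add: eventually_sequentially topspace_eq dist_norm v_def)
 qed
qed

lemma nsq_small:
 assumes "\<And>e. e > 0 ==> \<exists>N. \<forall>n\<ge>N. \<forall>x\<in>carrier G. cmod (v n x) < e" and v: "\<And>n. cfun (v n)"
 shows "(\<lambda>n. sqrt (nsq (v n))) \<longlonglongrightarrow> 0"
proof (rule LIMSEQ_I)
 fix e :: real assume e: "e > 0"
 then obtain N where N: "\<forall>n\<ge>N. \<forall>x\<in>carrier G. cmod (v n x) < e / 2"
  using assms(1)[of "e / 2"] by auto
 have "sqrt (nsq (v n)) < e" if "n \<ge> N" for n
 proof -
  have "nsq (v n) \<le> (e / 2)\<^sup>2" using N that by (intro nsq_bound v) (auto simp: less_imp_le)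
  hence "sqrt (nsq (v n)) \<le> e / 2" using real_sqrt_le_mono e by fastforce
  thus ?thesis using e by simp
 qed
 thus "\<exists>N. \<forall>n\<ge>N. norm (sqrt (nsq (v n)) - 0) < e"
  by (intro exI[of _ N]) (simp add: nsq_nonneg)
qed

lemma ip_gram: "cfun u ==> cfun k ==> ip (convolution (convolution u k) (adj k)) u = of_real (nsq (convolution u k))"
 using ip_convolution[of u k "convolution u k"] cfun_convolution[of u k]
 by (metis ip_cnj ip_self complex_cnj_complex_of_real)

text \<open>The supremum \<open>l\<close> of \<open>nsq (Q u)\<close> over the unit ball is the top
  of the spectrum of the positive operator
  \<open>u \<mapsto> convolution u (convolution k (adj k))\<close>. A maximising sequence is an
  approximate eigensequence, and compactness of the operator turns its images into a uniformly
  convergent sequence, whose limit is a continuous eigenfunction.\<close>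

lemma gram_eigenfunction:
 assumes k: "cfun k" and u0: "cfun u0" and x0: "x0 \<in> carrier G" "convolution u0 k x0 \<noteq> 0"
 obtains l w where "l > (0::real)" "cfun w" "\<exists>x\<in>carrier G. w x \<noteq> 0"
  "\<And>x. x \<in> carrier G ==> convolution w (convolution k (adj k)) x = of_real l * w x"
proof -
 define Q where "Q u = convolution u k" for u
 have cQ: "cfun (Q u)" if "cfun u" for u unfolding Q_def by (intro cfun_convolution that k)
 obtain C where C: "C > 0" "\<And>u x. cfun u ==> x \<in> carrier G ==> cmod (Q u x) \<le> C * sqrt (nsq u)"
  using convolution_bound[OF k] unfolding Q_def by metis
 have nQ: "nsq (Q u) \<le> C\<^sup>2 * nsq u" if "cfun u" for u
  using nsq_bound[OF cQ[OF that] C(2)[OF that]] nsq_nonneg[of u] by (simp add: power_mult_distrib)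
 define S where "S = {nsq (Q u) |u. cfun u \<and> nsq u \<le> 1}"
 have bS: "bdd_above S" unfolding S_def
 proof (rule bdd_aboveI)
  fix s assume "s \<in> {nsq (Q u) |u. cfun u \<and> nsq u \<le> 1}"
  then obtain u where "cfun u" "nsq u \<le> 1" "s = nsq (Q u)" by blast
  thus "s \<le> C\<^sup>2" using nQ[of u] mult_left_mono[of "nsq u" 1 "C\<^sup>2"] by simp
 qed
 define l where "l = Sup S"
 have le1: "nsq (Q u) \<le> l" if "cfun u" "nsq u \<le> 1" for u
  unfolding l_def using that by (intro cSup_upper bS) (auto simp: S_def)
 have Qscale: "nsq (Q (\<lambda>x. c * u x)) = (cmod c)\<^sup>2 * nsq (Q u)" for c u
  unfolding Q_def by (simp add: convolution_scale[abs_def] nsq_scale)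
 have le: "nsq (Q u) \<le> l * nsq u" if u: "cfun u" for u
 proof (cases "nsq u = 0")
  case True
  thus ?thesis using nQ[OF u] by simp
 next
  case False
  hence pos: "nsq u > 0" using nsq_nonneg[of u] by linarith
  have "(cmod (of_real (1 / sqrt (nsq u)) :: complex))\<^sup>2 = 1 / nsq u"
   using pos by (simp add: power_divide norm_divide)
  hence "nsq (\<lambda>x. of_real (1 / sqrt (nsq u)) * u x) = 1" "nsq (Q (\<lambda>x. of_real (1 / sqrt (nsq u)) * u x)) = nsq (Q u) / nsq u"
   using pos by (simp_all add: nsq_scale Qscale del: of_real_divide)
  hence "nsq (Q u) / nsq u \<le> l"
   using le1[of "\<lambda>x. of_real (1 / sqrt (nsq u)) * u x"] cfun_scale[OF u] by (metis order_refl)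
  thus ?thesis using pos by (simp add: field_simps)
 qed
 have "nsq (Q u0) > 0"
  using nsq_eq_0[OF cQ[OF u0] _ x0(1)] x0(2) nsq_nonneg[of "Q u0"] unfolding Q_def by fastforce
 hence lpos: "l > 0"
  using le[OF u0] nsq_nonneg[of u0] by (metis less_le_not_le linorder_not_less mult_nonpos_nonneg order_trans)
 \<comment> \<open>The adjoint has the same norm bound: the square of the norm of the image is a
   pairing of \<open>Q z\<close> with \<open>v\<close>, to which Cauchy-Schwarz applies.\<close>
 have leadj: "nsq (convolution v (adj k)) \<le> l * nsq v" if v: "cfun v" for v
 proof -
  define z where "z = convolution v (adj k)"
  have cz: "cfun z" unfolding z_def by (intro cfun_convolution v cfun_adj k)
  have "nsq z = cmod (ip z z)" by (simp add: ip_self nsq_nonneg)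
  also have "... = cmod (ip (Q z) v)"
   unfolding Q_def using ip_convolution[OF cz k v] by (simp add: z_def)
  also have "... \<le> sqrt (nsq (Q z)) * sqrt (nsq v)" by (intro Cauchy_Schwarz cQ cz v)
  also have "... \<le> sqrt (l * nsq z) * sqrt (nsq v)"
   using le[OF cz] nsq_nonneg by (intro mult_right_mono) auto
  finally have "nsq z \<le> sqrt (l * nsq z * nsq v)" by (simp add: real_sqrt_mult)
  hence "(nsq z)\<^sup>2 \<le> l * nsq z * nsq v"
   using nsq_nonneg[of z] nsq_nonneg[of v] lpos by (metis mult_nonneg_nonneg less_imp_le power_mono real_sqrt_pow2)
  thus ?thesis using nsq_nonneg[of z] nsq_nonneg[of v] lpos unfolding z_def[symmetric]
   by (cases "nsq z = 0") (auto simp: power2_eq_square mult.assoc mult.left_commute[of l])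
 qed
 define \<psi> where "\<psi> = convolution k (adj k)"
 have c\<psi>: "cfun \<psi>" unfolding \<psi>_def by (intro cfun_convolution k cfun_adj)
 have R: "convolution u \<psi> x = convolution (Q u) (adj k) x" if "cfun u" "x \<in> carrier G" for u x
  unfolding \<psi>_def Q_def using convolution_assoc[OF that(1) k cfun_adj[OF k] that(2)] by simp
 have nR: "nsq (convolution u \<psi>) \<le> l\<^sup>2 * nsq u" if u: "cfun u" for u
 proof -
  have "nsq (convolution u \<psi>) = nsq (convolution (Q u) (adj k))" using R[OF u] by (rule nsq_cong)
  also have "... \<le> l * nsq (Q u)" by (rule leadj[OF cQ[OF u]])
  also have "... \<le> l * (l * nsq u)" using le[OF u] lpos by simp
  finally show ?thesis by (simp add: power2_eq_square)
 qed
 have ipR: "ip (convolution u \<psi>) u = of_real (nsq (Q u))" if u: "cfun u" for u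
  using ip_gram[OF u k] ip_cong[of "convolution u \<psi>" "convolution (Q u) (adj k)" u u] R[OF u]
  unfolding Q_def by metis
 have "\<exists>u. cfun u \<and> nsq u \<le> 1 \<and> l - 1 / real (Suc n) < nsq (Q u)" for n
 proof -
  have "S \<noteq> {}" unfolding S_def by (auto intro!: exI[of _ "\<lambda>_. 0"] simp: nsq_def)
  thus ?thesis
   using less_cSupD[of S "l - 1 / real (Suc n)"] unfolding l_def[symmetric] by (auto simp: S_def)
 qed
 then obtain u where u: "\<And>n. cfun (u n)" "\<And>n. nsq (u n) \<le> 1" "\<And>n. l - 1 / real (Suc n) < nsq (Q (u n))"
  by metis
 obtain r :: "nat => nat" and w where r: "strict_mono r" and w: "cfun w"
  and lim: "\<And>e. e > 0 ==> \<exists>N. \<forall>n\<ge>N. \<forall>x\<in>carrier G. cmod (convolution (u (r n)) \<psi> x - w x) < e"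
  using convolution_compact[of \<psi> u, OF c\<psi> u(1) u(2)] by blast
 define v where "v n = convolution (u (r n)) \<psi>" for n
 have cv: "cfun (v n)" for n unfolding v_def by (intro cfun_convolution u c\<psi>)
 have lw: "(\<lambda>n. sqrt (nsq (\<lambda>x. v n x - w x))) \<longlonglongrightarrow> 0"
  by (rule nsq_small) (use lim in \<open>auto simp: v_def intro!: continuous_map_diff cfun_convolution u c\<psi> w\<close>)
 have inv0: "(\<lambda>n. 1 / real (Suc (r n))) \<longlonglongrightarrow> 0"
  using LIMSEQ_subseq_LIMSEQ[OF LIMSEQ_inverse_real_of_nat r] by (simp add: o_def inverse_eq_divide)
 \<comment> \<open>Expanding the square: the norm of \<open>v n\<close> is at most \<open>l\<close>,
   and its pairing with \<open>u (r n)\<close> is \<open>nsq (Q (u (r n)))\<close>, which is almost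
   \<open>l\<close>.\<close>
 have close: "nsq (\<lambda>x. v n x - of_real l * u (r n) x) \<le> 2 * l * (1 / real (Suc (r n)))" for n
 proof -
  have "nsq (\<lambda>x. v n x - of_real l * u (r n) x) = nsq (v n) - 2 * (l * nsq (Q (u (r n)))) + l\<^sup>2 * nsq (u (r n))"
   using nsq_diff[OF cv[of n] cfun_scale[OF u(1), of "of_real l" "r n"]] lpos
   by (simp add: ip_scale_right nsq_scale v_def ipR[OF u(1)])
  also have "... \<le> l\<^sup>2 * 1 - 2 * (l * (l - 1 / real (Suc (r n)))) + l\<^sup>2 * 1"
  proof (intro add_mono diff_mono mult_left_mono)
   show "nsq (v n) \<le> l\<^sup>2 * 1"
    unfolding v_def using nR[OF u(1)[of "r n"]] u(2)[of "r n"] mult_left_mono[of "nsq (u (r n))" 1 "l\<^sup>2"] by simp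
  qed (use u lpos in \<open>auto simp: less_imp_le\<close>)
  also have "... = 2 * l * (1 / real (Suc (r n)))" by (simp add: power2_eq_square algebra_simps)
  finally show ?thesis .
 qed
 have close0: "(\<lambda>n. sqrt (nsq (\<lambda>x. v n x - of_real l * u (r n) x))) \<longlonglongrightarrow> 0"
 proof (rule tendsto_sandwich[of "\<lambda>_. 0" _ _ "\<lambda>n. sqrt (2 * l * (1 / real (Suc (r n))))"])
  have "(\<lambda>n. sqrt (2 * l * (1 / real (Suc (r n))))) \<longlonglongrightarrow> sqrt (2 * l * 0)"
   by (intro tendsto_intros inv0)
  thus "(\<lambda>n. sqrt (2 * l * (1 / real (Suc (r n))))) \<longlonglongrightarrow> 0" by simp
 qed (use close nsq_nonneg in \<open>auto simp: real_sqrt_le_iff\<close>)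
 obtain B where B: "B > 0" "\<And>u x. cfun u ==> x \<in> carrier G ==> cmod (convolution u \<psi> x) \<le> B * sqrt (nsq u)"
  using convolution_bound[OF c\<psi>] by metis
 have small: "(\<lambda>n. convolution (f n) \<psi> x) \<longlonglongrightarrow> 0"
  if "\<And>n. cfun (f n)" "(\<lambda>n. sqrt (nsq (f n))) \<longlonglongrightarrow> 0" "x \<in> carrier G" for f x
 proof (rule Lim_null_comparison)
  show "\<forall>\<^sub>F n in sequentially. cmod (convolution (f n) \<psi> x) \<le> B * sqrt (nsq (f n))"
   using B(2) that by auto
  show "(\<lambda>n. B * sqrt (nsq (f n))) \<longlonglongrightarrow> 0"
   using tendsto_mult_left[OF that(2), of B] by simp
 qed
 \<comment> \<open>The \<open>u (r n)\<close> themselves need not converge, so the operator is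
   applied once more: images of \<open>v n\<close> tend to the image of \<open>w\<close>, and they
   differ from \<open>of_real l * v n\<close> by the image of the small difference just
   estimated.\<close>
 have eig: "convolution w \<psi> x = of_real l * w x" if x: "x \<in> carrier G" for x
 proof -
  have "(\<lambda>n. convolution (\<lambda>x. v n x - w x) \<psi> x) \<longlonglongrightarrow> 0"
   by (rule small[OF _ lw x]) (intro continuous_map_diff cv w)
  moreover have "convolution (\<lambda>x. v n x - w x) \<psi> x = convolution (v n) \<psi> x - convolution w \<psi> x" for n
   by (intro convolution_diff cv w c\<psi> x)
  ultimately have 1: "(\<lambda>n. convolution (v n) \<psi> x) \<longlonglongrightarrow> convolution w \<psi> x"
   by (simp add: LIM_zero_iff)
  have "(\<lambda>n. convolution (\<lambda>x. v n x - of_real l * u (r n) x) \<psi> x) \<longlonglongrightarrow> 0"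
   by (rule small[OF _ close0 x]) (intro continuous_map_diff cv cfun_scale u)
  moreover have "convolution (\<lambda>x. v n x - of_real l * u (r n) x) \<psi> x = convolution (v n) \<psi> x - of_real l * v n x" for n
   using convolution_diff[OF cv[of n] cfun_scale[OF u(1)[of "r n"]] c\<psi> x, of "of_real l"]
   by (simp add: convolution_scale v_def)
  ultimately have 2: "(\<lambda>n. convolution (v n) \<psi> x - of_real l * v n x) \<longlonglongrightarrow> 0"
   by simp
  have "(\<lambda>n. v n x) \<longlonglongrightarrow> w x"
  proof (rule LIMSEQ_I)
   fix e :: real assume "e > 0"
   thus "\<exists>no. \<forall>n\<ge>no. norm (v n x - w x) < e" using lim[of e] x unfolding v_def by blast
  qed
  hence "(\<lambda>n. of_real l * v n x) \<longlonglongrightarrow> of_real l * w x"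
   by (rule tendsto_mult_left)
  from tendsto_add[OF 2 this] have "(\<lambda>n. convolution (v n) \<psi> x) \<longlonglongrightarrow> of_real l * w x"
   by simp
  with 1 show ?thesis by (rule LIMSEQ_unique)
 qed
 have "\<exists>x\<in>carrier G. w x \<noteq> 0"
 proof (rule ccontr)
  assume "\<not> ?thesis"
  hence w0: "nsq (\<lambda>x. v n x - w x) = nsq (v n)" for n by (intro nsq_cong) auto
  \<comment> \<open>By Cauchy-Schwarz a maximising sequence cannot have images tending to 0, because
    \<open>l > 0\<close>.\<close>
  have "l - 1 / real (Suc (r n)) \<le> sqrt (nsq (v n))" for n
  proof -
   have "nsq (Q (u (r n))) = cmod (ip (v n) (u (r n)))" by (simp add: v_def ipR[OF u(1)] nsq_nonneg)
   also have "... \<le> sqrt (nsq (v n)) * sqrt (nsq (u (r n)))" by (intro Cauchy_Schwarz cv u)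
   also have "... \<le> sqrt (nsq (v n)) * 1" using u(2) nsq_nonneg by (intro mult_left_mono) auto
   finally show ?thesis using u(3)[of "r n"] by linarith
  qed
  moreover have "(\<lambda>n. sqrt (nsq (v n))) \<longlonglongrightarrow> 0" using lw by (simp add: w0)
  moreover have "(\<lambda>n. l - 1 / real (Suc (r n))) \<longlonglongrightarrow> l - 0"
   by (intro tendsto_intros inv0)
  ultimately have "l - 0 \<le> 0" by (intro LIMSEQ_le) auto
  thus False using lpos by simp
 qed
 thus ?thesis using that[OF lpos w] eig unfolding \<psi>_def by blast
qed

end

section \<open>Finite-dimensional eigenspaces and irreducible representations\<close>

context compact_group
begin

definition orthonormal :: "nat => (nat => 'a => complex) => bool" where
 "orthonormal n e \<longleftrightarrow> (\<forall>i<n. cfun (e i)) \<and> (\<forall>i<n. \<forall>j<n. ip (e i) (e j) = (if i = j then 1 else 0))"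

lemma ip_orthonormal_sum:
 assumes e: "orthonormal n e" and j: "j < n"
 shows "ip (\<lambda>x. \<Sum>i<n. c i * e i x) (e j) = c j"
proof -
 have "ip (\<lambda>x. \<Sum>i<n. c i * e i x) (e j) = (\<Sum>i<n. ip (\<lambda>x. c i * e i x) (e j))"
  using e j by (intro ip_sum_left cfun_scale) (auto simp: orthonormal_def)
 also have "... = (\<Sum>i<n. if i = j then c i else 0)"
  using e j by (intro sum.cong) (auto simp: ip_scale_left orthonormal_def)
 also have "... = c j" using j by simp
 finally show ?thesis .
qed

lemma cfun_orthonormal_sum: "orthonormal n e ==> cfun (\<lambda>x. \<Sum>i<n. c i * e i x)"
 by (intro continuous_map_sum cfun_scale) (auto simp: orthonormal_def)

lemma orthonormal_residual:
 assumes e: "orthonormal n e" and h: "cfun h"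
 shows "nsq (\<lambda>x. h x - (\<Sum>i<n. ip h (e i) * e i x)) = nsq h - (\<Sum>i<n. (cmod (ip h (e i)))\<^sup>2)"
  and "j < n ==> ip (\<lambda>x. h x - (\<Sum>i<n. ip h (e i) * e i x)) (e j) = 0"
proof -
 define P where "P x = (\<Sum>i<n. ip h (e i) * e i x)" for x
 have cP: "cfun P" unfolding P_def by (rule cfun_orthonormal_sum[OF e])
 have ipP: "ip P (e j) = ip h (e j)" if "j < n" for j unfolding P_def by (rule ip_orthonormal_sum[OF e that])
 have Pu: "ip P u = (\<Sum>i<n. ip h (e i) * cnj (ip u (e i)))" if "cfun u" for u
 proof -
  have "ip P u = (\<Sum>i<n. ip (\<lambda>x. ip h (e i) * e i x) u)"
   unfolding P_def using e that by (intro ip_sum_left cfun_scale) (auto simp: orthonormal_def)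
  thus ?thesis by (simp add: ip_scale_left ip_cnj)
 qed
 have s: "(\<Sum>i<n. ip h (e i) * cnj (ip h (e i))) = of_real (\<Sum>i<n. (cmod (ip h (e i)))\<^sup>2)"
  by (simp add: complex_norm_square del: of_real_power)
 have 1: "ip P h = of_real (\<Sum>i<n. (cmod (ip h (e i)))\<^sup>2)" using Pu[OF h] s by simp
 have 2: "ip P P = of_real (\<Sum>i<n. (cmod (ip h (e i)))\<^sup>2)" using Pu[OF cP] s ipP by simp
 have "ip h P = cnj (ip P h)" by (simp add: ip_cnj)
 hence "Re (ip h P) = (\<Sum>i<n. (cmod (ip h (e i)))\<^sup>2)"
  by (simp only: 1 complex_cnj_complex_of_real Re_complex_of_real)
 moreover have "nsq P = (\<Sum>i<n. (cmod (ip h (e i)))\<^sup>2)" using 2 unfolding ip_self of_real_eq_iff .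
 ultimately show "nsq (\<lambda>x. h x - (\<Sum>i<n. ip h (e i) * e i x)) = nsq h - (\<Sum>i<n. (cmod (ip h (e i)))\<^sup>2)"
  using nsq_diff[OF h cP] by (simp add: P_def)
 show "ip (\<lambda>x. h x - (\<Sum>i<n. ip h (e i) * e i x)) (e j) = 0" if "j < n"
  using ip_diff_left[OF h cP, of "e j"] ipP[OF that] e that by (simp add: P_def orthonormal_def)
qed

lemma Bessel: "orthonormal n e ==> cfun h ==> (\<Sum>i<n. (cmod (ip h (e i)))\<^sup>2) \<le> nsq h"
 using orthonormal_residual(1)[of n e h] nsq_nonneg[of "\<lambda>x. h x - (\<Sum>i<n. ip h (e i) * e i x)"] by simp

text \<open>The Hilbert-Schmidt bound: at each \<open>x\<close>, the coefficients of the kernel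
  section along \<open>e i\<close> have modulus \<open>l * cmod (e i x)\<close>. Bessel bounds the
  sum of their squares by a constant, and integration over \<open>x\<close> leaves
  \<open>n * l^2\<close>.\<close>

lemma eigenspace_bounded:
 assumes \<psi>: "cfun \<psi>" and l: "l > 0"
 obtains N where "\<And>n e. orthonormal n e ==>
  (\<And>i x. i < n ==> x \<in> carrier G ==> convolution (e i) \<psi> x = of_real l * e i x) ==> n \<le> N"
proof -
 obtain C where C: "C > 0" "\<And>x. x \<in> carrier G ==> nsq (\<lambda>y. cnj (\<psi> (inv y \<otimes> x))) \<le> C\<^sup>2"
  using convolution_bound[OF \<psi>] by metis
 have "n \<le> nat \<lceil>C\<^sup>2 / l\<^sup>2\<rceil>" if e: "orthonormal n e"
  and eig: "\<And>i x. i < n ==> x \<in> carrier G ==> convolution (e i) \<psi> x = of_real l * e i x" for n e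
 proof -
  have ce: "cfun (e i)" if "i < n" for i using e that by (simp add: orthonormal_def)
  have le: "(\<Sum>i<n. l\<^sup>2 * (cmod (e i x))\<^sup>2) \<le> C\<^sup>2" if x: "x \<in> carrier G" for x
  proof -
   define h where "h = (\<lambda>y. cnj (\<psi> (inv y \<otimes> x)))"
   have "(cmod (ip h (e i)))\<^sup>2 = l\<^sup>2 * (cmod (e i x))\<^sup>2" if i: "i < n" for i
   proof -
    have "cmod (ip h (e i)) = cmod (ip (e i) h)" using ip_cnj[of h "e i"] complex_mod_cnj by metis
    also have "... = cmod (of_real l * e i x)"
     unfolding h_def convolution_eq_ip[OF x, symmetric] eig[OF i x] ..
    finally show ?thesis by (simp add: norm_mult power_mult_distrib)
   qed
   thus ?thesis using Bessel[OF e, of h] cfun_kernel[OF \<psi> x] C(2)[OF x] unfolding h_def by simp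
  qed
  have "(\<integral>x. (\<Sum>i<n. l\<^sup>2 * (cmod (e i x))\<^sup>2) \<partial>haar) \<le> (\<integral>x. C\<^sup>2 \<partial>haar)"
   using le ce by (intro integral_mono Bochner_Integration.integrable_sum integrable_mult_right nsq_integrable) auto
  moreover have "(\<integral>x. (\<Sum>i<n. l\<^sup>2 * (cmod (e i x))\<^sup>2) \<partial>haar) = (\<Sum>i<n. l\<^sup>2 * nsq (e i))"
   unfolding nsq_def using ce by (subst Bochner_Integration.integral_sum) (auto intro: integrable_mult_right nsq_integrable)
  moreover have "nsq (e i) = 1" if "i < n" for i
   using e that ip_self[of "e i"] by (simp add: orthonormal_def)
  ultimately have "real n * l\<^sup>2 \<le> C\<^sup>2" by simp
  hence "real n \<le> C\<^sup>2 / l\<^sup>2" using l by (simp add: field_simps)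
  thus ?thesis by linarith
 qed
 thus ?thesis using that by blast
qed

text \<open>The last conjunct excludes the zero space, so dimensions are positive. Functions are not
  normalised off the carrier; elements are compared by their values on it.\<close>

definition invariant_space :: "('a => complex) set => bool" where
 "invariant_space W \<longleftrightarrow> (\<forall>u\<in>W. cfun u) \<and> (\<forall>u\<in>W. \<forall>v\<in>W. (\<lambda>x. u x + v x) \<in> W) \<and>
   (\<forall>c. \<forall>u\<in>W. (\<lambda>x. c * u x) \<in> W) \<and> (\<forall>g\<in>carrier G. \<forall>u\<in>W. (\<lambda>x. u (inv g \<otimes> x)) \<in> W) \<and>
   (\<exists>u\<in>W. \<exists>x\<in>carrier G. u x \<noteq> 0)"

lemma invariant_spaceD:
 assumes "invariant_space W"
 shows "u \<in> W ==> cfun u" "u \<in> W ==> v \<in> W ==> (\<lambda>x. u x + v x) \<in> W"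
  "u \<in> W ==> (\<lambda>x. c * u x) \<in> W" "g \<in> carrier G ==> u \<in> W ==> (\<lambda>x. u (inv g \<otimes> x)) \<in> W"
  "\<exists>u\<in>W. \<exists>x\<in>carrier G. u x \<noteq> 0"
 using assms by (simp_all add: invariant_space_def)

lemma invariant_space_sum:
 assumes W: "invariant_space W" and "finite S" "\<And>i. i \<in> S ==> u i \<in> W"
 shows "(\<lambda>x. \<Sum>i\<in>S. c i * u i x) \<in> W" using assms(2,3)
proof (induction S rule: finite_induct)
 case empty
 obtain v where "v \<in> W" using invariant_spaceD(5)[OF W] by blast
 hence "(\<lambda>x. 0 * v x) \<in> W" by (rule invariant_spaceD(3)[OF W])
 thus ?case by simp
next
 case (insert i S)
 have "(\<lambda>x. c i * u i x) \<in> W" using insert.prems by (intro invariant_spaceD(3)[OF W]) auto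
 moreover have "(\<lambda>x. \<Sum>i\<in>S. c i * u i x) \<in> W" using insert by auto
 ultimately have "(\<lambda>x. c i * u i x + (\<Sum>i\<in>S. c i * u i x)) \<in> W"
  by (rule invariant_spaceD(2)[OF W])
 thus ?case using insert.hyps by simp
qed

text \<open>Otherwise the residual of \<open>u\<close> is nonzero, and after normalisation it would
  lengthen the family.\<close>

lemma maximal_orthonormal_spans:
 assumes W: "invariant_space W" and e: "orthonormal n e" "\<And>i. i < n ==> e i \<in> W"
  and max: "\<not> (\<exists>e'. orthonormal (Suc n) e' \<and> (\<forall>i<Suc n. e' i \<in> W))"
  and u: "u \<in> W" and x: "x \<in> carrier G"
 shows "u x = (\<Sum>i<n. ip u (e i) * e i x)"
proof (rule ccontr)
 assume ne: "u x \<noteq> (\<Sum>i<n. ip u (e i) * e i x)"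
 define h where "h x = u x - (\<Sum>i<n. ip u (e i) * e i x)" for x
 have cu: "cfun u" using W u by (simp add: invariant_space_def)
 have "(\<lambda>x. \<Sum>i<n. (- ip u (e i)) * e i x) \<in> W"
  using e(2) by (intro invariant_space_sum W) auto
 with u have "(\<lambda>x. u x + (\<Sum>i<n. (- ip u (e i)) * e i x)) \<in> W"
  by (rule invariant_spaceD(2)[OF W])
 hence hW: "h \<in> W" unfolding h_def[abs_def] by (simp add: sum_negf)
 have ch: "cfun h" using W hW by (simp add: invariant_space_def)
 have "nsq h \<noteq> 0" using nsq_eq_0[OF ch _ x] ne by (auto simp: h_def)
 hence pos: "nsq h > 0" using nsq_nonneg[of h] by linarith
 define s :: complex where "s = of_real (1 / sqrt (nsq h))"
 have s: "s * cnj s * of_real (nsq h) = 1"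
 proof -
  have "(1 / sqrt (nsq h)) * (1 / sqrt (nsq h)) * nsq h = 1" using pos by simp
  thus ?thesis unfolding s_def complex_cnj_complex_of_real of_real_mult[symmetric] by simp
 qed
 define e' where "e' i = (if i = n then (\<lambda>x. s * h x) else e i)" for i
 have he: "ip h (e j) = 0" if "j < n" for j
  unfolding h_def[abs_def] by (rule orthonormal_residual(2)[OF e(1) cu that])
 have eh: "ip (e j) h = 0" if "j < n" for j using he[OF that] ip_cnj[of h "e j"] by simp
 have "orthonormal (Suc n) e'" unfolding orthonormal_def
 proof (intro conjI allI impI)
  fix i assume "i < Suc n"
  thus "cfun (e' i)" using e(1) cfun_scale[OF ch] by (auto simp: e'_def orthonormal_def less_Suc_eq)
  fix j assume "j < Suc n"
  thus "ip (e' i) (e' j) = (if i = j then 1 else 0)"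
   using \<open>i < Suc n\<close> e(1) he eh s[folded ip_self]
   by (auto simp: e'_def orthonormal_def less_Suc_eq ip_scale_left ip_scale_right mult_ac)
 qed
 moreover have "(\<lambda>x. s * h x) \<in> W" by (rule invariant_spaceD(3)[OF W hW])
 hence "\<forall>i<Suc n. e' i \<in> W" using e(2) by (auto simp: e'_def less_Suc_eq)
 ultimately show False using max by blast
qed

text \<open>An invariant space of least dimension inside an eigenspace yields an irreducible representation.\<close>

lemma irreducible_in_eigenspace:
 assumes \<psi>: "cfun \<psi>" and l: "l > 0" and w: "cfun w" "x0 \<in> carrier G" "w x0 \<noteq> 0"
  and eig: "\<And>x. x \<in> carrier G ==> convolution w \<psi> x = of_real l * w x"
 obtains n e \<rho> where "orthonormal n e" "irreducible_representation G T n \<rho>"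
  "\<And>i x. i < n ==> x \<in> carrier G ==> convolution (e i) \<psi> x = of_real l * e i x"
  "\<And>g v x. g \<in> carrier G ==> v \<in> carrier_vec n ==> x \<in> carrier G ==>
    (\<Sum>i<n. (\<rho> g *\<^sub>v v) $ i * e i x) = (\<Sum>i<n. v $ i * e i (inv g \<otimes> x))"
proof -
 define E where "E = {u. cfun u \<and> (\<forall>x\<in>carrier G. convolution u \<psi> x = of_real l * u x)}"
 obtain N where N: "\<And>n e. orthonormal n e ==>
  (\<And>i x. i < n ==> x \<in> carrier G ==> convolution (e i) \<psi> x = of_real l * e i x) ==> n \<le> N"
  using eigenspace_bounded[OF \<psi> l] by metis
 have E: "invariant_space E" unfolding invariant_space_def
 proof (intro conjI ballI allI)
  show "cfun u" if "u \<in> E" for u using that by (simp add: E_def)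
  show "(\<lambda>x. u x + v x) \<in> E" if "u \<in> E" "v \<in> E" for u v
  proof -
   have "convolution (\<lambda>x. u x + v x) \<psi> x = convolution u \<psi> x + convolution v \<psi> x" if "x \<in> carrier G" for x
    using convolution_diff[of u "\<lambda>x. - 1 * v x" \<psi> x] convolution_scale[of "-1" v \<psi> x] that \<open>u \<in> E\<close> \<open>v \<in> E\<close> \<psi>
    by (simp add: E_def continuous_map_minus)
   thus ?thesis using that by (simp add: E_def distrib_left continuous_map_add)
  qed
  show "(\<lambda>x. c * u x) \<in> E" if "u \<in> E" for c u
   using that cfun_scale by (simp add: E_def convolution_scale mult.left_commute)
  show "(\<lambda>x. u (inv g \<otimes> x)) \<in> E" if "g \<in> carrier G" "u \<in> E" for g u
   using that cfun_translate[of u "inv g"] convolution_left[of u \<psi> g] \<psi> by (simp add: E_def)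
  show "\<exists>u\<in>E. \<exists>x\<in>carrier G. u x \<noteq> 0" using w eig by (auto simp: E_def)
 qed
 \<comment> \<open>That \<open>fam W n\<close> holds and \<open>fam W (Suc n)\<close> fails
   expresses dimension \<open>n\<close> by orthonormal families alone, insensitive to values off the
   carrier.\<close>
 define fam where "fam W n \<longleftrightarrow> (\<exists>e. orthonormal n e \<and> (\<forall>i<n. e i \<in> W))" for W n
 have famN: "n \<le> N" if "fam W n" "W \<subseteq> E" for W n using that N unfolding fam_def E_def by blast
 have fammono: "fam W m" if "fam W n" "m \<le> n" for W m n
 proof -
  obtain e where "orthonormal n e" "\<forall>i<n. e i \<in> W"
   using \<open>fam W n\<close> unfolding fam_def by blast
  hence "orthonormal m e \<and> (\<forall>i<m. e i \<in> W)"
   using \<open>m \<le> n\<close> unfolding orthonormal_def by simp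
  thus ?thesis unfolding fam_def by (intro exI[of _ e])
 qed
 have fam0: "fam W 0" for W by (simp add: fam_def orthonormal_def)
 have exmax: "\<exists>n. fam W n \<and> \<not> fam W (Suc n)" if "W \<subseteq> E" for W
 proof (rule ccontr)
  assume "\<not> ?thesis"
  hence "fam W n" for n by (induction n) (use fam0 in auto)
  thus False using famN[of W "Suc N"] that by simp
 qed
 define Pn where "Pn n \<longleftrightarrow> (\<exists>W. invariant_space W \<and> W \<subseteq> E \<and> fam W n \<and> \<not> fam W (Suc n))" for n
 define n where "n = (LEAST n. Pn n)"
 have "\<exists>n. Pn n" using exmax[OF subset_refl] E unfolding Pn_def by blast
 hence "Pn n" unfolding n_def by (rule LeastI_ex)
 then obtain W where W: "invariant_space W" "W \<subseteq> E" "fam W n" "\<not> fam W (Suc n)"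
  unfolding Pn_def by blast
 then obtain e where e: "orthonormal n e" "\<And>i. i < n ==> e i \<in> W"
  unfolding fam_def by blast
 have span: "u x = (\<Sum>i<n. ip u (e' i) * e' i x)"
  if "orthonormal n e'" "\<And>i. i < n ==> e' i \<in> W" "u \<in> W" "x \<in> carrier G" for e' u x
  by (rule maximal_orthonormal_spans[OF W(1) that(1,2) _ that(3,4)]) (use W(4) in \<open>auto simp: fam_def\<close>)
 have ce: "cfun (e i)" if "i < n" for i using e(1) that by (simp add: orthonormal_def)
 have LW: "(\<lambda>x. e j (inv g \<otimes> x)) \<in> W" if "j < n" "g \<in> carrier G" for j g
  using W(1) e(2) that by (simp add: invariant_space_def)
 \<comment> \<open>Matrix entries of left translation in the basis \<open>e\<close>.\<close>
 define a where "a g i j = ip (\<lambda>x. e j (inv g \<otimes> x)) (e i)" for g i j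
 define \<rho> where "\<rho> g = mat n n (\<lambda>(i, j). a g i j)" for g
 have tr: "e j (inv g \<otimes> x) = (\<Sum>i<n. a g i j * e i x)" if "j < n" "g \<in> carrier G" "x \<in> carrier G" for j g x
  using span[OF e LW[OF that(1,2)] that(3)] by (simp add: a_def)
 have \<rho>v: "(\<rho> g *\<^sub>v v) $ i = (\<Sum>j<n. a g i j * v $ j)" if "i < n" "v \<in> carrier_vec n" for g v i
  using that by (auto simp: \<rho>_def mult_mat_vec_def scalar_prod_def lessThan_atLeast0 intro!: sum.cong)
 have U: "(\<Sum>i<n. (\<rho> g *\<^sub>v v) $ i * e i x) = (\<Sum>i<n. v $ i * e i (inv g \<otimes> x))"
  if g: "g \<in> carrier G" and v: "v \<in> carrier_vec n" and x: "x \<in> carrier G" for g v x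
 proof -
  have "(\<Sum>i<n. (\<rho> g *\<^sub>v v) $ i * e i x) = (\<Sum>i<n. \<Sum>j<n. v $ j * (a g i j * e i x))"
   using v by (intro sum.cong refl) (simp add: \<rho>v sum_distrib_right sum_distrib_left mult_ac)
  also have "... = (\<Sum>j<n. \<Sum>i<n. v $ j * (a g i j * e i x))" by (rule sum.swap)
  also have "... = (\<Sum>j<n. v $ j * e j (inv g \<otimes> x))"
   using g x by (intro sum.cong refl) (simp add: tr sum_distrib_left)
  finally show ?thesis .
 qed
 have "matrix_representation G T n \<rho>" unfolding matrix_representation_def
 proof (intro conjI ballI allI impI)
  show "\<rho> g \<in> carrier_mat n n" for g by (simp add: \<rho>_def)
  have "a \<one> i j = (if i = j then 1 else 0)" if "i < n" "j < n" for i j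
  proof -
   have "a \<one> i j = ip (e j) (e i)" unfolding a_def by (rule ip_cong) auto
   thus ?thesis using e(1) that by (auto simp: orthonormal_def)
  qed
  thus "\<rho> \<one> = 1\<^sub>m n" by (intro eq_matI) (auto simp: \<rho>_def)
  show "\<rho> (g \<otimes> h) = \<rho> g * \<rho> h" if g: "g \<in> carrier G" and h: "h \<in> carrier G" for g h
  proof (rule eq_matI)
   fix i j assume "i < dim_row (\<rho> g * \<rho> h)" "j < dim_col (\<rho> g * \<rho> h)"
   hence ij: "i < n" "j < n" by (auto simp: \<rho>_def)
   have "a (g \<otimes> h) i j = ip (\<lambda>x. \<Sum>k<n. (\<Sum>m<n. a g k m * a h m j) * e k x) (e i)"
    unfolding a_def[of "g \<otimes> h"]
   proof (rule ip_cong)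
    fix x assume x: "x \<in> carrier G"
    have "e j (inv (g \<otimes> h) \<otimes> x) = e j (inv h \<otimes> (inv g \<otimes> x))"
     using g h x by (simp add: inv_mult_group m_assoc)
    also have "... = (\<Sum>m<n. a h m j * (\<Sum>k<n. a g k m * e k x))"
     using g h x ij by (simp add: tr)
    also have "... = (\<Sum>m<n. \<Sum>k<n. a g k m * a h m j * e k x)"
     by (simp add: sum_distrib_left mult_ac)
    also have "... = (\<Sum>k<n. \<Sum>m<n. a g k m * a h m j * e k x)" by (rule sum.swap)
    also have "... = (\<Sum>k<n. (\<Sum>m<n. a g k m * a h m j) * e k x)"
     by (simp add: sum_distrib_right)
    finally show "e j (inv (g \<otimes> h) \<otimes> x) = (\<Sum>k<n. (\<Sum>m<n. a g k m * a h m j) * e k x)" .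
   qed simp
   also have "... = (\<Sum>m<n. a g i m * a h m j)" by (rule ip_orthonormal_sum[OF e(1) ij(1)])
   finally show "\<rho> (g \<otimes> h) $$ (i, j) = (\<rho> g * \<rho> h) $$ (i, j)"
    using ij by (simp add: \<rho>_def scalar_prod_def lessThan_atLeast0)
  qed (auto simp: \<rho>_def)
  show "cmap T (\<lambda>g. \<rho> g $$ (i, j))" if "i < n" "j < n" for i j
  proof -
   have "cmap (prod_topology T T) (\<lambda>(g, x). e j (inv g \<otimes> x) * cnj (e i x))"
    unfolding case_prod_unfold
    by (intro continuous_map_mult_algebra continuous_map_cnj continuous_map_apply[OF ce[OF that(1)]] continuous_map_apply[OF ce[OF that(2)]]
     continuous_map_mult continuous_map_inverse continuous_map_fst continuous_map_snd)
   from continuous_map_integral_parameter[OF compact_T sets_haar prob_space_haar this]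
   have "cmap T (\<lambda>g. a g i j)" by (simp add: a_def ip_def)
   thus ?thesis using that by (simp add: \<rho>_def)
  qed
 qed
 moreover have "n > 0"
 proof (rule ccontr)
  assume "\<not> n > 0"
  hence "u x = 0" if "u \<in> W" "x \<in> carrier G" for u x using span[OF e that] by simp
  thus False using invariant_spaceD(5)[OF W(1)] by blast
 qed
 moreover have "V = {0\<^sub>v n} \<or> V = carrier_vec n"
  if V: "V \<subseteq> carrier_vec n" "0\<^sub>v n \<in> V" "\<forall>u\<in>V. \<forall>v\<in>V. u + v \<in> V" "\<forall>c. \<forall>v\<in>V. c \<cdot>\<^sub>v v \<in> V"
   "\<forall>g\<in>carrier G. \<forall>v\<in>V. \<rho> g *\<^sub>v v \<in> V" for V
 proof (rule disjCI)
  assume "V \<noteq> carrier_vec n"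
  show "V = {0\<^sub>v n}"
  proof (rule ccontr)
   assume nz: "V \<noteq> {0\<^sub>v n}"
   \<comment> \<open>The functions whose coefficient vectors lie in the invariant subspace
     \<open>V\<close>. As an invariant subspace of the eigenspace it cannot have dimension below the
     least one, which is \<open>n\<close>.\<close>
   define W' where "W' = {u. cfun u \<and> (\<exists>v\<in>V. \<forall>x\<in>carrier G. u x = (\<Sum>i<n. v $ i * e i x))}"
   have inj: "v = v'" if "v \<in> carrier_vec n" "v' \<in> carrier_vec n"
    "\<forall>x\<in>carrier G. (\<Sum>i<n. v $ i * e i x) = (\<Sum>i<n. v' $ i * e i x)" for v v'
   proof (rule eq_vecI)
    fix i assume "i < dim_vec v'"
    hence i: "i < n" using that by simp
    have "ip (\<lambda>x. \<Sum>i<n. v $ i * e i x) (e i) = ip (\<lambda>x. \<Sum>i<n. v' $ i * e i x) (e i)"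
     using that(3) by (intro ip_cong) auto
    thus "v $ i = v' $ i" by (simp add: ip_orthonormal_sum[OF e(1) i])
   qed (use that in simp)
   have eigW: "W' \<subseteq> E"
   proof
    fix u assume "u \<in> W'"
    then obtain v where v: "cfun u" "v \<in> V" "\<forall>x\<in>carrier G. u x = (\<Sum>i<n. v $ i * e i x)"
     unfolding W'_def by blast
    have "(\<lambda>x. \<Sum>i<n. v $ i * e i x) \<in> W" using e(2) by (intro invariant_space_sum W) auto
    hence "(\<lambda>x. \<Sum>i<n. v $ i * e i x) \<in> E" using W(2) by blast
    thus "u \<in> E"
     using v convolution_cong[of u "\<lambda>x. \<Sum>i<n. v $ i * e i x" \<psi>] by (simp add: E_def)
   qed
   have W': "invariant_space W'" unfolding invariant_space_def
   proof (intro conjI ballI allI)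
    show "cfun u" if "u \<in> W'" for u using that by (simp add: W'_def)
    show "(\<lambda>x. u x + v x) \<in> W'" if uv: "u \<in> W'" "v \<in> W'" for u v
    proof -
     obtain a where a: "cfun u" "a \<in> V" "\<forall>x\<in>carrier G. u x = (\<Sum>i<n. a $ i * e i x)"
      using uv unfolding W'_def by blast
     obtain b where b: "cfun v" "b \<in> V" "\<forall>x\<in>carrier G. v x = (\<Sum>i<n. b $ i * e i x)"
      using uv unfolding W'_def by blast
     have "a + b \<in> V" "dim_vec b = n" using a b V(1,3) by auto
     moreover have "\<forall>x\<in>carrier G. u x + v x = (\<Sum>i<n. (a + b) $ i * e i x)"
      using a(3) b(3) \<open>dim_vec b = n\<close> by (simp add: distrib_right sum.distrib)
     ultimately show ?thesis using continuous_map_add[OF a(1) b(1)] unfolding W'_def by blast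
    qed
    show "(\<lambda>x. c * u x) \<in> W'" if u: "u \<in> W'" for c u
    proof -
     obtain a where a: "cfun u" "a \<in> V" "\<forall>x\<in>carrier G. u x = (\<Sum>i<n. a $ i * e i x)"
      using u unfolding W'_def by blast
     have "c \<cdot>\<^sub>v a \<in> V" "dim_vec a = n" using a V(1,4) by auto
     moreover have "\<forall>x\<in>carrier G. c * u x = (\<Sum>i<n. (c \<cdot>\<^sub>v a) $ i * e i x)"
      using a(3) \<open>dim_vec a = n\<close> by (simp add: sum_distrib_left mult_ac)
     ultimately show ?thesis using a(1) cfun_scale unfolding W'_def by blast
    qed
    show "(\<lambda>x. u (inv g \<otimes> x)) \<in> W'" if g: "g \<in> carrier G" and u: "u \<in> W'" for g u
    proof -
     obtain b where b: "cfun u" "b \<in> V" "\<forall>x\<in>carrier G. u x = (\<Sum>i<n. b $ i * e i x)"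
      using u unfolding W'_def by blast
     have "\<forall>x\<in>carrier G. u (inv g \<otimes> x) = (\<Sum>i<n. (\<rho> g *\<^sub>v b) $ i * e i x)"
      using b g V(1) U[OF g, of b] by (auto simp: subset_iff)
     moreover have "\<rho> g *\<^sub>v b \<in> V" using b g V(5) by blast
     moreover have "cfun (\<lambda>x. u (inv g \<otimes> x))" using b(1) g by (intro cfun_translate) auto
     ultimately show ?thesis unfolding W'_def by blast
    qed
    obtain v where v: "v \<in> V" "v \<noteq> 0\<^sub>v n" using nz V(2) by blast
    have "\<exists>x\<in>carrier G. (\<Sum>i<n. v $ i * e i x) \<noteq> 0"
    proof (rule ccontr)
     assume "\<not> ?thesis"
     hence "v = 0\<^sub>v n" using v V(1) by (intro inj) auto
     thus False using v(2) by simp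
    qed
    moreover have "(\<lambda>x. \<Sum>i<n. v $ i * e i x) \<in> W'"
     unfolding W'_def using cfun_orthonormal_sum[OF e(1)] v(1) by blast
    ultimately show "\<exists>u\<in>W'. \<exists>x\<in>carrier G. u x \<noteq> 0"
     by (intro bexI[of _ "\<lambda>x. \<Sum>i<n. v $ i * e i x"])
   qed
   obtain m where m: "fam W' m" "\<not> fam W' (Suc m)" using exmax[OF eigW] by blast
   hence "Pn m" unfolding Pn_def using W' eigW by blast
   hence "n \<le> m" unfolding n_def by (rule Least_le)
   hence "fam W' n" using m fammono by blast
   then obtain e' where e': "orthonormal n e'" "\<And>i. i < n ==> e' i \<in> W'"
    unfolding fam_def by blast
   \<comment> \<open>Elements of \<open>W'\<close> are arbitrary off the carrier and may fail to lie
     in \<open>W\<close>; they are replaced by the combinations of \<open>e\<close> with the same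
     values on the carrier.\<close>
   have "\<exists>f. orthonormal n f \<and> (\<forall>i<n. f i \<in> W \<and> (\<forall>x\<in>carrier G. f i x = e' i x))"
   proof -
    have "\<exists>v\<in>V. \<forall>x\<in>carrier G. e' i x = (\<Sum>k<n. v $ k * e k x)" if "i < n" for i
     using e'(2)[OF that] by (auto simp: W'_def)
    then obtain b where b: "\<And>i. i < n ==> b i \<in> V \<and> (\<forall>x\<in>carrier G. e' i x = (\<Sum>k<n. b i $ k * e k x))"
     by metis
    define f where "f i x = (\<Sum>k<n. b i $ k * e k x)" for i x
    have fe: "f i x = e' i x" if "i < n" "x \<in> carrier G" for i x using b that by (simp add: f_def)
    have "ip (f i) (f j) = ip (e' i) (e' j)" if "i < n" "j < n" for i j
     using fe that by (intro ip_cong) auto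
    hence "orthonormal n f"
     using e'(1) cfun_orthonormal_sum[OF e(1)] unfolding orthonormal_def f_def[abs_def] by auto
    moreover have "f i \<in> W" for i
     unfolding f_def[abs_def] using e(2) by (intro invariant_space_sum W) auto
    ultimately show ?thesis using fe by blast
   qed
   then obtain f where f: "orthonormal n f" "\<And>i. i < n ==> f i \<in> W" "\<And>i x. i < n ==> x \<in> carrier G ==> f i x = e' i x"
    by blast
   have "carrier_vec n \<subseteq> V"
   proof
    fix v :: "complex vec" assume v: "v \<in> carrier_vec n"
    define u where "u x = (\<Sum>i<n. v $ i * e i x)" for x
    have uW: "u \<in> W" unfolding u_def[abs_def] using e(2) by (intro invariant_space_sum W) auto
    have "u x = (\<Sum>i<n. ip u (f i) * e' i x)" if x: "x \<in> carrier G" for x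
     using span[OF f(1,2) uW x] f(3)[OF _ x] by simp
    moreover have "(\<lambda>x. \<Sum>i<n. ip u (f i) * e' i x) \<in> W'"
     using e'(2) by (intro invariant_space_sum W') auto
    ultimately have "\<exists>v'\<in>V. \<forall>x\<in>carrier G. u x = (\<Sum>i<n. v' $ i * e i x)"
     unfolding W'_def by auto
    then obtain v' where v': "v' \<in> V" "\<forall>x\<in>carrier G. (\<Sum>i<n. v $ i * e i x) = (\<Sum>i<n. v' $ i * e i x)"
     unfolding u_def by blast
    hence "v = v'" using V(1) v by (intro inj) auto
    thus "v \<in> V" using v'(1) by simp
   qed
   thus False using V(1) \<open>V \<noteq> carrier_vec n\<close> by blast
  qed
 qed
 ultimately have "irreducible_representation G T n \<rho>" unfolding irreducible_representation_def by blast
 moreover have "convolution (e i) \<psi> x = of_real l * e i x" if "i < n" "x \<in> carrier G" for i x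
  using e(2)[OF that(1)] W(2) that(2) by (auto simp: E_def)
 ultimately show ?thesis using that[OF e(1) _ _ U] by blast
qed

end

section \<open>Multiplicity-free coset spaces\<close>

context compact_group
begin

definition coset_convolution :: "('a => complex) => ('a set => complex) => 'a set => complex" where
 "coset_convolution u f x = (\<integral>y. u y * f (inv y <# x) \<partial>haar)"

definition lift :: "'a set => ('a set => complex) => 'a => complex" where
 "lift H f g = f (g <# H)"

lemma cfun_lift: "cmap (coset_space G T H) f ==> cfun (lift H f)"
 unfolding lift_def by (rule continuous_map_apply[OF _ continuous_map_coset])

lemma coset_convolution_coset:
 assumes "subgroup H G" "g \<in> carrier G"
 shows "coset_convolution u f (g <# H) = convolution u (lift H f) g"
 unfolding coset_convolution_def convolution_def lift_def
 by (rule haar_integral_cong) (use assms in \<open>simp add: coset_action\<close>)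

lemma continuous_coset_convolution:
 assumes H: "subgroup H G" and u: "cfun u" and f: "cmap (coset_space G T H) f"
 shows "cmap (coset_space G T H) (coset_convolution u f)"
proof (rule continuous_compose_quotient_map[OF quotient_map_coset[OF H]])
 have "cfun (convolution u (lift H f))" by (intro cfun_convolution u cfun_lift f)
 thus "cmap T (coset_convolution u f \<circ> (\<lambda>g. g <# H))"
  by (rule continuous_map_eq) (simp add: topspace_eq coset_convolution_coset[OF H])
qed

text \<open>Any linear operator \<open>D\<close> commuting with left translations, followed by
  convolution with a function on the coset space, intertwines. It is applied with \<open>D\<close>
  the identity and with \<open>D\<close> convolution by \<open>k\<close>.\<close>

lemma intertwiner_convolution:
 assumes H: "subgroup H G" and f: "cmap (coset_space G T H) f"
  and k: "cfun k" and e: "orthonormal n e"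
  and equi: "\<And>g v x. g \<in> carrier G ==> v \<in> carrier_vec n ==> x \<in> carrier G ==>
    (\<Sum>i<n. (\<rho> g *\<^sub>v v) $ i * e i x) = (\<Sum>i<n. v $ i * e i (inv g \<otimes> x))"
  and D: "\<And>u. cfun u ==> cfun (D u)"
  "\<And>u v x. cfun u ==> cfun v ==> x \<in> carrier G ==> D (\<lambda>x. u x + v x) x = D u x + D v x"
  "\<And>c u x. cfun u ==> x \<in> carrier G ==> D (\<lambda>x. c * u x) x = c * D u x"
  "\<And>g u x. cfun u ==> g \<in> carrier G ==> x \<in> carrier G ==> D (\<lambda>x. u (inv g \<otimes> x)) x = D u (inv g \<otimes> x)"
  "\<And>u v x. (\<And>x. x \<in> carrier G ==> u x = v x) ==> x \<in> carrier G ==> D u x = D v x"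
 shows "(\<lambda>v. \<lambda>x\<in>topspace (coset_space G T H). coset_convolution (D (\<lambda>x. \<Sum>i<n. v $ i * e i x)) f x)
   \<in> intertwiners G (coset_space G T H) n \<rho>"
proof -
 define U :: "complex vec => 'a => complex" where "U v x = (\<Sum>i<n. v $ i * e i x)" for v x
 have cU: "cfun (U v)" for v unfolding U_def[abs_def] by (rule cfun_orthonormal_sum[OF e])
 have cl: "cfun (lift H f)" by (rule cfun_lift[OF f])
 let ?X = "coset_space G T H"
 let ?S = "\<lambda>v. \<lambda>x\<in>topspace ?X. coset_convolution (D (U v)) f x"
 have val: "coset_convolution u f (g <# H) = convolution u (lift H f) g" if "g \<in> carrier G" for u g
  by (rule coset_convolution_coset[OF H that])
 have "?S \<in> intertwiners G ?X n \<rho>" unfolding intertwiners_def mem_Collect_eq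
 proof (intro conjI ballI allI)
  show "?S v \<in> carrier (cfun_ring ?X)" for v
   using continuous_coset_convolution[OF H D(1)[OF cU] f] unfolding cfun_ring_def
   by (auto intro: continuous_map_eq)
  show "?S (v + w) = ?S v \<oplus>\<^bsub>cfun_ring ?X\<^esub> ?S w" if vw: "v \<in> carrier_vec n" "w \<in> carrier_vec n" for v w
  proof -
   have "U (v + w) x = U v x + U w x" for x using vw by (simp add: U_def distrib_right sum.distrib)
   hence DU: "D (U (v + w)) x = D (U v) x + D (U w) x" if "x \<in> carrier G" for x
    using D(2)[OF cU cU that] D(5)[of "U (v + w)" "\<lambda>x. U v x + U w x" x] that by simp
   have "convolution (D (U (v + w))) (lift H f) g = convolution (D (U v)) (lift H f) g + convolution (D (U w)) (lift H f) g"
    if g: "g \<in> carrier G" for g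
   proof -
    have "convolution (D (U (v + w))) (lift H f) g = convolution (\<lambda>x. D (U v) x + D (U w) x) (lift H f) g"
     by (rule convolution_cong) (rule DU)
    also have "... = convolution (D (U v)) (lift H f) g + convolution (D (U w)) (lift H f) g"
     unfolding convolution_def using cfun_kernel_section[OF D(1)[OF cU] cl g]
     by (simp add: distrib_right haar_integrable)
    finally show ?thesis .
   qed
   thus ?thesis by (auto simp: cfun_ring_def fun_eq_iff topspace_cosets val)
  qed
  show "?S (c \<cdot>\<^sub>v v) = cfun_scale ?X c (?S v)" if v: "v \<in> carrier_vec n" for c v
  proof -
   have "U (c \<cdot>\<^sub>v v) x = c * U v x" for x using v by (simp add: U_def sum_distrib_left mult_ac)
   hence "D (U (c \<cdot>\<^sub>v v)) x = c * D (U v) x" if "x \<in> carrier G" for x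
    using D(3)[OF cU that] D(5)[of "U (c \<cdot>\<^sub>v v)" "\<lambda>x. c * U v x" x] that by simp
   hence "convolution (D (U (c \<cdot>\<^sub>v v))) (lift H f) g = c * convolution (D (U v)) (lift H f) g" for g
    using convolution_cong[of "D (U (c \<cdot>\<^sub>v v))" "\<lambda>x. c * D (U v) x" "lift H f" g] by (simp add: convolution_scale)
   thus ?thesis by (auto simp: cfun_scale_def fun_eq_iff topspace_cosets val)
  qed
  show "?S (\<rho> g *\<^sub>v v) = translate G ?X g (?S v)" if g: "g \<in> carrier G" and v: "v \<in> carrier_vec n" for g v
  proof -
   have "D (U (\<rho> g *\<^sub>v v)) x = D (U v) (inv g \<otimes> x)" if x: "x \<in> carrier G" for x
   proof -
    have "D (U (\<rho> g *\<^sub>v v)) x = D (\<lambda>x. U v (inv g \<otimes> x)) x"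
     using equi[OF g v] x by (intro D(5)) (auto simp: U_def)
    thus ?thesis using D(4)[OF cU g x] by simp
   qed
   hence "convolution (D (U (\<rho> g *\<^sub>v v))) (lift H f) a = convolution (D (U v)) (lift H f) (inv g \<otimes> a)"
    if a: "a \<in> carrier G" for a using convolution_left[OF D(1)[OF cU] cl g a, of v]
     convolution_cong[of "D (U (\<rho> g *\<^sub>v v))" "\<lambda>x. D (U v) (inv g \<otimes> x)" "lift H f" a] by simp
   hence "coset_convolution (D (U (\<rho> g *\<^sub>v v))) f x = coset_convolution (D (U v)) f (inv g <# x)"
    if "x \<in> topspace ?X" for x using that g by (auto simp: topspace_cosets val coset_action[OF H])
   thus ?thesis using coset_action_closed[OF H, of "inv g"] g by (auto simp: translate_def fun_eq_iff)
  qed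
 qed
 thus ?thesis by (simp add: U_def[abs_def])
qed

text \<open>Commutativity enters only here: both operators below are intertwiners on the same irreducible
 space, so their images contain a common nonzero function.\<close>

theorem commutative_common_function:
 assumes H: "subgroup H G" and comm: "commutative_homogeneous_space G T H"
  and f: "cmap (coset_space G T H) f"
  and g: "cmap (coset_space G T H) g"
  and nz: "(\<integral>y. f (y <# H) * g (y <# H) \<partial>haar) \<noteq> 0"
 obtains u v where "cfun u" "cfun v"
  "\<And>x. x \<in> topspace (coset_space G T H) ==> coset_convolution u f x = coset_convolution v (\<lambda>x. cnj (g x)) x"
  "\<exists>x\<in>topspace (coset_space G T H). coset_convolution u f x \<noteq> 0"
proof -
 let ?X = "coset_space G T H"
 define g' where "g' x = cnj (g x)" for x
 have cg': "cmap ?X g'" unfolding g'_def by (intro continuous_map_cnj g)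
 define a where "a = lift H f"
 define b where "b = lift H g'"
 have ca: "cfun a" and cb: "cfun b" unfolding a_def b_def by (intro cfun_lift f cg')+
 \<comment> \<open>Chosen so that its value at the unit is the given integral, and so that
   convolution by it factors through \<open>a\<close> while its adjoint factors through
   \<open>b\<close>.\<close>
 define k where "k = convolution a (adj b)"
 have ck: "cfun k" unfolding k_def by (intro cfun_convolution ca cfun_adj cb)
 have "k \<one> = (\<integral>y. f (y <# H) * g (y <# H) \<partial>haar)"
  unfolding k_def convolution_def by (rule haar_integral_cong) (simp add: a_def b_def lift_def adj_def g'_def)
 hence k1: "k \<one> \<noteq> 0" using nz by simp
 \<comment> \<open>This value is the squared norm of \<open>k\<close> composed with the inverse;
   convolution by \<open>k\<close> is therefore a nonzero operator, as
   \<open>gram_eigenfunction\<close> requires.\<close>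
 have "convolution (adj k) k \<one> \<noteq> 0"
 proof -
  have "convolution (adj k) k \<one> = of_real (nsq (\<lambda>y. k (inv y)))"
   unfolding convolution_def nsq_def integral_complex_of_real[symmetric]
   by (rule haar_integral_cong) (simp add: adj_def complex_norm_square mult.commute del: of_real_power)
  moreover have "nsq (\<lambda>y. k (inv y)) \<noteq> 0"
   using nsq_eq_0[OF cfun_inv[OF ck], of \<one>] k1 by auto
  ultimately show ?thesis by simp
 qed
 then obtain l w where l: "l > (0::real)" and w: "cfun w" "\<exists>x\<in>carrier G. w x \<noteq> 0"
  "\<And>x. x \<in> carrier G ==> convolution w (convolution k (adj k)) x = of_real l * w x"
  using gram_eigenfunction[OF ck cfun_adj[OF ck] one_closed] by blast
 obtain x0 where x0: "x0 \<in> carrier G" "w x0 \<noteq> 0" using w(2) by blast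
 have cp: "cfun (convolution k (adj k))" by (intro cfun_convolution ck cfun_adj)
 show ?thesis
 proof (rule irreducible_in_eigenspace[OF cp l w(1) x0 w(3)])
 fix n e \<rho>
 assume e: "orthonormal n e" and irr: "irreducible_representation G T n \<rho>"
  and eig: "\<And>i x. i < n ==> x \<in> carrier G ==> convolution (e i) (convolution k (adj k)) x = of_real l * e i x"
  and equi: "\<And>g v x. g \<in> carrier G ==> v \<in> carrier_vec n ==> x \<in> carrier G ==>
    (\<Sum>i<n. (\<rho> g *\<^sub>v v) $ i * e i x) = (\<Sum>i<n. v $ i * e i (inv g \<otimes> x))"
 have n: "n > 0" using irr by (simp add: irreducible_representation_def)
 define D where "D u = convolution u k" for u
 define S1 where "S1 = (\<lambda>v. \<lambda>x\<in>topspace ?X. coset_convolution (\<lambda>x. \<Sum>i<n. v $ i * e i x) f x)"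
 define S2 where "S2 = (\<lambda>v. \<lambda>x\<in>topspace ?X. coset_convolution (D (\<lambda>x. \<Sum>i<n. v $ i * e i x)) g' x)"
 have S1: "S1 \<in> intertwiners G ?X n \<rho>"
  unfolding S1_def by (rule intertwiner_convolution[OF H f ck e equi, where D = "\<lambda>u. u"]) auto
 have S2: "S2 \<in> intertwiners G ?X n \<rho>" unfolding S2_def
 proof (rule intertwiner_convolution[OF H cg' ck e equi])
  show "D (\<lambda>x. u x + v x) x = D u x + D v x" if "cfun u" "cfun v" "x \<in> carrier G" for u v x
   unfolding D_def convolution_def using cfun_kernel_section[OF _ ck that(3)] that
   by (simp add: distrib_right haar_integrable)
  show "D u x = D v x" if "\<And>x. x \<in> carrier G ==> u x = v x" for u v x
   unfolding D_def using that by (rule convolution_cong)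
 qed (auto simp: D_def cfun_convolution ck convolution_scale convolution_left)
 obtain S where S: "\<forall>R\<in>intertwiners G ?X n \<rho>. \<exists>c. \<forall>v\<in>carrier_vec n. R v = cfun_scale ?X c (S v)"
  using comm[unfolded commutative_homogeneous_space_def, rule_format, OF irr] by (elim bexE)
 obtain c1 where c1': "\<forall>v\<in>carrier_vec n. S1 v = cfun_scale ?X c1 (S v)"
  using bspec[OF S S1] by (elim exE)
 obtain c2 where c2': "\<forall>v\<in>carrier_vec n. S2 v = cfun_scale ?X c2 (S v)"
  using bspec[OF S S2] by (elim exE)
 note c1 = c1'[rule_format] and c2 = c2'[rule_format]
 define v0 :: "complex vec" where "v0 = unit_vec n 0"
 have v0: "v0 \<in> carrier_vec n" by (simp add: v0_def)
 define u where "u = (\<lambda>x. \<Sum>i<n. v0 $ i * e i x)"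
 have cu: "cfun u" unfolding u_def by (rule cfun_orthonormal_sum[OF e])
 have ue: "u x = e 0 x" for x
 proof -
  have "u x = (\<Sum>i<n. if i = 0 then e i x else 0)"
   unfolding u_def v0_def using n by (intro sum.cong) auto
  thus ?thesis using n by simp
 qed
 have ue': "u = e 0" using ue by auto
 obtain z where z: "z \<in> carrier G" "u z \<noteq> 0"
 proof -
  have "nsq u = 1" using e n ip_self[of u] by (simp add: ue' orthonormal_def)
  moreover have "nsq u = nsq (\<lambda>_. 0)" if "\<forall>z\<in>carrier G. u z = 0"
   using that by (intro nsq_cong) auto
  ultimately show ?thesis using that by (force simp: nsq_def)
 qed
 \<comment> \<open>Applying \<open>k\<close> and then its adjoint multiplies \<open>u\<close> by
   \<open>l\<close>. Since \<open>D u\<close> factors through \<open>convolution u a\<close>, and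
   \<open>convolution (D u) (adj k)\<close> through \<open>convolution (D u) b\<close>, neither of
   these two can vanish.\<close>
 have R': "convolution (D u) (adj k) z \<noteq> 0"
  using convolution_assoc[OF cu ck cfun_adj[OF ck] z(1)] eig[OF n z(1)] z(2) l by (simp add: ue' D_def)
 have cD: "cfun (D u)" unfolding D_def by (intro cfun_convolution cu ck)
 have nz1: "\<exists>x\<in>carrier G. convolution u a x \<noteq> 0"
 proof (rule ccontr)
  assume no: "\<not> ?thesis"
  have "D u x = 0" if x: "x \<in> carrier G" for x
  proof -
   have "D u x = convolution (convolution u a) (adj b) x"
    unfolding D_def k_def using convolution_assoc[OF cu ca cfun_adj[OF cb] x] by simp
   also have "... = convolution (\<lambda>_. 0) (adj b) x" using no by (intro convolution_cong) auto
   finally show ?thesis by (simp add: convolution_def)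
  qed
  hence "convolution (D u) (adj k) z = convolution (\<lambda>_. 0) (adj k) z" by (rule convolution_cong)
  thus False using R' by (simp add: convolution_def)
 qed
 have nz2: "\<exists>x\<in>carrier G. convolution (D u) b x \<noteq> 0"
 proof (rule ccontr)
  assume no: "\<not> ?thesis"
  have "convolution (D u) (adj k) z = convolution (D u) (convolution b (adj a)) z"
   unfolding convolution_def[of "D u"]
  proof (rule haar_integral_cong)
   fix y assume y: "y \<in> carrier G"
   have "adj k (inv y \<otimes> z) = convolution (adj (adj b)) (adj a) (inv y \<otimes> z)"
    unfolding k_def using y z(1) by (intro adj_convolution ca cfun_adj cb) auto
   also have "... = convolution b (adj a) (inv y \<otimes> z)"
    by (rule convolution_cong) (rule adj_adj)
   finally show "D u y * adj k (inv y \<otimes> z) = D u y * convolution b (adj a) (inv y \<otimes> z)"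
    by simp
  qed
  also have "... = convolution (convolution (D u) b) (adj a) z"
   using convolution_assoc[OF cD cb cfun_adj[OF ca] z(1)] by simp
  also have "... = convolution (\<lambda>_. 0) (adj a) z" using no by (intro convolution_cong) auto
  finally show False using R' by (simp add: convolution_def)
 qed
 have X: "x <# H \<in> topspace ?X" if "x \<in> carrier G" for x using that by (auto simp: topspace_cosets)
 have s1: "coset_convolution u f x = c1 * S v0 x" and s2: "coset_convolution (D u) g' x = c2 * S v0 x"
  if "x \<in> topspace ?X" for x using fun_cong[OF c1[OF v0], of x] fun_cong[OF c2[OF v0], of x] that
  by (simp_all add: S1_def S2_def cfun_scale_def u_def)
 have "c1 \<noteq> 0"
 proof
  assume "c1 = 0"
  hence "convolution u a x = 0" if "x \<in> carrier G" for x
   using s1[OF X[OF that]] coset_convolution_coset[OF H that, of u f] by (simp add: a_def)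
  thus False using nz1 by blast
 qed
 have "c2 \<noteq> 0"
 proof
  assume "c2 = 0"
  hence "convolution (D u) b x = 0" if "x \<in> carrier G" for x
   using s2[OF X[OF that]] coset_convolution_coset[OF H that, of "D u" g'] by (simp add: b_def)
  thus False using nz2 by blast
 qed
 show thesis
 \<comment> \<open>At \<open>v0\<close> the two intertwiners take the values \<open>c1\<close> and
   \<open>c2\<close> times one function; rescaling the second makes them equal.\<close>
 proof (rule that[of u "\<lambda>x. c1 / c2 * D u x"])
  show "cfun u" "cfun (\<lambda>x. c1 / c2 * D u x)" by (intro cu cfun_scale cD)+
  show "coset_convolution u f x = coset_convolution (\<lambda>x. c1 / c2 * D u x) (\<lambda>x. cnj (g x)) x"
   if x: "x \<in> topspace ?X" for x
  proof -
   have "coset_convolution (\<lambda>x. c1 / c2 * D u x) (\<lambda>x. cnj (g x)) x = c1 / c2 * coset_convolution (D u) g' x"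
    unfolding coset_convolution_def g'_def integral_mult_right_zero[symmetric]
    by (rule haar_integral_cong) (simp add: mult.assoc)
   thus ?thesis using s1[OF x] s2[OF x] \<open>c2 \<noteq> 0\<close> by simp
  qed
  obtain x where x: "x \<in> carrier G" "convolution u a x \<noteq> 0" using nz1 by blast
  hence "coset_convolution u f (x <# H) \<noteq> 0"
   using coset_convolution_coset[OF H x(1), of u f] by (simp add: a_def)
  thus "\<exists>x\<in>topspace ?X. coset_convolution u f x \<noteq> 0" using X[OF x(1)] by blast
 qed
 qed
qed

end

section \<open>Bishop-Machado theorem\<close>

locale continuous_algebra =
 fixes X :: "'x topology" and B :: "('x => complex) set"
 assumes compact_X: "compact_space X"
  and continuous: "f \<in> B ==> cmap X f"
  and const: "(\<lambda>_. c) \<in> B"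
  and add: "f \<in> B ==> g \<in> B ==> (\<lambda>x. f x + g x) \<in> B"
  and mult: "f \<in> B ==> g \<in> B ==> (\<lambda>x. f x * g x) \<in> B"
begin

lemma scale: "f \<in> B ==> (\<lambda>x. c * f x) \<in> B" using mult[OF const] by blast

lemma diff: "f \<in> B ==> g \<in> B ==> (\<lambda>x. f x - g x) \<in> B"
 using add[of f "\<lambda>x. -1 * g x"] scale[of g "-1"] by simp

lemma power: "f \<in> B ==> (\<lambda>x. f x ^ n) \<in> B"
 by (induction n) (auto intro: const mult)

lemma sum: "finite S ==> (\<And>i. i \<in> S ==> f i \<in> B) ==> (\<lambda>x. \<Sum>i\<in>S. f i x) \<in> B"
 by (induction S rule: finite_induct) (auto intro: const add)

text \<open>Two uses of Bernoulli's inequality. The expression behaves like a step at 1/2, where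
  \<open>2 ^ n * t ^ n\<close> passes from small to large, so the values below 1/3 and above 2/3 are
  separated at a geometric rate.\<close>

lemma power_of_one_minus_bounds:
 fixes t :: real
 assumes "0 \<le> t" "t \<le> 1"
 shows "t \<le> 1/3 ==> 1 - (1 - t ^ n) ^ (2 ^ n) \<le> (2/3) ^ n"
  and "t \<ge> 2/3 ==> (1 - t ^ n) ^ (2 ^ n) \<le> (3/4) ^ n"
proof -
 have tn: "0 \<le> t ^ n" "t ^ n \<le> 1" using assms by (auto simp: power_le_one)
 show "1 - (1 - t ^ n) ^ (2 ^ n) \<le> (2/3) ^ n" if "t \<le> 1/3"
 proof -
  have "1 + real (2 ^ n) * (- (t ^ n)) \<le> (1 + - (t ^ n)) ^ (2 ^ n)"
   using tn by (intro Bernoulli_inequality) auto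
  hence "1 - (1 - t ^ n) ^ (2 ^ n) \<le> 2 ^ n * t ^ n" by simp
  also have "... = (2 * t) ^ n" by (simp add: power_mult_distrib)
  also have "... \<le> (2/3) ^ n" using that assms by (intro power_mono) auto
  finally show ?thesis .
 qed
 show "(1 - t ^ n) ^ (2 ^ n) \<le> (3/4) ^ n" if "t \<ge> 2/3"
 proof -
  have "1 + real (2 ^ n) * t ^ n \<le> (1 + t ^ n) ^ (2 ^ n)" using tn by (intro Bernoulli_inequality) auto
  moreover have "(4/3) ^ n \<le> (2 * t) ^ n" using that by (intro power_mono) auto
  ultimately have "(4/3) ^ n \<le> (1 + t ^ n) ^ (2 ^ n)" by (simp add: power_mult_distrib)
  hence "(1 - t ^ n) ^ (2 ^ n) * (4/3) ^ n \<le> (1 - t ^ n) ^ (2 ^ n) * (1 + t ^ n) ^ (2 ^ n)"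
   using tn by (intro mult_left_mono) auto
  also have "... = ((1 - t ^ n) * (1 + t ^ n)) ^ (2 ^ n)" by (rule power_mult_distrib[symmetric])
  also have "... \<le> 1"
  proof (rule power_le_one)
   have "(1 - t ^ n) * (1 + t ^ n) = 1 - t ^ n * t ^ n" by (simp add: algebra_simps)
   thus "(1 - t ^ n) * (1 + t ^ n) \<le> 1" using tn by simp
   show "0 \<le> (1 - t ^ n) * (1 + t ^ n)" using tn by simp
  qed
  finally have "(1 - t ^ n) ^ (2 ^ n) * (4/3) ^ n \<le> 1" .
  hence "(1 - t ^ n) ^ (2 ^ n) * (4/3) ^ n * (3/4) ^ n \<le> 1 * (3/4) ^ n" by (rule mult_right_mono) simp
  moreover have "(4/3) ^ n * (3/4) ^ n = (1::real)" by (simp add: power_mult_distrib[symmetric])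
  ultimately show ?thesis by (simp add: mult.assoc)
 qed
qed

text \<open>Gluing inside the algebra: a polynomial in \<open>h\<close> is nearly 1 where
  \<open>r \<le> 1/3\<close> and nearly 0 where \<open>r \<ge> 2/3\<close>. Used as a convex weight,
  it selects the approximation that is valid; in the middle third both are.\<close>

lemma near_on_split:
 assumes f: "cmap X f" and E: "closedin X E"
  and h: "h \<in> B" and hE: "\<And>x. x \<in> E ==> h x = of_real (r x) \<and> 0 \<le> r x \<and> r x \<le> (1::real)"
  and a1: "a1 \<in> B" "\<And>x. x \<in> E ==> r x \<le> 2/3 ==> norm (f x - a1 x) < d"
  and a2: "a2 \<in> B" "\<And>x. x \<in> E ==> 1/3 \<le> r x ==> norm (f x - a2 x) < d"
 shows "\<exists>a\<in>B. \<forall>x\<in>E. norm (f x - a x) < d"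
proof -
 have cont: "rcmap X (\<lambda>x. norm (f x - a x))" if "a \<in> B" for a
  by (intro continuous_map_norm continuous_map_diff f continuous[OF that])
 have Rh: "rcmap X (\<lambda>x. Re (h x))"
  using continuous_map_compose[OF continuous[OF h], of euclideanreal Re]
  by (simp add: o_def continuous_map_iff_continuous2 continuous_on_Re)
 \<comment> \<open>On a closed set the strict bound is attained below \<open>d\<close>, which leaves
   room for the error of the weights.\<close>
 have max: "\<exists>d'<d. \<forall>x\<in>S. norm (f x - a x) \<le> d'"
  if S: "closedin X S" and a: "a \<in> B" and le: "\<And>x. x \<in> S ==> norm (f x - a x) < d" for S a
 proof (cases "S = {}")
  case False
  have "compactin X S" using S compact_X closedin_compact_space by blast
  hence "compact ((\<lambda>x. norm (f x - a x)) ` S)" using image_compactin[OF _ cont[OF a], of S] by simp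
  then obtain x where "x \<in> S" "\<forall>y\<in>S. norm (f y - a y) \<le> norm (f x - a x)"
   using compact_attains_sup[of "(\<lambda>x. norm (f x - a x)) ` S"] False by auto
  thus ?thesis using le by blast
 qed (auto intro: exI[of _ "d - 1"])
 have S1: "closedin X {x \<in> E. r x \<le> 2/3}"
 proof -
  have "closedin X {x \<in> topspace X. Re (h x) \<in> {..2/3}}"
   by (intro closedin_continuous_map_preimage[OF Rh]) auto
  moreover have "{x \<in> E. r x \<le> 2/3} = E \<inter> {x \<in> topspace X. Re (h x) \<in> {..2/3}}"
   using hE closedin_subset[OF E] by auto
  ultimately show ?thesis using E by (simp add: closedin_Int)
 qed
 have S2: "closedin X {x \<in> E. 1/3 \<le> r x}"
 proof -
  have "closedin X {x \<in> topspace X. Re (h x) \<in> {1/3..}}"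
   by (intro closedin_continuous_map_preimage[OF Rh]) auto
  moreover have "{x \<in> E. 1/3 \<le> r x} = E \<inter> {x \<in> topspace X. Re (h x) \<in> {1/3..}}"
   using hE closedin_subset[OF E] by auto
  ultimately show ?thesis using E by (simp add: closedin_Int)
 qed
 obtain d1 where d1: "d1 < d" "\<And>x. x \<in> E ==> r x \<le> 2/3 ==> norm (f x - a1 x) \<le> d1"
  using max[OF S1 a1(1)] a1(2) by auto
 obtain d2 where d2: "d2 < d" "\<And>x. x \<in> E ==> 1/3 \<le> r x ==> norm (f x - a2 x) \<le> d2"
  using max[OF S2 a2(1)] a2(2) by auto
 obtain C1 where C1: "C1 > 0" "\<And>x. x \<in> topspace X ==> norm (norm (f x - a1 x)) \<le> C1"
  using continuous_map_compact_bounded[OF compact_X cont[OF a1(1)]] by metis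
 obtain C2 where C2: "C2 > 0" "\<And>x. x \<in> topspace X ==> norm (norm (f x - a2 x)) \<le> C2"
  using continuous_map_compact_bounded[OF compact_X cont[OF a2(1)]] by metis
 have "(\<lambda>n. (2/3) ^ n * C2) \<longlonglongrightarrow> 0" "(\<lambda>n. (3/4) ^ n * C1) \<longlonglongrightarrow> 0"
  by (intro tendsto_mult_left_zero LIMSEQ_realpow_zero; simp)+
 hence "eventually (\<lambda>n. (2/3) ^ n * C2 < d - d1 \<and> (3/4) ^ n * C1 < d - d2) sequentially"
  using d1(1) d2(1) by (intro eventually_conj order_tendstoD) auto
 from eventually_happens'[OF sequentially_bot this]
 obtain n where n: "(2/3) ^ n * C2 < d - d1" "(3/4) ^ n * C1 < d - d2" by blast
 define k where "k x = (1 - h x ^ n) ^ (2 ^ n)" for x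
 define a where "a x = k x * a1 x + (1 - k x) * a2 x" for x
 have "k \<in> B" unfolding k_def by (intro power diff const h)
 hence "a \<in> B" unfolding a_def by (intro add mult diff const a1 a2)
 moreover have "norm (f x - a x) < d" if x: "x \<in> E" for x
 proof -
  have xX: "x \<in> topspace X" using x E closedin_subset by blast
  define \<kappa> where "\<kappa> = (1 - r x ^ n) ^ (2 ^ n)"
  have r: "0 \<le> r x" "r x \<le> 1" "h x = of_real (r x)" using hE[OF x] by auto
  hence \<kappa>: "k x = of_real \<kappa>" "0 \<le> \<kappa>" "\<kappa> \<le> 1"
   by (auto simp: k_def \<kappa>_def power_le_one)
  have "f x - a x = of_real \<kappa> * (f x - a1 x) + of_real (1 - \<kappa>) * (f x - a2 x)"
   by (simp add: a_def \<kappa> algebra_simps)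
  also have "norm ... \<le> \<kappa> * norm (f x - a1 x) + (1 - \<kappa>) * norm (f x - a2 x)"
   using \<kappa> by (intro norm_triangle_le add_mono) (simp_all add: norm_mult del: of_real_diff)
  finally have le: "norm (f x - a x) \<le> \<kappa> * norm (f x - a1 x) + (1 - \<kappa>) * norm (f x - a2 x)" .
  have C: "norm (f x - a1 x) \<le> C1" "norm (f x - a2 x) \<le> C2" using C1(2)[OF xX] C2(2)[OF xX] by auto
  consider "r x \<le> 1/3" | "1/3 \<le> r x" "r x \<le> 2/3" | "2/3 \<le> r x" by linarith
  thus ?thesis
  proof cases
   case 1
   have "1 - \<kappa> \<le> (2/3) ^ n"
    unfolding \<kappa>_def using power_of_one_minus_bounds(1)[OF r(1,2) 1] .
   hence "(1 - \<kappa>) * norm (f x - a2 x) \<le> (2/3) ^ n * C2"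
    using C \<kappa> by (intro mult_mono) auto
   moreover have "\<kappa> * norm (f x - a1 x) \<le> norm (f x - a1 x)"
    using \<kappa> by (simp add: mult_left_le_one_le)
   ultimately show ?thesis using le n(1) d1(2)[OF x] 1 by linarith
  next
   case 2
   have "\<kappa> * norm (f x - a1 x) \<le> \<kappa> * max d1 d2" "(1 - \<kappa>) * norm (f x - a2 x) \<le> (1 - \<kappa>) * max d1 d2"
    using \<kappa> d1(2)[OF x 2(2)] d2(2)[OF x 2(1)] by (intro mult_left_mono; simp)+
   hence "norm (f x - a x) \<le> max d1 d2" using le by (simp add: algebra_simps)
   thus ?thesis using d1(1) d2(1) by simp
  next
   case 3
   have "\<kappa> \<le> (3/4) ^ n" unfolding \<kappa>_def using power_of_one_minus_bounds(2)[OF r(1,2) 3] .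
   hence "\<kappa> * norm (f x - a1 x) \<le> (3/4) ^ n * C1" using C \<kappa> by (intro mult_mono) auto
   moreover have "(1 - \<kappa>) * norm (f x - a2 x) \<le> norm (f x - a2 x)"
    using \<kappa> by (simp add: mult_left_le_one_le)
   ultimately show ?thesis using le n(2) d2(2)[OF x] 3 by linarith
  qed
 qed
 ultimately show ?thesis by blast
qed

text \<open>A minimal closed set on which approximation fails must be antisymmetric: a nonconstant
  real function would split it into two overlapping proper closed subsets, approximation succeeds on
  each, and \<open>near_on_split\<close> glues.\<close>

theorem Bishop_Machado:
 assumes f: "cmap X f"
  and anti: "\<And>E. closedin X E ==> antisymmetric_set B E ==> \<exists>a\<in>B. \<forall>x\<in>E. norm (f x - a x) < d"
 shows "\<exists>a\<in>B. \<forall>x\<in>topspace X. norm (f x - a x) < d"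
proof (rule ccontr)
 assume no: "\<not> ?thesis"
 \<comment> \<open>Minimal closed sets are found as maximal open complements.\<close>
 define \<A> where "\<A> = {U. openin X U \<and> \<not> (\<exists>a\<in>B. \<forall>x\<in>topspace X - U. norm (f x - a x) < d)}"
 have "{} \<in> \<A>" using no by (simp add: \<A>_def)
 hence "\<A> \<noteq> {}" by blast
 moreover have "\<Union>\<C> \<in> \<A>" if ne: "\<C> \<noteq> {}" and chain: "subset.chain \<A> \<C>" for \<C>
 proof -
  have \<C>: "U \<in> \<A>" if "U \<in> \<C>" for U using chain that by (auto simp: subset.chain_def)
  have op: "openin X (\<Union>\<C>)" using \<C> by (intro openin_Union) (auto simp: \<A>_def)
  have False if a: "a \<in> B" "\<forall>x\<in>topspace X - \<Union>\<C>. norm (f x - a x) < d" for a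
  proof -
   \<comment> \<open>If \<open>a\<close> were good off the union of the chain, then \<open>V\<close>
     and the chain would cover \<open>X\<close>; a finite subcover contains a largest chain member,
     off which \<open>a\<close> would already be good.\<close>
   define V where "V = {x \<in> topspace X. norm (f x - a x) \<in> {..<d}}"
   have "rcmap X (\<lambda>x. norm (f x - a x))"
    by (intro continuous_map_norm continuous_map_diff f continuous[OF a(1)])
   hence "openin X V" unfolding V_def by (rule openin_continuous_map_preimage) auto
   moreover have "topspace X \<subseteq> \<Union>(insert V \<C>)" using a(2) by (auto simp: V_def)
   moreover have "openin X U" if "U \<in> insert V \<C>" for U
    using that \<open>openin X V\<close> \<C> by (auto simp: \<A>_def)
   ultimately obtain \<F> where \<F>: "finite \<F>" "\<F> \<subseteq> insert V \<C>" "topspace X \<subseteq> \<Union>\<F>"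
    using compactinD[OF compact_X[unfolded compact_space_def], of "insert V \<C>"] by blast
   obtain U where U: "U \<in> \<C>" "topspace X \<subseteq> V \<union> U"
   proof (cases "\<F> - {V} = {}")
    case True
    thus ?thesis using that ne \<F>(3) by blast
   next
    case False
    have "subset.chain \<A> (\<F> - {V})" using chain \<F>(2) unfolding subset.chain_def by blast
    hence "\<Union>(\<F> - {V}) \<in> \<F> - {V}"
     using Union_in_chain[of "\<F> - {V}"] \<F>(1) False by blast
    thus ?thesis using that[of "\<Union>(\<F> - {V})"] \<F> by blast
   qed
   thus False using \<C>[OF U(1)] a(1) by (auto simp: \<A>_def V_def)
  qed
  thus ?thesis using op by (auto simp: \<A>_def)
 qed
 ultimately obtain U where U: "U \<in> \<A>" and max: "\<And>V. V \<in> \<A> ==> U \<subseteq> V ==> V = U"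
  using subset_Zorn_nonempty[of \<A>] by blast
 define E where "E = topspace X - U"
 have opU: "openin X U" using U by (simp add: \<A>_def)
 have E: "closedin X E" and noE: "\<not> (\<exists>a\<in>B. \<forall>x\<in>E. norm (f x - a x) < d)"
  using U by (auto simp: \<A>_def E_def)
 have good: "\<exists>a\<in>B. \<forall>x\<in>E'. norm (f x - a x) < d" if E': "closedin X E'" "E' \<subseteq> E" "E' \<noteq> E" for E'
 proof (rule ccontr)
  assume "\<not> ?thesis"
  moreover have "topspace X - (topspace X - E') = E'" using E'(1) closedin_subset by blast
  ultimately have "topspace X - E' \<in> \<A>" using E' by (auto simp: \<A>_def)
  moreover have "U \<subseteq> topspace X - E'" using E' openin_subset[OF opU] by (auto simp: E_def)
  ultimately have "topspace X - E' = U" by (rule max)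
  thus False using E' closedin_subset[OF E'(1)] by (auto simp: E_def)
 qed
 have "\<not> antisymmetric_set B E" using anti[OF E] noE by blast
 then obtain g where g: "g \<in> B" "g ` E \<subseteq> \<real>" "\<not> g constant_on E"
  unfolding antisymmetric_set_def by blast
 have gE: "g x = of_real (Re (g x))" if "x \<in> E" for x using g(2) that by (simp add: image_subset_iff)
 have "compactin X E" using E compact_X closedin_compact_space by blast
 moreover have cRe: "rcmap X (\<lambda>x. Re (g x))"
  using continuous_map_compose[OF continuous[OF g(1)], of euclideanreal Re]
  by (simp add: o_def continuous_map_iff_continuous2 continuous_on_Re)
 ultimately have comp: "compact ((\<lambda>x. Re (g x)) ` E)" using image_compactin by fastforce
 have neE: "E \<noteq> {}" using noE const by blast
 obtain x0 where x0: "x0 \<in> E" "\<And>x. x \<in> E ==> Re (g x0) \<le> Re (g x)"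
  using compact_attains_inf[OF comp] neE by auto
 obtain x1 where x1: "x1 \<in> E" "\<And>x. x \<in> E ==> Re (g x) \<le> Re (g x1)"
  using compact_attains_sup[OF comp] neE by auto
 have lt: "Re (g x0) < Re (g x1)"
 proof (rule ccontr)
  assume "\<not> ?thesis"
  hence "g x = g x0" if "x \<in> E" for x using x0 x1 that gE by (metis order_antisym not_less order_trans)
  thus False using g(3) unfolding constant_on_def by blast
 qed
 \<comment> \<open>The normalisation makes \<open>r\<close> attain 0 and 1 on \<open>E\<close>, so
   each of the two overlapping pieces misses a point and is proper.\<close>
 define D where "D = Re (g x1) - Re (g x0)"
 define r where "r x = (Re (g x) - Re (g x0)) / D" for x
 define h where "h x = (1 / of_real D) * (g x - of_real (Re (g x0)))" for x
 have D: "D > 0" using lt by (simp add: D_def)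
 have h: "h \<in> B" unfolding h_def by (intro scale diff const g)
 have hr: "h x = of_real (r x) \<and> 0 \<le> r x \<and> r x \<le> 1" if "x \<in> E" for x
  using x0(2)[OF that] x1(2)[OF that] D gE[OF that] by (auto simp: h_def r_def D_def)
 have cr: "rcmap X r"
  unfolding r_def by (intro continuous_map_real_divide continuous_map_diff cRe) (use D in auto)
 have r01: "r x0 = 0" "r x1 = 1" using D by (auto simp: r_def D_def)
 have S1: "closedin X (E \<inter> {x \<in> topspace X. r x \<in> {..2/3}})"
  and S2: "closedin X (E \<inter> {x \<in> topspace X. r x \<in> {1/3..}})"
  by (intro closedin_Int E closedin_continuous_map_preimage[OF cr]; simp)+
 have "x1 \<notin> E \<inter> {x \<in> topspace X. r x \<in> {..2/3}}" "x0 \<notin> E \<inter> {x \<in> topspace X. r x \<in> {1/3..}}"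
  using r01 by auto
 hence ne: "E \<inter> {x \<in> topspace X. r x \<in> {..2/3}} \<noteq> E" "E \<inter> {x \<in> topspace X. r x \<in> {1/3..}} \<noteq> E"
  using x0(1) x1(1) by auto
 obtain a1 where a1: "a1 \<in> B" "\<forall>x\<in>E \<inter> {x \<in> topspace X. r x \<in> {..2/3}}. norm (f x - a1 x) < d"
  using good[OF S1 Int_lower1 ne(1)] by blast
 obtain a2 where a2: "a2 \<in> B" "\<forall>x\<in>E \<inter> {x \<in> topspace X. r x \<in> {1/3..}}. norm (f x - a2 x) < d"
  using good[OF S2 Int_lower1 ne(2)] by blast
 have "\<exists>a\<in>B. \<forall>x\<in>E. norm (f x - a x) < d"
  by (rule near_on_split[OF f E h hr a1(1) _ a2(1)]) (use a1(2) a2(2) closedin_subset[OF E] in auto)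
 thus False using noE by blast
qed

end

section \<open>Local sections of compact Lie groups\<close>

text \<open>\<open>Euclidean_space\<close> sits in an infinite product, where a basic open set
  restricts only finitely many coordinates; the coordinates from \<open>N\<close> on vanish for all
  points. The entry 1 in the minimum covers the case without restrictions.\<close>

lemma Euclidean_space_box:
 assumes D: "openin (Euclidean_space N) D" and z: "z \<in> D"
 obtains e where "e > 0" "\<And>w. w \<in> topspace (Euclidean_space N) ==> (\<And>i. i < N ==> \<bar>w i - z i\<bar> < e) ==> w \<in> D"
proof -
 obtain D' where D': "openin (powertop_real UNIV) D'" "D = D' \<inter> {x. \<forall>i\<ge>N. x i = 0}"
  using D unfolding Euclidean_space_def openin_subtopology by blast
 have "\<exists>U. finite {i \<in> UNIV. U i \<noteq> topspace euclideanreal} \<and> (\<forall>i\<in>UNIV. openin euclideanreal (U i)) \<and>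
   z \<in> Pi\<^sub>E UNIV U \<and> Pi\<^sub>E UNIV U \<subseteq> D'"
  using openin_product_topology_alt[of "\<lambda>_. euclideanreal" UNIV D'] D' z by blast
 then obtain U :: "nat => real set" where U: "finite {i. U i \<noteq> UNIV}" "\<And>i. open (U i)" "z \<in> Pi\<^sub>E UNIV U" "Pi\<^sub>E UNIV U \<subseteq> D'"
  by (auto simp flip: open_openin)
 have "\<exists>e>0. ball (z i) e \<subseteq> U i" for i
  using U(2,3) open_contains_ball by (metis PiE_mem UNIV_I)
 then obtain \<epsilon> where \<epsilon>: "\<And>i. \<epsilon> i > 0 \<and> ball (z i) (\<epsilon> i) \<subseteq> U i"
  by metis
 define e where "e = Min (insert 1 (\<epsilon> ` {i. U i \<noteq> UNIV}))"
 have e: "e > 0" "\<And>i. U i \<noteq> UNIV ==> e \<le> \<epsilon> i"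
  unfolding e_def using U(1) \<epsilon> by (auto simp: Min_gr_iff)
 have z0: "z i = 0" if "i \<ge> N" for i using z D'(2) that by auto
 have "w \<in> D" if w: "w \<in> topspace (Euclidean_space N)" "\<And>i. i < N ==> \<bar>w i - z i\<bar> < e" for w
 proof -
  have w0: "w i = 0" if "i \<ge> N" for i using w(1) that by (simp add: topspace_Euclidean_space)
  have "w i \<in> U i" for i
  proof (cases "U i = UNIV")
   case False
   have "\<bar>w i - z i\<bar> < e" using w(2)[of i] z0[of i] w0[of i] e(1) by (cases "i < N") auto
   hence "w i \<in> ball (z i) (\<epsilon> i)"
    using e(2)[OF False] by (simp add: dist_real_def abs_minus_commute)
   thus ?thesis using \<epsilon> by blast
  qed simp
  hence "w \<in> D'" using U(4) by auto
  thus ?thesis using D'(2) w0 by simp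
 qed
 thus ?thesis using that e(1) by blast
qed

text \<open>The mean value inequality in \<open>t\<close> for the derivative \<open>g\<close>, then
  in \<open>s\<close> for the difference of \<open>f\<close> at the two values of
  \<open>t\<close>.\<close>

lemma second_difference_bound:
 fixes f :: "real => real => real"
 assumes "convex S" "convex T"
  and f: "\<And>s t. s \<in> S ==> t \<in> T ==> ((\<lambda>s. f s t) has_field_derivative g s t) (at s)"
  and g: "\<And>s t. s \<in> S ==> t \<in> T ==> ((\<lambda>t. g s t) has_field_derivative h s t) (at t)"
  and h: "\<And>s t. s \<in> S ==> t \<in> T ==> \<bar>h s t\<bar> \<le> B"
  and "s \<in> S" "s' \<in> S" "t \<in> T" "t' \<in> T"
 shows "\<bar>f s' t' - f s t' - f s' t + f s t\<bar> \<le> B * \<bar>s' - s\<bar> * \<bar>t' - t\<bar>"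
proof -
 have gb: "norm (g x t' - g x t) \<le> B * norm (t' - t)" if "x \<in> S" for x
  by (rule field_differentiable_bound[OF \<open>convex T\<close>, of "g x" "h x"])
   (use g h that assms(8,9) in \<open>auto intro: has_field_derivative_at_within\<close>)
 have "norm ((f s' t' - f s' t) - (f s t' - f s t)) \<le> (B * norm (t' - t)) * norm (s' - s)"
 proof (rule field_differentiable_bound[OF \<open>convex S\<close>, of "\<lambda>s. f s t' - f s t" "\<lambda>s. g s t' - g s t"])
  show "((\<lambda>s. f s t' - f s t) has_field_derivative g x t' - g x t) (at x within S)" if "x \<in> S" for x
   by (rule has_field_derivative_at_within[OF DERIV_diff[OF f[OF that assms(9)] f[OF that assms(8)]]])
 qed (use gb assms in auto)
 thus ?thesis by (simp add: algebra_simps)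
qed

lemma double_telescope:
 fixes P :: "nat => nat => real"
 shows "(\<Sum>i<n. \<Sum>l<m. P (Suc i) (Suc l) - P i (Suc l) - P (Suc i) l + P i l) = P n m - P 0 m - P n 0 + P 0 0"
proof -
 have "(\<Sum>l<m. P (Suc i) (Suc l) - P i (Suc l) - P (Suc i) l + P i l) = (P (Suc i) m - P i m) - (P (Suc i) 0 - P i 0)" for i
  by (induction m) auto
 hence "(\<Sum>i<n. \<Sum>l<m. P (Suc i) (Suc l) - P i (Suc l) - P (Suc i) l + P i l) =
   (\<Sum>i<n. (P (Suc i) m - P i m) - (P (Suc i) 0 - P i 0))" by simp
 also have "... = P n m - P 0 m - P n 0 + P 0 0" by (induction n) auto
 finally show ?thesis .
qed

definition join_coords :: "nat => (nat => real) => (nat => real) => nat => real" where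
 "join_coords n x y = (\<lambda>i. if i < n then x i else if i < n + n then y (i - n) else 0)"

lemma join_coords_topspace: "join_coords n x y \<in> topspace (Euclidean_space (n + n))"
 by (simp add: join_coords_def topspace_Euclidean_space)

lemma fst_coords_join: "x \<in> topspace (Euclidean_space n) ==> fst_coords n (join_coords n x y) = x"
 by (auto simp: fst_coords_def join_coords_def topspace_Euclidean_space fun_eq_iff)

lemma snd_coords_join: "y \<in> topspace (Euclidean_space n) ==> snd_coords n (join_coords n x y) = y"
 by (auto simp: snd_coords_def join_coords_def topspace_Euclidean_space fun_eq_iff)

text \<open>A mixed difference telescopes over a grid in which one coordinate of each block changes
  at a time; every cell is bounded through one second derivative, mixed between the blocks. For the
  multiplication of a group this is the only differential information used.\<close>

lemma cont_diff_mixed_bound: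
 assumes cd: "cont_diff (n + n) 2 D f"
  and D: "openin (Euclidean_space (n + n)) D" and p: "join_coords n p p \<in> D"
 obtains e K where "e > 0" "K \<ge> 0"
  "\<And>x x' y y'. (\<And>i. i < n ==> \<bar>x i - p i\<bar> < e \<and> \<bar>x' i - p i\<bar> < e \<and> \<bar>y i - p i\<bar> < e \<and> \<bar>y' i - p i\<bar> < e) ==>
   \<bar>f (join_coords n x' y') - f (join_coords n x y') - f (join_coords n x' y) + f (join_coords n x y)\<bar>
   \<le> K * (\<Sum>i<n. \<bar>x' i - x i\<bar>) * (\<Sum>l<n. \<bar>y' l - y l\<bar>)"
proof -
 define z where "z = join_coords n p p"
 define g where "g i w = deriv (\<lambda>t. f (w(i := t))) (w i)" for i w
 define h where "h i l w = deriv (\<lambda>t. g i (w(l := t))) (w l)" for i l w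
 have cd': "cont_diff (n + n) (Suc (Suc 0)) D f" using cd by (simp add: numeral_2_eq_2)
 have f': "((\<lambda>t. f (w(i := t))) has_field_derivative g i w) (at (w i))" if "w \<in> D" "i < n + n" for w i
  using cd' that by (simp add: g_def DERIV_deriv_iff_real_differentiable)
 have g': "((\<lambda>t. g i (w(l := t))) has_field_derivative h i l w) (at (w l))"
  if "w \<in> D" "i < n + n" "l < n + n" for w i l
  using cd' that by (simp add: h_def g_def DERIV_deriv_iff_real_differentiable)
 have hc: "continuous_map (subtopology (Euclidean_space (n + n)) D) euclideanreal (h i l)"
  if "i < n + n" "l < n + n" for i l using cd' that by (simp add: h_def[abs_def] g_def[abs_def])
 \<comment> \<open>Dominates each second derivative at the centre plus the oscillation of at most 1
   permitted in \<open>W\<close>.\<close>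
 define K where "K = 1 + (\<Sum>i<n+n. \<Sum>l<n+n. \<bar>h i l z\<bar>)"
 define W where "W i l = {w \<in> topspace (subtopology (Euclidean_space (n + n)) D). h i l w \<in> {h i l z - 1 <..< h i l z + 1}}" for i l
 have W: "openin (Euclidean_space (n + n)) (W i l)" if "i < n + n" "l < n + n" for i l
 proof -
  have "openin (subtopology (Euclidean_space (n + n)) D) (W i l)"
   unfolding W_def by (rule openin_continuous_map_preimage[OF hc[OF that]]) auto
  thus ?thesis using D openin_trans_full by blast
 qed
 define W0 where "W0 = D \<inter> (\<Inter>il\<in>{..<n+n} \<times> {..<n+n}. W (fst il) (snd il))"
 have "openin (Euclidean_space (n + n)) W0"
 \<comment> \<open>With an empty index set the intersection would be \<open>UNIV\<close> and not an
   open set of the space.\<close>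
 proof (cases "n = 0")
  case False
  hence "openin (Euclidean_space (n + n)) (\<Inter>il\<in>{..<n+n} \<times> {..<n+n}. W (fst il) (snd il))"
   using W by (intro openin_INT2) (auto simp: lessThan_empty_iff)
  thus ?thesis unfolding W0_def using D by (rule openin_Int[rotated])
 next
  case True
  thus ?thesis using D by (simp add: W0_def)
 qed
 moreover have "z \<in> W0"
 proof -
  have "z \<in> D" "z \<in> topspace (Euclidean_space (n + n))"
   using p join_coords_topspace by (simp_all add: z_def)
  thus ?thesis by (simp add: W0_def W_def)
 qed
 ultimately obtain e where e: "e > 0"
  "\<And>w. w \<in> topspace (Euclidean_space (n + n)) ==> (\<And>i. i < n + n ==> \<bar>w i - z i\<bar> < e) ==> w \<in> W0"
  using Euclidean_space_box by metis
 have inW0: "join_coords n x y \<in> W0" if "\<And>i. i < n ==> \<bar>x i - p i\<bar> < e" "\<And>i. i < n ==> \<bar>y i - p i\<bar> < e" for x y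
  by (rule e(2)[OF join_coords_topspace]) (use that in \<open>auto simp: z_def join_coords_def\<close>)
 have hK: "\<bar>h i l w\<bar> \<le> K" if "w \<in> W0" "i < n + n" "l < n + n" for i l w
 proof -
  have "\<bar>h i l z\<bar> \<le> (\<Sum>l<n+n. \<bar>h i l z\<bar>)"
   using that by (intro member_le_sum) auto
  also have "... \<le> (\<Sum>i<n+n. \<Sum>l<n+n. \<bar>h i l z\<bar>)"
   using that by (intro member_le_sum[of i "{..<n+n}" "\<lambda>i. \<Sum>l<n+n. \<bar>h i l z\<bar>"]) (auto intro!: sum_nonneg)
  finally have "\<bar>h i l z\<bar> + 1 \<le> K" by (simp add: K_def)
  moreover have "w \<in> W i l" using that by (auto simp: W0_def)
  hence "h i l z - 1 < h i l w" "h i l w < h i l z + 1" by (auto simp: W_def)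
  ultimately show ?thesis by linarith
 qed
 have K0: "K \<ge> 0" by (simp add: K_def add_nonneg_nonneg sum_nonneg)
 have step: "\<bar>f (join_coords n (x(i := s')) (y(l := t'))) - f (join_coords n (x(i := s)) (y(l := t')))
   - f (join_coords n (x(i := s')) (y(l := t))) + f (join_coords n (x(i := s)) (y(l := t)))\<bar> \<le> K * \<bar>s' - s\<bar> * \<bar>t' - t\<bar>"
  if i: "i < n" and l: "l < n" and x: "\<And>i. i < n ==> \<bar>x i - p i\<bar> < e" and y: "\<And>i. i < n ==> \<bar>y i - p i\<bar> < e"
   and st: "\<bar>s - p i\<bar> < e" "\<bar>s' - p i\<bar> < e" "\<bar>t - p l\<bar> < e" "\<bar>t' - p l\<bar> < e" for x y i l s s' t t'
 proof -
  define w where "w s t = join_coords n (x(i := s)) (y(l := t))" for s t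
  have wi: "(w s t)(i := s') = w s' t" and wl: "(w s t)(n + l := t') = w s t'"
   and wv: "w s t i = s" "w s t (n + l) = t" for s s' t t'
   using i l by (auto simp: w_def join_coords_def fun_eq_iff)
  have wW: "w s t \<in> W0" if "s \<in> ball (p i) e" "t \<in> ball (p l) e" for s t
   unfolding w_def using that x y by (intro inW0) (auto simp: dist_real_def abs_minus_commute)
  have wD: "w s t \<in> D" if "s \<in> ball (p i) e" "t \<in> ball (p l) e" for s t
   using wW[OF that] by (simp add: W0_def)
  show ?thesis unfolding w_def[symmetric]
  proof (rule second_difference_bound[of "ball (p i) e" "ball (p l) e" "\<lambda>s t. f (w s t)" "\<lambda>s t. g i (w s t)" "\<lambda>s t. h i (n + l) (w s t)"])
   show "((\<lambda>s. f (w s t)) has_field_derivative g i (w s t)) (at s)" if "s \<in> ball (p i) e" "t \<in> ball (p l) e" for s t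
    using f'[OF wD[OF that], of i] i by (simp add: wi wv)
   show "((\<lambda>t. g i (w s t)) has_field_derivative h i (n + l) (w s t)) (at t)" if "s \<in> ball (p i) e" "t \<in> ball (p l) e" for s t
    using g'[OF wD[OF that], of i "n + l"] i l by (simp add: wl wv)
   show "\<bar>h i (n + l) (w s t)\<bar> \<le> K" if "s \<in> ball (p i) e" "t \<in> ball (p l) e" for s t
    using hK[OF wW[OF that], of i "n + l"] i l by simp
  qed (use st in \<open>auto simp: dist_real_def abs_minus_commute\<close>)
 qed
 show ?thesis
 proof (rule that[OF e(1) K0])
  fix x x' y y' :: "nat => real"
  assume A: "\<And>i. i < n ==> \<bar>x i - p i\<bar> < e \<and> \<bar>x' i - p i\<bar> < e \<and> \<bar>y i - p i\<bar> < e \<and> \<bar>y' i - p i\<bar> < e"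
  \<comment> \<open>Interpolation between the end points: the first \<open>k\<close> coordinates
    have already moved.\<close>
  define X where "X k i = (if i < k then x' i else x i)" for k i :: nat
  define Y where "Y k i = (if i < k then y' i else y i)" for k i :: nat
  define P where "P k l = f (join_coords n (X k) (Y l))" for k l
  have XS: "X (Suc i) = (X i)(i := x' i)" "X i = (X i)(i := x i)" for i by (auto simp: X_def fun_eq_iff)
  have YS: "Y (Suc i) = (Y i)(i := y' i)" "Y i = (Y i)(i := y i)" for i by (auto simp: Y_def fun_eq_iff)
  have P1: "\<bar>P (Suc i) (Suc l) - P i (Suc l) - P (Suc i) l + P i l\<bar> \<le> K * \<bar>x' i - x i\<bar> * \<bar>y' l - y l\<bar>"
   if "i < n" "l < n" for i l using step[of i l "X i" "Y l" "x i" "x' i" "y l" "y' l"] A that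
   unfolding P_def XS(1) YS(1) XS(2)[symmetric] YS(2)[symmetric] by (auto simp: X_def Y_def)
  have "\<bar>P n n - P 0 n - P n 0 + P 0 0\<bar> \<le> (\<Sum>i<n. \<Sum>l<n. K * \<bar>x' i - x i\<bar> * \<bar>y' l - y l\<bar>)"
   unfolding double_telescope[symmetric]
   by (intro order_trans[OF sum_abs] sum_mono order_trans[OF sum_abs] sum_mono) (use P1 in auto)
  also have "... = K * (\<Sum>i<n. \<bar>x' i - x i\<bar>) * (\<Sum>l<n. \<bar>y' l - y l\<bar>)"
   unfolding mult.assoc by (subst sum_product) (simp add: sum_distrib_left)
  also have "P n n - P 0 n - P n 0 + P 0 0 =
    f (join_coords n x' y') - f (join_coords n x y') - f (join_coords n x' y) + f (join_coords n x y)"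
  proof -
   have "join_coords n (X n) v = join_coords n x' v" "join_coords n v (Y n) = join_coords n v y'"
    "X 0 = x" "Y 0 = y" for v by (auto simp: join_coords_def X_def Y_def fun_eq_iff)
   thus ?thesis by (simp add: P_def)
  qed
  finally show "\<bar>f (join_coords n x' y') - f (join_coords n x y') - f (join_coords n x' y) + f (join_coords n x y)\<bar>
   \<le> K * (\<Sum>i<n. \<bar>x' i - x i\<bar>) * (\<Sum>l<n. \<bar>y' l - y l\<bar>)" .
 qed
qed

text \<open>A chart sending the unit to 0, measured by the Euclidean norm. The estimate
  \<open>mixed\<close> says that multiplication is addition up to a second-order error, and
  \<open>C * r0 \<le> 1/16\<close> makes this error at most a sixteenth of a factor, small enough
  for all the numerical comparisons that follow.\<close>

locale normed_chart = compact_group G T for G :: "('a, 'b) monoid_scheme" (structure) and T +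
 fixes n :: nat and U :: "'a set" and \<psi> :: "'a => nat => real" and C r0 :: real and nrm :: "(nat => real) => real"
  and N :: "'a => real"
 defines "nrm v \<equiv> L2_set v {..<n}" and "N x \<equiv> nrm (\<psi> x)"
 assumes U: "openin T U" "\<one> \<in> U"
  and \<psi>_continuous: "i < n ==> rcmap (subtopology T U) (\<lambda>x. \<psi> x i)"
  and \<psi>_one: "i < n ==> \<psi> \<one> i = 0"
  and r0: "0 < r0" and C: "0 < C" "C * r0 \<le> 1/16"
  and N_zero: "x \<in> U ==> N x = 0 ==> x = \<one>"
  and N_nbhd: "openin T S ==> \<one> \<in> S ==> \<exists>r>0. \<forall>x\<in>U. N x < r \<longrightarrow> x \<in> S"
  and N_closed: "s \<le> r0 ==> closedin T {x \<in> U. N x \<le> s}"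
  and mult_U: "a \<in> U ==> N a \<le> r0 ==> d \<in> U ==> N d \<le> r0 ==> a \<otimes> d \<in> U"
  and mixed: "a \<in> U ==> N a \<le> r0 ==> a' \<in> U ==> N a' \<le> r0 ==> d \<in> U ==> N d \<le> r0 ==>
   nrm (\<lambda>i. (\<psi> (a \<otimes> d) i - \<psi> a i) - (\<psi> (a' \<otimes> d) i - \<psi> a' i)) \<le> C * nrm (\<lambda>i. \<psi> a i - \<psi> a' i) * N d"

lemma (in compact_lie_group) compact_group: "compact_group G T"
 by unfold_locales (rule compact Hausdorff second_countable)+

lemma L2_set_abs: "L2_set (\<lambda>i. \<bar>v i\<bar>) A = L2_set v A" by (simp add: L2_set_def)

lemma sum_abs_le_L2_set: "(\<Sum>i<n. \<bar>v i\<bar>) \<le> real n * L2_set v {..<n}"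
proof -
 have "(\<Sum>i<n. \<bar>v i\<bar>) \<le> (\<Sum>i<n. L2_set v {..<n})"
  using member_le_L2_set[of "{..<n}" _ "\<lambda>i. \<bar>v i\<bar>"] by (intro sum_mono) (simp add: L2_set_abs)
 thus ?thesis by simp
qed

lemma (in compact_lie_group) normed_chart_exists: "\<exists>n U \<psi> C r0. normed_chart G T n U \<psi> C r0"
proof -
 interpret compact_group G T by (rule compact_group)
 obtain n \<A> where at: "smooth_atlas T n \<A>" and sm: "smooth_group_operations G n \<A>"
  using smooth_structure by blast
 have "\<one> \<in> (\<Union>(U, \<phi>)\<in>\<A>. U)" using at topspace_eq by (simp add: smooth_atlas_def)
 then obtain U \<phi> where U: "(U, \<phi>) \<in> \<A>" "\<one> \<in> U" by auto
 have ch: "chart T n (U, \<phi>)" using at U(1) unfolding smooth_atlas_def by blast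
 have oU: "openin T U" and oI: "openin (Euclidean_space n) (\<phi> ` U)"
  and hm: "homeomorphic_map (subtopology T U) (subtopology (Euclidean_space n) (\<phi> ` U)) \<phi>"
  using ch by (auto simp: chart_def)
 have tU: "topspace (subtopology T U) = U" using openin_subset[OF oU] by auto
 have inj: "inj_on \<phi> U" using homeomorphic_imp_injective_map[OF hm] tU by simp
 have phiE: "\<phi> x \<in> topspace (Euclidean_space n)" if "x \<in> U" for x
  using openin_subset[OF oI] that by blast
 have phi0: "\<phi> x i = 0" if "x \<in> U" "i \<ge> n" for x i
  using phiE[OF that(1)] that(2) by (simp add: topspace_Euclidean_space)
 define p where "p = \<phi> \<one>"
 define m where "m z = inv_into U \<phi> (fst_coords n z) \<otimes> inv_into U \<phi> (snd_coords n z)" for z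
 define D where "D = {z \<in> topspace (Euclidean_space (n + n)). fst_coords n z \<in> \<phi> ` U \<and> snd_coords n z \<in> \<phi> ` U \<and> m z \<in> U}"
 have "smooth_map (n + n) n D (\<phi> \<circ> m)"
  using sm U(1) unfolding smooth_group_operations_def D_def m_def Let_def by fast
 hence oD: "openin (Euclidean_space (n + n)) D"
  and cd: "\<And>j k. j < n ==> cont_diff (n + n) k D (\<lambda>z. \<phi> (m z) j)"
  by (auto simp: smooth_map_def o_def)
 have mj: "m (join_coords n (\<phi> a) (\<phi> d)) = a \<otimes> d" if "a \<in> U" "d \<in> U" for a d
  using that inj phiE by (simp add: m_def fst_coords_join snd_coords_join inv_into_f_f)
 have inD: "join_coords n (\<phi> a) (\<phi> d) \<in> D \<longleftrightarrow> a \<otimes> d \<in> U" if "a \<in> U" "d \<in> U" for a d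
  using that phiE by (simp add: D_def mj join_coords_topspace fst_coords_join snd_coords_join)
 have pD: "join_coords n p p \<in> D" unfolding p_def using inD[OF U(2,2)] U(2) by simp
 define bnd where "bnd j e K \<longleftrightarrow> (\<forall>x x' y y'. (\<forall>i<n. \<bar>x i - p i\<bar> < e \<and> \<bar>x' i - p i\<bar> < e \<and> \<bar>y i - p i\<bar> < e \<and> \<bar>y' i - p i\<bar> < e) \<longrightarrow>
   \<bar>\<phi> (m (join_coords n x' y')) j - \<phi> (m (join_coords n x y')) j - \<phi> (m (join_coords n x' y)) j + \<phi> (m (join_coords n x y)) j\<bar>
   \<le> K * (\<Sum>i<n. \<bar>x' i - x i\<bar>) * (\<Sum>l<n. \<bar>y' l - y l\<bar>))" for j e K
 have "\<exists>e>0. \<exists>K\<ge>0. bnd j e K" if "j < n" for j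
 proof (rule cont_diff_mixed_bound[OF cd[OF that, of 2] oD pD])
  fix e K :: real
  assume "e > 0" "K \<ge> 0" and *: "\<And>x x' y y'. (\<And>i. i < n ==> \<bar>x i - p i\<bar> < e \<and> \<bar>x' i - p i\<bar> < e \<and> \<bar>y i - p i\<bar> < e \<and> \<bar>y' i - p i\<bar> < e) ==>
   \<bar>\<phi> (m (join_coords n x' y')) j - \<phi> (m (join_coords n x y')) j - \<phi> (m (join_coords n x' y)) j + \<phi> (m (join_coords n x y)) j\<bar>
   \<le> K * (\<Sum>i<n. \<bar>x' i - x i\<bar>) * (\<Sum>l<n. \<bar>y' l - y l\<bar>)"
  have "bnd j e K" unfolding bnd_def by (intro allI impI *) simp
  thus ?thesis using \<open>e > 0\<close> \<open>K \<ge> 0\<close> by blast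
 qed
 then obtain ee KK where eK: "\<And>j. j < n ==> ee j > 0" "\<And>j. j < n ==> KK j \<ge> (0::real)" "\<And>j. j < n ==> bnd j (ee j) (KK j)"
  by metis
 define e where "e = Min (insert 1 (ee ` {..<n}))"
 have e: "e > 0" "\<And>j. j < n ==> e \<le> ee j"
  unfolding e_def using eK(1) by (auto simp: Min_gr_iff)
 define K where "K = (\<Sum>j<n. KK j)"
 have K: "K \<ge> 0" unfolding K_def using eK(2) by (intro sum_nonneg) auto
 obtain eD where eD: "eD > 0" "\<And>w. w \<in> topspace (Euclidean_space (n + n)) ==> (\<And>i. i < n + n ==> \<bar>w i - join_coords n p p i\<bar> < eD) ==> w \<in> D"
  using Euclidean_space_box[OF oD pD] by metis
 define \<psi> where "\<psi> x i = \<phi> x i - p i" for x i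
 define nrm where "nrm v = L2_set v {..<n}" for v
 define N where "N x = nrm (\<psi> x)" for x
 have le_nrm: "\<bar>v i\<bar> \<le> nrm v" if "i < n" for v i
  using member_le_L2_set[of "{..<n}" i "\<lambda>i. \<bar>v i\<bar>"] that by (simp add: nrm_def L2_set_abs)
 have \<psi>c: "rcmap (subtopology T U) (\<lambda>x. \<psi> x i)" for i
 proof -
  have "continuous_map (subtopology T U) (Euclidean_space n) \<phi>"
   using homeomorphic_imp_continuous_map[OF hm] continuous_map_in_subtopology by blast
  hence "continuous_map (subtopology T U) (powertop_real UNIV) \<phi>"
   unfolding Euclidean_space_def continuous_map_in_subtopology by blast
  hence "rcmap (subtopology T U) (\<lambda>x. \<phi> x i)"
   by (simp add: continuous_map_componentwise_UNIV)
  thus ?thesis unfolding \<psi>_def by (intro continuous_map_diff) auto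
 qed
 have Nc: "rcmap (subtopology T U) N" unfolding N_def nrm_def L2_set_def
  by (intro continuous_map_sqrt continuous_map_sum continuous_map_real_pow \<psi>c) auto
 have nb: "\<exists>r>0. \<forall>x\<in>U. N x < r \<longrightarrow> x \<in> S" if S: "openin T S" "\<one> \<in> S" for S
 proof -
  have "openin (subtopology T U) (S \<inter> U)" using S(1) openin_subtopology_Int by blast
  hence "openin (subtopology (Euclidean_space n) (\<phi> ` U)) (\<phi> ` (S \<inter> U))"
   using homeomorphic_imp_open_map[OF hm] by (simp add: open_map_def)
  hence "openin (Euclidean_space n) (\<phi> ` (S \<inter> U))" using oI openin_trans_full by blast
  moreover have "p \<in> \<phi> ` (S \<inter> U)" using S U(2) by (simp add: p_def)
  ultimately obtain r where r: "r > 0"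
   "\<And>w. w \<in> topspace (Euclidean_space n) ==> (\<And>i. i < n ==> \<bar>w i - p i\<bar> < r) ==> w \<in> \<phi> ` (S \<inter> U)"
   using Euclidean_space_box by metis
  have "x \<in> S" if x: "x \<in> U" "N x < r" for x
  proof -
   have "\<phi> x \<in> \<phi> ` (S \<inter> U)"
   proof (rule r(2)[OF phiE[OF x(1)]])
    fix i assume "i < n"
    thus "\<bar>\<phi> x i - p i\<bar> < r"
     using le_nrm[of i "\<psi> x"] x(2) by (simp add: N_def \<psi>_def)
   qed
   thus ?thesis using inj x(1) by (auto dest: inj_onD)
  qed
  thus ?thesis using r(1) by blast
 qed
 \<comment> \<open>A closed neighbourhood of the unit inside the chart domain: norm balls contained
   in it are closed in \<open>T\<close> and not merely in \<open>U\<close>.\<close>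
 have "regular_space T" using Hausdorff_T compact_T compact_Hausdorff_imp_regular_space by blast
 then obtain O1 D1 where OD: "openin T O1" "closedin T D1" "\<one> \<in> O1" "O1 \<subseteq> D1" "D1 \<subseteq> U"
  using neighbourhood_base_of_closedin[of T] oU U(2) unfolding neighbourhood_base_of by meson
 obtain r1 where r1: "r1 > 0" "\<And>x. x \<in> U ==> N x < r1 ==> x \<in> O1"
  using nb[OF OD(1,3)] by blast
 have closed: "closedin T {x \<in> U. N x \<le> s}" if "s < r1" for s
 proof -
  have eq: "{x \<in> U. N x \<le> s} = {x \<in> topspace (subtopology T D1). N x \<in> {..s}}"
   using OD r1 that closedin_subset[OF OD(2)] by fastforce
  have "rcmap (subtopology T D1) N"
   using Nc OD(5) continuous_map_from_subtopology_mono by blast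
  hence "closedin (subtopology T D1) {x \<in> topspace (subtopology T D1). N x \<in> {..s}}"
   by (rule closedin_continuous_map_preimage) auto
  thus ?thesis unfolding eq using OD(2) closedin_trans_full by blast
 qed
 \<comment> \<open>The two factors \<open>n\<close> come from comparing sums of absolute values with
   Euclidean norms; adding 1 keeps the constant positive.\<close>
 define C where "C = K * real n * real n + 1"
 have C: "C > 0" unfolding C_def using K by (simp add: add_nonneg_pos)
 \<comment> \<open>Halving keeps the inequalities with \<open>e\<close>, \<open>eD\<close> and
   \<open>r1\<close> strict; the last term gives \<open>C * r0 \<le> 1/16\<close>.\<close>
 define r0 where "r0 = min (min (e / 2) (eD / 2)) (min (r1 / 2) (1 / (16 * C)))"
 have r0: "r0 > 0" "r0 < e" "r0 < eD" "r0 < r1" "C * r0 \<le> 1/16"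
 proof -
  show "r0 > 0" "r0 < e" "r0 < eD" "r0 < r1"
   using e(1) eD(1) r1(1) C by (auto simp: r0_def min_less_iff_disj)
  have "C * r0 \<le> C * (1 / (16 * C))" using C by (intro mult_left_mono) (auto simp: r0_def)
  thus "C * r0 \<le> 1/16" using C by simp
 qed
 have small: "\<bar>\<phi> x i - p i\<bar> < e" "\<bar>\<phi> x i - p i\<bar> < eD" if "N x \<le> r0" "i < n" for x i
  using le_nrm[OF that(2), of "\<psi> x"] that(1) r0 by (auto simp: N_def \<psi>_def)
 have multU: "a \<otimes> d \<in> U" if "a \<in> U" "N a \<le> r0" "d \<in> U" "N d \<le> r0" for a d
 proof -
  have "join_coords n (\<phi> a) (\<phi> d) \<in> D"
  proof (rule eD(2)[OF join_coords_topspace])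
   fix i assume i: "i < n + n"
   show "\<bar>join_coords n (\<phi> a) (\<phi> d) i - join_coords n p p i\<bar> < eD"
   proof (cases "i < n")
    case True
    thus ?thesis using small(2)[OF that(2) True] by (simp add: join_coords_def)
   next
    case False
    hence "i - n < n" using i by simp
    thus ?thesis using small(2)[OF that(4), of "i - n"] i False by (simp add: join_coords_def)
   qed
  qed
  thus ?thesis using inD that by blast
 qed
 have mixed: "nrm (\<lambda>i. (\<psi> (a \<otimes> d) i - \<psi> a i) - (\<psi> (a' \<otimes> d) i - \<psi> a' i)) \<le> C * nrm (\<lambda>i. \<psi> a i - \<psi> a' i) * N d"
  if a: "a \<in> U" "N a \<le> r0" "a' \<in> U" "N a' \<le> r0" and d: "d \<in> U" "N d \<le> r0" for a a' d
 proof -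
  define S where "S = (\<Sum>i<n. \<bar>\<phi> a i - \<phi> a' i\<bar>) * (\<Sum>l<n. \<bar>\<phi> d l - p l\<bar>)"
  have aG: "a \<in> carrier G" "a' \<in> carrier G" "d \<in> carrier G"
   using a d openin_subset[OF oU] topspace_eq by auto
  have comp: "\<bar>(\<psi> (a \<otimes> d) j - \<psi> a j) - (\<psi> (a' \<otimes> d) j - \<psi> a' j)\<bar> \<le> KK j * S" if j: "j < n" for j
  proof -
   have "\<bar>\<phi> (m (join_coords n (\<phi> a) (\<phi> d))) j - \<phi> (m (join_coords n (\<phi> a') (\<phi> d))) j
     - \<phi> (m (join_coords n (\<phi> a) p)) j + \<phi> (m (join_coords n (\<phi> a') p)) j\<bar>
     \<le> KK j * (\<Sum>i<n. \<bar>\<phi> a i - \<phi> a' i\<bar>) * (\<Sum>l<n. \<bar>\<phi> d l - p l\<bar>)"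
   proof (rule eK(3)[OF j, unfolded bnd_def, rule_format], intro conjI)
    fix i assume i: "i < n"
    have "e \<le> ee j" by (rule e(2)[OF j])
    thus "\<bar>\<phi> a' i - p i\<bar> < ee j" "\<bar>\<phi> a i - p i\<bar> < ee j" "\<bar>p i - p i\<bar> < ee j" "\<bar>\<phi> d i - p i\<bar> < ee j"
     using small(1)[OF a(2) i] small(1)[OF a(4) i] small(1)[OF d(2) i] e(1) by auto
   qed
   thus ?thesis using mj[OF a(1) d(1)] mj[OF a(3) d(1)] mj[OF a(1) U(2)] mj[OF a(3) U(2)] aG
    by (simp add: p_def[symmetric] \<psi>_def S_def algebra_simps)
  qed
  have S0: "S \<ge> 0" unfolding S_def by (intro mult_nonneg_nonneg sum_nonneg) auto
  have "nrm (\<lambda>i. (\<psi> (a \<otimes> d) i - \<psi> a i) - (\<psi> (a' \<otimes> d) i - \<psi> a' i))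
    \<le> (\<Sum>j<n. \<bar>(\<psi> (a \<otimes> d) j - \<psi> a j) - (\<psi> (a' \<otimes> d) j - \<psi> a' j)\<bar>)"
   unfolding nrm_def by (rule L2_set_le_sum_abs)
  also have "... \<le> (\<Sum>j<n. KK j * S)" using comp by (intro sum_mono) auto
  also have "... = K * S" by (simp add: K_def sum_distrib_right)
  also have "S \<le> (real n * nrm (\<lambda>i. \<psi> a i - \<psi> a' i)) * (real n * N d)"
   unfolding S_def N_def nrm_def
   using sum_abs_le_L2_set[of "\<lambda>i. \<psi> a i - \<psi> a' i" n] sum_abs_le_L2_set[of "\<psi> d" n]
   by (intro mult_mono) (auto simp: \<psi>_def L2_set_nonneg intro!: sum_nonneg)
  hence "K * S \<le> K * ((real n * nrm (\<lambda>i. \<psi> a i - \<psi> a' i)) * (real n * N d))"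
   using K by (rule mult_left_mono)
  also have "... = (K * real n * real n) * (nrm (\<lambda>i. \<psi> a i - \<psi> a' i) * N d)"
   by (simp add: mult_ac)
  also have "... \<le> C * (nrm (\<lambda>i. \<psi> a i - \<psi> a' i) * N d)"
   by (intro mult_right_mono) (auto simp: C_def N_def nrm_def L2_set_nonneg)
  finally show ?thesis by (simp add: mult.assoc)
 qed
 have "normed_chart G T n U \<psi> C r0"
 proof (unfold_locales; (unfold nrm_def[symmetric] N_def[symmetric])?)
  show "openin T U" "\<one> \<in> U" by (rule oU U(2))+
  show "\<psi> \<one> i = 0" for i by (simp add: \<psi>_def p_def)
  show "x = \<one>" if "x \<in> U" "N x = 0" for x
  proof -
   have "\<phi> x i = p i" for i using le_nrm[of i "\<psi> x"] that(2) phi0[OF that(1)] phi0[OF U(2)]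
    by (cases "i < n") (auto simp: N_def \<psi>_def p_def)
   hence "\<phi> x = \<phi> \<one>" by (auto simp: p_def)
   thus ?thesis using inj that(1) U(2) by (auto dest: inj_onD)
  qed
 qed (use \<psi>c r0 C nb closed multU mixed in auto)
 thus ?thesis by blast
qed

section \<open>Approximate additive arithmetic in a normed chart\<close>

context normed_chart
begin

lemma nrm_nonneg [simp]: "0 \<le> nrm v" by (simp add: nrm_def L2_set_nonneg)

lemma N_nonneg [simp]: "0 \<le> N x" by (simp add: N_def)

lemma nrm_add: "(\<And>i. i < n ==> u i = v i + w i) ==> nrm u \<le> nrm v + nrm w"
 using L2_set_triangle_ineq[of v w "{..<n}"] L2_set_cong[of "{..<n}" "{..<n}" u "\<lambda>i. v i + w i"]
 by (simp add: nrm_def)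

lemma nrm_scale: "(\<And>i. i < n ==> u i = c * v i) ==> nrm u = \<bar>c\<bar> * nrm v"
 using L2_set_cong[of "{..<n}" "{..<n}" u "\<lambda>i. c * v i"]
 by (simp add: nrm_def L2_set_def power_mult_distrib sum_distrib_left[symmetric] real_sqrt_mult)

lemma nrm_cong: "(\<And>i. i < n ==> u i = v i) ==> nrm u = nrm v"
 using nrm_scale[of u 1 v] by simp

lemma nrm_diff_swap: "nrm (\<lambda>i. u i - v i) = nrm (\<lambda>i. v i - u i)"
 using nrm_scale[of "\<lambda>i. u i - v i" "-1" "\<lambda>i. v i - u i"] by simp

lemma nrm_sub: "(\<And>i. i < n ==> u i = v i - w i) ==> nrm u \<le> nrm v + nrm w"
 using nrm_add[of u v "\<lambda>i. - w i"] nrm_scale[of "\<lambda>i. - w i" "-1" w] by simp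

lemma le_nrm: "i < n ==> \<bar>v i\<bar> \<le> nrm v"
 using member_le_L2_set[of "{..<n}" i "\<lambda>i. \<bar>v i\<bar>"] by (simp add: nrm_def L2_set_abs)

lemma N_one: "N \<one> = 0"
proof -
 have "N \<one> = nrm (\<lambda>_. 0)" unfolding N_def by (rule nrm_cong) (simp add: \<psi>_one)
 thus ?thesis by (simp add: nrm_def L2_set_def)
qed

definition nb :: "real => 'a set" where "nb r = {x \<in> U. N x \<le> r}"

lemma nb_carrier: "x \<in> nb r ==> x \<in> carrier G"
 using openin_subset[OF U(1)] topspace_eq by (auto simp: nb_def)

lemma nb_mono: "r \<le> s ==> x \<in> nb r ==> x \<in> nb s"
 by (auto simp: nb_def)

lemma one_nb: "0 \<le> r ==> \<one> \<in> nb r" by (simp add: nb_def N_one U)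

lemma mult_U': "a \<in> nb r0 ==> d \<in> nb r0 ==> a \<otimes> d \<in> U"
 by (simp add: nb_def mult_U)

lemma mixed': "a \<in> nb r0 ==> a' \<in> nb r0 ==> d \<in> nb r0 ==>
  nrm (\<lambda>i. (\<psi> (a \<otimes> d) i - \<psi> a i) - (\<psi> (a' \<otimes> d) i - \<psi> a' i)) \<le> C * nrm (\<lambda>i. \<psi> a i - \<psi> a' i) * N d"
 by (simp add: nb_def mixed)

text \<open>The case of \<open>mixed\<close> in which the second point is the unit, where the
  coordinates vanish.\<close>

lemma product_approx:
 assumes a: "a \<in> nb r0" and d: "d \<in> nb r0"
 shows "nrm (\<lambda>i. \<psi> (a \<otimes> d) i - \<psi> a i - \<psi> d i) \<le> C * N a * N d"
proof -
 have "nrm (\<lambda>i. (\<psi> (a \<otimes> d) i - \<psi> a i) - (\<psi> (\<one> \<otimes> d) i - \<psi> \<one> i)) \<le> C * nrm (\<lambda>i. \<psi> a i - \<psi> \<one> i) * N d"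
  using r0 by (intro mixed' a d one_nb) auto
 moreover have "nrm (\<lambda>i. \<psi> a i - \<psi> \<one> i) = N a"
  unfolding N_def by (rule nrm_cong) (simp add: \<psi>_one)
 moreover have "nrm (\<lambda>i. (\<psi> (a \<otimes> d) i - \<psi> a i) - (\<psi> (\<one> \<otimes> d) i - \<psi> \<one> i)) = nrm (\<lambda>i. \<psi> (a \<otimes> d) i - \<psi> a i - \<psi> d i)"
  using nb_carrier[OF d] by (intro nrm_cong) (simp add: \<psi>_one)
 ultimately show ?thesis by simp
qed

lemma C_N: "a \<in> nb r0 ==> C * N a \<le> 1/16"
proof -
 assume "a \<in> nb r0"
 hence "C * N a \<le> C * r0" using C by (intro mult_left_mono) (auto simp: nb_def)
 thus ?thesis using C by linarith
qed

lemma product_diff: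
 assumes a: "a \<in> nb r0" and d: "d \<in> nb r0"
 shows "nrm (\<lambda>i. \<psi> (a \<otimes> d) i - \<psi> a i) \<le> 17/16 * N d" "15/16 * N d \<le> nrm (\<lambda>i. \<psi> (a \<otimes> d) i - \<psi> a i)"
  "N (a \<otimes> d) \<le> N a + 17/16 * N d"
proof -
 have le: "C * N a * N d \<le> 1/16 * N d" using C_N[OF a] by (rule mult_right_mono) simp
 have "nrm (\<lambda>i. \<psi> (a \<otimes> d) i - \<psi> a i) \<le> nrm (\<lambda>i. \<psi> (a \<otimes> d) i - \<psi> a i - \<psi> d i) + N d"
  unfolding N_def by (rule nrm_add) simp
 thus 1: "nrm (\<lambda>i. \<psi> (a \<otimes> d) i - \<psi> a i) \<le> 17/16 * N d"
  using product_approx[OF a d] le by linarith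
 have "N d \<le> nrm (\<lambda>i. \<psi> (a \<otimes> d) i - \<psi> a i) + nrm (\<lambda>i. \<psi> (a \<otimes> d) i - \<psi> a i - \<psi> d i)"
  unfolding N_def by (rule nrm_sub) simp
 thus "15/16 * N d \<le> nrm (\<lambda>i. \<psi> (a \<otimes> d) i - \<psi> a i)"
  using product_approx[OF a d] le by linarith
 have "N (a \<otimes> d) \<le> N a + nrm (\<lambda>i. \<psi> (a \<otimes> d) i - \<psi> a i)"
  unfolding N_def by (rule nrm_add) simp
 thus "N (a \<otimes> d) \<le> N a + 17/16 * N d" using 1 by linarith
qed

text \<open>Each further factor adds an error proportional to the length reached so far, hence
  quadratic growth; the factor 2 absorbs the gap of 17/16 between the length of the power and
  \<open>real m * N c\<close>.\<close>

lemma power_approx: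
 assumes c: "c \<in> nb r0"
 shows "real m * N c \<le> r0 / 2 ==> c [^] m \<in> nb r0 \<and> nrm (\<lambda>i. \<psi> (c [^] m) i - real m * \<psi> c i) \<le> 2 * C * (real m * N c)\<^sup>2"
proof (induction m)
 case 0
 have "nrm (\<lambda>i. \<psi> (c [^] (0::nat)) i - real 0 * \<psi> c i) = nrm (\<lambda>i. 0 * \<psi> c i)"
  by (rule nrm_cong) (simp add: \<psi>_one)
 thus ?case using r0 one_nb nrm_scale[of "\<lambda>i. 0 * \<psi> c i" 0 "\<psi> c"] by simp
next
 case (Suc m)
 have sm: "real m * N c \<le> r0 / 2" using Suc.prems by (simp add: algebra_simps) (smt (verit) N_nonneg)
 note IH = Suc.IH[OF sm]
 define q where "q = c [^] m"
 have q: "q \<in> nb r0" "nrm (\<lambda>i. \<psi> q i - real m * \<psi> c i) \<le> 2 * C * (real m * N c)\<^sup>2"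
  using IH by (auto simp: q_def)
 have up: "N (c [^] k) \<le> 17/16 * (real k * N c)"
  if k: "real k * N c \<le> r0 / 2" "nrm (\<lambda>i. \<psi> (c [^] k) i - real k * \<psi> c i) \<le> 2 * C * (real k * N c)\<^sup>2" for k :: nat
 proof -
  have "N (c [^] k) \<le> nrm (\<lambda>i. \<psi> (c [^] k) i - real k * \<psi> c i) + nrm (\<lambda>i. real k * \<psi> c i)"
   unfolding N_def by (rule nrm_add) simp
  also have "nrm (\<lambda>i. real k * \<psi> c i) = real k * N c"
   unfolding N_def by (subst nrm_scale[of _ "real k" "\<psi> c"]) auto
  finally have 1: "N (c [^] k) \<le> nrm (\<lambda>i. \<psi> (c [^] k) i - real k * \<psi> c i) + real k * N c" .
  have "2 * C * (real k * N c) \<le> 2 * C * (r0 / 2)" using k(1) C by (intro mult_left_mono) auto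
  hence "2 * C * (real k * N c) \<le> 1/16" using C by linarith
  hence "(2 * C * (real k * N c)) * (real k * N c) \<le> 1/16 * (real k * N c)"
   by (rule mult_right_mono) simp
  hence "2 * C * (real k * N c)\<^sup>2 \<le> 1/16 * (real k * N c)"
   by (simp add: power2_eq_square mult.assoc)
  thus ?thesis using k(2) 1 by linarith
 qed
 have Nq: "N q \<le> 17/16 * (real m * N c)" unfolding q_def by (rule up[OF sm]) (use q q_def in simp)
 have qU: "q \<otimes> c \<in> U" by (rule mult_U'[OF q(1) c])
 have eq: "c [^] Suc m = q \<otimes> c" by (simp add: q_def)
 have "nrm (\<lambda>i. \<psi> (q \<otimes> c) i - real (Suc m) * \<psi> c i) \<le> nrm (\<lambda>i. \<psi> (q \<otimes> c) i - \<psi> q i - \<psi> c i) + nrm (\<lambda>i. \<psi> q i - real m * \<psi> c i)"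
  by (rule nrm_add) (simp add: algebra_simps)
 also have "... \<le> C * N q * N c + 2 * C * (real m * N c)\<^sup>2"
  using product_approx[OF q(1) c] q(2) by linarith
 also have "... \<le> C * (17/16 * (real m * N c)) * N c + 2 * C * (real m * N c)\<^sup>2"
  using Nq C by (intro add_right_mono mult_right_mono mult_left_mono) auto
 also have "... \<le> 2 * C * (real (Suc m) * N c)\<^sup>2"
 proof -
  \<comment> \<open>The increment of the bound has coefficient \<open>4 * m + 2\<close>, and the new
    error needs at most \<open>17/16 * m\<close> of it; \<open>47/16 * m + 2\<close>
    remains.\<close>
  have "2 * C * (real (Suc m) * N c)\<^sup>2 - (C * (17/16 * (real m * N c)) * N c + 2 * C * (real m * N c)\<^sup>2)
   = C * (N c)\<^sup>2 * (47/16 * real m + 2)" by (simp add: power2_eq_square algebra_simps)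
  moreover have "0 \<le> C * (N c)\<^sup>2 * (47/16 * real m + 2)"
   using C by (intro mult_nonneg_nonneg) auto
  ultimately show ?thesis by linarith
 qed
 finally have fin: "nrm (\<lambda>i. \<psi> (c [^] Suc m) i - real (Suc m) * \<psi> c i) \<le> 2 * C * (real (Suc m) * N c)\<^sup>2"
  by (simp only: eq)
 have "N (c [^] Suc m) \<le> 17/16 * (real (Suc m) * N c)" by (rule up[OF Suc.prems fin])
 also have "... \<le> r0" using Suc.prems r0 by linarith
 finally have "c [^] Suc m \<in> nb r0" using qU unfolding eq nb_def by simp
 thus ?case using fin by blast
qed

lemma power_norm:
 assumes "c \<in> nb r0" "real m * N c \<le> r0 / 2"
 shows "N (c [^] m) \<le> 17/16 * (real m * N c)"
proof -
 note p = power_approx[OF assms]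
 have "N (c [^] m) \<le> nrm (\<lambda>i. \<psi> (c [^] m) i - real m * \<psi> c i) + nrm (\<lambda>i. real m * \<psi> c i)"
  unfolding N_def by (rule nrm_add) simp
 also have "nrm (\<lambda>i. real m * \<psi> c i) = real m * N c"
  unfolding N_def by (subst nrm_scale[of _ "real m" "\<psi> c"]) auto
 finally have 1: "N (c [^] m) \<le> 2 * C * (real m * N c)\<^sup>2 + real m * N c" using p by linarith
 have "2 * C * (real m * N c) \<le> 2 * C * (r0 / 2)" using assms(2) C by (intro mult_left_mono) auto
 hence "2 * C * (real m * N c) \<le> 1/16" using C by linarith
 hence "(2 * C * (real m * N c)) * (real m * N c) \<le> 1/16 * (real m * N c)" by (rule mult_right_mono) simp
 thus ?thesis using 1 by (simp add: power2_eq_square mult.assoc)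
qed

text \<open>Directions of small elements of the subgroup accumulate, so a suitable power of a much smaller
 element is approximately half of a given one.\<close>

lemma approximate_halves:
 assumes K: "subgroup K G"
 obtains r where "r > 0" "\<And>e. e \<in> K ==> e \<in> nb r ==> N e > 0 ==>
  \<exists>f\<in>K. f \<in> U \<and> N f \<le> N e \<and> nrm (\<lambda>i. \<psi> e i - 2 * \<psi> f i) \<le> 1/4 * N e"
proof (rule ccontr)
 assume "\<not> thesis"
 \<comment> \<open>Radii tending to 0, below \<open>r0 / 2\<close> and \<open>1 / (16 * C)\<close>;
   a counterexample is taken at every scale.\<close>
 define r where "r k = min (r0 / 2) (min 1 (1 / (16 * C)) / real (Suc k))" for k
 have rpos: "r k > 0" for k using r0 C by (simp add: r_def)
 define half where "half e f \<longleftrightarrow> f \<in> U \<and> N f \<le> N e \<and> nrm (\<lambda>i. \<psi> e i - 2 * \<psi> f i) \<le> 1/4 * N e" for e f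
 have "\<exists>e. e \<in> K \<and> e \<in> nb (r k) \<and> N e > 0 \<and> \<not> (\<exists>f\<in>K. half e f)" for k
  using that[OF rpos[of k]] \<open>\<not> thesis\<close> unfolding half_def by blast
 then obtain e where e: "\<And>k. e k \<in> K" "\<And>k. e k \<in> nb (r k)" "\<And>k. N (e k) > 0"
  and no: "\<And>k f. f \<in> K ==> \<not> half (e k) f" by metis
 \<comment> \<open>Unit directions; bounded coordinates give a subsequence along which they
   converge.\<close>
 define X where "X k i = \<psi> (e k) i / N (e k)" for k i
 have bX: "bounded ((\<lambda>x. x i) ` range X)" if "i \<in> {..<n}" for i
 proof (rule boundedI[of _ 1])
  fix v assume "v \<in> (\<lambda>x. x i) ` range X"
  then obtain k where "v = X k i" by auto
  thus "norm v \<le> 1" using le_nrm[of i "\<psi> (e k)"] that e(3)[of k] by (simp add: X_def N_def)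
 qed
 obtain l :: "nat => real" and s :: "nat => nat" where s: "strict_mono s"
  and lim: "\<forall>\<epsilon>>0. eventually (\<lambda>k. \<forall>i\<in>{..<n}. dist (X (s k) i) (l i) < \<epsilon>) sequentially"
  using compact_lemma_general[of "{..<n}" "\<lambda>x i. x i" X "\<lambda>x. x"] bX by auto
 obtain k0 where k0: "\<And>k i. k \<ge> k0 ==> i < n ==> dist (X (s k) i) (l i) < 1 / (32 * real (Suc n))"
  using lim[rule_format, of "1 / (32 * real (Suc n))"] unfolding eventually_sequentially by auto
 \<comment> \<open>\<open>a\<close> is one counterexample and \<open>b\<close> a later one, at most
   1/16 as long and of nearly the same direction, so that a power of \<open>b\<close> can refute the
   failure of halving at \<open>a\<close>.\<close>
 define a where "a = e (s k0)"
 have a: "a \<in> K" "a \<in> nb (r (s k0))" "N a > 0" unfolding a_def by (rule e)+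
 have Na: "N a \<le> r0 / 2" "C * N a \<le> 1/16"
 proof -
  have ra: "N a \<le> r (s k0)" using a(2) by (simp add: nb_def)
  also have "... \<le> r0 / 2" by (simp add: r_def)
  finally show "N a \<le> r0 / 2" .
  have "r (s k0) \<le> min 1 (1 / (16 * C)) / real (Suc (s k0))" by (simp add: r_def)
  also have "... \<le> 1 / (16 * C) / 1" using C by (intro frac_le) auto
  finally have "C * N a \<le> C * (1 / (16 * C))" using ra C by (intro mult_left_mono) auto
  thus "C * N a \<le> 1/16" using C by simp
 qed
 obtain k where k: "k \<ge> k0" "r (s k) \<le> N a / 16"
 proof -
  obtain k1 :: nat where k1: "1 / real (Suc k1) < N a / 16"
   using nat_approx_posE[of "N a / 16"] a(3) by auto
  define k where "k = max k0 k1"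
  have "k \<le> s k" using s by (rule seq_suble)
  hence "real (Suc k1) \<le> real (Suc (s k))" by (simp add: k_def)
  hence "min 1 (1 / (16 * C)) / real (Suc (s k)) \<le> 1 / real (Suc k1)"
   by (intro frac_le min.cobounded1) auto
  hence "r (s k) \<le> 1 / real (Suc k1)" unfolding r_def by (rule order_trans[OF min.cobounded2])
  thus ?thesis using that[of k] k1 by (simp add: k_def)
 qed
 define b where "b = e (s k)"
 have b: "b \<in> K" "N b > 0" "N b \<le> N a / 16" "b \<in> nb r0"
 proof -
  have "b \<in> nb (r (s k))" "r (s k) \<le> r0" using e(2) r0 by (auto simp: b_def r_def)
  thus "N b \<le> N a / 16" "b \<in> nb r0" using k(2) by (auto simp: nb_def)
 qed (auto simp: b_def e)
 \<comment> \<open>The largest exponent for which \<open>real m * N b\<close> does not exceed half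
   of \<open>N a\<close>; the rounding costs at most \<open>N b\<close>.\<close>
 define m where "m = nat \<lfloor>N a / (2 * N b)\<rfloor>"
 have m: "real m * N b \<le> N a / 2" "N a / 2 < real m * N b + N b"
 proof -
  have x0: "0 \<le> N a / (2 * N b)" by simp
  have m1: "real m \<le> N a / (2 * N b)" and m2: "N a / (2 * N b) < real m + 1"
   unfolding m_def using x0 by linarith+
  have "real m * N b \<le> N a / (2 * N b) * N b" "N a / (2 * N b) * N b < (real m + 1) * N b"
   using mult_right_mono[OF m1, of "N b"] mult_strict_right_mono[OF m2 b(2)] by simp_all
  thus "real m * N b \<le> N a / 2" "N a / 2 < real m * N b + N b"
   using b(2) by (simp_all add: algebra_simps)
 qed
 have mr: "real m * N b \<le> r0 / 2" using m(1) Na(1) a(3) by linarith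
 define f where "f = b [^] m"
 have f: "f \<in> nb r0" "nrm (\<lambda>i. \<psi> f i - real m * \<psi> b i) \<le> 2 * C * (real m * N b)\<^sup>2"
  using power_approx[OF b(4) mr] by (auto simp: f_def)
 have fK: "f \<in> K"
  unfolding f_def using K b(1) by (induction m) (auto simp: subgroup.one_closed subgroup.m_closed)
 have Nf: "N f \<le> N a" using power_norm[OF b(4) mr] m(1) a(3) unfolding f_def by linarith
 have sq: "2 * C * (real m * N b)\<^sup>2 \<le> 1/32 * N a"
 proof -
  have "(real m * N b)\<^sup>2 \<le> (N a / 2)\<^sup>2" using m(1) by (intro power_mono) auto
  hence "2 * C * (real m * N b)\<^sup>2 \<le> 2 * C * (N a / 2)\<^sup>2"
   using C by (intro mult_left_mono) auto
  also have "... = (C * N a) * N a / 2" by (simp add: power2_eq_square)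
  also have "... \<le> (1/16) * N a / 2" using Na(2) by (intro divide_right_mono mult_right_mono) auto
  finally show ?thesis by simp
 qed
 have mX: "nrm (\<lambda>i. (N a / 2) * X (s k) i - real m * \<psi> b i) \<le> N b"
 proof -
  have "nrm (\<lambda>i. (N a / 2) * X (s k) i - real m * \<psi> b i) = \<bar>N a / 2 / N b - real m\<bar> * nrm (\<psi> b)"
   by (rule nrm_scale) (simp add: X_def b_def[symmetric] algebra_simps)
  also have "... = \<bar>(N a / 2 / N b - real m) * N b\<bar>" by (simp add: abs_mult N_def[symmetric])
  also have "(N a / 2 / N b - real m) * N b = N a / 2 - real m * N b"
   using b(2) by (simp add: algebra_simps)
  also have "\<bar>...\<bar> \<le> N b" using m by (simp add: abs_le_iff)
  finally show ?thesis .
 qed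
 have XX: "nrm (\<lambda>i. X (s k0) i - X (s k) i) \<le> 1/16"
 proof -
  have "nrm (\<lambda>i. X (s k0) i - X (s k) i) \<le> (\<Sum>i<n. \<bar>X (s k0) i - X (s k) i\<bar>)"
   unfolding nrm_def by (rule L2_set_le_sum_abs)
  also have "... \<le> (\<Sum>i<n. 1 / (16 * real (Suc n)))"
  proof (rule sum_mono)
   fix i assume "i \<in> {..<n}"
   hence "dist (X (s k0) i) (l i) < 1 / (32 * real (Suc n))" "dist (X (s k) i) (l i) < 1 / (32 * real (Suc n))"
    using k0 k(1) by auto
   hence "\<bar>X (s k0) i - X (s k) i\<bar> \<le> 1 / (32 * real (Suc n)) + 1 / (32 * real (Suc n))"
    unfolding dist_real_def by linarith
   moreover have "1 / (32 * t) + 1 / (32 * t) = 1 / (16 * t)" for t :: real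
    by (cases "t = 0") (auto simp: field_simps)
   ultimately show "\<bar>X (s k0) i - X (s k) i\<bar> \<le> 1 / (16 * real (Suc n))" by metis
  qed
  also have "... \<le> 1/16" by (simp add: field_simps)
  finally show ?thesis .
 qed
 have aX: "\<psi> a i = N a * X (s k0) i" for i using a(3) by (simp add: X_def a_def)
 have "nrm (\<lambda>i. \<psi> a i - 2 * \<psi> f i) \<le> nrm (\<lambda>i. N a * (X (s k0) i - X (s k) i)) + nrm (\<lambda>i. N a * X (s k) i - 2 * \<psi> f i)"
  by (rule nrm_add) (simp add: aX algebra_simps)
 also have "nrm (\<lambda>i. N a * X (s k) i - 2 * \<psi> f i) \<le>
   nrm (\<lambda>i. 2 * ((N a / 2) * X (s k) i - real m * \<psi> b i)) + nrm (\<lambda>i. 2 * (\<psi> f i - real m * \<psi> b i))"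
  by (rule nrm_sub) (simp add: algebra_simps)
 also have "nrm (\<lambda>i. N a * (X (s k0) i - X (s k) i)) = \<bar>N a\<bar> * nrm (\<lambda>i. X (s k0) i - X (s k) i)"
  by (rule nrm_scale) simp
 also have "nrm (\<lambda>i. 2 * ((N a / 2) * X (s k) i - real m * \<psi> b i)) = \<bar>2\<bar> * nrm (\<lambda>i. (N a / 2) * X (s k) i - real m * \<psi> b i)"
  by (rule nrm_scale) simp
 also have "nrm (\<lambda>i. 2 * (\<psi> f i - real m * \<psi> b i)) = \<bar>2\<bar> * nrm (\<lambda>i. \<psi> f i - real m * \<psi> b i)"
  by (rule nrm_scale) simp
 finally have "nrm (\<lambda>i. \<psi> a i - 2 * \<psi> f i) \<le> N a * nrm (\<lambda>i. X (s k0) i - X (s k) i) + (2 * N b + 2 * (1/32 * N a))"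
  using mX f(2) sq a(3) by simp
 moreover have "N a * nrm (\<lambda>i. X (s k0) i - X (s k) i) \<le> N a * (1/16)"
  using XX a(3) by (intro mult_left_mono) auto
 \<comment> \<open>The budget of 1/4: 1/16 for the directions, 2/16 for the rounding with
   \<open>N b \<le> N a / 16\<close>, and 1/16 for twice the error of the power.\<close>
 ultimately have "nrm (\<lambda>i. \<psi> a i - 2 * \<psi> f i) \<le> 1/4 * N a" using b(3) by linarith
 hence "half a f" using f(1) Nf by (simp add: half_def nb_def)
 thus False using no[OF fK] by (simp add: a_def)
qed

end

section \<open>Square roots in closed subgroups and local sections of the coset map\<close>

context normed_chart
begin

lemma continuous_N: "rcmap (subtopology T U) N" unfolding N_def nrm_def L2_set_def
 by (intro continuous_map_sqrt continuous_map_sum continuous_map_real_pow \<psi>_continuous) auto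

lemma nb_closed: "s \<le> r0 ==> closedin T (nb s)" unfolding nb_def by (rule N_closed)

lemma nb_neighbourhood:
 assumes "openin T S" "\<one> \<in> S"
 obtains r where "r > 0" "r \<le> r0" "nb r \<subseteq> S"
proof -
 obtain r where r: "r > 0" "\<And>x. x \<in> U ==> N x < r ==> x \<in> S"
  using N_nbhd[OF assms] by blast
 show ?thesis by (rule that[of "min (r / 2) r0"]) (use r r0 in \<open>auto simp: nb_def\<close>)
qed

lemma open_N_less: "openin T {x \<in> U. N x < s}"
proof -
 have "openin (subtopology T U) {x \<in> topspace (subtopology T U). N x \<in> {..<s}}"
  by (rule openin_continuous_map_preimage[OF continuous_N]) auto
 moreover have "{x \<in> topspace (subtopology T U). N x \<in> {..<s}} = {x \<in> U. N x < s}"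
  using openin_subset[OF U(1)] by auto
 ultimately show ?thesis using U(1) openin_trans_full by metis
qed

lemma nb_preimage:
 assumes h: "continuous_map (prod_topology T T) T (\<lambda>(x, y). h x y)" and "h \<one> \<one> = \<one>" and s: "s > 0"
 obtains r where "r > 0" "r \<le> r0" "\<And>x y. x \<in> nb r ==> y \<in> nb r ==> h x y \<in> nb s"
proof -
 define P where "P = {z \<in> topspace (prod_topology T T). (case z of (x, y) => h x y) \<in> {x \<in> U. N x < s}}"
 have oP: "openin (prod_topology T T) P"
  unfolding P_def by (rule openin_continuous_map_preimage[OF h open_N_less])
 have mP: "(\<one>, \<one>) \<in> P" using assms(2) U N_one s by (simp add: P_def topspace_eq)
 obtain V W where VW: "openin T V" "openin T W" "\<one> \<in> V" "\<one> \<in> W" "V \<times> W \<subseteq> P"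
  using openin_prod_topology_alt[THEN iffD1, rule_format, OF oP mP] by metis
 obtain r where r: "r > 0" "r \<le> r0" "nb r \<subseteq> V \<inter> W"
  using nb_neighbourhood[OF openin_Int[OF VW(1,2)]] VW(3,4) by blast
 show ?thesis
 proof (rule that[OF r(1,2)])
  fix x y assume "x \<in> nb r" "y \<in> nb r"
  hence "(x, y) \<in> V \<times> W" using r(3) by blast
  thus "h x y \<in> nb s" using VW(5) by (auto simp: nb_def P_def)
 qed
qed

lemma continuous_product_chart:
 assumes s: "s \<le> r0"
 shows "rcmap (subtopology T (nb s)) (\<lambda>d. nrm (\<lambda>i. \<psi> (d \<otimes> d) i - \<psi> c i))"
proof -
 have id: "continuous_map (subtopology T (nb s)) T (\<lambda>x. x)"
  by (simp add: continuous_map_from_subtopology)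
 have "continuous_map (subtopology T (nb s)) (subtopology T U) (\<lambda>d. d \<otimes> d)"
  using continuous_map_mult[OF id id] nb_mono[OF s] mult_U' by (auto simp: continuous_map_in_subtopology)
 hence "rcmap (subtopology T (nb s)) (\<lambda>d. \<psi> (d \<otimes> d) i)" if "i < n" for i
  using continuous_map_compose[OF _ \<psi>_continuous[OF that]] by (fastforce simp: o_def)
 thus ?thesis unfolding nrm_def L2_set_def
  by (intro continuous_map_sqrt continuous_map_sum continuous_map_real_pow continuous_map_diff) auto
qed

lemma N_square:
 assumes "d \<in> nb r0"
 shows "31/16 * N d \<le> N (d \<otimes> d)"
proof -
 have "2 * N d = nrm (\<lambda>i. 2 * \<psi> d i)"
  unfolding N_def by (subst nrm_scale[of _ 2 "\<psi> d"]) auto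
 also have "... \<le> N (d \<otimes> d) + nrm (\<lambda>i. \<psi> (d \<otimes> d) i - \<psi> d i - \<psi> d i)"
  unfolding N_def by (rule nrm_sub) simp
 finally have "2 * N d \<le> N (d \<otimes> d) + C * N d * N d"
  using product_approx[OF assms assms] by linarith
 moreover have "C * N d * N d \<le> 1/16 * N d" using C_N[OF assms] by (rule mult_right_mono) simp
 ultimately show ?thesis by linarith
qed

text \<open>A Newton step: if \<open>f\<close> is about half of \<open>e\<close>, then the square of
  \<open>d \<otimes> f\<close> is close to \<open>d \<otimes> d \<otimes> e\<close>. The estimate
  \<open>mixed\<close> pays for the lack of commutativity. The errors stay below 3/4 of
  \<open>N e\<close>, while the old distance was at least 15/16 of it.\<close>

lemma improve_square_root:
 assumes d: "d \<in> nb (r0/4)" and e: "e \<in> nb (r0/4)" and f: "f \<in> nb (r0/4)"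
  and pos: "N e > 0" and fe: "N f \<le> N e" and half: "nrm (\<lambda>i. \<psi> e i - 2 * \<psi> f i) \<le> 1/4 * N e"
 shows "nrm (\<lambda>i. \<psi> ((d \<otimes> f) \<otimes> (d \<otimes> f)) i - \<psi> (d \<otimes> d \<otimes> e) i) < nrm (\<lambda>i. \<psi> (d \<otimes> d) i - \<psi> (d \<otimes> d \<otimes> e) i)"
proof -
 have G: "d \<in> carrier G" "e \<in> carrier G" "f \<in> carrier G" using d e f nb_carrier by blast+
 have big: "d \<in> nb r0" "e \<in> nb r0" "f \<in> nb r0" using d e f r0 by (auto intro: nb_mono[of "r0/4"])
 have Nd: "N d \<le> r0/4" "N e \<le> r0/4" "N f \<le> r0/4" using d e f by (auto simp: nb_def)
 define x where "x = d \<otimes> f"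
 have x: "x \<in> nb r0" "x \<in> carrier G"
 proof -
  have "N x \<le> r0" unfolding x_def using product_diff(3)[OF big(1,3)] Nd r0 by linarith
  thus "x \<in> nb r0" using mult_U'[OF big(1,3)] by (simp add: nb_def x_def)
 qed (use G x_def in auto)
 have Nx: "N x \<le> 33/64 * r0" unfolding x_def using product_diff(3)[OF big(1,3)] Nd by linarith
 have xd: "x \<otimes> d \<in> nb r0"
 proof -
  have "N (x \<otimes> d) \<le> r0" using product_diff(3)[OF x(1) big(1)] Nx Nd r0 by linarith
  thus ?thesis using mult_U'[OF x(1) big(1)] by (simp add: nb_def)
 qed
 have dd: "d \<otimes> d \<in> nb r0"
 proof -
  have "N (d \<otimes> d) \<le> r0" using product_diff(3)[OF big(1,1)] Nd r0 by linarith
  thus ?thesis using mult_U'[OF big(1,1)] by (simp add: nb_def)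
 qed
 have C16: "C * t * N e' \<le> 1/16 * N e'" if "C * t \<le> 1/16" for t e'
  using that by (rule mult_right_mono) simp
 have E1: "nrm (\<lambda>i. \<psi> (d \<otimes> d \<otimes> e) i - \<psi> (d \<otimes> d) i - \<psi> e i) \<le> 1/16 * N e"
  using product_approx[OF dd big(2)] C16[OF C_N[OF dd]] by (rule order_trans)
 have E2: "nrm (\<lambda>i. \<psi> (x \<otimes> d \<otimes> f) i - \<psi> (x \<otimes> d) i - \<psi> f i) \<le> 1/16 * N e"
  using product_approx[OF xd big(3)] C16[OF C_N[OF xd], of f] fe by linarith
 have E4: "nrm (\<lambda>i. \<psi> x i - \<psi> d i - \<psi> f i) \<le> 1/16 * N e"
  using product_approx[OF big(1,3)] C16[OF C_N[OF big(1)], of f] fe unfolding x_def by linarith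
 have E3: "nrm (\<lambda>i. (\<psi> (x \<otimes> d) i - \<psi> x i) - (\<psi> (d \<otimes> d) i - \<psi> d i)) \<le> 17/256 * N e"
 proof -
  have "nrm (\<lambda>i. (\<psi> (x \<otimes> d) i - \<psi> x i) - (\<psi> (d \<otimes> d) i - \<psi> d i)) \<le> C * nrm (\<lambda>i. \<psi> x i - \<psi> d i) * N d"
   by (rule mixed'[OF x(1) big(1,1)])
  also have "... = (C * N d) * nrm (\<lambda>i. \<psi> x i - \<psi> d i)" by simp
  also have "... \<le> 1/16 * (17/16 * N f)"
   using C_N[OF big(1)] product_diff(1)[OF big(1,3)] C unfolding x_def by (intro mult_mono) auto
  finally show ?thesis using fe by linarith
 qed
 have xx: "x \<otimes> d \<otimes> f = x \<otimes> x" using G by (simp add: x_def m_assoc)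
 have "nrm (\<lambda>i. \<psi> (x \<otimes> x) i - \<psi> (d \<otimes> d \<otimes> e) i) \<le>
   nrm (\<lambda>i. (\<psi> (x \<otimes> d \<otimes> f) i - \<psi> (x \<otimes> d) i - \<psi> f i) + ((\<psi> (x \<otimes> d) i - \<psi> x i) - (\<psi> (d \<otimes> d) i - \<psi> d i)) + (\<psi> x i - \<psi> d i - \<psi> f i))
   + nrm (\<lambda>i. (\<psi> (d \<otimes> d \<otimes> e) i - \<psi> (d \<otimes> d) i - \<psi> e i) + (\<psi> e i - 2 * \<psi> f i))"
  unfolding xx by (rule nrm_sub) simp
 also have "nrm (\<lambda>i. (\<psi> (x \<otimes> d \<otimes> f) i - \<psi> (x \<otimes> d) i - \<psi> f i) + ((\<psi> (x \<otimes> d) i - \<psi> x i) - (\<psi> (d \<otimes> d) i - \<psi> d i)) + (\<psi> x i - \<psi> d i - \<psi> f i))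
   \<le> nrm (\<lambda>i. (\<psi> (x \<otimes> d \<otimes> f) i - \<psi> (x \<otimes> d) i - \<psi> f i) + ((\<psi> (x \<otimes> d) i - \<psi> x i) - (\<psi> (d \<otimes> d) i - \<psi> d i))) + nrm (\<lambda>i. \<psi> x i - \<psi> d i - \<psi> f i)"
  by (rule nrm_add) simp
 also have "nrm (\<lambda>i. (\<psi> (x \<otimes> d \<otimes> f) i - \<psi> (x \<otimes> d) i - \<psi> f i) + ((\<psi> (x \<otimes> d) i - \<psi> x i) - (\<psi> (d \<otimes> d) i - \<psi> d i)))
   \<le> nrm (\<lambda>i. \<psi> (x \<otimes> d \<otimes> f) i - \<psi> (x \<otimes> d) i - \<psi> f i) + nrm (\<lambda>i. (\<psi> (x \<otimes> d) i - \<psi> x i) - (\<psi> (d \<otimes> d) i - \<psi> d i))"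
  by (rule nrm_add) simp
 also have "nrm (\<lambda>i. (\<psi> (d \<otimes> d \<otimes> e) i - \<psi> (d \<otimes> d) i - \<psi> e i) + (\<psi> e i - 2 * \<psi> f i)) \<le>
   nrm (\<lambda>i. \<psi> (d \<otimes> d \<otimes> e) i - \<psi> (d \<otimes> d) i - \<psi> e i) + nrm (\<lambda>i. \<psi> e i - 2 * \<psi> f i)"
  by (rule nrm_add) simp
 finally have "nrm (\<lambda>i. \<psi> (x \<otimes> x) i - \<psi> (d \<otimes> d \<otimes> e) i) \<le> 3/4 * N e"
  using E1 E2 E3 E4 half pos by simp
 also have "... < 15/16 * N e" using pos by simp
 also have "... \<le> nrm (\<lambda>i. \<psi> (d \<otimes> d) i - \<psi> (d \<otimes> d \<otimes> e) i)"
  using product_diff(2)[OF dd big(2)] by (subst nrm_diff_swap)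
 finally show ?thesis by (simp add: x_def)
qed

text \<open>Among the \<open>d\<close> in a compact piece of \<open>K\<close>, take one whose square
  is closest to \<open>c\<close>. If its square were not \<open>c\<close>, multiplying
  \<open>d\<close> by an approximate half of the defect would bring it closer.\<close>

lemma square_roots:
 assumes K: "subgroup K G" "closedin T K"
 obtains t where "t > 0" "\<And>c. c \<in> K ==> c \<in> nb t ==> \<exists>d\<in>K. d \<in> nb (r0/4) \<and> d \<otimes> d = c"
proof -
 obtain r where r: "r > 0" and halves: "\<And>e. e \<in> K ==> e \<in> nb r ==> N e > 0 ==>
  \<exists>f\<in>K. f \<in> U \<and> N f \<le> N e \<and> nrm (\<lambda>i. \<psi> e i - 2 * \<psi> f i) \<le> 1/4 * N e"
  using approximate_halves[OF K(1)] by metis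
 define h where "h d c = inv (d \<otimes> d) \<otimes> c" for d c
 have ch: "continuous_map (prod_topology T T) T (\<lambda>(d, c). h d c)" unfolding case_prod_unfold h_def
  by (intro continuous_map_mult continuous_map_inverse continuous_map_fst continuous_map_snd)
 have h1: "h \<one> \<one> = \<one>" by (simp add: h_def)
 have mpos: "min r (r0/4) > 0" using r r0 by simp
 obtain s0 where s0: "s0 > 0" "s0 \<le> r0" "\<And>d c. d \<in> nb s0 ==> c \<in> nb s0 ==> h d c \<in> nb (min r (r0/4))"
  using nb_preimage[of h, OF ch h1 mpos] by metis
 define s where "s = min s0 (r0/4)"
 have s: "s > 0" "s \<le> s0" "s \<le> r0/4" "s \<le> r0" using s0 r0 by (auto simp: s_def)
 show ?thesis
 proof (rule that[of "s/4"])
  show "s/4 > 0" using s by simp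
  fix c assume cK: "c \<in> K" and c: "c \<in> nb (s/4)"
  define \<Delta> where "\<Delta> d = nrm (\<lambda>i. \<psi> (d \<otimes> d) i - \<psi> c i)" for d
  define S where "S = K \<inter> nb s"
  have clS: "closedin T S" unfolding S_def using K(2) nb_closed[OF s(4)] by (rule closedin_Int)
  hence compS: "compactin T S" using compact_T closedin_compact_space by blast
  have "rcmap (subtopology T S) \<Delta>" unfolding \<Delta>_def S_def
   by (rule continuous_map_from_subtopology_mono[OF continuous_product_chart[OF s(4)]]) auto
  hence "compactin euclideanreal (\<Delta> ` S)"
   using image_compactin[of "subtopology T S" S euclideanreal \<Delta>] compS by (simp add: compactin_subtopology)
  hence "compact (\<Delta> ` S)" by simp
  moreover have oneS: "\<one> \<in> S" using s K by (simp add: S_def one_nb subgroup.one_closed)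
  ultimately obtain d where d: "d \<in> S" and min: "\<And>d'. d' \<in> S ==> \<Delta> d \<le> \<Delta> d'"
   using compact_attains_inf[of "\<Delta> ` S"] by auto
  have dK: "d \<in> K" and ds: "d \<in> nb s" "d \<in> nb r0" "d \<in> nb (r0/4)" and dG: "d \<in> carrier G"
   using d nb_mono[OF s(4)] nb_mono[OF s(3)] nb_carrier by (auto simp: S_def)
  have cG: "c \<in> carrier G" by (rule nb_carrier[OF c])
  have N1: "\<Delta> \<one> = N c"
   unfolding \<Delta>_def N_def by (subst nrm_scale[of _ "-1" "\<psi> c"]) (auto simp: \<psi>_one)
  have Nc: "N c \<le> s/4" using c by (simp add: nb_def)
  have D1: "\<Delta> d \<le> s/4" using min[OF oneS] N1 Nc by linarith
  have "N (d \<otimes> d) \<le> \<Delta> d + N c" unfolding \<Delta>_def N_def by (rule nrm_add) simp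
  hence Nd: "N d \<le> 16/31 * (s/2)" using N_square[OF ds(2)] D1 Nc by linarith
  define e where "e = h d c"
  have e: "e \<in> nb r" "e \<in> nb (r0/4)"
  proof -
   have "c \<in> nb s0" "d \<in> nb s0" using nb_mono[of "s/4" s0 c] nb_mono[of s s0 d] c ds(1) s by auto
   hence "e \<in> nb (min r (r0/4))" unfolding e_def by (intro s0(3))
   thus "e \<in> nb r" "e \<in> nb (r0/4)" by (auto simp: nb_def)
  qed
  have eK: "e \<in> K" using K(1) dK cK by (simp add: e_def h_def subgroup.m_closed subgroup.m_inv_closed)
  have dde: "d \<otimes> d \<otimes> e = c" using dG cG by (simp add: e_def h_def m_assoc[symmetric])
  have "N e = 0"
  proof (rule ccontr)
   assume "N e \<noteq> 0"
   hence pos: "N e > 0" using N_nonneg[of e] by linarith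
   obtain f where f: "f \<in> K" "f \<in> U" "N f \<le> N e" "nrm (\<lambda>i. \<psi> e i - 2 * \<psi> f i) \<le> 1/4 * N e"
    using halves[OF eK e(1) pos] by blast
   have f4: "f \<in> nb (r0/4)" "f \<in> nb r0" using f(2,3) e(2) r0 by (auto simp: nb_def)
   have dd: "d \<otimes> d \<in> nb r0"
    using mult_U'[OF ds(2,2)] product_diff(3)[OF ds(2,2)] ds(3) r0 by (auto simp: nb_def)
   \<comment> \<open>The defect is short because the distance is; consequently
     \<open>d \<otimes> f\<close> stays in the compact set on which \<open>d\<close> is
     minimal.\<close>
   have "15/16 * N e \<le> \<Delta> d" using product_diff(2)[OF dd, of e] nb_mono[of "r0/4" r0 e] e(2) r0
    unfolding \<Delta>_def dde by (subst nrm_diff_swap) auto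
   hence "N f \<le> 16/15 * (s/4)" using f(3) D1 by linarith
   hence "N (d \<otimes> f) \<le> s" using product_diff(3)[OF ds(2) f4(2)] Nd s(1) by linarith
   hence "d \<otimes> f \<in> S"
    using mult_U'[OF ds(2) f4(2)] K(1) dK f(1) by (simp add: S_def nb_def subgroup.m_closed)
   from min[OF this] show False
    using improve_square_root[OF ds(3) e(2) f4(1) pos f(3,4)] unfolding \<Delta>_def dde by simp
  qed
  hence "e = \<one>" using N_zero e(1) by (simp add: nb_def)
  hence "d \<otimes> d = c" using dde dG by simp
  thus "\<exists>d\<in>K. d \<in> nb (r0/4) \<and> d \<otimes> d = c" using dK ds(3) by blast
 qed
qed

text \<open>Midpoints: if \<open>a\<close> and \<open>a \<otimes> d \<otimes> d\<close> have the same norm, the strict convexity of the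
 Euclidean norm makes \<open>a \<otimes> d\<close> strictly smaller.\<close>

lemma midpoint_smaller:
 assumes a: "a \<in> nb (r0/4)" and d: "d \<in> nb (r0/4)" and b: "a \<otimes> d \<otimes> d \<in> U"
  and eq: "N (a \<otimes> d \<otimes> d) = N a" and pos: "N d > 0"
 shows "a \<otimes> d \<in> U" "N (a \<otimes> d) < N a"
proof -
 have big: "a \<in> nb r0" "d \<in> nb r0" using a d r0 by (auto intro: nb_mono[of "r0/4"])
 have Na: "N a \<le> r0/4" "N d \<le> r0/4" using a d by (auto simp: nb_def)
 show adU: "a \<otimes> d \<in> U" by (rule mult_U'[OF big])
 hence ad: "a \<otimes> d \<in> nb r0" using product_diff(3)[OF big] Na r0 by (simp add: nb_def)
 have G: "a \<in> carrier G" "d \<in> carrier G" using big nb_carrier by blast+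
 have dd: "d \<otimes> d \<in> nb r0"
  using mult_U'[OF big(2,2)] product_diff(3)[OF big(2,2)] Na r0 by (auto simp: nb_def)
 define x y z where "x = \<psi> a" and "y = \<psi> (a \<otimes> d)" and "z = \<psi> (a \<otimes> d \<otimes> d)"
 define m where "m i = (x i + z i) / 2" for i
 \<comment> \<open>The deviation of \<open>a \<otimes> d\<close> from the midpoint in coordinates is
   half a second difference along \<open>d\<close>, hence quadratic in \<open>N d\<close>.\<close>
 have second: "nrm (\<lambda>i. y i - m i) \<le> 17/32 * C * (N d)\<^sup>2"
 proof -
  have "nrm (\<lambda>i. y i - m i) = \<bar>1/2\<bar> * nrm (\<lambda>i. (y i - x i) - (z i - y i))"
   by (rule nrm_scale) (simp add: m_def field_simps)
  also have "nrm (\<lambda>i. (y i - x i) - (z i - y i)) = nrm (\<lambda>i. (z i - y i) - (y i - x i))"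
   by (rule nrm_diff_swap)
  also have "... \<le> C * nrm (\<lambda>i. y i - x i) * N d"
   unfolding x_def y_def z_def by (rule mixed'[OF ad big])
  also have "... \<le> C * (17/16 * N d) * N d"
   using product_diff(1)[OF big] C unfolding x_def y_def by (intro mult_right_mono mult_left_mono) auto
  finally show ?thesis by (simp add: power2_eq_square)
 qed
 have zx: "nrm (\<lambda>i. z i - x i) \<ge> N d"
 proof -
  have "nrm (\<lambda>i. z i - x i) \<ge> 15/16 * N (d \<otimes> d)"
   using product_diff(2)[OF big(1) dd] G by (simp add: z_def x_def m_assoc)
  thus ?thesis using N_square[OF big(2)] pos by linarith
 qed
 \<comment> \<open>The parallelogram law: the coordinate midpoint of two vectors of equal norm gains
   a quarter of their squared distance.\<close>
 have sq: "(nrm v)\<^sup>2 = (\<Sum>i<n. (v i)\<^sup>2)" for v by (simp add: nrm_def L2_set_def sum_nonneg)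
 have "(nrm m)\<^sup>2 = (\<Sum>i<n. 1/2 * (x i)\<^sup>2 + 1/2 * (z i)\<^sup>2 - 1/4 * (z i - x i)\<^sup>2)"
  unfolding sq by (intro sum.cong) (auto simp: m_def power2_eq_square field_simps)
 also have "... = 1/2 * (nrm x)\<^sup>2 + 1/2 * (nrm z)\<^sup>2 - 1/4 * (nrm (\<lambda>i. z i - x i))\<^sup>2"
  unfolding sq by (simp only: sum.distrib sum_subtractf sum_distrib_left)
 also have "... \<le> (N a)\<^sup>2 - 1/4 * (N d)\<^sup>2"
 proof -
  have "nrm x = N a" "nrm z = N a" using eq by (auto simp: x_def z_def N_def)
  moreover have "(N d)\<^sup>2 \<le> (nrm (\<lambda>i. z i - x i))\<^sup>2"
   using zx by (rule power_mono) simp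
  ultimately show ?thesis by simp
 qed
 finally have m2: "(nrm m)\<^sup>2 \<le> (N a)\<^sup>2 - 1/4 * (N d)\<^sup>2" .
 have mle: "nrm m \<le> N a"
 proof (rule power2_le_imp_le)
  show "(nrm m)\<^sup>2 \<le> (N a)\<^sup>2" using m2 zero_le_power2[of "N d"] by linarith
 qed simp
 define \<eta> where "\<eta> = C * (N d)\<^sup>2"
 have \<eta>0: "\<eta> \<ge> 0" using C by (simp add: \<eta>_def)
 have Ny: "N (a \<otimes> d) \<le> nrm m + \<eta>"
 proof -
  have "N (a \<otimes> d) \<le> nrm m + nrm (\<lambda>i. y i - m i)"
   unfolding N_def y_def[symmetric] by (rule nrm_add) simp
  moreover have "17/32 * C * (N d)\<^sup>2 \<le> \<eta>" using \<eta>0 by (simp add: \<eta>_def)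
  ultimately show ?thesis using second by linarith
 qed
 have "(N (a \<otimes> d))\<^sup>2 \<le> (nrm m + \<eta>)\<^sup>2" using Ny by (rule power_mono) simp
 also have "... = (nrm m)\<^sup>2 + (2 * nrm m + \<eta>) * \<eta>"
  by (simp add: power2_eq_square algebra_simps)
 \<comment> \<open>Curvature of the chart costs 3/16 of the square of \<open>N d\<close>, less than
   the gain of 1/4 from convexity.\<close>
 also have "... \<le> (N a)\<^sup>2 - 1/4 * (N d)\<^sup>2 + 3/16 * (N d)\<^sup>2"
 proof -
  have "C * N d \<le> 1/16" "C * N a \<le> 1/16" using C_N big by blast+
  have "\<eta> \<le> 1/16 * N d"
   using mult_right_mono[OF \<open>C * N d \<le> 1/16\<close>, of "N d"] by (simp add: \<eta>_def power2_eq_square mult.assoc)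
  hence "C * (2 * nrm m + \<eta>) \<le> C * (2 * N a + 1/16 * N d)"
   using mle C by (intro mult_left_mono) auto
  also have "... \<le> 3/16"
   using \<open>C * N d \<le> 1/16\<close> \<open>C * N a \<le> 1/16\<close> by (simp add: algebra_simps)
  finally have "C * (2 * nrm m + \<eta>) * (N d)\<^sup>2 \<le> 3/16 * (N d)\<^sup>2"
   by (rule mult_right_mono) simp
  thus ?thesis using m2 by (simp add: \<eta>_def mult_ac)
 qed
 also have "... < (N a)\<^sup>2" using pos by simp
 finally show "N (a \<otimes> d) < N a" by (rule power2_less_imp_less) simp
qed

text \<open>Two shortest elements of a coset differ by a small element of \<open>K\<close>; with a
  square root \<open>d\<close> of it in \<open>K\<close>, the element \<open>a \<otimes> d\<close>
  of the same coset would be shorter.\<close>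

lemma unique_minimiser:
 assumes K: "subgroup K G" "closedin T K"
 obtains q where "q > 0" "q \<le> r0" "\<And>a b. a \<in> nb q ==> b \<in> nb q ==> inv a \<otimes> b \<in> K ==>
  (\<And>k. k \<in> K ==> a \<otimes> k \<in> U ==> N a \<le> N (a \<otimes> k)) ==> N b = N a ==> b = a"
proof -
 obtain t where t: "t > 0" "\<And>c. c \<in> K ==> c \<in> nb t ==> \<exists>d\<in>K. d \<in> nb (r0/4) \<and> d \<otimes> d = c"
  using square_roots[OF K] by metis
 have "continuous_map (prod_topology T T) T (\<lambda>(a, b). inv a \<otimes> b)" unfolding case_prod_unfold
  by (intro continuous_map_mult continuous_map_inverse continuous_map_fst continuous_map_snd)
 from nb_preimage[OF this _ t(1)] obtain q where q: "q > 0" "q \<le> r0" "\<And>a b. a \<in> nb q ==> b \<in> nb q ==> inv a \<otimes> b \<in> nb t"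
  by auto
 show ?thesis
 proof (rule that[of "min q (r0/4)"])
  show "min q (r0/4) > 0" "min q (r0/4) \<le> r0" using q r0 by auto
  fix a b assume a: "a \<in> nb (min q (r0/4))" and b: "b \<in> nb (min q (r0/4))" and cK: "inv a \<otimes> b \<in> K"
   and min: "\<And>k. k \<in> K ==> a \<otimes> k \<in> U ==> N a \<le> N (a \<otimes> k)" and eq: "N b = N a"
  have a': "a \<in> nb q" "a \<in> nb (r0/4)" "b \<in> nb q" "b \<in> U" using a b by (auto simp: nb_def)
  have G: "a \<in> carrier G" "b \<in> carrier G" using a b nb_carrier by blast+
  obtain d where d: "d \<in> K" "d \<in> nb (r0/4)" "d \<otimes> d = inv a \<otimes> b"
   using t(2)[OF cK q(3)[OF a'(1,3)]] by blast
  have dG: "d \<in> carrier G" by (rule nb_carrier[OF d(2)])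
  have add: "a \<otimes> d \<otimes> d = b"
   using G dG d(3) by (simp add: m_assoc) (simp add: m_assoc[symmetric])
  have "N d = 0"
  proof (rule ccontr)
   assume "N d \<noteq> 0"
   hence pos: "N d > 0" using N_nonneg[of d] by linarith
   have "a \<otimes> d \<in> U" "N (a \<otimes> d) < N a"
    using midpoint_smaller[OF a'(2) d(2) _ _ pos] add a'(4) eq by auto
   thus False using min[OF d(1)] by simp
  qed
  hence "d = \<one>" using N_zero d(2) by (simp add: nb_def)
  thus "b = a" using add G by simp
 qed
qed

text \<open>The section sends a coset near \<open>K\<close> to its unique element of least norm.\<close>

lemma local_section_at_base:
 assumes K: "subgroup K G" "closedin T K"
 obtains \<Omega> \<sigma> where "openin (coset_space G T K) \<Omega>" "K \<in> \<Omega>"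
  "continuous_map (subtopology (coset_space G T K) \<Omega>) T \<sigma>"
  "\<And>y. y \<in> \<Omega> ==> \<sigma> y \<in> carrier G \<and> \<sigma> y <# K = y"
proof -
 let ?X = "coset_space G T K"
 obtain q where q: "q > 0" "q \<le> r0" and uniq: "\<And>a b. a \<in> nb q ==> b \<in> nb q ==> inv a \<otimes> b \<in> K ==>
  (\<And>k. k \<in> K ==> a \<otimes> k \<in> U ==> N a \<le> N (a \<otimes> k)) ==> N b = N a ==> b = a"
  using unique_minimiser[OF K] by metis
 define pr where "pr g = g <# K" for g
 \<comment> \<open>Cosets meeting the open ball: the set is open, and minimisation over the closed
   ball of radius \<open>q\<close> ends strictly inside.\<close>
 define \<Omega> where "\<Omega> = pr ` {x \<in> U. N x < q}"
 have opr: "openin ?X (pr ` V)" if "openin T V" for V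
  using open_map_coset[OF K(1)] that unfolding open_map_def pr_def by blast
 have cpr: "continuous_map T ?X pr" unfolding pr_def by (rule continuous_map_coset)
 have hX: "Hausdorff_space ?X" by (rule Hausdorff_coset_space[OF K])
 have UG: "x \<in> carrier G" if "x \<in> U" for x using that openin_subset[OF U(1)] topspace_eq by blast
 have o\<Omega>: "openin ?X \<Omega>" unfolding \<Omega>_def by (rule opr[OF open_N_less])
 have K\<Omega>: "K \<in> \<Omega>"
 proof -
  have "pr \<one> = K" unfolding pr_def using K(1) by (simp add: lcos_mult_one subgroup.subset)
  thus ?thesis unfolding \<Omega>_def using U(2) N_one q(1) by force
 qed
 define mini where "mini y a \<longleftrightarrow> a \<in> nb q \<and> pr a = y \<and> (\<forall>b\<in>nb q. pr b = y \<longrightarrow> N a \<le> N b)" for y a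
 have pr_eq: "pr a = pr b \<longleftrightarrow> inv a \<otimes> b \<in> K" if "a \<in> carrier G" "b \<in> carrier G" for a b
  unfolding pr_def by (rule l_coset_eq_iff[OF K(1) that])
 have Nnb: "rcmap (subtopology T S) N" if "S \<subseteq> nb q" for S
  using continuous_map_from_subtopology_mono[OF continuous_N] that by (auto simp: nb_def)
 have attains: "\<exists>a\<in>S. \<forall>b\<in>S. N a \<le> N b" if S: "closedin T S" "S \<subseteq> nb q" "S \<noteq> {}" for S
 proof -
  have "compactin T S" using S(1) compact_T closedin_compact_space by blast
  hence "compact (N ` S)"
   using image_compactin[of "subtopology T S" S euclideanreal N] Nnb[OF S(2)] by (simp add: compactin_subtopology)
  thus ?thesis using compact_attains_inf[of "N ` S"] S(3) by auto
 qed
 have fib: "closedin T {x \<in> topspace T. pr x \<in> {y}}" if "y \<in> topspace ?X" for y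
  by (intro closedin_continuous_map_preimage[OF cpr]) (use that hX in \<open>simp add: closedin_Hausdorff_sing_eq\<close>)
 have \<Omega>X: "y \<in> topspace ?X" if "y \<in> \<Omega>" for y
  using that openin_subset[OF o\<Omega>] by blast
 have ex: "\<exists>a. mini y a" if y: "y \<in> \<Omega>" for y
 proof -
  obtain x where x: "x \<in> U" "N x < q" "y = pr x" using y unfolding \<Omega>_def by blast
  define S where "S = nb q \<inter> {x \<in> topspace T. pr x \<in> {y}}"
  have "closedin T S" unfolding S_def by (intro closedin_Int nb_closed q fib \<Omega>X y)
  moreover have "x \<in> S" using x UG by (auto simp: S_def nb_def topspace_eq)
  ultimately obtain a where a: "a \<in> S" "\<forall>b\<in>S. N a \<le> N b"
   using attains[of S] by (auto simp: S_def)
  thus ?thesis using nb_carrier by (intro exI[of _ a]) (auto simp: mini_def S_def topspace_eq)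
 qed
 \<comment> \<open>Strictness ensures that elements of the coset outside the ball, too, are longer
   than the minimiser.\<close>
 have lt: "N a < q" if y: "y \<in> \<Omega>" and m: "mini y a" for y a
 proof -
  obtain x where "x \<in> U" "N x < q" "y = pr x" using y unfolding \<Omega>_def by blast
  hence "N a \<le> N x" using m UG by (auto simp: mini_def nb_def)
  thus ?thesis using \<open>N x < q\<close> by linarith
 qed
 have unique: "b = a" if y: "y \<in> \<Omega>" and a: "mini y a" and b: "b \<in> nb q" "pr b = y" "N b \<le> N a" for y a b
 proof (rule uniq)
  show "a \<in> nb q" "b \<in> nb q" using a b by (auto simp: mini_def)
  hence G: "a \<in> carrier G" "b \<in> carrier G" using nb_carrier by blast+
  show "inv a \<otimes> b \<in> K" using pr_eq[OF G] a b by (simp add: mini_def)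
  show "N b = N a" using a b by (auto simp: mini_def intro: antisym)
  fix k assume k: "k \<in> K" "a \<otimes> k \<in> U"
  have kG: "k \<in> carrier G" using K(1) k(1) by (rule subgroup.mem_carrier)
  have "pr (a \<otimes> k) = y"
   using pr_eq[OF G(1), of "a \<otimes> k"] k(1) G kG a by (simp add: m_assoc[symmetric] mini_def)
  thus "N a \<le> N (a \<otimes> k)"
   using a k(2) lt[OF y a] by (cases "N (a \<otimes> k) \<le> q") (auto simp: mini_def nb_def)
 qed
 define \<sigma> where "\<sigma> y = (SOME a. mini y a)" for y
 have \<sigma>: "mini y (\<sigma> y)" if "y \<in> \<Omega>" for y
  unfolding \<sigma>_def using ex[OF that] by (rule someI_ex)
 have \<sigma>G: "\<sigma> y \<in> carrier G" if "y \<in> \<Omega>" for y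
  using \<sigma>[OF that] nb_carrier by (auto simp: mini_def)
 have t\<Omega>: "topspace (subtopology ?X \<Omega>) = \<Omega>" using \<Omega>X by auto
 have "continuous_map (subtopology ?X \<Omega>) T \<sigma>" unfolding continuous_map t\<Omega>
 proof (intro conjI allI impI)
  show "\<sigma> ` \<Omega> \<subseteq> topspace T" using \<sigma>G by (auto simp: topspace_eq)
  fix V assume V: "openin T V"
  have "\<exists>W. openin ?X W \<and> y0 \<in> W \<and> (\<forall>y\<in>W \<inter> \<Omega>. \<sigma> y \<in> V)" if y0: "y0 \<in> \<Omega>" "\<sigma> y0 \<in> V" for y0
  proof -
   define v where "v = N (\<sigma> y0)"
   have vq: "v < q" unfolding v_def by (rule lt[OF y0(1) \<sigma>[OF y0(1)]])
   define S where "S = (nb q - V) \<inter> {x \<in> topspace T. pr x \<in> {y0}}"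
   have clV: "closedin T (nb q - V)" by (intro closedin_diff nb_closed q V)
   have clS: "closedin T S" unfolding S_def by (intro closedin_Int clV fib \<Omega>X y0)
   have gt: "v < N b" if "b \<in> S" for b
   proof (rule ccontr)
    assume "\<not> v < N b"
    hence "b = \<sigma> y0"
     using that by (intro unique[OF y0(1) \<sigma>[OF y0(1)]]) (auto simp: S_def v_def)
    thus False using that y0(2) by (auto simp: S_def)
   qed
   \<comment> \<open>A level above the minimum \<open>v\<close> but below the norm of every
     competitor in the coset \<open>y0\<close> that lies in the ball and outside \<open>V\<close>;
     without competitors \<open>q\<close> itself serves.\<close>
   obtain v' where v': "v < v'" "v' \<le> q" "\<And>b. b \<in> S ==> v' < N b"
   proof (cases "S = {}")
    case True
    thus ?thesis using that[of q] vq by auto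
   next
    case False
    then obtain b where b: "b \<in> S" "\<forall>c\<in>S. N b \<le> N c"
     using attains[OF clS] by (auto simp: S_def)
    hence vb: "v < N b" "N b \<le> q" using gt by (auto simp: S_def nb_def)
    have "(v + N b) / 2 < N c" if c: "c \<in> S" for c
     using b(2) c vb(1) by (auto simp: field_simps dest!: bspec)
    thus ?thesis using that[of "(v + N b) / 2"] vb by auto
   qed
   \<comment> \<open>Points outside \<open>V\<close> of norm at most \<open>v'\<close>. Their image
     is compact, hence closed, and misses \<open>y0\<close>; for a coset off this image that
     contains an element shorter than \<open>v'\<close>, the minimiser must lie in
     \<open>V\<close>.\<close>
   define Bad where "Bad = (nb q - V) \<inter> nb v'"
   have "closedin T Bad" unfolding Bad_def using v' q by (intro closedin_Int clV nb_closed) auto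
   hence "compactin T Bad" using compact_T closedin_compact_space by blast
   hence "compactin ?X (pr ` Bad)" by (rule image_compactin[OF _ cpr])
   hence clB: "closedin ?X (pr ` Bad)" by (rule compactin_imp_closedin[OF hX])
   have y0B: "y0 \<notin> pr ` Bad"
   proof
    assume "y0 \<in> pr ` Bad"
    then obtain b where b: "b \<in> Bad" "y0 = pr b" by blast
    hence "b \<in> S" using nb_carrier by (auto simp: S_def Bad_def topspace_eq)
    thus False using v'(3)[of b] b(1) by (auto simp: Bad_def nb_def)
   qed
   define W where "W = (topspace ?X - pr ` Bad) \<inter> pr ` {x \<in> U. N x < v'}"
   have "openin ?X W"
    unfolding W_def using clB by (intro openin_Int opr open_N_less) (simp add: closedin_def)
   moreover have "y0 \<in> W"
   proof -
    have "\<sigma> y0 \<in> U" "pr (\<sigma> y0) = y0" "N (\<sigma> y0) < v'"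
     using \<sigma>[OF y0(1)] v'(1) by (auto simp: mini_def nb_def v_def)
    hence "y0 \<in> pr ` {x \<in> U. N x < v'}" by (intro image_eqI[of _ _ "\<sigma> y0"]) auto
    thus ?thesis using y0B \<Omega>X[OF y0(1)] by (simp add: W_def)
   qed
   moreover have "\<sigma> y \<in> V" if y: "y \<in> W \<inter> \<Omega>" for y
   proof (rule ccontr)
    assume nV: "\<sigma> y \<notin> V"
    obtain x where x: "x \<in> U" "N x < v'" "y = pr x" using y unfolding W_def by blast
    have m: "mini y (\<sigma> y)" using \<sigma> y by blast
    have "x \<in> nb q" using x v'(2) by (simp add: nb_def)
    hence "N (\<sigma> y) \<le> N x" using m x(3) by (auto simp: mini_def)
    hence "\<sigma> y \<in> Bad" using m x(2) nV by (auto simp: Bad_def mini_def nb_def)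
    hence "y \<in> pr ` Bad" using m by (intro image_eqI[of _ _ "\<sigma> y"]) (auto simp: mini_def)
    thus False using y by (simp add: W_def)
   qed
   ultimately show ?thesis by blast
  qed
  thus "openin (subtopology ?X \<Omega>) {y \<in> \<Omega>. \<sigma> y \<in> V}"
  proof (subst openin_subopen, intro ballI)
   fix y0 assume "y0 \<in> {y \<in> \<Omega>. \<sigma> y \<in> V}"
   then obtain W where "openin ?X W" "y0 \<in> W" "\<forall>y\<in>W \<inter> \<Omega>. \<sigma> y \<in> V" "y0 \<in> \<Omega>"
    using \<open>\<And>y0. y0 \<in> \<Omega> ==> \<sigma> y0 \<in> V ==> \<exists>W. openin ?X W \<and> y0 \<in> W \<and> (\<forall>y\<in>W \<inter> \<Omega>. \<sigma> y \<in> V)\<close> by blast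
   thus "\<exists>W. openin (subtopology ?X \<Omega>) W \<and> y0 \<in> W \<and> W \<subseteq> {y \<in> \<Omega>. \<sigma> y \<in> V}"
    using openin_subtopology_Int[of ?X W \<Omega>] by (intro exI[of _ "W \<inter> \<Omega>"]) auto
  qed
 qed
 thus ?thesis using that[OF o\<Omega> K\<Omega>] \<sigma> \<sigma>G unfolding mini_def pr_def by blast
qed

end

lemma (in compact_lie_group) local_section:
 assumes K: "subgroup K G" "closedin T K" and y: "y \<in> topspace (coset_space G T K)"
 obtains \<Omega> \<sigma> where "openin (coset_space G T K) \<Omega>" "y \<in> \<Omega>"
  "continuous_map (subtopology (coset_space G T K) \<Omega>) T \<sigma>"
  "\<And>z. z \<in> \<Omega> ==> \<sigma> z \<in> carrier G \<and> \<sigma> z <# K = z"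
proof -
 let ?X = "coset_space G T K"
 interpret compact_group G T by (rule compact_group)
 obtain n U \<psi> C r0 where "normed_chart G T n U \<psi> C r0" using normed_chart_exists by blast
 then interpret normed_chart G T n U \<psi> C r0 "\<lambda>v. L2_set v {..<n}" "\<lambda>x. L2_set (\<psi> x) {..<n}"
  by simp_all
 obtain \<Omega> \<sigma> where \<Omega>: "openin ?X \<Omega>" "K \<in> \<Omega>" and \<sigma>: "continuous_map (subtopology ?X \<Omega>) T \<sigma>"
  "\<And>y. y \<in> \<Omega> ==> \<sigma> y \<in> carrier G \<and> \<sigma> y <# K = y"
  using local_section_at_base[OF K] by metis
 obtain g where g: "g \<in> carrier G" "y = g <# K" using y by (auto simp: topspace_cosets)
 have act: "continuous_map ?X ?X (\<lambda>x. inv g <# x)"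
  using g by (intro continuous_map_act K continuous_map_const_carrier) auto
 define \<Omega>' where "\<Omega>' = {x \<in> topspace ?X. inv g <# x \<in> \<Omega>}"
 have K1: "inv g <# y = K" using g K(1) by (simp add: coset_action lcos_mult_one subgroup.subset)
 have o: "openin ?X \<Omega>'"
  unfolding \<Omega>'_def by (rule openin_continuous_map_preimage[OF act \<Omega>(1)])
 have "continuous_map (subtopology ?X \<Omega>') (subtopology ?X \<Omega>) (\<lambda>x. inv g <# x)"
  using continuous_map_from_subtopology[OF act] by (auto simp: continuous_map_in_subtopology \<Omega>'_def)
 from continuous_map_compose[OF this \<sigma>(1)]
 have "continuous_map (subtopology ?X \<Omega>') T (\<lambda>x. g \<otimes> \<sigma> (inv g <# x))"
  using g by (intro continuous_map_mult continuous_map_const_carrier) (auto simp: o_def)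
 moreover have "g \<otimes> \<sigma> (inv g <# z) \<in> carrier G \<and> (g \<otimes> \<sigma> (inv g <# z)) <# K = z" if z: "z \<in> \<Omega>'" for z
 proof -
  have s: "\<sigma> (inv g <# z) \<in> carrier G" "\<sigma> (inv g <# z) <# K = inv g <# z" "z \<in> topspace ?X"
   using \<sigma>(2)[of "inv g <# z"] z by (auto simp: \<Omega>'_def)
  have "(g \<otimes> \<sigma> (inv g <# z)) <# K = g <# (inv g <# z)"
   using coset_action[OF K(1) g(1) s(1)] s(2) by simp
  also have "... = z"
   using coset_action_assoc[OF K(1) g(1) _ s(3), of "inv g"] coset_action_one[OF K(1) s(3)] g(1) by simp
  finally show ?thesis using g s by simp
 qed
 ultimately show ?thesis
  using that[OF o, of "\<lambda>x. g \<otimes> \<sigma> (inv g <# x)"] K1 \<Omega>(2) y by (auto simp: \<Omega>'_def)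
qed

section \<open>Uniform algebras\<close>

lemma continuous_map_restrict:
 "continuous_map X Y (restrict f (topspace X)) \<longleftrightarrow> continuous_map X Y f"
 by (intro iffI; erule continuous_map_eq) simp_all

lemma restrict_in_cfun:
 "restrict f (topspace X) \<in> carrier (cfun_ring X) \<longleftrightarrow> cmap X f"
 by (simp add: cfun_ring_def continuous_map_restrict)

lemma cfun_ring_carrierD:
 assumes "f \<in> carrier (cfun_ring X)"
 shows "cmap X f" "restrict f (topspace X) = f"
 using assms by (auto simp: cfun_ring_def extensional_restrict)

lemma cfun_ring_operations:
 "restrict f (topspace X) \<oplus>\<^bsub>cfun_ring X\<^esub> restrict g (topspace X) = (\<lambda>x\<in>topspace X. f x + g x)"
 "restrict f (topspace X) \<otimes>\<^bsub>cfun_ring X\<^esub> restrict g (topspace X) = (\<lambda>x\<in>topspace X. f x * g x)"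
 "cfun_scale X c (restrict f (topspace X)) = (\<lambda>x\<in>topspace X. c * f x)"
 by (auto simp: cfun_ring_def cfun_scale_def)

lemma ring_cfun_ring: "ring (cfun_ring X)"
proof (rule ringI)
 note ops = cfun_ring_def continuous_map_restrict fun_eq_iff
 show "abelian_group (cfun_ring X)"
 proof (rule abelian_groupI)
  fix f g assume f: "f \<in> carrier (cfun_ring X)" and g: "g \<in> carrier (cfun_ring X)"
  show "f \<oplus>\<^bsub>cfun_ring X\<^esub> g \<in> carrier (cfun_ring X)"
   using f g by (simp add: ops continuous_map_add)
  show "f \<oplus>\<^bsub>cfun_ring X\<^esub> g = g \<oplus>\<^bsub>cfun_ring X\<^esub> f"
   by (simp add: ops add.commute)
  show "f \<oplus>\<^bsub>cfun_ring X\<^esub> g \<oplus>\<^bsub>cfun_ring X\<^esub> h = f \<oplus>\<^bsub>cfun_ring X\<^esub> (g \<oplus>\<^bsub>cfun_ring X\<^esub> h)" for h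
   by (simp add: ops add.assoc)
 next
  fix f assume f: "f \<in> carrier (cfun_ring X)"
  show "\<exists>g\<in>carrier (cfun_ring X). g \<oplus>\<^bsub>cfun_ring X\<^esub> f = \<zero>\<^bsub>cfun_ring X\<^esub>"
   using f cfun_ring_carrierD(1)[OF f]
   by (intro bexI[of _ "\<lambda>x\<in>topspace X. - f x"]) (simp_all add: ops continuous_map_minus)
  show "\<zero>\<^bsub>cfun_ring X\<^esub> \<oplus>\<^bsub>cfun_ring X\<^esub> f = f"
   using f extensional_arb[of f "topspace X"] by (auto simp: ops)
 qed (simp add: ops)
 show "monoid (cfun_ring X)"
 proof (rule monoidI)
  fix f g assume f: "f \<in> carrier (cfun_ring X)" and g: "g \<in> carrier (cfun_ring X)"
  show "f \<otimes>\<^bsub>cfun_ring X\<^esub> g \<in> carrier (cfun_ring X)"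
   using f g by (simp add: ops continuous_map_mult_algebra)
  show "f \<otimes>\<^bsub>cfun_ring X\<^esub> g \<otimes>\<^bsub>cfun_ring X\<^esub> h = f \<otimes>\<^bsub>cfun_ring X\<^esub> (g \<otimes>\<^bsub>cfun_ring X\<^esub> h)" for h
   by (simp add: ops mult.assoc)
 next
  fix f assume f: "f \<in> carrier (cfun_ring X)"
  show "\<one>\<^bsub>cfun_ring X\<^esub> \<otimes>\<^bsub>cfun_ring X\<^esub> f = f" "f \<otimes>\<^bsub>cfun_ring X\<^esub> \<one>\<^bsub>cfun_ring X\<^esub> = f"
   using f extensional_arb[of f "topspace X"] by (auto simp: ops)
 qed (simp add: ops)
qed (simp_all add: cfun_ring_def fun_eq_iff distrib_left distrib_right)

locale uniform_algebra =
 fixes X :: "'x topology" and A :: "('x => complex) set"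
 assumes compact_space_X: "compact_space X" and nonempty: "topspace X \<noteq> {}"
  and function_algebra: "function_algebra X A"
begin

text \<open>\<open>A\<close> freed from extensionality: membership ignores values off the space, so
  sums, products and translates can be plain lambda terms.\<close>

definition \<B> :: "('x => complex) set" where "\<B> = {f. restrict f (topspace X) \<in> A}"

lemma subring_A: "subring A (cfun_ring X)" using function_algebra by (simp add: function_algebra_def)

lemma ring_A: "ring (cfun_subring X A)" by (rule ring.subring_is_ring[OF ring_cfun_ring subring_A])

lemma A_carrier: "f \<in> A ==> f \<in> carrier (cfun_ring X)"
 using subringE(1)[OF subring_A] by blast

lemma restrict_A: "f \<in> A ==> restrict f (topspace X) = f"
 using A_carrier cfun_ring_carrierD(2) by blast

lemma A_\<B>: "f \<in> A ==> f \<in> \<B>" by (simp add: \<B>_def restrict_A)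

lemma \<B>_A: "f \<in> \<B> ==> restrict f (topspace X) \<in> A" by (simp add: \<B>_def)

lemma \<B>_cong: "(\<And>x. x \<in> topspace X ==> f x = g x) ==> f \<in> \<B> \<longleftrightarrow> g \<in> \<B>"
 by (simp add: \<B>_def cong: restrict_cong)

sublocale continuous_algebra X \<B>
proof
 show "compact_space X" by (rule compact_space_X)
 fix f g :: "'x => complex" assume f: "f \<in> \<B>"
 show "cmap X f" using A_carrier[OF \<B>_A[OF f]] by (simp add: restrict_in_cfun)
 assume g: "g \<in> \<B>"
 show "(\<lambda>x. f x + g x) \<in> \<B>" using subringE(7)[OF subring_A \<B>_A[OF f] \<B>_A[OF g]]
  by (simp add: \<B>_def cfun_ring_operations)
 show "(\<lambda>x. f x * g x) \<in> \<B>" using subringE(6)[OF subring_A \<B>_A[OF f] \<B>_A[OF g]]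
  by (simp add: \<B>_def cfun_ring_operations)
next
 show "(\<lambda>_. c) \<in> \<B>" for c using function_algebra by (simp add: function_algebra_def \<B>_def)
qed

lemma uniform_limit:
 assumes f: "cmap X f"
  and approx: "\<And>e. e > 0 ==> \<exists>g\<in>\<B>. \<forall>x\<in>topspace X. norm (f x - g x) \<le> e"
 shows "f \<in> \<B>"
proof (rule ccontr)
 let ?m = "cfunspace X (euclidean_metric :: complex metric)" and ?r = "\<lambda>f. restrict f (topspace X)"
 interpret S: Metric_space "mspace ?m" "mdist ?m" by (rule Metric_space_mspace_mdist)
 have msp: "mspace ?m = carrier (cfun_ring X)" using compact_space_X
  by (simp only: compactin_mspace_cfunspace compact_space_def) (auto simp: cfun_ring_def)
 assume "f \<notin> \<B>"
 hence fm: "?r f \<in> mspace ?m - A"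
  using f by (simp add: \<B>_def msp restrict_in_cfun del: mspace_cfunspace)
 have "openin (mtopology_of ?m) (topspace (mtopology_of ?m) - A)"
  using function_algebra unfolding function_algebra_def closedin_def by (elim conjE)
 hence "\<exists>r>0. S.mball (?r f) r \<subseteq> mspace ?m - A"
  unfolding mtopology_of_def S.topspace_mtopology S.openin_mtopology
  by (elim conjE allE[of _ "?r f"] impE[OF _ fm])
 then obtain r where r: "r > 0" "S.mball (?r f) r \<subseteq> mspace ?m - A" by (elim exE conjE)
 obtain g where g: "g \<in> \<B>" "\<forall>x\<in>topspace X. norm (f x - g x) \<le> r / 2"
  using approx[of "r / 2"] r(1) by auto
 have "mdist ?m (?r f) (?r g) \<le> r / 2"
  using g(2) r(1) by (intro mdist_cfunspace_le) (auto simp: dist_norm)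
 moreover have "?r g \<in> mspace ?m" "?r f \<in> mspace ?m"
  using f g(1) continuous by (simp_all add: msp restrict_in_cfun del: mspace_cfunspace)
 ultimately have "?r g \<in> S.mball (?r f) r" using r(1) by (simp del: mspace_cfunspace)
 hence "?r g \<notin> A" using r(2) by blast
 thus False using g(1) by (simp add: \<B>_def)
qed

text \<open>The Neumann series: its partial sums lie in the algebra and converge uniformly at the
  rate \<open>q ^ n / (1 - q)\<close>.\<close>

lemma inverse_one_minus:
 assumes g: "g \<in> \<B>" and q: "q < 1" "\<And>x. x \<in> topspace X ==> norm (g x) \<le> q"
 shows "(\<lambda>x. inverse (1 - g x)) \<in> \<B>"
proof (rule uniform_limit)
 have ne: "g x \<noteq> 1" if "x \<in> topspace X" for x using q(2)[OF that] q(1) by auto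
 have q0: "0 \<le> q" using nonempty q(2) norm_ge_zero order_trans by blast
 show "cmap X (\<lambda>x. inverse (1 - g x))"
 proof -
  have "continuous_map X (top_of_set (UNIV - {1})) g"
   using continuous[OF g] ne by (auto simp: continuous_map_in_subtopology)
  moreover have "cmap (top_of_set (UNIV - {1})) (\<lambda>z::complex. inverse (1 - z))"
   by (auto intro!: continuous_intros)
  ultimately show ?thesis by (rule continuous_map_compose[unfolded o_def])
 qed
 fix e :: real assume e: "e > 0"
 have "(\<lambda>n. q ^ n / (1 - q)) \<longlonglongrightarrow> 0 / (1 - q)"
  using q0 q(1) by (intro tendsto_intros LIMSEQ_power_zero) auto
 hence "\<forall>\<^sub>F n in sequentially. q ^ n / (1 - q) < e"
  using e by (intro order_tendstoD(2)[where y = "0 / (1 - q)"]) auto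
 then obtain n where n: "q ^ n / (1 - q) < e" using eventually_happens'[OF sequentially_bot] by blast
 show "\<exists>h\<in>\<B>. \<forall>x\<in>topspace X. norm (inverse (1 - g x) - h x) \<le> e"
 proof (intro bexI ballI)
  show "(\<lambda>x. \<Sum>k<n. g x ^ k) \<in> \<B>" by (intro sum power g) simp
  fix x assume x: "x \<in> topspace X"
  have "inverse (1 - g x) - (\<Sum>k<n. g x ^ k) = g x ^ n / (1 - g x)"
   using ne[OF x] by (simp add: sum_gp_strict field_simps)
  also have "norm ... \<le> q ^ n / (1 - q)"
  proof -
   have "1 - q \<le> norm (1 - g x)" using norm_triangle_ineq2[of 1 "g x"] q(2)[OF x] by simp
   thus ?thesis using q q0 x by (auto simp: norm_divide norm_power intro!: frac_le power_mono)
  qed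
  finally show "norm (inverse (1 - g x) - (\<Sum>k<n. g x ^ k)) \<le> e" using n by linarith
 qed
qed

context
 fixes \<phi> assumes \<phi>: "\<phi> \<in> characters X A"
begin

abbreviation (input) ev :: "('x => complex) => complex" where
 "ev f \<equiv> \<phi> (restrict f (topspace X))"

lemma character_laws:
 "f \<in> A ==> g \<in> A ==> \<phi> (f \<oplus>\<^bsub>cfun_ring X\<^esub> g) = \<phi> f + \<phi> g"
 "f \<in> A ==> g \<in> A ==> \<phi> (f \<otimes>\<^bsub>cfun_ring X\<^esub> g) = \<phi> f * \<phi> g"
 "f \<in> A ==> \<phi> (cfun_scale X c f) = c * \<phi> f"
 using \<phi> unfolding characters_def by blast+

lemma character_add: "f \<in> \<B> ==> g \<in> \<B> ==> ev (\<lambda>x. f x + g x) = ev f + ev g"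
 using character_laws(1)[OF \<B>_A \<B>_A, of f g] unfolding cfun_ring_operations .

lemma character_mult: "f \<in> \<B> ==> g \<in> \<B> ==> ev (\<lambda>x. f x * g x) = ev f * ev g"
 using character_laws(2)[OF \<B>_A \<B>_A, of f g] unfolding cfun_ring_operations .

lemma character_scale: "f \<in> \<B> ==> ev (\<lambda>x. c * f x) = c * ev f"
 using character_laws(3)[OF \<B>_A, of f c] unfolding cfun_ring_operations .

lemma character_one: "ev (\<lambda>x. 1) = 1"
proof -
 obtain f where "f \<in> A" "\<phi> f \<noteq> 0" using \<phi> unfolding characters_def by blast
 thus ?thesis using character_mult[OF A_\<B> const, of f 1] restrict_A by simp
qed

lemma character_const: "ev (\<lambda>x. c) = c" using character_scale[OF const, of c 1] character_one by simp

lemma character_diff: "f \<in> \<B> ==> g \<in> \<B> ==> ev (\<lambda>x. f x - g x) = ev f - ev g"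
 using character_add[of f "\<lambda>x. (-1) * g x"] character_scale[of g "-1"] scale[of g "-1"] by simp

text \<open>Characters are automatically contractive: if the value at \<open>f\<close> exceeded
  \<open>c\<close>, dividing by it would give \<open>g\<close> with value 1 and \<open>1 - g\<close>
  invertible, although the character annihilates \<open>1 - g\<close>.\<close>

lemma character_bound:
 assumes f: "f \<in> \<B>" and c: "\<And>x. x \<in> topspace X ==> norm (f x) \<le> c"
 shows "norm (ev f) \<le> c"
proof (rule ccontr)
 assume n: "\<not> norm (ev f) \<le> c"
 have c0: "0 \<le> c" using nonempty c norm_ge_zero order_trans by blast
 define g where "g x = inverse (ev f) * f x" for x
 have gB: "g \<in> \<B>" unfolding g_def by (rule scale[OF f])
 have ne: "ev f \<noteq> 0" using n c0 by auto
 have q: "c / norm (ev f) < 1" using n c0 by (subst divide_less_eq_1) linarith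
 have gq: "norm (g x) \<le> c / norm (ev f)" if "x \<in> topspace X" for x
  using c[OF that] by (simp add: g_def norm_mult norm_inverse divide_inverse_commute mult_left_mono)
 have ne1: "g x \<noteq> 1" if "x \<in> topspace X" for x using gq[OF that] q by auto
 have g1: "ev g = 1" unfolding g_def using character_scale[OF f] ne by simp
 have "1 = ev (\<lambda>x. inverse (1 - g x) * (1 - g x))"
  using ne1 character_one by (simp cong: restrict_cong)
 also have "... = ev (\<lambda>x. inverse (1 - g x)) * (1 - ev g)"
  using inverse_one_minus[OF gB q gq] diff[OF const gB, of 1] character_diff[OF const gB, of 1] character_one
  by (simp add: character_mult)
 finally show False using g1 by simp
qed

end

lemma evaluation_character:
 assumes x: "x \<in> topspace X"
 shows "(\<lambda>f\<in>A. f x) \<in> characters X A"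
proof -
 have "f \<oplus>\<^bsub>cfun_ring X\<^esub> g \<in> A" "f \<otimes>\<^bsub>cfun_ring X\<^esub> g \<in> A" if "f \<in> A" "g \<in> A" for f g
  using subringE(6,7)[OF subring_A that] by auto
 moreover have "cfun_scale X c f \<in> A" if "f \<in> A" for c f
  using \<B>_A[OF scale[OF A_\<B>[OF that]]] by (simp add: cfun_scale_def)
 moreover have "\<exists>f\<in>A. f x \<noteq> 0" using x by (intro bexI[OF _ \<B>_A[OF const, of 1]]) simp
 ultimately show ?thesis using x by (auto simp: characters_def cfun_scale_def cfun_ring_def)
qed

lemma topspace_maximal_ideal_space: "topspace (maximal_ideal_space X A) = characters X A"
 by (auto simp: maximal_ideal_space_def characters_def PiE_def)

lemma continuous_map_maximal_ideal_space: "continuous_map Y (maximal_ideal_space X A) h \<longleftrightarrow>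
   (\<forall>y\<in>topspace Y. h y \<in> characters X A) \<and> (\<forall>f\<in>A. cmap Y (\<lambda>y. h y f))"
proof -
 have "characters X A \<subseteq> extensional A" unfolding characters_def by blast
 hence "(\<forall>y\<in>topspace Y. h y \<in> characters X A) ==> h ` topspace Y \<subseteq> extensional A"
  by blast
 thus ?thesis unfolding maximal_ideal_space_def continuous_map_in_subtopology continuous_map_componentwise
  by (simp add: image_subset_iff Pi_iff) blast
qed

lemma continuous_map_character:
 "f \<in> A ==> cmap (maximal_ideal_space X A) (\<lambda>\<phi>. \<phi> f)"
 using continuous_map_maximal_ideal_space[of "maximal_ideal_space X A" "\<lambda>x. x"] by simp

end

text \<open>If no point evaluation were equal to \<open>\<phi>\<close>, finitely many functions annihilated by \<open>\<phi>\<close>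
 would have no common zero, and the sum of the squares of their absolute values would be invertible.\<close>

lemma character_of_continuous_functions:
 assumes Y: "compact_space Y"
  and add: "\<And>u v. cmap Y u ==> cmap Y v ==> \<phi> (\<lambda>y. u y + v y) = \<phi> u + \<phi> v"
  and mult: "\<And>u v. cmap Y u ==> cmap Y v ==> \<phi> (\<lambda>y. u y * v y) = \<phi> u * \<phi> v"
  and const: "\<And>c. \<phi> (\<lambda>y. c) = (c :: complex)"
  and cong: "\<And>u v. (\<And>y. y \<in> topspace Y ==> u y = v y) ==> \<phi> u = \<phi> v"
 shows "\<exists>y\<in>topspace Y. \<forall>u. cmap Y u \<longrightarrow> \<phi> u = u y"
proof (rule ccontr)
 assume "\<not> ?thesis"
 hence "\<forall>y\<in>topspace Y. \<exists>u. cmap Y u \<and> \<phi> u \<noteq> u y"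
  by blast
 hence "\<forall>y\<in>topspace Y. cmap Y (SOME u. cmap Y u \<and> \<phi> u \<noteq> u y) \<and>
   \<phi> (SOME u. cmap Y u \<and> \<phi> u \<noteq> u y) \<noteq> (SOME u. cmap Y u \<and> \<phi> u \<noteq> u y) y"
  by (intro ballI someI_ex[of "\<lambda>u. cmap Y u \<and> \<phi> u \<noteq> u _"]) simp
 then obtain u where u: "\<And>y. y \<in> topspace Y ==> cmap Y (u y) \<and> \<phi> (u y) \<noteq> u y y"
  by (intro that[of "\<lambda>y. SOME u. cmap Y u \<and> \<phi> u \<noteq> u y"]) simp
 define v where "v y z = u y z + (- \<phi> (u y))" for y z
 have cv: "cmap Y (v y)" and v0: "\<phi> (v y) = 0" and vy: "v y y \<noteq> 0" if "y \<in> topspace Y" for y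
 proof -
  have uy: "cmap Y (u y)" "\<phi> (u y) \<noteq> u y y" using u[OF that] by auto
  show "cmap Y (v y)" unfolding v_def using uy by (intro continuous_map_add) auto
  show "\<phi> (v y) = 0"
   unfolding v_def using add[OF uy(1), of "\<lambda>_. - \<phi> (u y)"] const[of "- \<phi> (u y)"] by simp
  show "v y y \<noteq> 0" unfolding v_def using uy(2) by auto
 qed
 define W where "W y = {z \<in> topspace Y. v y z \<in> - {0}}" for y
 have "\<forall>U\<in>W ` topspace Y. openin Y U"
  unfolding W_def using openin_continuous_map_preimage[OF cv, of _ "- {0}"] by auto
 moreover have "topspace Y \<subseteq> \<Union> (W ` topspace Y)" using vy by (auto simp: W_def)
 ultimately obtain \<F> where "finite \<F>" "\<F> \<subseteq> W ` topspace Y" "topspace Y \<subseteq> \<Union>\<F>"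
  using Y unfolding compact_space_alt by (elim allE[of _ "W ` topspace Y"] impE) auto
 then obtain P where P: "finite P" "P \<subseteq> topspace Y" "topspace Y \<subseteq> (\<Union>y\<in>P. W y)"
  using finite_subset_image[of \<F> W "topspace Y"] by auto
 define s where "s z = (\<Sum>y\<in>P. v y z * cnj (v y z))" for z
 have cs: "cmap Y s"
  unfolding s_def using P cv by (intro continuous_map_sum continuous_map_mult_algebra continuous_map_cnj) auto
 have "\<phi> (\<lambda>z. \<Sum>y\<in>Q. v y z * cnj (v y z)) = 0" if "finite Q" "Q \<subseteq> topspace Y" for Q
  using that
 proof (induction Q)
  case empty
  show ?case using const[of 0] by simp
 next
  case (insert y Q)
  have "\<phi> (\<lambda>z. \<Sum>y\<in>insert y Q. v y z * cnj (v y z)) =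
    \<phi> (\<lambda>z. v y z * cnj (v y z)) + \<phi> (\<lambda>z. \<Sum>y\<in>Q. v y z * cnj (v y z))"
   using insert cv by (subst add[symmetric])
    (auto intro!: continuous_map_sum continuous_map_mult_algebra continuous_map_cnj)
  thus ?case using insert cv v0 by (simp add: mult continuous_map_cnj)
 qed
 hence "\<phi> s = 0" unfolding s_def using P by blast
 have s0: "s z \<noteq> 0" if "z \<in> topspace Y" for z
 proof -
  have "s z = of_real (\<Sum>y\<in>P. (cmod (v y z))\<^sup>2)"
   by (simp add: s_def complex_norm_square[symmetric])
  moreover have "(\<Sum>y\<in>P. (cmod (v y z))\<^sup>2) \<noteq> 0"
   using P that by (subst sum_nonneg_eq_0_iff) (auto simp: W_def)
  ultimately show ?thesis by (simp only: of_real_eq_0_iff not_False_eq_True)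
 qed
 have "continuous_map Y (top_of_set (UNIV - {0})) s"
  using cs s0 by (auto simp: continuous_map_in_subtopology)
 moreover have "cmap (top_of_set (UNIV - {0})) (\<lambda>z::complex. inverse z)"
  by (auto intro!: continuous_intros)
 ultimately have "cmap Y (\<lambda>z. inverse (s z))"
  by (rule continuous_map_compose[unfolded o_def])
 hence "\<phi> (\<lambda>z. s z * inverse (s z)) = 0" using mult[OF cs] \<open>\<phi> s = 0\<close> by simp
 moreover have "\<phi> (\<lambda>z. s z * inverse (s z)) = \<phi> (\<lambda>z. 1)"
  using s0 by (intro cong) simp
 ultimately show False using const[of 1] by simp
qed

section \<open>Fibres of an invariant algebra\<close>

locale invariant_algebra = compact_group +
 fixes H :: "'a set" and A :: "('a set => complex) set" and F :: "'a set set"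
 assumes subgroup_H: "subgroup H G" and closed_H: "closedin T H"
  and function_algebra_A: "function_algebra (coset_space G T H) A"
  and invariant_A: "translation_invariant G (coset_space G T H) A"
  and maximal_F: "maximal_antisymmetric_set (coset_space G T H) A F" and H_in_F: "H \<in> F"
begin

abbreviation "M \<equiv> coset_space G T H"
definition "K = stabilizer G (\<lambda>g. image (l_coset G g)) F"
abbreviation "N \<equiv> coset_space G T K"
abbreviation "\<pi> \<equiv> coset_projection G K"

lemma coset_in_M: "g \<in> carrier G ==> g <# H \<in> topspace M"
 unfolding topspace_cosets by blast

lemma M_cosetE:
 assumes "x \<in> topspace M" obtains g where "g \<in> carrier G" "x = g <# H"
 using assms unfolding topspace_cosets by blast

sublocale UA: uniform_algebra M A
proof
 show "topspace M \<noteq> {}" using coset_in_M[of \<one>] by blast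
qed (auto intro: compact_coset_space function_algebra_A)

abbreviation "\<B> \<equiv> UA.\<B>"

lemma one_coset_H: "\<one> <# H = H" using subgroup.subset[OF subgroup_H] by (rule lcos_mult_one)

lemmas H_action = coset_action_closed[OF subgroup_H] coset_action_assoc[OF subgroup_H]
 coset_action_one[OF subgroup_H] coset_action[OF subgroup_H]

lemma \<B>_translate:
 assumes f: "f \<in> \<B>" and g: "g \<in> carrier G"
 shows "(\<lambda>x. f (g <# x)) \<in> \<B>"
proof -
 have "translate G M (inv g) (restrict f (topspace M)) \<in> A"
  using invariant_A UA.\<B>_A[OF f] inv_closed[OF g] by (auto simp: translation_invariant_def)
 also have "translate G M (inv g) (restrict f (topspace M)) = restrict (\<lambda>x. f (g <# x)) (topspace M)"
  unfolding translate_def by (rule restrict_ext) (simp add: g H_action)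
 finally show ?thesis unfolding UA.\<B>_def mem_Collect_eq .
qed

definition anti :: "'a set set => bool" where
 "anti E \<longleftrightarrow> E \<subseteq> topspace M \<and> (\<forall>f\<in>\<B>. f ` E \<subseteq> \<real> \<longrightarrow> f constant_on E)"

lemma anti_iff: "anti E \<longleftrightarrow> E \<subseteq> topspace M \<and> antisymmetric_set A E"
proof -
 have "f constant_on E" if E: "E \<subseteq> topspace M" "antisymmetric_set A E" and f: "f \<in> \<B>" "f ` E \<subseteq> \<real>" for f
 proof -
  have "restrict f (topspace M) x = f x" if "x \<in> E" for x using E that by auto
  moreover have "restrict f (topspace M) constant_on E"
   using E(2) UA.\<B>_A[OF f(1)] f(2) E(1) unfolding antisymmetric_set_def by fastforce
  ultimately show ?thesis by (simp add: constant_on_def)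
 qed
 thus ?thesis unfolding anti_def antisymmetric_set_def using UA.A_\<B> by blast
qed

lemma anti_F: "anti F" and F_maximal: "anti E ==> F \<subseteq> E ==> E = F"
 using maximal_F unfolding maximal_antisymmetric_set_def anti_iff by blast+

lemma antiD: "anti E ==> f \<in> \<B> ==> (\<And>x. x \<in> E ==> f x \<in> \<real>) ==> x \<in> E ==> y \<in> E ==> f x = f y"
 unfolding anti_def constant_on_def by (metis image_subsetI)

lemma antiI:
 assumes "E \<subseteq> topspace M"
  and "\<And>f x y. f \<in> \<B> ==> (\<And>x. x \<in> E ==> f x \<in> \<real>) ==> x \<in> E ==> y \<in> E ==> f x = f y"
 shows "anti E" unfolding anti_def
proof (intro conjI ballI impI)
 fix f assume f: "f \<in> \<B>" "f ` E \<subseteq> \<real>"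
 have eq: "f x = f y" if "x \<in> E" "y \<in> E" for x y using assms(2)[OF f(1) _ that] f(2) by blast
 show "f constant_on E" unfolding constant_on_def
 proof (intro exI ballI)
  fix x assume x: "x \<in> E"
  show "f x = f (SOME x. x \<in> E)" by (rule eq[OF x someI[of "\<lambda>x. x \<in> E", OF x]])
 qed
qed (rule assms(1))

text \<open>Two antisymmetric sets with a common point have an antisymmetric union; maximality of
  \<open>F\<close> absorbs it.\<close>

lemma anti_subset_F:
 assumes E: "anti E" "x \<in> E" "x \<in> F"
 shows "E \<subseteq> F"
proof -
 have "anti (E \<union> F)"
 proof (rule antiI)
  show "E \<union> F \<subseteq> topspace M" using E(1) anti_F by (auto simp: anti_def)
  fix f y z assume f: "f \<in> \<B>" "\<And>x. x \<in> E \<union> F ==> f x \<in> \<real>" and yz: "y \<in> E \<union> F" "z \<in> E \<union> F"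
  have "f y = f x" if "y \<in> E \<union> F" for y
   using antiD[OF E(1) f(1) _ _ E(2)] antiD[OF anti_F f(1) _ _ E(3)] f(2) that by blast
  thus "f y = f z" using yz by simp
 qed
 thus ?thesis using F_maximal by blast
qed

lemma anti_translate:
 assumes E: "anti E" and g: "g \<in> carrier G"
 shows "anti (l_coset G g ` E)"
proof (rule antiI)
 show "l_coset G g ` E \<subseteq> topspace M" using E g H_action(1) by (auto simp: anti_def)
 fix f x y assume f: "f \<in> \<B>" "\<And>x. x \<in> l_coset G g ` E ==> f x \<in> \<real>"
  and xy: "x \<in> l_coset G g ` E" "y \<in> l_coset G g ` E"
 obtain x' y' where "x' \<in> E" "x = g <# x'" "y' \<in> E" "y = g <# y'" using xy by blast
 thus "f x = f y" using antiD[OF E \<B>_translate[OF f(1) g]] f(2) by blast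
qed

lemma F_subset: "F \<subseteq> topspace M" using anti_F by (simp add: anti_def)

text \<open>A translate of \<open>F\<close> is antisymmetric, so it lies in \<open>F\<close> as soon
  as it meets \<open>F\<close>; the same for the inverse gives equality. This is why
  \<open>F\<close> is the orbit of the base point under \<open>K\<close>.\<close>

lemma K_iff: "k \<in> K \<longleftrightarrow> k \<in> carrier G \<and> k <# H \<in> F"
proof
 assume "k \<in> K"
 hence k: "k \<in> carrier G" "l_coset G k ` F = F" by (auto simp: K_def stabilizer_def)
 thus "k \<in> carrier G \<and> k <# H \<in> F" using H_in_F by blast
next
 assume k: "k \<in> carrier G \<and> k <# H \<in> F"
 have 1: "l_coset G k ` F \<subseteq> F"
  using k H_in_F by (intro anti_subset_F[of _ "k <# H"] anti_translate anti_F) auto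
 have "inv k <# (k <# H) = H" using k by (simp add: H_action one_coset_H)
 hence 2: "l_coset G (inv k) ` F \<subseteq> F" using k H_in_F image_eqI[of H "l_coset G (inv k)" "k <# H" F]
  by (intro anti_subset_F[of _ H] anti_translate anti_F) auto
 have "F \<subseteq> l_coset G k ` F"
 proof
  fix x assume x: "x \<in> F"
  have "x = k <# (inv k <# x)" using k x F_subset by (simp add: H_action subsetD)
  thus "x \<in> l_coset G k ` F" using 2 x by blast
 qed
 with 1 show "k \<in> K" using k by (auto simp: K_def stabilizer_def)
qed

lemma subgroup_K: "subgroup K G"
proof
 show "K \<subseteq> carrier G" "\<one> \<in> K" using K_iff one_coset_H H_in_F by auto
 have s: "k \<in> carrier G \<and> l_coset G k ` F = F" if "k \<in> K" for k
  using that by (auto simp: K_def stabilizer_def)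
 fix k assume k: "k \<in> K"
 obtain x where x: "x \<in> F" "H = k <# x" using s[OF k] H_in_F by blast
 have "inv k <# H = x" using s[OF k] x F_subset by (simp add: H_action subsetD)
 thus "inv k \<in> K" using s[OF k] x by (simp add: K_iff)
 fix l assume l: "l \<in> K"
 have "k <# (l <# H) \<in> F" using s[OF k] l by (auto simp: K_iff)
 thus "k \<otimes> l \<in> K" using k l by (simp add: K_iff H_action)
qed

text \<open>By continuity the closure of an antisymmetric set is antisymmetric, so maximality forces
  \<open>F\<close> to be closed.\<close>

lemma closed_F: "closedin M F"
proof -
 have sub: "F \<subseteq> M closure_of F" by (rule closure_of_subset[OF F_subset])
 have "anti (M closure_of F)"
 proof (rule antiI)
  show "M closure_of F \<subseteq> topspace M" by (rule closure_of_subset_topspace)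
  fix f x y assume f: "f \<in> \<B>" "\<And>x. x \<in> M closure_of F ==> f x \<in> \<real>"
   and xy: "x \<in> M closure_of F" "y \<in> M closure_of F"
  have "closedin M {x \<in> topspace M. f x \<in> {f H}}"
   by (rule closedin_continuous_map_preimage[OF UA.continuous[OF f(1)]]) simp
  moreover have "F \<subseteq> {x \<in> topspace M. f x \<in> {f H}}"
   using antiD[OF anti_F f(1) _ _ H_in_F] f(2) sub F_subset by blast
  ultimately have "M closure_of F \<subseteq> {x \<in> topspace M. f x \<in> {f H}}"
   by (rule closure_of_minimal[rotated])
  from subsetD[OF this xy(1)] subsetD[OF this xy(2)] show "f x = f y" by simp
 qed
 hence "M closure_of F = F" by (rule F_maximal[OF _ sub])
 thus ?thesis by (simp add: closure_of_eq)
qed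

lemma closed_K: "closedin T K"
proof -
 have "K = {k \<in> topspace T. k <# H \<in> F}" using K_iff by (auto simp: topspace_eq)
 thus ?thesis using closedin_continuous_map_preimage[OF continuous_map_coset closed_F] by simp
qed

lemma H_subset_K: "H \<subseteq> K"
proof
 fix h assume "h \<in> H"
 thus "h \<in> K" using H_in_F subgroup.mem_carrier[OF subgroup_H] subgroup_H
  by (simp add: K_iff coset_join3)
qed

lemma K_carrier: "k \<in> K ==> k \<in> carrier G" by (simp add: K_iff)

lemmas K_action = coset_action_closed[OF subgroup_K] coset_action_assoc[OF subgroup_K]
 coset_action_one[OF subgroup_K] coset_action[OF subgroup_K]

lemma coset_in_N: "g \<in> carrier G ==> g <# K \<in> topspace N"
 unfolding topspace_cosets by blast

lemma N_cosetE:
 assumes "y \<in> topspace N" obtains g where "g \<in> carrier G" "y = g <# K"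
 using assms unfolding topspace_cosets by blast

lemma coset_K_eq_iff: "a \<in> carrier G ==> b \<in> carrier G ==> a <# K = b <# K \<longleftrightarrow> inv a \<otimes> b \<in> K"
 by (rule l_coset_eq_iff[OF subgroup_K])

lemma projection_coset:
 assumes g: "g \<in> carrier G"
 shows "\<pi> (g <# H) = g <# K"
proof
 show "\<pi> (g <# H) \<subseteq> g <# K"
 proof
  fix x assume "x \<in> \<pi> (g <# H)"
  hence "\<exists>h\<in>H. \<exists>k\<in>K. x = g \<otimes> h \<otimes> k"
   unfolding coset_projection_def set_mult_def l_coset_def by blast
  then obtain h k where hk: "h \<in> H" "k \<in> K" "x = g \<otimes> h \<otimes> k" by (elim bexE)
  have hK: "h \<in> K" using H_subset_K hk(1) by (rule subsetD)
  have "x = g \<otimes> (h \<otimes> k)"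
   using g hk K_carrier[OF hK] K_carrier[OF hk(2)] by (simp add: m_assoc)
  thus "x \<in> g <# K" using subgroup.m_closed[OF subgroup_K hK hk(2)] unfolding l_coset_def by blast
 qed
 show "g <# K \<subseteq> \<pi> (g <# H)"
 proof
  fix x assume "x \<in> g <# K"
  hence "\<exists>k\<in>K. x = g \<otimes> \<one> \<otimes> k" unfolding l_coset_def r_one[OF g] by blast
  then obtain k where "k \<in> K" "x = g \<otimes> \<one> \<otimes> k" by (elim bexE)
  thus "x \<in> \<pi> (g <# H)" using subgroup.one_closed[OF subgroup_H]
   unfolding coset_projection_def set_mult_def l_coset_def by blast
 qed
qed

lemma projection_base: "\<pi> H = \<one> <# K" using projection_coset[of \<one>] by (simp add: one_coset_H)

lemma projection_in_N: "x \<in> topspace M ==> \<pi> x \<in> topspace N"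
 by (elim M_cosetE) (simp add: projection_coset coset_in_N)

lemma projection_action:
 assumes "g \<in> carrier G" "x \<in> topspace M"
 shows "\<pi> (g <# x) = g <# \<pi> x"
proof -
 obtain a where "a \<in> carrier G" "x = a <# H" using assms(2) by (rule M_cosetE)
 thus ?thesis using assms(1) by (simp add: H_action(4) K_action(4) projection_coset)
qed

lemma continuous_projection: "continuous_map M N \<pi>"
proof -
 have "continuous_map T N (\<pi> \<circ> (\<lambda>g. g <# H))"
  by (rule continuous_map_eq[OF continuous_map_coset]) (simp add: topspace_eq projection_coset)
 thus ?thesis using continuous_compose_quotient_map_eq[OF quotient_map_coset[OF subgroup_H]] by blast
qed

lemma F_eq_fibre: "x \<in> F \<longleftrightarrow> x \<in> topspace M \<and> \<pi> x = \<pi> H"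
proof (cases "x \<in> topspace M")
 case True
 then obtain g where "g \<in> carrier G" "x = g <# H" by (rule M_cosetE)
 thus ?thesis using True coset_K_eq_iff[of \<one> g] by (auto simp: projection_coset projection_base K_iff)
next
 case False
 thus ?thesis using F_subset by blast
qed

lemma same_fibreD:
 assumes "x \<in> topspace M" "y \<in> topspace M" "\<pi> x = \<pi> y"
 obtains g where "g \<in> carrier G" "x = g <# H" "inv g <# y \<in> F" "y = g <# (inv g <# y)"
proof -
 obtain g where g: "g \<in> carrier G" "x = g <# H" using assms(1) by (rule M_cosetE)
 have "\<pi> (inv g <# y) = \<pi> H" using assms g by (simp add: projection_action flip: assms(3))
   (simp add: projection_coset K_action projection_base)
 hence "inv g <# y \<in> F" using assms(2) g by (simp add: F_eq_fibre H_action)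
 moreover have "y = g <# (inv g <# y)" using assms(2) g by (simp add: H_action)
 ultimately show ?thesis using that g by blast
qed

text \<open>A translation carries \<open>x\<close> to the base point and the whole antisymmetric set
  into \<open>F\<close>, which is a fibre.\<close>

lemma anti_in_fibre:
 assumes E: "anti E" "x \<in> E" "y \<in> E"
 shows "\<pi> x = \<pi> y"
proof -
 have xy: "x \<in> topspace M" "y \<in> topspace M" using E by (auto simp: anti_def)
 obtain g where g: "g \<in> carrier G" "x = g <# H" using xy(1) by (rule M_cosetE)
 have "inv g <# x = H" using g by (simp add: H_action one_coset_H)
 hence "l_coset G (inv g) ` E \<subseteq> F" using E g H_in_F image_eqI[of H "l_coset G (inv g)" x E]
  by (intro anti_subset_F[of _ H] anti_translate) auto
 hence "\<pi> (inv g <# y) = \<pi> H" using E(3) F_eq_fibre by blast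
 hence "g <# \<pi> (inv g <# y) = g <# \<pi> H" by simp
 thus ?thesis
  using xy g by (simp add: projection_action projection_in_N K_action H_action projection_base projection_coset)
qed

lemma real_constant_on_fibres:
 assumes f: "f \<in> \<B>" "\<And>x. x \<in> topspace M ==> f x \<in> \<real>"
  and xy: "x \<in> topspace M" "y \<in> topspace M" "\<pi> x = \<pi> y"
 shows "f x = f y"
proof -
 obtain g where g: "g \<in> carrier G" "x = g <# H" "inv g <# y \<in> F" "y = g <# (inv g <# y)"
  using same_fibreD[OF xy] .
 have "f (g <# H) = f (g <# (inv g <# y))"
  by (rule antiD[OF anti_F \<B>_translate[OF f(1) g(1)] _ H_in_F g(3)])
   (use f(2) g(1) F_subset in \<open>simp add: H_action subsetD\<close>)
 thus ?thesis using g by simp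
qed

lemma pullback_in_\<B>:
 assumes u: "cmap N u"
 shows "(\<lambda>x. u (\<pi> x)) \<in> \<B>"
proof (rule UA.uniform_limit)
 show cu: "cmap M (\<lambda>x. u (\<pi> x))"
  by (rule continuous_map_apply[OF u continuous_projection])
 fix e :: real assume e: "e > 0"
 have "\<exists>a\<in>\<B>. \<forall>x\<in>topspace M. norm (u (\<pi> x) - a x) < e"
 proof (rule UA.Bishop_Machado[OF cu])
  fix E assume E: "closedin M E" "antisymmetric_set \<B> E"
  hence aE: "anti E" unfolding anti_def antisymmetric_set_def using closedin_subset by blast
  show "\<exists>a\<in>\<B>. \<forall>x\<in>E. norm (u (\<pi> x) - a x) < e"
  proof (cases "E = {}")
   case True
   thus ?thesis using UA.const[of 0] by blast
  next
   case False
   then obtain x0 where "x0 \<in> E" by blast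
   show ?thesis
   proof (intro bexI ballI)
    fix x assume "x \<in> E"
    hence "\<pi> x = \<pi> x0" using \<open>x0 \<in> E\<close> by (rule anti_in_fibre[OF aE])
    thus "norm (u (\<pi> x) - u (\<pi> x0)) < e" using e by simp
   qed (rule UA.const)
  qed
 qed
 thus "\<exists>a\<in>\<B>. \<forall>x\<in>topspace M. norm (u (\<pi> x) - a x) \<le> e"
  using less_imp_le by blast
qed

lemma compact_space_N: "compact_space N" and Hausdorff_space_N: "Hausdorff_space N"
 by (rule compact_coset_space, rule Hausdorff_coset_space[OF subgroup_K closed_K])

lemma projection_onto: "\<pi> ` topspace M = topspace N"
proof
 show "topspace N \<subseteq> \<pi> ` topspace M"
 proof
  fix y assume "y \<in> topspace N"
  then obtain g where "g \<in> carrier G" "y = g <# K" by (rule N_cosetE)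
  thus "y \<in> \<pi> ` topspace M"
   by (intro image_eqI[of _ _ "g <# H"]) (simp_all add: projection_coset coset_in_M)
 qed
qed (use projection_in_N in blast)

section \<open>Invariant measures on the fibres\<close>

sublocale KG: compact_group "G\<lparr>carrier := K\<rparr>" "subtopology T K"
 by (rule compact_subgroup[OF subgroup_K closed_K])

lemma topspace_K: "topspace (subtopology T K) = K" using K_carrier by (auto simp: topspace_eq)

definition fib :: "'a set => 'a set topology" where
 "fib y = subtopology M {x \<in> topspace M. \<pi> x = y}"

lemma topspace_fib: "topspace (fib y) = {x \<in> topspace M. \<pi> x = y}" by (auto simp: fib_def)

lemma closed_fib: "y \<in> topspace N ==> closedin M {x \<in> topspace M. \<pi> x = y}"
 using closedin_continuous_map_preimage[OF continuous_projection, of "{y}"] Hausdorff_space_N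
 by (simp add: closedin_Hausdorff_sing_eq)

lemma fib_compact:
 assumes "y \<in> topspace N"
 shows "compact_space (fib y)" "Hausdorff_space (fib y)" "second_countable (fib y)"
proof -
 show "compact_space (fib y)" unfolding fib_def using closed_fib[OF assms] compact_coset_space[of H]
  by (simp add: closedin_compact_space compact_space_subtopology)
 show "Hausdorff_space (fib y)" "second_countable (fib y)"
  unfolding fib_def using Hausdorff_coset_space[OF subgroup_H closed_H] second_countable_coset_space[OF subgroup_H]
  by (simp_all add: Hausdorff_space_subtopology second_countable_subtopology)
qed

lemma continuous_orbit:
 assumes g: "continuous_map X T a"
 shows "continuous_map X M (\<lambda>x. a x <# H)"
 using continuous_map_compose[OF g continuous_map_coset] by (simp add: o_def)

lemma continuous_K: "continuous_map (subtopology T K) T (\<lambda>k. k)"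
 by (rule continuous_map_from_subtopology) simp

lemma continuous_into_fib:
 assumes g: "g \<in> carrier G"
 shows "continuous_map (subtopology T K) (fib (g <# K)) (\<lambda>k. (g \<otimes> k) <# H)"
proof -
 have "\<pi> ((g \<otimes> k) <# H) = g <# K" if "k \<in> K" for k
  using g that K_carrier[OF that] coset_K_eq_iff[of g "g \<otimes> k"]
  by (simp add: projection_coset m_assoc[symmetric])
 moreover have "continuous_map (subtopology T K) M (\<lambda>k. (g \<otimes> k) <# H)"
  by (intro continuous_orbit continuous_map_mult continuous_map_const_carrier g continuous_K)
 ultimately show ?thesis unfolding fib_def continuous_map_in_subtopology topspace_K
  using coset_in_M g K_carrier by auto
qed

lemma stabilizer_coset:
 assumes g: "g \<in> carrier G"
 shows "s \<in> stabilizer G (l_coset G) (g <# K) \<longleftrightarrow> (\<exists>k\<in>K. s = g \<otimes> k \<otimes> inv g)"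
proof
 assume "s \<in> stabilizer G (l_coset G) (g <# K)"
 hence s: "s \<in> carrier G" and "s <# (g <# K) = g <# K" unfolding stabilizer_def by blast+
 hence "(s \<otimes> g) <# K = g <# K" using g by (simp only: K_action(4))
 hence "inv g \<otimes> (s \<otimes> g) \<in> K" using g s coset_K_eq_iff[of g "s \<otimes> g"] by simp
 moreover have "s = g \<otimes> (inv g \<otimes> (s \<otimes> g)) \<otimes> inv g"
  using g s by (simp add: m_assoc) (simp add: m_assoc[symmetric])
 ultimately show "\<exists>k\<in>K. s = g \<otimes> k \<otimes> inv g" by blast
next
 assume "\<exists>k\<in>K. s = g \<otimes> k \<otimes> inv g"
 then obtain k where k: "k \<in> K" "s = g \<otimes> k \<otimes> inv g" by blast
 have kG: "k \<in> carrier G" by (rule K_carrier[OF k(1)])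
 have "s <# (g <# K) = (g \<otimes> k) <# K" using g k kG by (simp add: K_action m_assoc)
 also have "... = g <# K"
  using g k kG coset_K_eq_iff[of g "g \<otimes> k"] by (simp add: m_assoc[symmetric])
 finally show "s \<in> stabilizer G (l_coset G) (g <# K)" using g k kG by (simp add: stabilizer_def)
qed

text \<open>Haar measure of \<open>K\<close> transported along the orbit map of \<open>K\<close>
  onto the fibre over \<open>g <# K\<close>.\<close>

definition fibm :: "'a => 'a set measure" where
 "fibm g = distr KG.haar (borel_of (fib (g <# K))) (\<lambda>k. (g \<otimes> k) <# H)"

lemma fib_measurable:
 assumes "g \<in> carrier G"
 shows "(\<lambda>k. (g \<otimes> k) <# H) \<in> measurable KG.haar (borel_of (fib (g <# K)))"
 using measurable_borel_of_continuous_map[OF continuous_into_fib[OF assms]]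
 by (simp add: measurable_cong_sets[OF KG.sets_haar refl])

lemma continuous_stabilizer_action:
 assumes g: "g \<in> carrier G" and k: "k \<in> K"
 shows "continuous_map (fib (g <# K)) (fib (g <# K)) (\<lambda>x. (g \<otimes> k \<otimes> inv g) <# x)"
proof -
 have s: "g \<otimes> k \<otimes> inv g \<in> carrier G" "(g \<otimes> k \<otimes> inv g) <# (g <# K) = g <# K"
  using stabilizer_coset[OF g, of "g \<otimes> k \<otimes> inv g"] g k K_carrier[OF k] by (auto simp: stabilizer_def)
 have "continuous_map M M (\<lambda>x. (g \<otimes> k \<otimes> inv g) <# x)"
  using s(1) by (intro continuous_map_act subgroup_H continuous_map_const_carrier continuous_map_id[unfolded id_def])
 hence "continuous_map (fib (g <# K)) M (\<lambda>x. (g \<otimes> k \<otimes> inv g) <# x)"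
  unfolding fib_def by (rule continuous_map_from_subtopology)
 moreover have "(g \<otimes> k \<otimes> inv g) <# x \<in> {x \<in> topspace M. \<pi> x = g <# K}" if "x \<in> topspace (fib (g <# K))" for x
  using that s by (simp add: topspace_fib projection_action H_action)
 ultimately show ?thesis by (subst (2) fib_def) (auto simp: continuous_map_in_subtopology)
qed

text \<open>Invariance is phrased with images of Borel sets, measurability with preimages; the
  inverse action converts one into the other.\<close>

lemma action_preimage:
 assumes g: "g \<in> carrier G" and k: "k \<in> K" and B: "B \<subseteq> topspace (fib (g <# K))"
 shows "l_coset G (g \<otimes> k \<otimes> inv g) ` B =
  (\<lambda>x. (g \<otimes> inv k \<otimes> inv g) <# x) -` B \<inter> topspace (fib (g <# K))" (is "?l = ?r")
proof -
 let ?s = "g \<otimes> k \<otimes> inv g" and ?t = "g \<otimes> inv k \<otimes> inv g"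
 have kG: "k \<in> carrier G" by (rule K_carrier[OF k])
 have st: "?s \<otimes> ?t = \<one>" "?t \<otimes> ?s = \<one>"
  using g kG by (simp_all add: m_assoc) (simp_all add: m_assoc[symmetric])
 have cl: "?s \<in> carrier G" "?t \<in> carrier G" using g kG by auto
 have inv: "?t <# (?s <# x) = x" "?s <# (?t <# x) = x" if "x \<in> topspace M" for x
  using st cl that by (simp_all only: H_action)
 have M: "x \<in> topspace M" if "x \<in> topspace (fib (g <# K))" for x
  using that by (simp add: topspace_fib)
 have mem: "?s <# x \<in> topspace (fib (g <# K))" if "x \<in> topspace (fib (g <# K))" for x
  using continuous_map_image_subset_topspace[OF continuous_stabilizer_action[OF g k]] that by blast
 show ?thesis
 proof
  show "?l \<subseteq> ?r" using B inv(1) M mem by (auto simp: subset_iff)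
  show "?r \<subseteq> ?l" using inv(2) M by (force intro!: image_eqI)
 qed
qed

text \<open>The stabiliser is the conjugate of \<open>K\<close> by \<open>g\<close>; under the orbit
  map its action becomes left translation on \<open>K\<close>.\<close>

lemma invariant_fibm:
 assumes g: "g \<in> carrier G"
 shows "invariant_probability G (stabilizer G (l_coset G) (g <# K)) (fib (g <# K)) (fibm g)"
 unfolding invariant_probability_def
proof (intro conjI ballI)
 show "sets (fibm g) = sets (borel_of (fib (g <# K)))" by (simp add: fibm_def)
 show "prob_space (fibm g)" unfolding fibm_def by (rule KG.haar.prob_space_distr[OF fib_measurable[OF g]])
 fix s B assume "s \<in> stabilizer G (l_coset G) (g <# K)" and B: "B \<in> sets (fibm g)"
 then obtain k where k: "k \<in> K" "s = g \<otimes> k \<otimes> inv g" using stabilizer_coset[OF g] by blast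
 let ?j = "\<lambda>k. (g \<otimes> k) <# H"
 have kG: "k \<in> carrier G" by (rule K_carrier[OF k(1)])
 have ik: "inv k \<in> K" by (rule subgroup.m_inv_closed[OF subgroup_K k(1)])
 have Bs: "B \<in> sets (borel_of (fib (g <# K)))" using B by (simp add: fibm_def)
 hence Bsub: "B \<subseteq> topspace (fib (g <# K))" using sets.sets_into_space by fastforce
 have eq: "l_coset G s ` B = (\<lambda>x. (g \<otimes> inv k \<otimes> inv g) <# x) -` B \<inter> space (borel_of (fib (g <# K)))"
  unfolding k(2) space_borel_of by (rule action_preimage[OF g k(1) Bsub])
 have sB: "l_coset G s ` B \<in> sets (borel_of (fib (g <# K)))"
  unfolding eq by (rule measurable_sets[OF measurable_borel_of_continuous_map[OF continuous_stabilizer_action[OF g ik]] Bs])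
 define C where "C = ?j -` B \<inter> space KG.haar"
 have Cs: "C \<in> sets KG.haar" unfolding C_def by (rule measurable_sets[OF fib_measurable[OF g] Bs])
 have left: "(\<lambda>x. inv k \<otimes> x) \<in> measurable KG.haar KG.haar"
  using measurable_borel_of_continuous_map[OF KG.continuous_map_left_mult, of "inv k"] ik
  by (simp add: measurable_cong_sets[OF KG.sets_haar KG.sets_haar])
 have "?j -` (l_coset G s ` B) \<inter> space KG.haar = (\<lambda>x. inv k \<otimes> x) -` C \<inter> space KG.haar"
 proof -
  have "?j l \<in> l_coset G s ` B \<longleftrightarrow> ?j (inv k \<otimes> l) \<in> B" if l: "l \<in> K" for l
  proof -
   have "?j l \<in> topspace (fib (g <# K))"
    using continuous_map_image_subset_topspace[OF continuous_into_fib[OF g]] l topspace_K by blast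
   moreover have "(g \<otimes> inv k \<otimes> inv g) <# ?j l = ?j (inv k \<otimes> l)"
    using g kG K_carrier[OF l] by (simp add: H_action m_assoc) (simp add: m_assoc[symmetric])
   ultimately show ?thesis unfolding eq by simp
  qed
  moreover have "inv k \<otimes> l \<in> K" if "l \<in> K" for l
   using ik that subgroup.m_closed[OF subgroup_K] by blast
  ultimately show ?thesis by (auto simp: C_def)
 qed
 hence "emeasure (fibm g) (l_coset G s ` B) = emeasure KG.haar ((\<lambda>x. inv k \<otimes> x) -` C \<inter> space KG.haar)"
  unfolding fibm_def by (simp only: emeasure_distr[OF fib_measurable[OF g] sB])
 also have "... = emeasure (distr KG.haar KG.haar (\<lambda>x. inv k \<otimes> x)) C"
  by (rule emeasure_distr[OF left Cs, symmetric])
 also have "distr KG.haar KG.haar (\<lambda>x. inv k \<otimes> x) = KG.haar"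
  using KG.haar_left[of "inv k"] ik by (simp cong: distr_cong)
 also have "emeasure KG.haar C = emeasure (fibm g) B"
  unfolding fibm_def C_def by (rule emeasure_distr[OF fib_measurable[OF g] Bs, symmetric])
 finally show "emeasure (fibm g) (l_coset G s ` B) = emeasure (fibm g) B" .
qed

text \<open>The integral of \<open>f\<close> against an invariant measure does not change when
  \<open>f\<close> is averaged over the stabiliser, and the average is constant on the fibre since
  the stabiliser acts transitively there.\<close>

lemma fibm_unique:
 assumes g: "g \<in> carrier G"
  and \<mu>: "invariant_probability G (stabilizer G (l_coset G) (g <# K)) (fib (g <# K)) \<mu>"
 shows "\<mu> = fibm g"
proof -
 let ?Y = "fib (g <# K)" and ?s = "\<lambda>k. g \<otimes> k \<otimes> inv g"
 have y: "g <# K \<in> topspace N" by (rule coset_in_N[OF g])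
 have sets\<mu>: "sets \<mu> = sets (borel_of ?Y)" and prob\<mu>: "prob_space \<mu>"
  using \<mu> by (auto simp: invariant_probability_def)
 interpret \<mu>: prob_space \<mu> by (rule prob\<mu>)
 interpret fibm: prob_space "fibm g" using invariant_fibm[OF g] by (simp add: invariant_probability_def)
 show ?thesis
 proof (rule integral_eq_imp_measure_eq[OF fib_compact[OF y] sets\<mu>])
  show "finite_measure \<mu>" "finite_measure (fibm g)"
   by (rule \<mu>.finite_measure_axioms, rule fibm.finite_measure_axioms)
  show "sets (fibm g) = sets (borel_of ?Y)" by (simp add: fibm_def)
  fix f :: "'a set => real" assume f: "rcmap ?Y f"
  have inv: "(\<integral>x. f (?s k <# x) \<partial>\<mu>) = (\<integral>x. f x \<partial>\<mu>)" if k: "k \<in> K" for k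
  proof -
   have ik: "inv k \<in> K" by (rule subgroup.m_inv_closed[OF subgroup_K k])
   have ms: "(\<lambda>x. ?s k <# x) \<in> measurable \<mu> \<mu>"
    using measurable_borel_of_continuous_map[OF continuous_stabilizer_action[OF g k]]
    by (simp add: measurable_cong_sets[OF sets\<mu> sets\<mu>])
   have "distr \<mu> \<mu> (\<lambda>x. ?s k <# x) = \<mu>"
   proof (rule measure_eqI)
    fix B assume "B \<in> sets (distr \<mu> \<mu> (\<lambda>x. ?s k <# x))"
    hence B: "B \<in> sets \<mu>" by simp
    hence "B \<subseteq> topspace ?Y" using sets\<mu> sets.sets_into_space[of B "borel_of ?Y"] by simp
    from action_preimage[OF g ik this] have "(\<lambda>x. ?s k <# x) -` B \<inter> space \<mu> = l_coset G (?s (inv k)) ` B"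
     using sets_eq_imp_space_eq[OF sets\<mu>] k K_carrier[OF k] by simp
    moreover have "?s (inv k) \<in> stabilizer G (l_coset G) (g <# K)"
     using stabilizer_coset[OF g] ik by blast
    ultimately show "emeasure (distr \<mu> \<mu> (\<lambda>x. ?s k <# x)) B = emeasure \<mu> B"
     using \<mu> B by (simp add: emeasure_distr[OF ms] invariant_probability_def)
   qed simp
   moreover have "(\<integral>x. f x \<partial>distr \<mu> \<mu> (\<lambda>x. ?s k <# x)) = (\<integral>x. f (?s k <# x) \<partial>\<mu>)"
    by (rule integral_distr[OF ms borel_measurable_continuous_map[OF sets\<mu> f]])
   ultimately show ?thesis by simp
  qed
  have c2: "rcmap (prod_topology (subtopology T K) ?Y) (\<lambda>(k, x). f (?s k <# x))"
  proof -
   have "continuous_map (prod_topology (subtopology T K) ?Y) M (\<lambda>p. ?s (fst p) <# snd p)"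
    using continuous_map_compose[OF continuous_map_fst continuous_K]
     continuous_map_from_subtopology_mono[of M "topspace M" M "\<lambda>x. x"]
    by (intro continuous_map_act subgroup_H continuous_map_mult continuous_map_const_carrier g inv_closed)
     (auto simp: o_def fib_def intro!: continuous_map_into_fulltopology[OF continuous_map_snd])
   moreover have "?s k <# x \<in> {x \<in> topspace M. \<pi> x = g <# K}" if "k \<in> K" "x \<in> topspace ?Y" for k x
    using continuous_map_image_subset_topspace[OF continuous_stabilizer_action[OF g that(1)]] that(2)
    unfolding topspace_fib by blast
   ultimately have "continuous_map (prod_topology (subtopology T K) ?Y) ?Y (\<lambda>p. ?s (fst p) <# snd p)"
    by (subst (2) fib_def) (auto simp: continuous_map_in_subtopology)
   from continuous_map_apply[OF f this] show ?thesis by (simp add: case_prod_unfold)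
  qed
  have "(\<integral>x. f x \<partial>\<mu>) = (\<integral>k. (\<integral>x. f (?s k <# x) \<partial>\<mu>) \<partial>KG.haar)"
  proof -
   have "(\<integral>k. (\<integral>x. f (?s k <# x) \<partial>\<mu>) \<partial>KG.haar) = (\<integral>k. (\<integral>x. f x \<partial>\<mu>) \<partial>KG.haar)"
    by (rule KG.haar_integral_cong) (use inv in simp)
   thus ?thesis using KG.haar_prob by simp
  qed
  also have "... = (\<integral>x. (\<integral>k. f (?s k <# x) \<partial>KG.haar) \<partial>\<mu>)"
   by (rule Fubini_continuous[OF KG.compact_T KG.Hausdorff_T KG.sets_haar KG.prob_space_haar
      fib_compact(1)[OF y] sets\<mu> prob\<mu> c2])
  also have "... = (\<integral>x. (\<integral>k. f ((g \<otimes> k) <# H) \<partial>KG.haar) \<partial>\<mu>)"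
  proof (rule Bochner_Integration.integral_cong[OF refl])
   fix x assume "x \<in> space \<mu>"
   hence "x \<in> topspace ?Y" using sets_eq_imp_space_eq[OF sets\<mu>] by simp
   hence x: "x \<in> topspace M" "\<pi> x = g <# K" by (simp_all add: topspace_fib)
   obtain a where a: "a \<in> carrier G" "x = a <# H" using x(1) by (rule M_cosetE)
   define l where "l = inv g \<otimes> a"
   \<comment> \<open>The point is reached from the base of the fibre by \<open>l\<close>, and right
     invariance of the Haar measure of \<open>K\<close> removes \<open>l\<close>.\<close>
   have l: "l \<in> K" "a = g \<otimes> l"
    using x(2) a g coset_K_eq_iff[of g a] by (auto simp: projection_coset l_def m_assoc[symmetric])
   have "?s k <# x = (g \<otimes> (k \<otimes> l)) <# H" if "k \<in> K" for k
    using g a l K_carrier[OF l(1)] K_carrier[OF that]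
    by (simp add: H_action m_assoc) (simp add: m_assoc[symmetric])
   hence "(\<integral>k. f (?s k <# x) \<partial>KG.haar) = (\<integral>k. f ((g \<otimes> (k \<otimes> l)) <# H) \<partial>KG.haar)"
    by (intro KG.haar_integral_cong) simp
   also have "... = (\<integral>k. f ((g \<otimes> k) <# H) \<partial>KG.haar)"
    using KG.haar_integral_right[of l, OF _ continuous_map_apply[OF f continuous_into_fib[OF g]]] l(1) by simp
   finally show "(\<integral>k. f (?s k <# x) \<partial>KG.haar) = (\<integral>k. f ((g \<otimes> k) <# H) \<partial>KG.haar)" .
  qed
  also have "... = (\<integral>k. f ((g \<otimes> k) <# H) \<partial>KG.haar)"
   using \<mu>.prob_space by simp
  also have "... = (\<integral>x. f x \<partial>fibm g)" unfolding fibm_def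
   by (rule integral_distr[OF fib_measurable[OF g] borel_measurable_continuous_map[OF refl f], symmetric])
  finally show "(\<integral>x. f x \<partial>\<mu>) = (\<integral>x. f x \<partial>fibm g)" .
 qed
qed

lemma fibre_measure_eq:
 assumes g: "g \<in> carrier G"
 shows "fibre_measure G M K (g <# K) = fibm g" unfolding fibre_measure_def fib_def[symmetric]
 by (rule the_equality, rule invariant_fibm[OF g], rule fibm_unique[OF g])

abbreviation "\<alpha> \<equiv> fibre_average G T H K"

lemma fibre_average_coset:
 assumes f: "cmap M f" and g: "g \<in> carrier G"
 shows "\<alpha> f (g <# K) = (\<integral>k. f ((g \<otimes> k) <# H) \<partial>KG.haar)"
proof -
 have "cmap (fib (g <# K)) f"
  unfolding fib_def by (rule continuous_map_from_subtopology[OF f])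
 hence "f \<in> borel_measurable (borel_of (fib (g <# K)))"
  by (rule borel_measurable_continuous_map[OF refl])
 thus ?thesis using coset_in_N[OF g] unfolding fibre_average_def
  by (simp add: fibre_measure_eq[OF g] fibm_def integral_distr[OF fib_measurable[OF g]])
qed

end

section \<open>Averages over the fibres\<close>

context invariant_algebra
begin

lemma coset_K_absorb: "g \<in> carrier G ==> k \<in> K ==> (g \<otimes> k) <# K = g <# K"
 using coset_K_eq_iff[of g "g \<otimes> k"] K_carrier[of k] by (simp add: m_assoc[symmetric])

lemma continuous_orbit_average_kernel:
 assumes f: "cmap M f"
 shows "cmap (prod_topology T (subtopology T K)) (\<lambda>(g, k). f ((g \<otimes> k) <# H))"
proof -
 have "continuous_map (prod_topology T (subtopology T K)) M (\<lambda>p. (fst p \<otimes> snd p) <# H)"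
  by (intro continuous_orbit continuous_map_mult continuous_map_fst
    continuous_map_into_fulltopology[OF continuous_map_snd])
 from continuous_map_apply[OF f this] show ?thesis by (simp add: case_prod_unfold)
qed

lemma continuous_orbit_K:
 assumes f: "cmap M f" and g: "g \<in> carrier G"
 shows "cmap (subtopology T K) (\<lambda>k. f ((g \<otimes> k) <# H))"
 by (intro continuous_map_apply[OF f] continuous_orbit continuous_map_mult continuous_map_const_carrier g continuous_K)

lemma fibre_average_extensional: "\<alpha> f \<in> extensional (topspace N)" by (simp add: fibre_average_def)

lemma continuous_fibre_average:
 assumes f: "cmap M f"
 shows "cmap N (\<alpha> f)"
proof -
 have "cmap T (\<lambda>g. \<integral>k. f ((g \<otimes> k) <# H) \<partial>KG.haar)"
  by (rule continuous_map_integral_parameter[OF KG.compact_T KG.sets_haar KG.prob_space_haar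
     continuous_orbit_average_kernel[OF f]])
 hence "cmap T (\<alpha> f \<circ> (\<lambda>g. g <# K))"
  by (rule continuous_map_eq) (simp add: topspace_eq fibre_average_coset[OF f])
 thus ?thesis using continuous_compose_quotient_map_eq[OF quotient_map_coset[OF subgroup_K]] by blast
qed

lemma fibre_average_cong:
 assumes f: "cmap M f" and eq: "\<And>x. x \<in> topspace M ==> f x = h x"
 shows "\<alpha> f = \<alpha> h"
proof (rule extensionalityI[OF fibre_average_extensional fibre_average_extensional])
 have h: "cmap M h" by (rule continuous_map_eq[OF f eq])
 fix y assume "y \<in> topspace N"
 then obtain g where g: "g \<in> carrier G" "y = g <# K" by (rule N_cosetE)
 show "\<alpha> f y = \<alpha> h y"
  unfolding g(2) fibre_average_coset[OF f g(1)] fibre_average_coset[OF h g(1)]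
  by (rule KG.haar_integral_cong) (use g(1) K_carrier in \<open>simp add: eq coset_in_M\<close>)
qed

lemma fibre_average_add:
 assumes f: "cmap M f" and h: "cmap M h" and y: "y \<in> topspace N"
 shows "\<alpha> (\<lambda>x. f x + h x) y = \<alpha> f y + \<alpha> h y"
proof -
 obtain g where g: "g \<in> carrier G" "y = g <# K" using y by (rule N_cosetE)
 show ?thesis unfolding g(2) fibre_average_coset[OF f g(1)] fibre_average_coset[OF h g(1)]
   fibre_average_coset[OF continuous_map_add[OF f h] g(1)]
  by (intro Bochner_Integration.integral_add KG.haar_integrable continuous_orbit_K f h g(1))
qed

lemma fibre_average_pullback_mult:
 assumes f: "cmap M f" and u: "cmap N u" and y: "y \<in> topspace N"
 shows "\<alpha> (\<lambda>x. f x * u (\<pi> x)) y = \<alpha> f y * u y"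
proof -
 obtain g where g: "g \<in> carrier G" "y = g <# K" using y by (rule N_cosetE)
 have c: "cmap M (\<lambda>x. f x * u (\<pi> x))"
  by (intro continuous_map_mult_algebra f continuous_map_apply[OF u continuous_projection])
 have "(\<integral>k. f ((g \<otimes> k) <# H) * u (\<pi> ((g \<otimes> k) <# H)) \<partial>KG.haar) = (\<integral>k. f ((g \<otimes> k) <# H) * u y \<partial>KG.haar)"
  by (rule KG.haar_integral_cong) (use g K_carrier in \<open>simp add: projection_coset coset_K_absorb\<close>)
 thus ?thesis unfolding g(2) fibre_average_coset[OF f g(1)] fibre_average_coset[OF c g(1)] by simp
qed

lemma fibre_average_const: "y \<in> topspace N ==> \<alpha> (\<lambda>x. c) y = c"
proof -
 assume "y \<in> topspace N"
 then obtain g where g: "g \<in> carrier G" "y = g <# K" by (rule N_cosetE)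
 show ?thesis unfolding g(2) using KG.haar_prob by (subst fibre_average_coset[OF _ g(1)]) simp_all
qed

lemma fibre_average_pullback:
 assumes "cmap N u" "y \<in> topspace N"
 shows "\<alpha> (\<lambda>x. u (\<pi> x)) y = u y"
 using fibre_average_pullback_mult[of "\<lambda>x. 1", OF _ assms] assms(2) by (simp add: fibre_average_const)

lemma fibre_average_translate:
 assumes f: "cmap M f" and a: "a \<in> carrier G" and y: "y \<in> topspace N"
 shows "\<alpha> (\<lambda>x. f (a <# x)) y = \<alpha> f (a <# y)"
proof -
 obtain g where g: "g \<in> carrier G" "y = g <# K" using y by (rule N_cosetE)
 have "continuous_map M M (\<lambda>x. a <# x)"
  by (intro continuous_map_act subgroup_H continuous_map_const_carrier a continuous_map_id[unfolded id_def])
 hence c: "cmap M (\<lambda>x. f (a <# x))" by (rule continuous_map_apply[OF f])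
 have ag: "a <# y = (a \<otimes> g) <# K" using a g by (simp add: K_action(4))
 have cl: "a \<otimes> g \<in> carrier G" using a g by simp
 show ?thesis unfolding ag fibre_average_coset[OF f cl] unfolding g(2) fibre_average_coset[OF c g(1)]
  by (rule KG.haar_integral_cong) (use a g K_carrier in \<open>simp add: H_action(4) m_assoc\<close>)
qed

text \<open>Right translation by an element of \<open>K\<close> leaves the integral over the group
  unchanged; averaging over \<open>K\<close> and exchanging the integrals disintegrates it over the
  fibres.\<close>

lemma haar_fibre_average:
 assumes f: "cmap M f"
 shows "(\<integral>g. f (g <# H) \<partial>haar) = (\<integral>g. \<alpha> f (g <# K) \<partial>haar)"
proof -
 have "(\<integral>g. \<alpha> f (g <# K) \<partial>haar) = (\<integral>g. (\<integral>k. f ((g \<otimes> k) <# H) \<partial>KG.haar) \<partial>haar)"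
  by (rule haar_integral_cong) (rule fibre_average_coset[OF f])
 also have "... = (\<integral>k. (\<integral>g. f ((g \<otimes> k) <# H) \<partial>haar) \<partial>KG.haar)"
  by (rule Fubini_continuous[OF compact_T Hausdorff_T sets_haar prob_space_haar KG.compact_T KG.sets_haar
     KG.prob_space_haar continuous_orbit_average_kernel[OF f]])
 also have "... = (\<integral>k. (\<integral>g. f (g <# H) \<partial>haar) \<partial>KG.haar)"
  by (rule KG.haar_integral_cong)
   (use haar_integral_right[OF K_carrier continuous_map_apply[OF f continuous_map_coset]] in simp)
 also have "... = (\<integral>g. f (g <# H) \<partial>haar)" using KG.haar_prob by simp
 finally show ?thesis ..
qed

lemma continuous_translates:
 assumes u: "cfun u" and f: "cmap M f"
 shows "cmap (prod_topology T M) (\<lambda>(y, x). u y * f (inv y <# x))"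
proof -
 have "continuous_map (prod_topology T M) M (\<lambda>p. inv (fst p) <# snd p)"
  by (intro continuous_map_act subgroup_H continuous_map_inverse continuous_map_fst continuous_map_snd)
 hence "cmap (prod_topology T M) (\<lambda>p. u (fst p) * f (inv (fst p) <# snd p))"
  by (intro continuous_map_mult_algebra continuous_map_apply[OF u continuous_map_fst] continuous_map_apply[OF f])
 thus ?thesis by (simp add: case_prod_unfold)
qed

text \<open>A convolution is a uniform limit of linear combinations of translates. It therefore lies
  in every closed invariant algebra, and an ideal contains approximations of it.\<close>

lemma convolution_approximation:
 assumes u: "cfun u" and f: "cmap M f" and e: "e > 0"
 obtains P and w :: "'a => real" where "finite P" "P \<subseteq> carrier G"
  "\<And>x. x \<in> topspace M ==> norm (coset_convolution u f x - (\<Sum>p\<in>P. (of_real (w p) * u p) * f (inv p <# x))) \<le> e"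
proof -
 have m: "(\<lambda>g. g <# H) \<in> measurable haar (borel_of M)"
  using measurable_borel_of_continuous_map[OF continuous_map_coset]
  by (simp add: measurable_cong_sets[OF sets_haar refl])
 have "sets (distr haar (borel_of M) (\<lambda>g. g <# H)) = sets (borel_of M)" by simp
 from integral_uniform_sums[OF compact_T Hausdorff_T sets_haar prob_space_haar compact_coset_space this
   haar.prob_space_distr[OF m] continuous_translates[OF u f] e]
 obtain P w where "finite P" "P \<subseteq> topspace T"
  "\<forall>x\<in>topspace M. norm ((\<integral>y. u y * f (inv y <# x) \<partial>haar) - (\<Sum>p\<in>P. w p *\<^sub>R (u p * f (inv p <# x)))) \<le> e"
  by (elim exE conjE)
 thus ?thesis
  by (intro that[of P w]) (simp_all add: topspace_eq coset_convolution_def scaleR_conv_of_real mult.assoc)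
qed

lemma convolution_in_\<B>:
 assumes u: "cfun u" and f: "f \<in> \<B>"
 shows "coset_convolution u f \<in> \<B>"
proof (rule UA.uniform_limit)
 have cf: "cmap M f" by (rule UA.continuous[OF f])
 show "cmap M (coset_convolution u f)"
  by (rule continuous_coset_convolution[OF subgroup_H u cf])
 fix e :: real assume "e > 0"
 then obtain P w where P: "finite P" "P \<subseteq> carrier G"
  "\<And>x. x \<in> topspace M ==> norm (coset_convolution u f x - (\<Sum>p\<in>P. (of_real (w p) * u p) * f (inv p <# x))) \<le> e"
  using convolution_approximation[OF u cf] by blast
 show "\<exists>h\<in>\<B>. \<forall>x\<in>topspace M. norm (coset_convolution u f x - h x) \<le> e"
 proof (intro bexI ballI)
  show "(\<lambda>x. \<Sum>p\<in>P. (of_real (w p) * u p) * f (inv p <# x)) \<in> \<B>"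
   using P(2) by (intro UA.sum P(1) UA.scale \<B>_translate f inv_closed) auto
 qed (rule P(3))
qed

text \<open>Averaging over fibres commutes with left translation, hence with convolution from the
  left; so convolution preserves vanishing averages.\<close>

lemma fibre_average_convolution:
 assumes u: "cfun u" and f: "cmap M f" and g: "g \<in> carrier G"
 shows "\<alpha> (coset_convolution u f) (g <# K) = (\<integral>y. u y * \<alpha> f ((inv y \<otimes> g) <# K) \<partial>haar)"
proof -
 have c: "cmap (prod_topology (subtopology T K) T) (\<lambda>(k, y). u y * f (inv y <# ((g \<otimes> k) <# H)))"
 proof -
  have "continuous_map (prod_topology (subtopology T K) T) M (\<lambda>p. inv (snd p) <# ((g \<otimes> fst p) <# H))"
   by (intro continuous_map_act subgroup_H continuous_map_inverse continuous_map_snd continuous_orbit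
     continuous_map_mult continuous_map_const_carrier g continuous_map_into_fulltopology[OF continuous_map_fst])
  hence "cmap (prod_topology (subtopology T K) T)
    (\<lambda>p. u (snd p) * f (inv (snd p) <# ((g \<otimes> fst p) <# H)))"
   by (intro continuous_map_mult_algebra continuous_map_apply[OF u continuous_map_snd] continuous_map_apply[OF f])
  thus ?thesis by (simp add: case_prod_unfold)
 qed
 have "\<alpha> (coset_convolution u f) (g <# K) = (\<integral>k. (\<integral>y. u y * f (inv y <# ((g \<otimes> k) <# H)) \<partial>haar) \<partial>KG.haar)"
  unfolding fibre_average_coset[OF continuous_coset_convolution[OF subgroup_H u f] g] coset_convolution_def ..
 also have "... = (\<integral>y. (\<integral>k. u y * f (inv y <# ((g \<otimes> k) <# H)) \<partial>KG.haar) \<partial>haar)"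
  by (rule Fubini_continuous[OF KG.compact_T KG.Hausdorff_T KG.sets_haar KG.prob_space_haar
     compact_T sets_haar prob_space_haar c])
 also have "... = (\<integral>y. u y * \<alpha> f ((inv y \<otimes> g) <# K) \<partial>haar)"
 proof (rule haar_integral_cong)
  fix y assume y: "y \<in> carrier G"
  have cl: "inv y \<otimes> g \<in> carrier G" using y g by simp
  have "(\<integral>k. u y * f (inv y <# ((g \<otimes> k) <# H)) \<partial>KG.haar) = (\<integral>k. u y * f ((inv y \<otimes> g \<otimes> k) <# H) \<partial>KG.haar)"
   by (rule KG.haar_integral_cong) (use y g K_carrier in \<open>simp add: H_action(4) m_assoc\<close>)
  thus "(\<integral>k. u y * f (inv y <# ((g \<otimes> k) <# H)) \<partial>KG.haar) = u y * \<alpha> f ((inv y \<otimes> g) <# K)"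
   unfolding fibre_average_coset[OF f cl] by simp
 qed
 finally show ?thesis .
qed

definition \<A>0 :: "('a set => complex) set" where
 "\<A>0 = {f \<in> \<B>. \<forall>y\<in>topspace N. \<alpha> f y = 0}"

lemma convolution_in_\<A>0:
 assumes u: "cfun u" and f: "f \<in> \<A>0"
 shows "coset_convolution u f \<in> \<A>0"
proof -
 have fB: "f \<in> \<B>" and f0: "\<And>y. y \<in> topspace N ==> \<alpha> f y = 0"
  using f by (auto simp: \<A>0_def)
 have "\<alpha> (coset_convolution u f) y = 0" if y: "y \<in> topspace N" for y
 proof -
  obtain g where g: "g \<in> carrier G" "y = g <# K" using y by (rule N_cosetE)
  have "(\<integral>y. u y * \<alpha> f ((inv y \<otimes> g) <# K) \<partial>haar) = (\<integral>y. 0 \<partial>haar)"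
   by (rule haar_integral_cong) (use g in \<open>simp add: f0 coset_in_N\<close>)
  thus ?thesis unfolding g(2) fibre_average_convolution[OF u UA.continuous[OF fB] g(1)] by simp
 qed
 thus ?thesis using convolution_in_\<B>[OF u fB] by (simp add: \<A>0_def)
qed

lemma selfadjoint_in_\<A>0:
 assumes s: "s \<in> \<A>0" and cs: "(\<lambda>x. cnj (s x)) \<in> \<B>" and x: "x \<in> topspace M"
 shows "s x = 0"
proof -
 have sB: "s \<in> \<B>" and s0: "\<And>y. y \<in> topspace N ==> \<alpha> s y = 0"
  using s by (auto simp: \<A>0_def)
 have const: "s z = s z'" if z: "z \<in> topspace M" "z' \<in> topspace M" "\<pi> z = \<pi> z'" for z z'
 proof -
  \<comment> \<open>Twice the real part and minus twice the imaginary part both belong to the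
    algebra and are real, so antisymmetry applies to each.\<close>
  have "s z + cnj (s z) = s z' + cnj (s z')"
   by (rule real_constant_on_fibres[OF UA.add[OF sB cs] _ z]) (simp add: complex_add_cnj)
  moreover have "\<i> * (s z - cnj (s z)) = \<i> * (s z' - cnj (s z'))"
   by (rule real_constant_on_fibres[OF UA.scale[OF UA.diff[OF sB cs]] _ z]) (simp add: complex_is_Real_iff)
  ultimately show ?thesis by (simp add: complex_eq_iff)
 qed
 obtain a where a: "a \<in> carrier G" "x = a <# H" using x by (rule M_cosetE)
 have "\<alpha> s (a <# K) = (\<integral>k. s ((a \<otimes> k) <# H) \<partial>KG.haar)"
  by (rule fibre_average_coset[OF UA.continuous[OF sB] a(1)])
 also have "... = (\<integral>k. s x \<partial>KG.haar)" by (rule KG.haar_integral_cong, rule const)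
   (use a K_carrier in \<open>simp_all add: coset_in_M projection_coset coset_K_absorb\<close>)
 also have "... = s x" using KG.haar_prob by simp
 finally show ?thesis using s0[OF coset_in_N[OF a(1)]] by simp
qed

section \<open>Multiplicativity of the fibre average\<close>

context
 assumes comm: "commutative_homogeneous_space G T H"
begin

lemma integral_\<A>0:
 assumes f: "f \<in> \<A>0" and g: "g \<in> \<A>0"
 shows "(\<integral>y. f (y <# H) * g (y <# H) \<partial>haar) = 0"
proof (rule ccontr)
 assume nz: "(\<integral>y. f (y <# H) * g (y <# H) \<partial>haar) \<noteq> 0"
 have fB: "f \<in> \<B>" and gB: "g \<in> \<B>" using f g by (auto simp: \<A>0_def)
 obtain u v where uv: "cfun u" "cfun v"
  "\<And>x. x \<in> topspace M ==> coset_convolution u f x = coset_convolution v (\<lambda>x. cnj (g x)) x"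
  "\<exists>x\<in>topspace M. coset_convolution u f x \<noteq> 0"
  by (rule commutative_common_function[OF subgroup_H comm UA.continuous[OF fB] UA.continuous[OF gB] nz]) (rule that)
 \<comment> \<open>The common function equals the convolution of \<open>v\<close> with the conjugate
   of \<open>g\<close>; its conjugate is the convolution of the conjugate of \<open>v\<close> with
   \<open>g\<close> itself, an element of the algebra.\<close>
 have "coset_convolution (\<lambda>y. cnj (v y)) g \<in> \<B>"
  by (rule convolution_in_\<B>[OF continuous_map_cnj[OF uv(2)] gB])
 moreover have "coset_convolution (\<lambda>y. cnj (v y)) g x = cnj (coset_convolution u f x)" if "x \<in> topspace M" for x
  unfolding uv(3)[OF that] unfolding coset_convolution_def haar_cnj by simp
 ultimately have "(\<lambda>x. cnj (coset_convolution u f x)) \<in> \<B>"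
  using UA.\<B>_cong[of "coset_convolution (\<lambda>y. cnj (v y)) g" "\<lambda>x. cnj (coset_convolution u f x)"] by simp
 thus False using selfadjoint_in_\<A>0[OF convolution_in_\<A>0[OF uv(1) f]] uv(4) by blast
qed

lemma haar_square_pos:
 assumes w: "cmap N w" and y: "y \<in> topspace N" "w y \<noteq> 0"
 shows "(\<integral>g. w (g <# K) * cnj (w (g <# K)) \<partial>haar) \<noteq> 0"
proof -
 obtain a where a: "a \<in> carrier G" "y = a <# K" using y(1) by (rule N_cosetE)
 have c: "cfun (\<lambda>g. w (g <# K))" by (rule continuous_map_apply[OF w continuous_map_coset])
 have "(\<integral>g. w (g <# K) * cnj (w (g <# K)) \<partial>haar) = of_real (nsq (\<lambda>g. w (g <# K)))"
  using ip_self[of "\<lambda>g. w (g <# K)"] by (simp add: ip_def)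
 moreover have "nsq (\<lambda>g. w (g <# K)) \<noteq> 0" using nsq_eq_0[OF c _ a(1)] y(2) a(2) by auto
 ultimately show ?thesis by simp
qed

text \<open>From the vanishing of one integral to every fibre: multiplying \<open>g\<close> by the
  conjugate of the average \<open>?w\<close>, lifted from the base, stays in \<open>\<A>0\<close>,
  and the integral over the group becomes the squared norm of \<open>?w\<close>.\<close>

lemma fibre_average_mult_\<A>0:
 assumes f: "f \<in> \<A>0" and g: "g \<in> \<A>0" and y: "y \<in> topspace N"
 shows "\<alpha> (\<lambda>x. f x * g x) y = 0"
proof (rule ccontr)
 let ?w = "\<alpha> (\<lambda>x. f x * g x)"
 assume nz: "?w y \<noteq> 0"
 have fB: "f \<in> \<B>" and gB: "g \<in> \<B>" and g0: "\<And>y. y \<in> topspace N ==> \<alpha> g y = 0"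
  using f g by (auto simp: \<A>0_def)
 have fg: "cmap M (\<lambda>x. f x * g x)" by (rule UA.continuous[OF UA.mult[OF fB gB]])
 have w: "cmap N ?w" by (rule continuous_fibre_average[OF fg])
 have cw: "cmap N (\<lambda>y. cnj (?w y))" by (rule continuous_map_cnj[OF w])
 have "(\<lambda>x. g x * cnj (?w (\<pi> x))) \<in> \<A>0"
  using UA.mult[OF gB pullback_in_\<B>[OF cw]] fibre_average_pullback_mult[OF UA.continuous[OF gB] cw] g0
  by (simp add: \<A>0_def)
 from integral_\<A>0[OF f this]
 have "0 = (\<integral>z. (\<lambda>x. (f x * g x) * cnj (?w (\<pi> x))) (z <# H) \<partial>haar)"
  by (simp add: mult.assoc)
 also have "... = (\<integral>z. \<alpha> (\<lambda>x. (f x * g x) * cnj (?w (\<pi> x))) (z <# K) \<partial>haar)"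
  by (intro haar_fibre_average continuous_map_mult_algebra[OF fg] continuous_map_apply[OF cw continuous_projection])
 also have "... = (\<integral>z. ?w (z <# K) * cnj (?w (z <# K)) \<partial>haar)"
  by (rule haar_integral_cong) (simp add: fibre_average_pullback_mult[OF fg cw] coset_in_N)
 finally show False using haar_square_pos[OF w y nz] by simp
qed

text \<open>Both functions are split into the lift of their average and a part in
  \<open>\<A>0\<close>. Lifted functions pull out of the average, so the mixed terms vanish, and the
  product of the remaining parts averages to 0.\<close>

lemma fibre_average_mult:
 assumes f: "f \<in> \<B>" and g: "g \<in> \<B>" and y: "y \<in> topspace N"
 shows "\<alpha> (\<lambda>x. f x * g x) y = \<alpha> f y * \<alpha> g y"
proof -
 have c: "cmap N (\<alpha> h)" if "h \<in> \<B>" for h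
  by (rule continuous_fibre_average[OF UA.continuous[OF that]])
 have dec: "(\<lambda>x. h x + (- \<alpha> h (\<pi> x))) \<in> \<A>0" if h: "h \<in> \<B>" for h
 proof -
  have cm: "cmap N (\<lambda>y. - \<alpha> h y)" by (intro continuous_map_minus c h)
  have "\<alpha> (\<lambda>x. h x + (- \<alpha> h (\<pi> x))) y = 0" if "y \<in> topspace N" for y
   using fibre_average_add[OF UA.continuous[OF h] UA.continuous[OF pullback_in_\<B>[OF cm]] that]
    fibre_average_pullback[OF cm that] by simp
  thus ?thesis using UA.add[OF h pullback_in_\<B>[OF cm]] by (simp add: \<A>0_def)
 qed
 define f0 g0 where "f0 = (\<lambda>x. f x + (- \<alpha> f (\<pi> x)))" and "g0 = (\<lambda>x. g x + (- \<alpha> g (\<pi> x)))"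
 have fg0: "f0 \<in> \<A>0" "g0 \<in> \<A>0" unfolding f0_def g0_def using dec f g by blast+
 hence f0B: "f0 \<in> \<B>" and f0z: "\<alpha> f0 y = 0" using y by (auto simp: \<A>0_def)
 have g0B: "g0 \<in> \<B>" using fg0(2) by (simp add: \<A>0_def)
 have p0: "cmap M (\<lambda>x. f0 x * g0 x)"
  by (rule UA.continuous[OF UA.mult[OF f0B g0B]])
 have p1: "cmap M (\<lambda>x. f0 x * \<alpha> g (\<pi> x))"
  by (rule UA.continuous[OF UA.mult[OF f0B pullback_in_\<B>[OF c[OF g]]]])
 have p2: "cmap M (\<lambda>x. g x * \<alpha> f (\<pi> x))"
  by (rule UA.continuous[OF UA.mult[OF g pullback_in_\<B>[OF c[OF f]]]])
 have "(\<lambda>x. f x * g x) = (\<lambda>x. (f0 x * g0 x + f0 x * \<alpha> g (\<pi> x)) + g x * \<alpha> f (\<pi> x))"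
  by (simp add: f0_def g0_def algebra_simps)
 hence "\<alpha> (\<lambda>x. f x * g x) y = \<alpha> (\<lambda>x. (f0 x * g0 x + f0 x * \<alpha> g (\<pi> x)) + g x * \<alpha> f (\<pi> x)) y"
  by (rule arg_cong)
 also have "... = \<alpha> (\<lambda>x. f0 x * g0 x) y + \<alpha> (\<lambda>x. f0 x * \<alpha> g (\<pi> x)) y + \<alpha> (\<lambda>x. g x * \<alpha> f (\<pi> x)) y"
  unfolding fibre_average_add[OF continuous_map_add[OF p0 p1] p2 y] fibre_average_add[OF p0 p1 y] ..
 also have "... = \<alpha> f y * \<alpha> g y"
  unfolding fibre_average_mult_\<A>0[OF fg0 y] fibre_average_pullback_mult[OF UA.continuous[OF f0B] c[OF g] y]
   fibre_average_pullback_mult[OF UA.continuous[OF g] c[OF f] y] f0z by simp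
 finally show ?thesis .
qed

lemma fibre_average_carrier: "f \<in> \<B> ==> \<alpha> f \<in> carrier (cfun_ring N)"
 using continuous_fibre_average[OF UA.continuous] fibre_average_extensional by (simp add: cfun_ring_def)

lemma pullback_restrict:
 assumes "u \<in> carrier (cfun_ring N)"
 shows "(\<lambda>x\<in>topspace M. u (\<pi> x)) \<in> A" "\<alpha> (\<lambda>x\<in>topspace M. u (\<pi> x)) = u"
proof -
 have u: "cmap N u" "u \<in> extensional (topspace N)"
  using assms by (auto simp: cfun_ring_def)
 show "(\<lambda>x\<in>topspace M. u (\<pi> x)) \<in> A" by (rule UA.\<B>_A[OF pullback_in_\<B>[OF u(1)]])
 have "\<alpha> (\<lambda>x\<in>topspace M. u (\<pi> x)) = \<alpha> (\<lambda>x. u (\<pi> x))"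
  by (rule fibre_average_cong[OF UA.continuous[OF pullback_in_\<B>[OF u(1)]], symmetric]) simp
 also have "... = u"
  by (rule extensionalityI[OF fibre_average_extensional u(2)]) (rule fibre_average_pullback[OF u(1)])
 finally show "\<alpha> (\<lambda>x\<in>topspace M. u (\<pi> x)) = u" .
qed

lemma fibre_average_restrict: "f \<in> \<B> ==> \<alpha> (restrict f (topspace M)) = \<alpha> f"
 by (rule fibre_average_cong[symmetric, OF UA.continuous]) simp_all

lemma fibre_average_ring_hom: "\<alpha> \<in> Ring.ring_hom (cfun_subring M A) (cfun_ring N)"
proof (rule ring_hom_memI)
 fix f g assume fg: "f \<in> carrier (cfun_subring M A)" "g \<in> carrier (cfun_subring M A)"
 hence B: "f \<in> \<B>" "g \<in> \<B>" by (auto intro: UA.A_\<B>)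
 show "\<alpha> f \<in> carrier (cfun_ring N)" by (rule fibre_average_carrier[OF B(1)])
 have m: "f \<otimes>\<^bsub>cfun_subring M A\<^esub> g = restrict (\<lambda>x. f x * g x) (topspace M)"
  and a: "f \<oplus>\<^bsub>cfun_subring M A\<^esub> g = restrict (\<lambda>x. f x + g x) (topspace M)"
  by (simp_all add: cfun_ring_def)
 show "\<alpha> (f \<otimes>\<^bsub>cfun_subring M A\<^esub> g) = \<alpha> f \<otimes>\<^bsub>cfun_ring N\<^esub> \<alpha> g"
  unfolding m fibre_average_restrict[OF UA.mult[OF B]]
  by (rule extensionalityI[OF fibre_average_extensional]) (simp_all add: cfun_ring_def fibre_average_mult[OF B])
 show "\<alpha> (f \<oplus>\<^bsub>cfun_subring M A\<^esub> g) = \<alpha> f \<oplus>\<^bsub>cfun_ring N\<^esub> \<alpha> g"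
  unfolding a fibre_average_restrict[OF UA.add[OF B]]
  by (rule extensionalityI[OF fibre_average_extensional])
   (simp_all add: cfun_ring_def fibre_average_add[OF UA.continuous UA.continuous] B)
next
 have "\<alpha> (restrict (\<lambda>x. 1) (topspace M)) = \<one>\<^bsub>cfun_ring N\<^esub>"
  unfolding fibre_average_restrict[OF UA.const]
  by (rule extensionalityI[OF fibre_average_extensional]) (simp_all add: cfun_ring_def fibre_average_const)
 thus "\<alpha> \<one>\<^bsub>cfun_subring M A\<^esub> = \<one>\<^bsub>cfun_ring N\<^esub>"
  by (simp add: cfun_ring_def)
qed

lemma fibre_average_algebra_hom:
 "algebra_hom M A N (carrier (cfun_ring N)) \<alpha>" "\<alpha> ` A = carrier (cfun_ring N)"
proof -
 have "\<alpha> (cfun_scale M c f) = cfun_scale N c (\<alpha> f)" if "f \<in> A" for c f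
 proof -
  have f: "f \<in> \<B>" by (rule UA.A_\<B>[OF that])
  have "\<alpha> (cfun_scale M c f) = \<alpha> (\<lambda>x. c * f x)"
   unfolding cfun_scale_def by (rule fibre_average_restrict[OF UA.scale[OF f]])
  also have "... = cfun_scale N c (\<alpha> f)" by (rule extensionalityI[OF fibre_average_extensional])
    (simp_all add: cfun_scale_def fibre_average_mult[OF UA.const f] fibre_average_const)
  finally show ?thesis .
 qed
 thus "algebra_hom M A N (carrier (cfun_ring N)) \<alpha>"
  using fibre_average_ring_hom by (simp add: algebra_hom_def)
 show "\<alpha> ` A = carrier (cfun_ring N)"
 proof
  show "\<alpha> ` A \<subseteq> carrier (cfun_ring N)" using fibre_average_carrier[OF UA.A_\<B>] by blast
  show "carrier (cfun_ring N) \<subseteq> \<alpha> ` A"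
  proof
   fix u assume u: "u \<in> carrier (cfun_ring N)"
   show "u \<in> \<alpha> ` A"
    by (rule image_eqI[of u \<alpha> "\<lambda>x\<in>topspace M. u (\<pi> x)"]) (simp_all only: pullback_restrict[OF u])
  qed
 qed
qed

section \<open>The kernel as the largest proper invariant ideal\<close>

abbreviation "Z \<equiv> a_kernel (cfun_subring M A) (cfun_ring N) \<alpha>"

lemma Z_iff: "f \<in> Z \<longleftrightarrow> f \<in> A \<and> (\<forall>y\<in>topspace N. \<alpha> f y = 0)"
proof -
 have "\<alpha> f = (\<lambda>y\<in>topspace N. 0) \<longleftrightarrow> (\<forall>y\<in>topspace N. \<alpha> f y = 0)"
  by (auto intro: extensionalityI[OF fibre_average_extensional])
 thus ?thesis by (simp add: a_kernel_def' cfun_ring_def)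
qed

lemma ideal_Z: "ideal Z (cfun_subring M A)"
 by (rule ring_hom_ring.kernel_is_ideal[OF ring_hom_ringI2[OF UA.ring_A ring_cfun_ring fibre_average_ring_hom]])

lemma invariant_Z: "translation_invariant G M Z" unfolding translation_invariant_def
proof (intro ballI)
 fix g f assume g: "g \<in> carrier G" and f: "f \<in> Z"
 have fA: "f \<in> A" using f by (simp add: Z_iff)
 have fB: "f \<in> \<B>" by (rule UA.A_\<B>[OF fA])
 have "\<alpha> (translate G M g f) = \<alpha> (\<lambda>x. f (inv g <# x))"
  unfolding translate_def by (rule fibre_average_restrict[OF \<B>_translate[OF fB inv_closed[OF g]]])
 hence "\<alpha> (translate G M g f) y = 0" if "y \<in> topspace N" for y
  using f that g by (simp add: fibre_average_translate[OF UA.continuous[OF fB]] Z_iff K_action(1))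
 moreover have "translate G M g f \<in> A" using invariant_A g fA by (simp add: translation_invariant_def)
 ultimately show "translate G M g f \<in> Z" by (simp add: Z_iff)
qed

lemma Z_proper: "Z \<noteq> A"
proof
 assume "Z = A"
 hence "restrict (\<lambda>x. 1) (topspace M) \<in> Z" using UA.\<B>_A[OF UA.const, of 1] by simp
 thus False
  using coset_in_N[OF one_closed] fibre_average_const by (auto simp: Z_iff fibre_average_restrict[OF UA.const])
qed

text \<open>An ideal element with nonzero fibre average yields, by averaging translates, an ideal
  element so close to a nonzero constant that it is invertible in \<open>A\<close>.\<close>

lemma proper_ideal_subset_Z:
 assumes I: "ideal I (cfun_subring M A)" and inv: "translation_invariant G M I" and ne: "I \<noteq> A"
 shows "I \<subseteq> Z"
proof (rule ccontr)
 assume "\<not> I \<subseteq> Z"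
 then obtain f where f: "f \<in> I" "f \<notin> Z" by blast
 have sub: "additive_subgroup I (cfun_subring M A)" by (rule ideal.axioms(1)[OF I])
 have IA: "I \<subseteq> A" using additive_subgroup.a_subset[OF sub] by simp
 define J where "J = {f. restrict f (topspace M) \<in> I}"
 have Jadd: "(\<lambda>x. a x + b x) \<in> J" if "a \<in> J" "b \<in> J" for a b
  using additive_subgroup.a_closed[OF sub, of "restrict a (topspace M)" "restrict b (topspace M)"] that
  by (simp add: J_def cfun_ring_operations)
 have Jmult: "(\<lambda>x. a x * b x) \<in> J" if "a \<in> J" "b \<in> \<B>" for a b
  using ideal.I_r_closed[OF I, of "restrict a (topspace M)" "restrict b (topspace M)"] that UA.\<B>_A
  by (simp add: J_def cfun_ring_operations)
 have Jtranslate: "(\<lambda>x. a (g <# x)) \<in> J" if a: "a \<in> J" and g: "g \<in> carrier G" for a g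
 proof -
  have "translate G M (inv g) (restrict a (topspace M)) \<in> I"
   using inv a g by (simp add: translation_invariant_def J_def)
  also have "translate G M (inv g) (restrict a (topspace M)) = restrict (\<lambda>x. a (g <# x)) (topspace M)"
   unfolding translate_def by (rule restrict_ext) (simp add: g H_action)
  finally show ?thesis unfolding J_def mem_Collect_eq .
 qed
 have J0: "(\<lambda>x. 0) \<in> J"
  using additive_subgroup.zero_closed[OF sub] by (simp add: J_def cfun_ring_def)
 have Jsum: "(\<lambda>x. \<Sum>i\<in>S. a i x) \<in> J" if "finite S" "\<And>i. i \<in> S ==> a i \<in> J" for S :: "'a set" and a
  using that
 proof (induction S)
  case (insert i S)
  hence "(\<lambda>x. a i x + (\<Sum>i\<in>S. a i x)) \<in> J" by (intro Jadd) auto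
  thus ?case unfolding sum.insert[OF insert(1,2)] .
 qed (simp add: J0)
 have fA: "f \<in> A" using f IA by blast
 have fB: "f \<in> \<B>" by (rule UA.A_\<B>[OF fA])
 have w: "cmap N (\<alpha> f)"
  by (rule continuous_fibre_average[OF UA.continuous[OF fB]])
 have cw: "cmap N (\<lambda>y. cnj (\<alpha> f y))" by (rule continuous_map_cnj[OF w])
 obtain y where y: "y \<in> topspace N" "\<alpha> f y \<noteq> 0" using f(2) fA by (auto simp: Z_iff)
 \<comment> \<open>The factor makes the mean over the group the squared norm of the fibre average of
   \<open>f\<close>, so it cannot cancel.\<close>
 define h where "h x = f x * cnj (\<alpha> f (\<pi> x))" for x
 have "f \<in> J" using f(1) fA by (simp add: J_def UA.restrict_A)
 hence hJ: "h \<in> J" unfolding h_def by (rule Jmult[OF _ pullback_in_\<B>[OF cw]])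
 have hB: "h \<in> \<B>" unfolding h_def by (rule UA.mult[OF fB pullback_in_\<B>[OF cw]])
 have hc: "cmap M h" by (rule UA.continuous[OF hB])
 define c where "c = (\<integral>g. h (g <# H) \<partial>haar)"
 have "c = (\<integral>g. \<alpha> h (g <# K) \<partial>haar)"
  unfolding c_def by (rule haar_fibre_average[OF hc])
 also have "... = (\<integral>g. \<alpha> f (g <# K) * cnj (\<alpha> f (g <# K)) \<partial>haar)"
  by (rule haar_integral_cong) (simp add: h_def[abs_def] fibre_average_pullback_mult[OF UA.continuous[OF fB] cw] coset_in_N)
 finally have c0: "c \<noteq> 0" using haar_square_pos[OF w y] by simp
 have avg: "coset_convolution (\<lambda>y. 1) h x = c" if x: "x \<in> topspace M" for x
 proof -
  obtain a where a: "a \<in> carrier G" "x = a <# H" using x by (rule M_cosetE)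
  have ch: "cfun (\<lambda>y. h (y <# H))" by (rule continuous_map_apply[OF hc continuous_map_coset])
  have ca: "cfun (\<lambda>y. h ((y \<otimes> a) <# H))"
   by (rule continuous_map_apply[OF ch continuous_map_right_mult[OF a(1)]])
  have "coset_convolution (\<lambda>y. 1) h x = (\<integral>y. h ((inv y \<otimes> a) <# H) \<partial>haar)"
   unfolding coset_convolution_def by (rule haar_integral_cong) (simp add: a H_action(4))
  also have "... = c"
   unfolding c_def using haar_integral_inverse[OF ca] haar_integral_right[OF a(1) ch] by simp
  finally show ?thesis .
 qed
 \<comment> \<open>The ideal need not be closed, so the average over the whole group may fall
   outside it. A finite combination of translates within half of the modulus of \<open>c\<close>
   stays inside and is still invertible by the Neumann series.\<close>
 obtain P w where P: "finite P" "P \<subseteq> carrier G"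
  "\<And>x. x \<in> topspace M ==> norm (coset_convolution (\<lambda>y. 1) h x - (\<Sum>p\<in>P. (of_real (w p) * 1) * h (inv p <# x))) \<le> norm c / 2"
  using convolution_approximation[of "\<lambda>y. 1", OF _ hc, of "norm c / 2"] c0 by auto
 define s where "s x = (\<Sum>p\<in>P. h (inv p <# x) * (of_real (w p) * inverse c))" for x
 have sJ: "s \<in> J"
  unfolding s_def using P(2) by (intro Jsum P(1) Jmult Jtranslate hJ UA.const inv_closed) auto
 have sB: "s \<in> \<B>" using sJ IA by (auto simp: J_def UA.\<B>_def)
 have "norm (1 - s x) \<le> 1 / 2" if x: "x \<in> topspace M" for x
 proof -
  have "1 - s x = inverse c * (c - (\<Sum>p\<in>P. (of_real (w p) * 1) * h (inv p <# x)))"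
   using c0 by (simp add: s_def algebra_simps sum_distrib_left)
  hence "norm (1 - s x) = inverse (norm c) * norm (c - (\<Sum>p\<in>P. (of_real (w p) * 1) * h (inv p <# x)))"
   by (simp only: norm_mult norm_inverse)
  also have "... \<le> inverse (norm c) * (norm c / 2)"
   using P(3)[OF x] unfolding avg[OF x] by (intro mult_left_mono) auto
  finally show ?thesis using c0 by simp
 qed
 hence inv1: "(\<lambda>x. inverse (1 - (1 - s x))) \<in> \<B>"
  and ne0: "\<And>x. x \<in> topspace M ==> s x \<noteq> 0"
  using UA.inverse_one_minus[OF UA.diff[OF UA.const sB], of "1/2" 1] by (simp, fastforce)
 have "A \<subseteq> I"
 proof
  fix g assume g: "g \<in> A"
  have "(\<lambda>x. s x * (inverse (1 - (1 - s x)) * g x)) \<in> J"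
   by (rule Jmult[OF sJ UA.mult[OF inv1 UA.A_\<B>[OF g]]])
  hence "restrict (\<lambda>x. s x * (inverse (1 - (1 - s x)) * g x)) (topspace M) \<in> I"
   by (simp add: J_def)
  also have "restrict (\<lambda>x. s x * (inverse (1 - (1 - s x)) * g x)) (topspace M) = restrict g (topspace M)"
   by (rule restrict_ext) (simp add: ne0)
  finally show "g \<in> I" using UA.restrict_A[OF g] by simp
 qed
 thus False using ne IA by blast
qed

end

end

section \<open>The maximal ideal space\<close>

lemma continuous_map_into_normed:
 fixes f :: "'x => 'c::real_normed_vector"
 assumes "\<And>x e. x \<in> topspace X ==> e > 0 ==> \<exists>U. openin X U \<and> x \<in> U \<and> (\<forall>y\<in>U. norm (f y - f x) < e)"
 shows "cmap X f" using assms
 by (simp add: Met_TC.continuous_map_to_metric[of X f, unfolded mtopology_is_euclidean mball_eq_ball] dist_norm norm_minus_commute)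

lemma compact_Hausdorff_separate:
 assumes "compact_space X" "Hausdorff_space X" "closedin X C" "x \<in> topspace X" "x \<notin> C"
 obtains u :: "'x => complex" where "cmap X u" "u x = 1"
  "\<And>z. z \<in> C ==> u z = 0" "\<And>z. z \<in> topspace X ==> norm (u z) \<le> 1"
proof -
 have "closedin X {x}" using assms by (simp add: closedin_Hausdorff_sing_eq)
 moreover have "C \<inter> {x} = {}" using assms(5) by blast
 ultimately obtain f :: "'x => real" where f: "rcmap X f"
  "\<And>z. z \<in> topspace X ==> 0 \<le> f z" "\<And>z. z \<in> topspace X ==> f z \<le> 1"
  "\<And>z. z \<in> C ==> f z = 0" "\<And>z. z \<in> {x} ==> f z = 1"
  by (rule Hausdorff_compact_Urysohn[OF assms(1,2,3)]) (rule that)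
 show ?thesis by (rule that[OF continuous_map_of_real[OF f(1)]]) (simp_all add: f)
qed

context invariant_algebra
begin

abbreviation "MA \<equiv> maximal_ideal_space M A"
abbreviation "chars \<equiv> characters M A"
abbreviation "act \<equiv> dual_action G M A"

lemma char_pullback_ex:
 assumes \<phi>: "\<phi> \<in> chars"
 shows "\<exists>y\<in>topspace N. \<forall>u. cmap N u \<longrightarrow> \<phi> (\<lambda>x\<in>topspace M. u (\<pi> x)) = u y"
proof (rule character_of_continuous_functions[OF compact_space_N])
 fix u v :: "'a set => complex"
 assume u: "cmap N u" and v: "cmap N v"
 show "\<phi> (\<lambda>x\<in>topspace M. u (\<pi> x) + v (\<pi> x)) = \<phi> (\<lambda>x\<in>topspace M. u (\<pi> x)) + \<phi> (\<lambda>x\<in>topspace M. v (\<pi> x))"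
  by (rule UA.character_add[OF \<phi> pullback_in_\<B>[OF u] pullback_in_\<B>[OF v]])
 show "\<phi> (\<lambda>x\<in>topspace M. u (\<pi> x) * v (\<pi> x)) = \<phi> (\<lambda>x\<in>topspace M. u (\<pi> x)) * \<phi> (\<lambda>x\<in>topspace M. v (\<pi> x))"
  by (rule UA.character_mult[OF \<phi> pullback_in_\<B>[OF u] pullback_in_\<B>[OF v]])
next
 show "\<phi> (\<lambda>x\<in>topspace M. c) = c" for c by (rule UA.character_const[OF \<phi>])
 fix u v :: "'a set => complex"
 assume eq: "\<And>y. y \<in> topspace N ==> u y = v y"
 have "(\<lambda>x\<in>topspace M. u (\<pi> x)) = (\<lambda>x\<in>topspace M. v (\<pi> x))"
  by (rule restrict_ext) (simp add: eq projection_in_N)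
 thus "\<phi> (\<lambda>x\<in>topspace M. u (\<pi> x)) = \<phi> (\<lambda>x\<in>topspace M. v (\<pi> x))"
  by simp
qed

definition base_point :: "(('a set => complex) => complex) => 'a set" where
 "base_point \<phi> = (SOME y. y \<in> topspace N \<and>
   (\<forall>u. cmap N u \<longrightarrow> \<phi> (\<lambda>x\<in>topspace M. u (\<pi> x)) = u y))"

lemma base_point:
 assumes "\<phi> \<in> chars"
 shows "base_point \<phi> \<in> topspace N"
  "cmap N u ==> \<phi> (\<lambda>x\<in>topspace M. u (\<pi> x)) = u (base_point \<phi>)"
proof -
 have "base_point \<phi> \<in> topspace N \<and>
   (\<forall>u. cmap N u \<longrightarrow> \<phi> (\<lambda>x\<in>topspace M. u (\<pi> x)) = u (base_point \<phi>))"
  unfolding base_point_def by (rule someI_ex) (use char_pullback_ex[OF assms] in blast)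
 thus "base_point \<phi> \<in> topspace N"
  "cmap N u ==> \<phi> (\<lambda>x\<in>topspace M. u (\<pi> x)) = u (base_point \<phi>)"
  by blast+
qed

lemma base_point_eqI:
 assumes \<phi>: "\<phi> \<in> chars" and y: "y \<in> topspace N"
  and eq: "\<And>u. cmap N u ==> \<phi> (\<lambda>x\<in>topspace M. u (\<pi> x)) = u y"
 shows "base_point \<phi> = y"
proof (rule ccontr)
 assume ne: "base_point \<phi> \<noteq> y"
 have "closedin N {base_point \<phi>}"
  using base_point(1)[OF \<phi>] Hausdorff_space_N by (simp add: closedin_Hausdorff_sing_eq)
 moreover have "y \<notin> {base_point \<phi>}" using ne by simp
 ultimately obtain u :: "'a set => complex" where u: "cmap N u" "u y = 1"
  "\<And>z. z \<in> {base_point \<phi>} ==> u z = 0"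
  by (rule compact_Hausdorff_separate[OF compact_space_N Hausdorff_space_N _ y]) (rule that)
 thus False using eq[OF u(1)] base_point(2)[OF \<phi> u(1)] by simp
qed

lemma base_point_evaluation:
 assumes x: "x \<in> topspace M"
 shows "base_point (\<lambda>f\<in>A. f x) = \<pi> x"
proof (rule base_point_eqI[OF UA.evaluation_character[OF x] projection_in_N[OF x]])
 fix u :: "'a set => complex" assume "cmap N u"
 thus "(\<lambda>f\<in>A. f x) (\<lambda>x\<in>topspace M. u (\<pi> x)) = u (\<pi> x)"
  using x UA.\<B>_A[OF pullback_in_\<B>] by simp
qed

lemma act_apply:
 assumes "f \<in> A" "g \<in> carrier G"
 shows "act g \<phi> f = \<phi> (\<lambda>x\<in>topspace M. f (g <# x))"
 using assms by (simp add: dual_action_def translate_def)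

lemma translate_in_A: "f \<in> A ==> g \<in> carrier G ==> (\<lambda>x\<in>topspace M. f (g <# x)) \<in> A"
 by (rule UA.\<B>_A[OF \<B>_translate[OF UA.A_\<B>]])

lemma act_character:
 assumes \<phi>: "\<phi> \<in> chars" and g: "g \<in> carrier G"
 shows "act g \<phi> \<in> chars"
proof -
 have tB: "(\<lambda>x. f (g <# x)) \<in> \<B>" if "f \<in> A" for f
  by (rule \<B>_translate[OF UA.A_\<B>[OF that] g])
 have cl: "f \<oplus>\<^bsub>cfun_ring M\<^esub> h \<in> A" "f \<otimes>\<^bsub>cfun_ring M\<^esub> h \<in> A" if "f \<in> A" "h \<in> A" for f h
  using subringE(6,7)[OF UA.subring_A that] by auto
 have cls: "cfun_scale M c f \<in> A" if "f \<in> A" for c f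
  using UA.\<B>_A[OF UA.scale[OF UA.A_\<B>[OF that]]] by (simp add: cfun_scale_def)
 have "act g \<phi> (f \<oplus>\<^bsub>cfun_ring M\<^esub> h) = act g \<phi> f + act g \<phi> h" if fh: "f \<in> A" "h \<in> A" for f h
 proof -
  have "(\<lambda>x\<in>topspace M. (f \<oplus>\<^bsub>cfun_ring M\<^esub> h) (g <# x)) = (\<lambda>x\<in>topspace M. f (g <# x) + h (g <# x))"
   by (rule restrict_ext) (simp add: cfun_ring_def H_action(1) g)
  thus ?thesis unfolding act_apply[OF cl(1)[OF fh] g] act_apply[OF fh(1) g] act_apply[OF fh(2) g]
   using UA.character_add[OF \<phi> tB[OF fh(1)] tB[OF fh(2)]] by simp
 qed
 moreover have "act g \<phi> (f \<otimes>\<^bsub>cfun_ring M\<^esub> h) = act g \<phi> f * act g \<phi> h" if fh: "f \<in> A" "h \<in> A" for f h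
 proof -
  have "(\<lambda>x\<in>topspace M. (f \<otimes>\<^bsub>cfun_ring M\<^esub> h) (g <# x)) = (\<lambda>x\<in>topspace M. f (g <# x) * h (g <# x))"
   by (rule restrict_ext) (simp add: cfun_ring_def H_action(1) g)
  thus ?thesis unfolding act_apply[OF cl(2)[OF fh] g] act_apply[OF fh(1) g] act_apply[OF fh(2) g]
   using UA.character_mult[OF \<phi> tB[OF fh(1)] tB[OF fh(2)]] by simp
 qed
 moreover have "act g \<phi> (cfun_scale M c f) = c * act g \<phi> f" if f: "f \<in> A" for c f
 proof -
  have "(\<lambda>x\<in>topspace M. (cfun_scale M c f) (g <# x)) = (\<lambda>x\<in>topspace M. c * f (g <# x))"
   by (rule restrict_ext) (simp add: cfun_scale_def H_action(1) g)
  thus ?thesis unfolding act_apply[OF cls[OF f] g] act_apply[OF f g]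
   using UA.character_scale[OF \<phi> tB[OF f]] by simp
 qed
 moreover have "act g \<phi> (\<lambda>x\<in>topspace M. 1) \<noteq> 0"
 proof -
  have "(\<lambda>x\<in>topspace M. (\<lambda>x\<in>topspace M. 1) (g <# x)) = (\<lambda>x\<in>topspace M. 1::complex)"
   by (rule restrict_ext) (simp add: H_action(1) g)
  thus ?thesis unfolding act_apply[OF UA.\<B>_A[OF UA.const] g] using UA.character_one[OF \<phi>] by simp
 qed
 moreover have "act g \<phi> \<in> extensional A" by (simp add: dual_action_def)
 ultimately show ?thesis using UA.\<B>_A[OF UA.const, of 1] unfolding characters_def by blast
qed

lemma act_assoc:
 assumes \<phi>: "\<phi> \<in> chars" and ab: "a \<in> carrier G" "b \<in> carrier G"
 shows "act a (act b \<phi>) = act (a \<otimes> b) \<phi>"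
proof (rule extensionalityI[of _ A])
 fix f assume f: "f \<in> A"
 have "(\<lambda>x\<in>topspace M. (\<lambda>x\<in>topspace M. f (a <# x)) (b <# x)) = (\<lambda>x\<in>topspace M. f ((a \<otimes> b) <# x))"
  by (rule restrict_ext) (simp add: H_action(1,2) ab)
 thus "act a (act b \<phi>) f = act (a \<otimes> b) \<phi> f"
  using ab f translate_in_A[OF f ab(1)] by (simp add: act_apply)
qed (simp_all add: dual_action_def)

lemma act_one:
 assumes \<phi>: "\<phi> \<in> chars"
 shows "act \<one> \<phi> = \<phi>"
proof (rule extensionalityI[of _ A])
 fix f assume f: "f \<in> A"
 have "(\<lambda>x\<in>topspace M. f (\<one> <# x)) = restrict f (topspace M)"
  by (rule restrict_ext) (simp add: H_action(3))
 thus "act \<one> \<phi> f = \<phi> f" using UA.restrict_A[OF f] by (simp add: act_apply[OF f])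
next
 show "\<phi> \<in> extensional A" using \<phi> unfolding characters_def by blast
qed (simp add: dual_action_def)

lemma continuous_map_action:
 assumes H': "subgroup L G" and g: "g \<in> carrier G" and u: "cmap (coset_space G T L) u"
 shows "cmap (coset_space G T L) (\<lambda>y. u (g <# y))"
 by (intro continuous_map_apply[OF u] continuous_map_act H' continuous_map_const_carrier g
   continuous_map_id[unfolded id_def])

lemma base_point_act:
 assumes \<phi>: "\<phi> \<in> chars" and g: "g \<in> carrier G"
 shows "base_point (act g \<phi>) = g <# base_point \<phi>"
proof (rule base_point_eqI[OF act_character[OF \<phi> g]])
 show "g <# base_point \<phi> \<in> topspace N" by (rule K_action(1)[OF g base_point(1)[OF \<phi>]])
 fix u :: "'a set => complex" assume u: "cmap N u"
 have "(\<lambda>x\<in>topspace M. (\<lambda>x\<in>topspace M. u (\<pi> x)) (g <# x)) = (\<lambda>x\<in>topspace M. u (g <# \<pi> x))"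
  by (rule restrict_ext) (simp add: g H_action(1) projection_action)
 thus "act g \<phi> (\<lambda>x\<in>topspace M. u (\<pi> x)) = u (g <# base_point \<phi>)"
  unfolding act_apply[OF UA.\<B>_A[OF pullback_in_\<B>[OF u]] g]
  using base_point(2)[OF \<phi> continuous_map_action[OF subgroup_K g u]] by simp
qed

text \<open>Joint continuity although the weak-* topology is coarse: a translate of \<open>f\<close>
  varies continuously in the sup-norm by the tube lemma, and characters are contractive, so the
  error is uniform in the character.\<close>

lemma continuous_act: "continuous_map (prod_topology T MA) MA (\<lambda>(g, \<phi>). act g \<phi>)"
 unfolding UA.continuous_map_maximal_ideal_space
proof (intro conjI ballI)
 show "(\<lambda>(g, \<phi>). act g \<phi>) p \<in> chars" if "p \<in> topspace (prod_topology T MA)" for p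
  using that act_character by (auto simp: topspace_eq UA.topspace_maximal_ideal_space)
 fix f assume f: "f \<in> A"
 have cf: "cmap M f" by (rule UA.continuous[OF UA.A_\<B>[OF f]])
 show "cmap (prod_topology T MA) (\<lambda>p. (case p of (g, \<phi>) => act g \<phi>) f)"
 proof (rule continuous_map_into_normed)
  fix p and e :: real assume "p \<in> topspace (prod_topology T MA)" and e: "e > 0"
  then obtain a \<psi> where p: "p = (a, \<psi>)" "a \<in> carrier G" "\<psi> \<in> chars"
   by (auto simp: topspace_eq UA.topspace_maximal_ideal_space)
  have "continuous_map (prod_topology T M) M (\<lambda>p. fst p <# snd p)"
   by (intro continuous_map_act subgroup_H continuous_map_fst continuous_map_snd)
  from continuous_map_apply[OF cf this]
  have "cmap (prod_topology T M) (\<lambda>(g, x). f (g <# x))"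
   by (simp add: case_prod_unfold)
  from continuous_map_compact_tube[OF compact_coset_space this _ half_gt_zero[OF e], of a]
  obtain U where U: "openin T U" "a \<in> U"
   "\<And>g x. g \<in> U ==> x \<in> topspace M ==> norm (f (g <# x) - f (a <# x)) < e / 2"
   using p(2) by (auto simp: topspace_eq)
  let ?h = "\<lambda>x\<in>topspace M. f (a <# x)"
  have ch: "cmap MA (\<lambda>\<phi>. \<phi> ?h)"
   by (rule UA.continuous_map_character[OF translate_in_A[OF f p(2)]])
  define W where "W = {\<phi> \<in> topspace MA. \<phi> ?h \<in> ball (\<psi> ?h) (e / 2)}"
  have oW: "openin MA W" unfolding W_def by (rule openin_continuous_map_preimage[OF ch]) simp
  show "\<exists>V. openin (prod_topology T MA) V \<and> p \<in> V \<and>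
    (\<forall>q\<in>V. norm ((case q of (g, \<phi>) => act g \<phi>) f - (case p of (g, \<phi>) => act g \<phi>) f) < e)"
  proof (intro exI[of _ "U \<times> W"] conjI ballI)
   show "openin (prod_topology T MA) (U \<times> W)" using U(1) oW by (simp add: openin_prod_Times_iff)
   show "p \<in> U \<times> W" using U(2) p e by (simp add: W_def UA.topspace_maximal_ideal_space)
   fix q assume "q \<in> U \<times> W"
   then obtain g \<phi> where q: "q = (g, \<phi>)" "g \<in> U" "\<phi> \<in> W" by blast
   have g: "g \<in> carrier G" using openin_subset[OF U(1)] q(2) by (auto simp: topspace_eq)
   have \<phi>: "\<phi> \<in> chars" "norm (\<phi> ?h - \<psi> ?h) < e / 2"
    using q(3) by (auto simp: W_def UA.topspace_maximal_ideal_space dist_norm norm_minus_commute)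
   have "norm (\<phi> (\<lambda>x\<in>topspace M. f (g <# x) - f (a <# x))) \<le> e / 2"
    using U(3)[OF q(2)] by (intro UA.character_bound[OF \<phi>(1)] UA.diff \<B>_translate UA.A_\<B> f g p(2)) (simp add: less_imp_le)
   hence "norm (act g \<phi> f - \<phi> ?h) \<le> e / 2" unfolding act_apply[OF f g]
    using UA.character_diff[OF \<phi>(1) \<B>_translate[OF UA.A_\<B>[OF f] g] \<B>_translate[OF UA.A_\<B>[OF f] p(2)]] by simp
   hence "norm (act g \<phi> f - \<psi> ?h) < e"
    using \<phi>(2) norm_triangle_ineq[of "act g \<phi> f - \<phi> ?h" "\<phi> ?h - \<psi> ?h"] by simp
   thus "norm ((case q of (g, \<phi>) => act g \<phi>) f - (case p of (g, \<phi>) => act g \<phi>) f) < e"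
    using act_apply[OF f p(2)] by (simp add: p(1) q(1))
  qed
 qed
qed

lemma continuous_map_act_characters:
 assumes "continuous_map X T a" "continuous_map X MA b"
 shows "continuous_map X MA (\<lambda>x. act (a x) (b x))"
 using continuous_map_compose[OF continuous_map_pairedI[OF assms] continuous_act] by (simp add: o_def)

text \<open>A Urysohn function on the base that is 1 at the base point of the character and vanishes
  off \<open>V\<close> lifts to an element of \<open>A\<close>; characters not annihilating this
  lift have base point in \<open>V\<close>.\<close>

lemma continuous_base_point: "continuous_map MA N base_point" unfolding continuous_map
proof (intro conjI allI impI)
 show "base_point ` topspace MA \<subseteq> topspace N"
  using base_point(1) by (auto simp: UA.topspace_maximal_ideal_space)
 fix V assume V: "openin N V"
 show "openin MA {\<phi> \<in> topspace MA. base_point \<phi> \<in> V}"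
 proof (subst openin_subopen, intro ballI)
  fix \<psi> assume "\<psi> \<in> {\<phi> \<in> topspace MA. base_point \<phi> \<in> V}"
  hence \<psi>: "\<psi> \<in> chars" "base_point \<psi> \<in> V"
   by (auto simp: UA.topspace_maximal_ideal_space)
  have "closedin N (topspace N - V)" "base_point \<psi> \<notin> topspace N - V" using V \<psi>(2) by auto
  then obtain u :: "'a set => complex" where u: "cmap N u" "u (base_point \<psi>) = 1"
   "\<And>z. z \<in> topspace N - V ==> u z = 0"
   by (rule compact_Hausdorff_separate[OF compact_space_N Hausdorff_space_N _ base_point(1)[OF \<psi>(1)]]) (rule that)
  let ?h = "\<lambda>x\<in>topspace M. u (\<pi> x)"
  define W where "W = {\<phi> \<in> topspace MA. \<phi> ?h \<in> - {0}}"
  have "openin MA W" unfolding W_def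
   by (rule openin_continuous_map_preimage[OF UA.continuous_map_character[OF UA.\<B>_A[OF pullback_in_\<B>[OF u(1)]]]]) auto
  moreover have "\<psi> \<in> W"
   using \<psi>(1) base_point(2)[OF \<psi>(1) u(1)] u(2) by (simp add: W_def UA.topspace_maximal_ideal_space)
  moreover have "W \<subseteq> {\<phi> \<in> topspace MA. base_point \<phi> \<in> V}"
  proof
   fix \<phi> assume "\<phi> \<in> W"
   hence \<phi>: "\<phi> \<in> topspace MA" "\<phi> \<in> chars" "\<phi> ?h \<noteq> 0"
    by (auto simp: W_def UA.topspace_maximal_ideal_space)
   have "u (base_point \<phi>) \<noteq> 0" using \<phi>(3) base_point(2)[OF \<phi>(2) u(1)] by simp
   hence "base_point \<phi> \<in> V"
    using u(3)[of "base_point \<phi>"] base_point(1)[OF \<phi>(2)] by blast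
   thus "\<phi> \<in> {\<phi> \<in> topspace MA. base_point \<phi> \<in> V}" using \<phi>(1) by simp
  qed
  ultimately show "\<exists>W. openin MA W \<and> \<psi> \<in> W \<and> W \<subseteq> {\<phi> \<in> topspace MA. base_point \<phi> \<in> V}"
   by (intro exI[of _ W] conjI)
 qed
qed

lemma base_point_onto: "base_point ` topspace MA = topspace N"
proof
 show "base_point ` topspace MA \<subseteq> topspace N"
  using base_point(1) by (auto simp: UA.topspace_maximal_ideal_space)
 show "topspace N \<subseteq> base_point ` topspace MA"
 proof
  fix y assume "y \<in> topspace N"
  then obtain x where x: "x \<in> topspace M" "y = \<pi> x" using projection_onto by blast
  show "y \<in> base_point ` topspace MA" by (rule image_eqI[of _ _ "\<lambda>f\<in>A. f x"])
    (simp_all add: x base_point_evaluation UA.topspace_maximal_ideal_space UA.evaluation_character)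
 qed
qed

lemma bdd_F: "f \<in> \<B> ==> bdd_above ((\<lambda>q. cmod (f q)) ` F)"
 using continuous_map_compact_bounded[OF compact_coset_space UA.continuous, of f] F_subset
 by (metis (no_types, lifting) bdd_above.I2 subsetD)

text \<open>Multiplying \<open>f\<close> by a lifted function equal to 1 at the base point leaves
  the value of a character over it unchanged, while \<open>f\<close> can be cut off away from
  \<open>F\<close>. Conversely, a character over another point is nonzero on a lifted function that
  vanishes on \<open>F\<close>.\<close>

lemma base_fibre_hull: "{\<phi> \<in> chars. base_point \<phi> = \<pi> H} = algebra_hull M A F"
proof (intro equalityI subsetI)
 fix \<phi> assume "\<phi> \<in> {\<phi> \<in> chars. base_point \<phi> = \<pi> H}"
 hence \<phi>: "\<phi> \<in> chars" "base_point \<phi> = \<pi> H" by auto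
 have "cmod (\<phi> f) \<le> (SUP q\<in>F. cmod (f q))" if f: "f \<in> A" for f
 proof (rule field_le_epsilon)
  fix e :: real assume e: "e > 0"
  let ?S = "SUP q\<in>F. cmod (f q)"
  have fB: "f \<in> \<B>" by (rule UA.A_\<B>[OF f])
  have S: "cmod (f q) \<le> ?S" if "q \<in> F" for q by (rule cSUP_upper[OF that bdd_F[OF fB]])
  have S0: "0 \<le> ?S" using S[OF H_in_F] norm_ge_zero[of "f H"] by linarith
  have cn: "rcmap M (\<lambda>x. cmod (f x))"
   by (rule continuous_map_norm[OF UA.continuous[OF fB]])
  \<comment> \<open>The set where \<open>f\<close> is too large. Its image in the base is closed and
    misses the base point, so the cut-off can vanish on it.\<close>
  define C where "C = {x \<in> topspace M. cmod (f x) \<in> {?S + e..}}"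
  have "closedin M C" unfolding C_def by (rule closedin_continuous_map_preimage[OF cn]) simp
  hence "compactin M C" using compact_coset_space closedin_compact_space by blast
  hence "compactin N (\<pi> ` C)" by (rule image_compactin[OF _ continuous_projection])
  hence "closedin N (\<pi> ` C)" by (rule compactin_imp_closedin[OF Hausdorff_space_N])
  moreover have "\<pi> H \<notin> \<pi> ` C"
  proof
   assume "\<pi> H \<in> \<pi> ` C"
   then obtain x where x: "x \<in> C" "\<pi> x = \<pi> H" by force
   hence "x \<in> F" unfolding F_eq_fibre C_def by blast
   thus False using S[of x] x(1) e by (simp add: C_def)
  qed
  ultimately obtain u :: "'a set => complex" where u: "cmap N u" "u (\<pi> H) = 1"
   "\<And>z. z \<in> \<pi> ` C ==> u z = 0" "\<And>z. z \<in> topspace N ==> norm (u z) \<le> 1"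
   by (rule compact_Hausdorff_separate[OF compact_space_N Hausdorff_space_N _ base_point(1)[OF \<phi>(1), unfolded \<phi>(2)]])
    (rule that)
  have "\<phi> f = \<phi> (restrict f (topspace M)) * \<phi> (\<lambda>x\<in>topspace M. u (\<pi> x))"
   using base_point(2)[OF \<phi>(1) u(1)] u(2) \<phi>(2) UA.restrict_A[OF f] by simp
  also have "... = \<phi> (\<lambda>x\<in>topspace M. f x * u (\<pi> x))"
   by (rule UA.character_mult[OF \<phi>(1) fB pullback_in_\<B>[OF u(1)], symmetric])
  also have "cmod ... \<le> ?S + e"
  proof (rule UA.character_bound[OF \<phi>(1) UA.mult[OF fB pullback_in_\<B>[OF u(1)]]])
   fix x assume x: "x \<in> topspace M"
   show "cmod (f x * u (\<pi> x)) \<le> ?S + e"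
   proof (cases "x \<in> C")
    case True
    thus ?thesis using u(3)[of "\<pi> x"] S0 e by simp
   next
    case False
    hence "cmod (f x) \<le> ?S + e" using x by (simp add: C_def)
    moreover have "cmod (f x) * cmod (u (\<pi> x)) \<le> cmod (f x) * 1"
     by (rule mult_left_mono[OF u(4)[OF projection_in_N[OF x]]]) simp
    ultimately show ?thesis unfolding norm_mult by linarith
   qed
  qed
  finally show "cmod (\<phi> f) \<le> ?S + e" .
 qed
 thus "\<phi> \<in> algebra_hull M A F" using \<phi>(1) by (simp add: algebra_hull_def)
next
 fix \<phi> assume "\<phi> \<in> algebra_hull M A F"
 hence \<phi>: "\<phi> \<in> chars" and b: "\<And>f. f \<in> A ==> cmod (\<phi> f) \<le> (SUP q\<in>F. cmod (f q))"
  by (auto simp: algebra_hull_def)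
 have "base_point \<phi> = \<pi> H"
 proof (rule ccontr)
  assume ne: "base_point \<phi> \<noteq> \<pi> H"
  have "closedin N {\<pi> H}"
   using projection_base coset_in_N[OF one_closed] Hausdorff_space_N by (simp add: closedin_Hausdorff_sing_eq)
  moreover have "base_point \<phi> \<notin> {\<pi> H}" using ne by simp
  ultimately obtain u :: "'a set => complex" where u: "cmap N u" "u (base_point \<phi>) = 1"
   "\<And>z. z \<in> {\<pi> H} ==> u z = 0"
   by (rule compact_Hausdorff_separate[OF compact_space_N Hausdorff_space_N _ base_point(1)[OF \<phi>]]) (rule that)
  let ?h = "\<lambda>x\<in>topspace M. u (\<pi> x)"
  have "(SUP q\<in>F. cmod (?h q)) = (SUP q\<in>F. 0)"
   by (rule SUP_cong[OF refl]) (use F_eq_fibre u(3) in auto)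
  also have "... = 0" using H_in_F by (intro cSUP_const) blast
  finally show False
   using b[OF UA.\<B>_A[OF pullback_in_\<B>[OF u(1)]]] base_point(2)[OF \<phi> u(1)] u(2) by simp
 qed
 thus "\<phi> \<in> {\<phi> \<in> chars. base_point \<phi> = \<pi> H}" using \<phi> by simp
qed

text \<open>The assumption \<open>sec\<close> isolates what the Lie structure contributes. The
  inverse of the trivialisation moves the reference fibre back by the opposite quotient of section
  values.\<close>

lemma base_point_locally_trivial:
 assumes sec: "\<And>y. y \<in> topspace N ==> \<exists>\<Omega> \<sigma>. openin N \<Omega> \<and> y \<in> \<Omega> \<and>
   continuous_map (subtopology N \<Omega>) T \<sigma> \<and> (\<forall>z\<in>\<Omega>. \<sigma> z \<in> carrier G \<and> \<sigma> z <# K = z)"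
 shows "locally_trivial_fibration MA N base_point" unfolding locally_trivial_fibration_def
proof (intro conjI ballI)
 show "continuous_map MA N base_point" by (rule continuous_base_point)
 show "base_point ` topspace MA = topspace N" by (rule base_point_onto)
 fix y assume y: "y \<in> topspace N"
 obtain \<Omega> \<sigma> where \<Omega>: "openin N \<Omega>" "y \<in> \<Omega>" and c\<sigma>: "continuous_map (subtopology N \<Omega>) T \<sigma>"
  and \<sigma>: "\<forall>z\<in>\<Omega>. \<sigma> z \<in> carrier G \<and> \<sigma> z <# K = z"
  using sec[OF y] by (elim exE conjE)
 have \<sigma>G: "\<sigma> z \<in> carrier G" if "z \<in> \<Omega>" for z using \<sigma> that by blast
 have \<sigma>K: "\<sigma> z <# K = z" if "z \<in> \<Omega>" for z using \<sigma> that by blast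
 have \<Omega>N: "z \<in> topspace N" if "z \<in> \<Omega>" for z
  using openin_subset[OF \<Omega>(1)] that by blast
 define X where "X = subtopology MA {\<phi> \<in> topspace MA. base_point \<phi> \<in> \<Omega>}"
 define E where "E = subtopology MA {\<phi> \<in> topspace MA. base_point \<phi> = y}"
 define h where "h \<phi> = (base_point \<phi>, act (\<sigma> y \<otimes> inv \<sigma> (base_point \<phi>)) \<phi>)" for \<phi>
 define k where "k q = act (\<sigma> (fst q) \<otimes> inv \<sigma> y) (snd q)" for q
 have tX: "\<phi> \<in> topspace X \<longleftrightarrow> \<phi> \<in> chars \<and> base_point \<phi> \<in> \<Omega>" for \<phi>
  by (auto simp: X_def UA.topspace_maximal_ideal_space)
 have tE: "\<phi> \<in> topspace E \<longleftrightarrow> \<phi> \<in> chars \<and> base_point \<phi> = y" for \<phi>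
  by (auto simp: E_def UA.topspace_maximal_ideal_space)
 have tN: "z \<in> topspace (subtopology N \<Omega>) \<longleftrightarrow> z \<in> \<Omega>" for z
  using \<Omega>N by auto
 have to_base: "inv \<sigma> z <# z = K" if z: "z \<in> \<Omega>" for z
 proof -
  have "inv \<sigma> z <# (\<sigma> z <# K) = (inv \<sigma> z \<otimes> \<sigma> z) <# K"
   using \<sigma>G[OF z] by (intro K_action(4)) auto
  also have "... = K" using \<sigma>G[OF z] subgroup.subset[OF subgroup_K] by (simp add: lcos_mult_one)
  finally show ?thesis unfolding \<sigma>K[OF z] .
 qed
 have shift: "(\<sigma> z \<otimes> inv \<sigma> z') <# z' = z" if z: "z \<in> \<Omega>" "z' \<in> \<Omega>" for z z'
  using K_action(2)[OF \<sigma>G[OF z(1)] inv_closed[OF \<sigma>G[OF z(2)]] \<Omega>N[OF z(2)]] to_base[OF z(2)] \<sigma>K[OF z(1)] by simp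
 have base_shift: "base_point (act (\<sigma> z \<otimes> inv \<sigma> (base_point \<phi>)) \<phi>) = z"
  if "z \<in> \<Omega>" "\<phi> \<in> chars" "base_point \<phi> \<in> \<Omega>" for z \<phi>
  using base_point_act[OF that(2), of "\<sigma> z \<otimes> inv \<sigma> (base_point \<phi>)"] shift[OF that(1,3)] \<sigma>G[OF that(1)] \<sigma>G[OF that(3)]
  by simp
 have cancel: "act (\<sigma> z \<otimes> inv \<sigma> z') (act (\<sigma> z' \<otimes> inv \<sigma> z) \<phi>) = \<phi>" if z: "z \<in> \<Omega>" "z' \<in> \<Omega>" and \<phi>: "\<phi> \<in> chars" for z z' \<phi>
 proof -
  have s: "\<sigma> z \<in> carrier G" "\<sigma> z' \<in> carrier G" using \<sigma>G z by auto
  have "\<sigma> z \<otimes> inv \<sigma> z' \<otimes> (\<sigma> z' \<otimes> inv \<sigma> z) = \<one>"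
   using s by (simp add: m_assoc) (simp add: m_assoc[symmetric])
  thus ?thesis
   using act_assoc[OF \<phi>, of "\<sigma> z \<otimes> inv \<sigma> z'" "\<sigma> z' \<otimes> inv \<sigma> z"] s act_one[OF \<phi>] by simp
 qed
 have act_ch: "act (\<sigma> z \<otimes> inv \<sigma> z') \<phi> \<in> chars" if "z \<in> \<Omega>" "z' \<in> \<Omega>" "\<phi> \<in> chars" for z z' \<phi>
  using that \<sigma>G by (intro act_character) auto
 have ext: "continuous_map X MA (\<lambda>\<phi>. \<phi>)" "continuous_map E MA (\<lambda>\<phi>. \<phi>)"
  unfolding X_def E_def by (rule continuous_map_from_subtopology, simp)+
 have cbX: "continuous_map X (subtopology N \<Omega>) base_point" by (rule continuous_map_into_subtopology)
   (use continuous_map_from_subtopology[OF continuous_base_point] tX in \<open>auto simp: X_def\<close>)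
 have "continuous_map X T (\<lambda>\<phi>. \<sigma> y \<otimes> inv \<sigma> (base_point \<phi>))"
  using continuous_map_compose[OF cbX c\<sigma>]
  by (intro continuous_map_mult continuous_map_const_carrier \<sigma>G \<Omega>(2) continuous_map_inverse) (simp add: o_def)
 hence "continuous_map X MA (\<lambda>\<phi>. act (\<sigma> y \<otimes> inv \<sigma> (base_point \<phi>)) \<phi>)"
  by (rule continuous_map_act_characters[OF _ ext(1)])
 moreover have "act (\<sigma> y \<otimes> inv \<sigma> (base_point \<phi>)) \<phi> \<in> topspace E" if "\<phi> \<in> topspace X" for \<phi>
  using that act_ch[OF \<Omega>(2)] base_shift[OF \<Omega>(2)] unfolding tX tE by blast
 ultimately have "continuous_map X E (\<lambda>\<phi>. act (\<sigma> y \<otimes> inv \<sigma> (base_point \<phi>)) \<phi>)"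
  unfolding E_def by (intro continuous_map_into_subtopology) auto
 hence ch: "continuous_map X (prod_topology (subtopology N \<Omega>) E) h"
  unfolding h_def[abs_def] by (rule continuous_map_pairedI[OF cbX])
 have "continuous_map (prod_topology (subtopology N \<Omega>) E) T (\<lambda>q. \<sigma> (fst q) \<otimes> inv \<sigma> y)"
  using continuous_map_compose[OF continuous_map_fst c\<sigma>]
  by (intro continuous_map_mult continuous_map_const_carrier \<sigma>G \<Omega>(2) inv_closed) (simp add: o_def)
 moreover have "continuous_map (prod_topology (subtopology N \<Omega>) E) MA snd"
  using continuous_map_compose[OF continuous_map_snd ext(2)] by (simp add: o_def)
 ultimately have "continuous_map (prod_topology (subtopology N \<Omega>) E) MA k"
  unfolding k_def[abs_def] by (rule continuous_map_act_characters)
 moreover have kX: "k q \<in> topspace X" if "q \<in> topspace (prod_topology (subtopology N \<Omega>) E)" for q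
 proof -
  have q: "fst q \<in> \<Omega>" "snd q \<in> chars" "base_point (snd q) = y"
   using that by (auto simp: tE tN)
  show ?thesis
   using act_ch[OF q(1) \<Omega>(2) q(2)] base_shift[OF q(1,2)] q \<Omega>(2) by (simp add: tX k_def)
 qed
 ultimately have ck: "continuous_map (prod_topology (subtopology N \<Omega>) E) X k"
  unfolding X_def by (intro continuous_map_into_subtopology) auto
 have "homeomorphic_maps X (prod_topology (subtopology N \<Omega>) E) h k" unfolding homeomorphic_maps_def
 proof (intro conjI ballI ch ck)
  fix \<phi> assume "\<phi> \<in> topspace X"
  thus "k (h \<phi>) = \<phi>"
   using cancel[OF _ \<Omega>(2), of "base_point \<phi>" \<phi>] by (simp add: h_def k_def tX)
 next
  fix q assume "q \<in> topspace (prod_topology (subtopology N \<Omega>) E)"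
  hence q: "fst q \<in> \<Omega>" "snd q \<in> chars" "base_point (snd q) = y" by (auto simp: tE tN)
  have b: "base_point (k q) = fst q" using base_shift[OF q(1,2)] q(3) \<Omega>(2) by (simp add: k_def)
  have "h (k q) = (fst q, act (\<sigma> y \<otimes> inv \<sigma> (fst q)) (k q))" by (simp only: h_def b)
  also have "act (\<sigma> y \<otimes> inv \<sigma> (fst q)) (k q) = snd q"
   unfolding k_def by (rule cancel[OF \<Omega>(2) q(1,2)])
  finally show "h (k q) = q" by simp
 qed
 hence hom: "homeomorphic_map X (prod_topology (subtopology N \<Omega>) E) h"
  by (rule homeomorphic_maps_imp_map)
 show "\<exists>U h. openin N U \<and> y \<in> U \<and>
   homeomorphic_map (subtopology MA {x \<in> topspace MA. base_point x \<in> U})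
    (prod_topology (subtopology N U) (subtopology MA {x \<in> topspace MA. base_point x = y})) h \<and>
   (\<forall>x\<in>topspace MA. base_point x \<in> U \<longrightarrow> fst (h x) = base_point x)"
  using \<Omega> hom[unfolded X_def E_def] by (intro exI[of _ \<Omega>] exI[of _ h] conjI ballI impI) (simp_all add: h_def)
qed

section \<open>Fibre averages as characters\<close>

context
 assumes comm: "commutative_homogeneous_space G T H"
begin

lemma average_character:
 assumes y: "y \<in> topspace N"
 shows "(\<lambda>f\<in>A. \<alpha> f y) \<in> chars"
proof -
 have cl: "f \<oplus>\<^bsub>cfun_ring M\<^esub> h \<in> A" "f \<otimes>\<^bsub>cfun_ring M\<^esub> h \<in> A" if "f \<in> A" "h \<in> A" for f h
  using subringE(6,7)[OF UA.subring_A that] by auto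
 have cls: "cfun_scale M c f \<in> A" if "f \<in> A" for c f
  using UA.\<B>_A[OF UA.scale[OF UA.A_\<B>[OF that]]] by (simp add: cfun_scale_def)
 have "\<alpha> (f \<oplus>\<^bsub>cfun_ring M\<^esub> h) y = \<alpha> f y + \<alpha> h y" "\<alpha> (f \<otimes>\<^bsub>cfun_ring M\<^esub> h) y = \<alpha> f y * \<alpha> h y"
  if "f \<in> A" "h \<in> A" for f h
  using ring_hom_memE(2,3)[OF fibre_average_ring_hom[OF comm], of f h] that y by (simp_all add: cfun_ring_def)
 moreover have "\<alpha> (cfun_scale M c f) y = c * \<alpha> f y" if "f \<in> A" for c f
  using fibre_average_algebra_hom(1)[OF comm] that y by (simp add: algebra_hom_def cfun_scale_def)
 moreover have one: "(\<lambda>x\<in>topspace M. 1) \<in> A" by (rule UA.\<B>_A[OF UA.const])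
 moreover have "\<alpha> (\<lambda>x\<in>topspace M. 1) y \<noteq> 0"
  using y by (simp only: fibre_average_restrict[OF comm UA.const] fibre_average_const) simp
 ultimately have "\<exists>f\<in>A. (\<lambda>f\<in>A. \<alpha> f y) f \<noteq> 0"
  by (intro bexI[OF _ one]) simp
 thus ?thesis
  using cl cls \<open>\<And>h f. f \<in> A ==> h \<in> A ==> \<alpha> (f \<oplus>\<^bsub>cfun_ring M\<^esub> h) y = \<alpha> f y + \<alpha> h y\<close>
   \<open>\<And>h f. f \<in> A ==> h \<in> A ==> \<alpha> (f \<otimes>\<^bsub>cfun_ring M\<^esub> h) y = \<alpha> f y * \<alpha> h y\<close>
   \<open>\<And>f c. f \<in> A ==> \<alpha> (cfun_scale M c f) y = c * \<alpha> f y\<close>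
  unfolding characters_def mem_Collect_eq by (intro conjI ballI allI) simp_all
qed

lemma base_point_average:
 assumes y: "y \<in> topspace N"
 shows "base_point (\<lambda>f\<in>A. \<alpha> f y) = y"
proof (rule base_point_eqI[OF average_character[OF y] y])
 fix u :: "'a set => complex" assume u: "cmap N u"
 show "(\<lambda>f\<in>A. \<alpha> f y) (\<lambda>x\<in>topspace M. u (\<pi> x)) = u y"
  using UA.\<B>_A[OF pullback_in_\<B>[OF u]] fibre_average_pullback[OF u y]
  by (simp add: fibre_average_restrict[OF comm pullback_in_\<B>[OF u]])
qed

text \<open>Fibre averages form a continuous section of \<open>base_point\<close>, and a section of
  a continuous map is an embedding.\<close>

lemma average_embedding: "embedding_map N MA (\<lambda>y. \<lambda>f\<in>A. \<alpha> f y)"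
proof -
 have "continuous_map N MA (\<lambda>y. \<lambda>f\<in>A. \<alpha> f y)"
  unfolding UA.continuous_map_maximal_ideal_space
  using average_character continuous_fibre_average[OF UA.continuous[OF UA.A_\<B>]] by simp
 hence "retraction_maps MA N base_point (\<lambda>y. \<lambda>f\<in>A. \<alpha> f y)"
  using continuous_base_point base_point_average by (simp add: retraction_maps_def)
 thus ?thesis by (intro section_imp_embedding_map) (auto simp: section_map_def)
qed

text \<open>This identifies the map prescribed in the theorem: composing a character with averaging
  and lifting is the fibre average at its base point.\<close>

lemma character_average_pullback:
 assumes \<phi>: "\<phi> \<in> chars"
 shows "(\<lambda>f\<in>A. \<phi> (\<lambda>x\<in>topspace M. \<alpha> f (\<pi> x))) = (\<lambda>f\<in>A. \<alpha> f (base_point \<phi>))"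
 by (rule restrict_ext) (rule base_point(2)[OF \<phi> continuous_fibre_average[OF UA.continuous[OF UA.A_\<B>]]])

end

end

theorem theorem5:
  fixes G :: "('g, 'b) monoid_scheme" and T :: "'g topology" and H :: "'g set"
    and A :: "('g set \<Rightarrow> complex) set" and F :: "'g set set"
  defines "M \<equiv> coset_space G T H"
  defines "K \<equiv> stabilizer G (\<lambda>g. image (l_coset G g)) F"
  defines "N \<equiv> coset_space G T K"
  defines "\<pi> \<equiv> coset_projection G K"
  defines "\<alpha> \<equiv> fibre_average G T H K"
  defines "\<iota> \<equiv> (\<lambda>f. \<lambda>x\<in>topspace M. f (\<pi> x))"
  defines "\<delta> \<equiv> (\<lambda>y. \<lambda>f\<in>A. \<alpha> f y)"
  defines "Z \<equiv> a_kernel (cfun_subring M A) (cfun_ring N) \<alpha>"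
  assumes "compact_lie_group G T" and "subgroup H G" and "closedin T H"
    and "commutative_homogeneous_space G T H"
    and "function_algebra M A" and "translation_invariant G M A"
    and "maximal_antisymmetric_set M A F" and "H \<in> F"
  shows
    "(algebra_hom M A N (carrier (cfun_ring N)) \<alpha> \<and> \<alpha> ` A = carrier (cfun_ring N)) \<and>
     (ideal Z (cfun_subring M A) \<and> translation_invariant G M Z \<and> Z \<noteq> A \<and>
        (\<forall>I. ideal I (cfun_subring M A) \<and> translation_invariant G M I \<and> I \<noteq> A \<longrightarrow> I \<subseteq> Z)) \<and>
     (\<iota> \<in> carrier (cfun_ring N) \<rightarrow> A \<and>
      embedding_map N (maximal_ideal_space M A) \<delta> \<and>
      (\<exists>p. (\<forall>\<phi>\<in>characters M A. (\<lambda>f\<in>A. \<phi> (\<iota> (\<alpha> f))) = \<delta> (p \<phi>)) \<and>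
           locally_trivial_fibration (maximal_ideal_space M A) N p \<and>
           (\<forall>g\<in>carrier G. \<forall>\<phi>\<in>characters M A. p (dual_action G M A g \<phi>) = g <#\<^bsub>G\<^esub> p \<phi>) \<and>
           {\<phi> \<in> characters M A. p \<phi> = \<pi> H} = algebra_hull M A F \<and>
           (\<forall>x\<in>topspace M. p (\<lambda>f\<in>A. f x) = \<pi> x)))"
proof -
 note K_eq = K_def
 interpret compact_lie_group G T by fact
 have "compact_group G T" by (rule compact_group)
 then interpret L: invariant_algebra G T H A F
  using assms unfolding M_def by (intro invariant_algebra.intro invariant_algebra_axioms.intro)
 have K: "K = L.K" unfolding K_eq L.K_def ..
 have comm: "commutative_homogeneous_space G T H" by fact
 have sec: "\<exists>\<Omega> \<sigma>. openin L.N \<Omega> \<and> y \<in> \<Omega> \<and> continuous_map (subtopology L.N \<Omega>) T \<sigma> \<and>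
   (\<forall>z\<in>\<Omega>. \<sigma> z \<in> carrier G \<and> \<sigma> z <#\<^bsub>G\<^esub> L.K = z)" if y: "y \<in> topspace L.N" for y
 proof -
  obtain \<Omega> \<sigma> where "openin L.N \<Omega>" "y \<in> \<Omega>" "continuous_map (subtopology L.N \<Omega>) T \<sigma>"
   "\<And>z. z \<in> \<Omega> ==> \<sigma> z \<in> carrier G \<and> \<sigma> z <#\<^bsub>G\<^esub> L.K = z"
   by (rule local_section[OF L.subgroup_K L.closed_K y]) (rule that)
  thus ?thesis by (intro exI[of _ \<Omega>] exI[of _ \<sigma>] conjI ballI) simp_all
 qed
 let ?Z = "a_kernel (cfun_subring L.M A) (cfun_ring L.N) L.\<alpha>"
 show ?thesis unfolding Z_def \<delta>_def \<iota>_def \<alpha>_def \<pi>_def N_def M_def K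
 proof (intro conjI allI impI)
  show "algebra_hom L.M A L.N (carrier (cfun_ring L.N)) L.\<alpha>" "L.\<alpha> ` A = carrier (cfun_ring L.N)"
   by (rule L.fibre_average_algebra_hom[OF comm])+
  show "ideal ?Z (cfun_subring L.M A)" "translation_invariant G L.M ?Z" "?Z \<noteq> A"
   by (rule L.ideal_Z[OF comm], rule L.invariant_Z[OF comm], rule L.Z_proper[OF comm])
  show "I \<subseteq> ?Z" if I: "ideal I (cfun_subring L.M A) \<and> translation_invariant G L.M I \<and> I \<noteq> A" for I
   using I by (elim conjE) (rule L.proper_ideal_subset_Z[OF comm])
  show "(\<lambda>f. \<lambda>x\<in>topspace L.M. f (L.\<pi> x)) \<in> carrier (cfun_ring L.N) \<rightarrow> A"
   by (intro funcsetI) (rule L.pullback_restrict(1)[OF comm])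
  show "embedding_map L.N (maximal_ideal_space L.M A) (\<lambda>y. \<lambda>f\<in>A. L.\<alpha> f y)"
   by (rule L.average_embedding[OF comm])
  show "\<exists>p. (\<forall>\<phi>\<in>characters L.M A.
      (\<lambda>f\<in>A. \<phi> (\<lambda>x\<in>topspace L.M. L.\<alpha> f (L.\<pi> x))) = (\<lambda>f\<in>A. L.\<alpha> f (p \<phi>))) \<and>
     locally_trivial_fibration (maximal_ideal_space L.M A) L.N p \<and>
     (\<forall>g\<in>carrier G. \<forall>\<phi>\<in>characters L.M A. p (dual_action G L.M A g \<phi>) = g <#\<^bsub>G\<^esub> p \<phi>) \<and>
     {\<phi> \<in> characters L.M A. p \<phi> = L.\<pi> H} = algebra_hull L.M A F \<and>
     (\<forall>x\<in>topspace L.M. p (\<lambda>f\<in>A. f x) = L.\<pi> x)"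
   by (intro exI[of _ L.base_point] conjI ballI L.base_point_locally_trivial sec L.base_fibre_hull
     L.character_average_pullback[OF comm] L.base_point_act L.base_point_evaluation)
 qed
qed

end
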